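(* Let $s\in\{0,1\}$. Suppose that $A_{\mathcal{T}}(\cdot;\cdot)\colon V^s_{\mathcal{T}}\times V^s_{\mathcal{T}}\to\mathbb{R}$ is linear in its second argument and satisfies: (A1) (Lipschitz continuity) there is a constant $C_{\mathrm{Lip}}>0$ with $|A_{\mathcal{T}}(w;v)-A_{\mathcal{T}}(z;v)|\le C_{\mathrm{Lip}}\|w-z\|_{\mathcal{T}}\|v\|_{\mathcal{T}}$ for all $w,z,v\in V^s_{\mathcal{T}}$; (A2) (discrete consistency) there are a linear operator $L_{\mathcal{T}}\colon V^s_{\mathcal{T}}\to L^2(\Omega)$ and positive constants $C_{\mathrm{cons}}$, $C_{L_{\mathcal{T}}}$ such that, for all $w,v\in V^s_{\mathcal{T}}$, $\left|A_{\mathcal{T}}(w;v)-\int_\Omega F_\gamma[w]L_{\mathcal{T}}v\right|\le C_{\mathrm{cons}}|w|_{J,\mathcal{T}}\|v\|_{\mathcal{T}}$ and $\|L_{\mathcal{T}}v\|_{L^2(\Omega)}\le C_{L_{\mathcal{T}}}\|v\|_{\mathcal{T}}$; (A3) (strong monotonicity) there is a constant $C_{\mathrm{mon}}>0$ with $C_{\mathrm{mon}}^{-1}\|w-v\|_{\mathcal{T}}^2\le A_{\mathcal{T}}(w;w-v)-A_{\mathcal{T}}(v;w-v)$ for all $w,v\in V^s_{\mathcal{T}}$. Let $u\in H^2(\Omega)\cap H^1_0(\Omega)$ be the unique function with $F[u]=0$ (equivalently $F_\gamma[u]=0$) pointwise a.e. in $\Omega$, and let $u_{\mathcal{T}}\in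 V^s_{\mathcal{T}}$ denote the unique solution of $A_{\mathcal{T}}(u_{\mathcal{T}};v)=0$ for all $v\in V^s_{\mathcal{T}}$. Then $$\|u-u_{\mathcal{T}}\|_{\mathcal{T}}\le C_{\mathrm{NB}}\inf_{v\in V^s_{\mathcal{T}}}\|u-v\|_{\mathcal{T}},$$ where $$C_{\mathrm{NB}}=1+C_{\mathrm{mon}}\left(C_{\mathrm{cons}}+C_{L_{\mathcal{T}}}\max\{1,\sqrt{2\lambda},\lambda\}\,(1+\sqrt{d+1})\right).$$
   Context: PDE setting. Let $d\in\{2,3\}$ and let $\Omega\subset\mathbb{R}^d$ be a bounded convex polytopal open set. Let $\mathscr{A},\mathscr{B}$ be nonempty compact metric spaces. Let $a$ (with values in symmetric $d\times d$ real matrices), $b$ (with values in $\mathbb{R}^d$), and the real-valued functions $c$ and $f$ be continuous on $\overline{\Omega}\times\mathscr{A}\times\mathscr{B}$; write $a^{\alpha\beta}(x)=a(x,\alpha,\beta)$, and similarly for $b,c,f$. Assume $c^{\alpha\beta}\ge 0$ in $\Omega$ and that there are $\underline{\nu},\overline{\nu}>0$ with $\underline{\nu}|\xi|^2\le \xi^\top a^{\alpha\beta}(x)\xi\le\overline{\nu}|\xi|^2$ for all $x\in\Omega$, $\xi\in\mathbb{R}^d$, $(\alpha,\beta)\in\mathscr{A}\times\mathscr{B}$. Cordes condition ($|\cdot|$ Frobenius/Euclidean norm): if $b\equiv0$ and $c\equiv0$, set $\lambda=0$ and assume there is $\nu\in(0,1]$ with $|a^{\alpha\beta}|^2/\mathrm{Tr}(a^{\alpha\beta})^2\le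 1/(d-1+\nu)$ in $\Omega$ for all $(\alpha,\beta)$; otherwise assume there are $\lambda>0$, $\nu\in(0,1]$ with $\frac{|a^{\alpha\beta}|^2+|b^{\alpha\beta}|^2/(2\lambda)+(c^{\alpha\beta}/\lambda)^2}{(\mathrm{Tr}(a^{\alpha\beta})+c^{\alpha\beta}/\lambda)^2}\le\frac{1}{d+\nu}$ in $\Omega$ for all $(\alpha,\beta)$. Let $L^{\alpha\beta}v=a^{\alpha\beta}:\nabla^2v+b^{\alpha\beta}\cdot\nabla v-c^{\alpha\beta}v$, $F[v]=\inf_{\alpha}\sup_{\beta}[L^{\alpha\beta}v-f^{\alpha\beta}]$ and $F_\gamma[v]=\inf_{\alpha}\sup_{\beta}[\gamma^{\alpha\beta}(L^{\alpha\beta}v-f^{\alpha\beta})]$ (pointwise a.e.), where $\gamma^{\alpha\beta}=\mathrm{Tr}\,a^{\alpha\beta}/|a^{\alpha\beta}|^2$ if $b\equiv0$ and $c\equiv0$, and otherwise $\gamma^{\alpha\beta}=\frac{\mathrm{Tr}\,a^{\alpha\beta}+c^{\alpha\beta}/\lambda}{|a^{\alpha\beta}|^2+|b^{\alpha\beta}|^2/(2\lambda)+|c^{\alpha\beta}|^2/\lambda^2}$. The equation $F[u]=0$ a.e. (equivalently $F_\gamma[u]=0$ a.e.) has a unique solution in $H^2(\Omega)\cap H^1_0(\Omega)$. For piecewise polynomials over a mesh, $F_\gamma$ is evaluated with piecewise gradients and Hessians. Mesh. $\mathcal{T}$ is a finite conforming partition of $\Omega$ into closed simplices. $\mathcal{F}$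 is the set of closed $(d-1)$-dimensional faces, $\mathcal{F}^I$ and $\mathcal{F}^B$ the interior and boundary faces. Each face $F$ has a fixed unit normal $\mathbf{n}_F$ (outward to $\Omega$ if $F\in\mathcal{F}^B$). The mesh-size function $h_{\mathcal{T}}$ equals $|K|^{1/d}$ on the interior of $K\in\mathcal{T}$ and $(\mathcal{H}^{d-1}(F))^{1/(d-1)}$ on $F\in\mathcal{F}$. For $F\in\mathcal{F}^I$ shared by $K,K'$, with $\mathbf{n}_F$ outward to $K$, the jump is $[\![v]\!]=v|_K-v|_{K'}$ (traces on $F$); for $F\in\mathcal{F}^B$, $[\![v]\!]$ is the trace $v|_F$; jumps of vector fields are componentwise. $\int_{\mathcal{G}}=\sum_{F\in\mathcal{G}}\int_F$ for $\mathcal{G}\subset\mathcal{F}$. Spaces and norms. Fix $p\ge2$; $V^0_{\mathcal{T}}=\{v\in L^2(\Omega): v|_K\in\mathbb{P}_p\ \forall K\in\mathcal{T}\}$ (total degree at most $p$), $V^1_{\mathcal{T}}=V^0_{\mathcal{T}}\cap H^1_0(\Omega)$. $\nabla$, $\nabla^2$ denote piecewise gradient and Hessian. On $V^s_{\mathcal{T}}+(H^2(\Omega)\cap H^1_0(\Omega))$: $|v|_{J,\mathcal{T}}^2=\int_{\mathcal{F}^I}h_{\mathcal{T}}^{-1}|[\![\nabla v]\!]|^2+\int_{\mathcal{F}}h_{\mathcal{T}}^{-3}|[\![v]\!]|^2$ and $\|v\|_{\mathcal{T}}^2=\int_\Omega[|\nabla^2v|^2+|\nabla v|^2+|v|^2]+|v|_{J,\mathcal{T}}^2$.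 Under (A1) and (A3) (and linearity in the second argument) the discrete problem $A_{\mathcal{T}}(u_{\mathcal{T}};v)=0$ for all $v\in V^s_{\mathcal{T}}$ has a unique solution. *)

theory Defs
  imports "HOL-Analysis.Analysis"
begin

section \<open>Smooth functions, weak derivatives and Sobolev spaces\<close>

text \<open>Functions are total on \<open>real ^ 'd\<close>; an element of a Lebesgue or Sobolev space on \<open>S\<close> is given
  by any representative, whose values outside \<open>S\<close> play no role.\<close>

definition pderiv_at :: "'d::finite \<Rightarrow> (real^'d \<Rightarrow> real) \<Rightarrow> real^'d \<Rightarrow> real" where
  "pderiv_at i f x = frechet_derivative f (at x) (axis i 1)"

primrec Ck :: "nat \<Rightarrow> (real^'d::finite \<Rightarrow> real) \<Rightarrow> bool" where
  "Ck 0 f \<longleftrightarrow> continuous_on UNIV f"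
| "Ck (Suc k) f \<longleftrightarrow> (\<forall>x. f differentiable (at x)) \<and> (\<forall>i. Ck k (pderiv_at i f))"

definition smooth :: "(real^'d::finite \<Rightarrow> real) \<Rightarrow> bool" where
  "smooth f \<longleftrightarrow> (\<forall>k. Ck k f)"

definition test_fun :: "(real^'d::finite) set \<Rightarrow> (real^'d \<Rightarrow> real) \<Rightarrow> bool" where
  "test_fun S \<phi> \<longleftrightarrow>
     smooth \<phi> \<and> compact (closure {x. \<phi> x \<noteq> 0}) \<and> closure {x. \<phi> x \<noteq> 0} \<subseteq> S"

definition L2_space :: "(real^'d::finite) set \<Rightarrow> (real^'d \<Rightarrow> real) set" where
  "L2_space S = {v. set_borel_measurable lebesgue S v \<and> set_integrable lebesgue S (\<lambda>x. (v x)\<^sup>2)}"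

definition L2_norm :: "(real^'d::finite) set \<Rightarrow> (real^'d \<Rightarrow> real) \<Rightarrow> real" where
  "L2_norm S v = sqrt (LINT x:S|lebesgue. (v x)\<^sup>2)"

definition loc_integrable :: "(real^'d::finite) set \<Rightarrow> (real^'d \<Rightarrow> real) \<Rightarrow> bool" where
  "loc_integrable S v \<longleftrightarrow> (\<forall>C. compact C \<and> C \<subseteq> S \<longrightarrow> set_integrable lebesgue C v)"

definition has_weak_pderiv ::
  "(real^'d::finite) set \<Rightarrow> 'd \<Rightarrow> (real^'d \<Rightarrow> real) \<Rightarrow> (real^'d \<Rightarrow> real) \<Rightarrow> bool" where
  "has_weak_pderiv S i v g \<longleftrightarrow>
     loc_integrable S v \<and> loc_integrable S g \<and>
     (\<forall>\<phi>. test_fun S \<phi> \<longrightarrow>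
        (LINT x:S|lebesgue. v x * pderiv_at i \<phi> x) = - (LINT x:S|lebesgue. g x * \<phi> x))"

text \<open>The weak derivative is determined only up to a null set, so a representative is chosen.\<close>

definition weak_pderiv :: "(real^'d::finite) set \<Rightarrow> 'd \<Rightarrow> (real^'d \<Rightarrow> real) \<Rightarrow> real^'d \<Rightarrow> real" where
  "weak_pderiv S i v = (SOME g. has_weak_pderiv S i v g)"

definition weak_grad :: "(real^'d::finite) set \<Rightarrow> (real^'d \<Rightarrow> real) \<Rightarrow> real^'d \<Rightarrow> real^'d" where
  "weak_grad S v x = (\<chi> i. weak_pderiv S i v x)"

definition weak_hess :: "(real^'d::finite) set \<Rightarrow> (real^'d \<Rightarrow> real) \<Rightarrow> real^'d \<Rightarrow> real^'d^'d" where
  "weak_hess S v x = (\<chi> i j. weak_pderiv S j (weak_pderiv S i v) x)"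

definition H1_space :: "(real^'d::finite) set \<Rightarrow> (real^'d \<Rightarrow> real) set" where
  "H1_space S = {v \<in> L2_space S. \<forall>i. \<exists>g \<in> L2_space S. has_weak_pderiv S i v g}"

definition H2_space :: "(real^'d::finite) set \<Rightarrow> (real^'d \<Rightarrow> real) set" where
  "H2_space S = {v \<in> H1_space S. \<forall>i. weak_pderiv S i v \<in> H1_space S}"

definition H1_norm :: "(real^'d::finite) set \<Rightarrow> (real^'d \<Rightarrow> real) \<Rightarrow> real" where
  "H1_norm S v = sqrt (LINT x:S|lebesgue. (norm (weak_grad S v x))\<^sup>2 + (v x)\<^sup>2)"

definition H10_space :: "(real^'d::finite) set \<Rightarrow> (real^'d \<Rightarrow> real) set" where
  "H10_space S = {v \<in> H1_space S. \<exists>\<phi>. (\<forall>n. test_fun S (\<phi> n)) \<and>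
     (\<lambda>n::nat. H1_norm S (\<lambda>x. \<phi> n x - v x)) \<longlonglongrightarrow> 0}"


section \<open>Hausdorff measure\<close>

text \<open>Normalised so that the \<open>s\<close>-dimensional measure on \<open>s\<close>-dimensional planes is Lebesgue measure
  (for \<open>s \<ge> 1\<close>). Covering sets are required to be bounded because \<open>diameter\<close> is real-valued.
  The outer measure is metric, hence countably additive on the Borel sets.\<close>

definition hausdorff_outer :: "nat \<Rightarrow> 'a::metric_space set \<Rightarrow> ennreal" where
  "hausdorff_outer s E =
     (SUP \<delta>\<in>{0::real<..}.
        INF C\<in>{C :: nat \<Rightarrow> 'a set. E \<subseteq> (\<Union>i. C i) \<and> (\<forall>i. bounded (C i) \<and> diameter (C i) \<le> \<delta>)}.
          (\<Sum>i. ennreal (unit_ball_vol (real s) * (diameter (C i) / 2) ^ s)))"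

definition hausdorff_measure :: "nat \<Rightarrow> 'a::metric_space measure" where
  "hausdorff_measure s = measure_of UNIV (sets borel) (hausdorff_outer s)"

abbreviation surface_measure :: "(real^'d::finite) measure" where
  "surface_measure \<equiv> hausdorff_measure (CARD('d) - 1)"


section \<open>Traces on faces of a simplex\<close>

text \<open>The trace operator from \<open>H1\<close> of the interior of \<open>K\<close> to \<open>L2\<close> of a face \<open>F\<close> is the continuous
  extension of the restriction of functions that are smooth up to the boundary.\<close>

definition has_trace ::
  "(real^'d::finite) set \<Rightarrow> (real^'d) set \<Rightarrow> (real^'d \<Rightarrow> real) \<Rightarrow> (real^'d \<Rightarrow> real) \<Rightarrow> bool" where
  "has_trace K F w g \<longleftrightarrow>
     w \<in> H1_space (interior K) \<and>
     g \<in> borel_measurable borel \<and> set_integrable surface_measure F (\<lambda>x. (g x)\<^sup>2) \<and>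
     (\<exists>\<phi>. (\<forall>n. smooth (\<phi> n)) \<and>
        (\<forall>n::nat. (\<lambda>x. \<phi> n x - w x) \<in> H1_space (interior K)) \<and>
        (\<lambda>n. H1_norm (interior K) (\<lambda>x. \<phi> n x - w x)) \<longlonglongrightarrow> 0 \<and>
        (\<forall>n. set_integrable surface_measure F (\<lambda>x. (\<phi> n x - g x)\<^sup>2)) \<and>
        (\<lambda>n. LINT x:F|surface_measure. (\<phi> n x - g x)\<^sup>2) \<longlonglongrightarrow> 0)"

definition face_trace ::
  "(real^'d::finite) set \<Rightarrow> (real^'d) set \<Rightarrow> (real^'d \<Rightarrow> real) \<Rightarrow> real^'d \<Rightarrow> real" where
  "face_trace K F w = (SOME g. has_trace K F w g)"


section \<open>Meshes, jumps and mesh-dependent norms\<close>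

definition simplicial_mesh :: "(real^'d::finite) set \<Rightarrow> (real^'d) set set \<Rightarrow> bool" where
  "simplicial_mesh \<Omega> \<T> \<longleftrightarrow>
     triangulation \<T> \<and> (\<forall>K\<in>\<T>. int CARD('d) simplex K) \<and> \<Union>\<T> = closure \<Omega>"

definition mesh_faces :: "(real^'d::finite) set set \<Rightarrow> (real^'d) set set" where
  "mesh_faces \<T> = {F. \<exists>K\<in>\<T>. F facet_of K}"

definition boundary_faces :: "(real^'d::finite) set \<Rightarrow> (real^'d) set set \<Rightarrow> (real^'d) set set" where
  "boundary_faces \<Omega> \<T> = {F \<in> mesh_faces \<T>. F \<subseteq> frontier \<Omega>}"

definition interior_faces :: "(real^'d::finite) set \<Rightarrow> (real^'d) set set \<Rightarrow> (real^'d) set set" where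
  "interior_faces \<Omega> \<T> = mesh_faces \<T> - boundary_faces \<Omega> \<T>"

text \<open>For a nonzero normal \<open>n\<close> of \<open>F\<close>: \<open>n\<close> points out of the convex set \<open>K\<close>, of which \<open>F\<close> is a face.\<close>

definition outward_to :: "(real^'d::finite) set \<Rightarrow> (real^'d) set \<Rightarrow> real^'d \<Rightarrow> bool" where
  "outward_to K F n \<longleftrightarrow> (\<forall>x\<in>K. \<forall>y\<in>F. n \<bullet> (x - y) \<le> 0)"

definition mesh_normals ::
  "(real^'d::finite) set \<Rightarrow> (real^'d) set set \<Rightarrow> ((real^'d) set \<Rightarrow> real^'d) \<Rightarrow> bool" where
  "mesh_normals \<Omega> \<T> nrm \<longleftrightarrow>
     (\<forall>F\<in>mesh_faces \<T>. norm (nrm F) = 1 \<and> (\<forall>x\<in>F. \<forall>y\<in>F. nrm F \<bullet> (x - y) = 0)) \<and>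
     (\<forall>F\<in>boundary_faces \<Omega> \<T>. outward_to \<Omega> F (nrm F))"

definition face_size :: "(real^'d::finite) set \<Rightarrow> real" where
  "face_size F = measure surface_measure F powr (1 / (real CARD('d) - 1))"

text \<open>Weak derivatives on the following open set, the union of the element interiors, are exactly the
  piecewise derivatives over the mesh.\<close>

definition broken_domain :: "(real^'d::finite) set set \<Rightarrow> (real^'d) set" where
  "broken_domain \<T> = (\<Union>K\<in>\<T>. interior K)"

definition jump ::
  "(real^'d::finite) set \<Rightarrow> (real^'d) set set \<Rightarrow> ((real^'d) set \<Rightarrow> real^'d) \<Rightarrow> (real^'d) set \<Rightarrow>
   (real^'d \<Rightarrow> real) \<Rightarrow> real^'d \<Rightarrow> real" where
  "jump \<Omega> \<T> nrm F v x =
     (if F \<in> boundary_faces \<Omega> \<T> then face_trace (THE K. K \<in> \<T> \<and> F facet_of K) F v x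
      else face_trace (THE K. K \<in> \<T> \<and> F facet_of K \<and> outward_to K F (nrm F)) F v x
         - face_trace (THE K. K \<in> \<T> \<and> F facet_of K \<and> outward_to K F (- nrm F)) F v x)"

definition grad_jump ::
  "(real^'d::finite) set \<Rightarrow> (real^'d) set set \<Rightarrow> ((real^'d) set \<Rightarrow> real^'d) \<Rightarrow> (real^'d) set \<Rightarrow>
   (real^'d \<Rightarrow> real) \<Rightarrow> real^'d \<Rightarrow> real^'d" where
  "grad_jump \<Omega> \<T> nrm F v x = (\<chi> i. jump \<Omega> \<T> nrm F (weak_pderiv (broken_domain \<T>) i v) x)"

definition jump_seminorm ::
  "(real^'d::finite) set \<Rightarrow> (real^'d) set set \<Rightarrow> ((real^'d) set \<Rightarrow> real^'d) \<Rightarrow>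
   (real^'d \<Rightarrow> real) \<Rightarrow> real" where
  "jump_seminorm \<Omega> \<T> nrm v = sqrt (
     (\<Sum>F\<in>interior_faces \<Omega> \<T>. LINT x:F|surface_measure.
        (norm (grad_jump \<Omega> \<T> nrm F v x))\<^sup>2 / face_size F) +
     (\<Sum>F\<in>mesh_faces \<T>. LINT x:F|surface_measure. (jump \<Omega> \<T> nrm F v x)\<^sup>2 / face_size F ^ 3))"

text \<open>The norm of \<open>real ^ 'd ^ 'd\<close> is the Frobenius norm.\<close>

definition mesh_norm ::
  "(real^'d::finite) set \<Rightarrow> (real^'d) set set \<Rightarrow> ((real^'d) set \<Rightarrow> real^'d) \<Rightarrow>
   (real^'d \<Rightarrow> real) \<Rightarrow> real" where
  "mesh_norm \<Omega> \<T> nrm v = sqrt (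
     (LINT x:\<Omega>|lebesgue. (norm (weak_hess (broken_domain \<T>) v x))\<^sup>2
        + (norm (weak_grad (broken_domain \<T>) v x))\<^sup>2 + (v x)\<^sup>2) +
     (jump_seminorm \<Omega> \<T> nrm v)\<^sup>2)"

text \<open>Polynomials in \<open>CARD('d)\<close> variables of total degree at most \<open>p\<close>, with multi-indices \<open>\<alpha>\<close>.\<close>

definition poly_fun :: "nat \<Rightarrow> (real^'d::finite \<Rightarrow> real) set" where
  "poly_fun p = {q. \<exists>c :: ('d \<Rightarrow> nat) \<Rightarrow> real.
     q = (\<lambda>x. \<Sum>\<alpha> | (\<Sum>i\<in>UNIV. \<alpha> i) \<le> p. c \<alpha> * (\<Prod>i\<in>UNIV. (x $ i) ^ \<alpha> i))}"

definition V0_space ::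
  "nat \<Rightarrow> (real^'d::finite) set \<Rightarrow> (real^'d) set set \<Rightarrow> (real^'d \<Rightarrow> real) set" where
  "V0_space p \<Omega> \<T> = {v \<in> L2_space \<Omega>.
     \<forall>K\<in>\<T>. \<exists>q \<in> poly_fun p. AE x in lebesgue. x \<in> K \<longrightarrow> v x = q x}"

definition V_space ::
  "nat \<Rightarrow> nat \<Rightarrow> (real^'d::finite) set \<Rightarrow> (real^'d) set set \<Rightarrow> (real^'d \<Rightarrow> real) set" where
  "V_space s p \<Omega> \<T> =
     (if s = 0 then V0_space p \<Omega> \<T> else V0_space p \<Omega> \<T> \<inter> H10_space \<Omega>)"


section \<open>Isaacs operators and the Cordes condition\<close>

definition lower_order_vanish ::
  "(real^'d::finite) set \<Rightarrow> 'm set \<Rightarrow> 'n set \<Rightarrow>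
   (real^'d \<Rightarrow> 'm \<Rightarrow> 'n \<Rightarrow> real^'d) \<Rightarrow> (real^'d \<Rightarrow> 'm \<Rightarrow> 'n \<Rightarrow> real) \<Rightarrow> bool" where
  "lower_order_vanish \<Omega> A B b c \<longleftrightarrow>
     (\<forall>x\<in>closure \<Omega>. \<forall>\<alpha>\<in>A. \<forall>\<beta>\<in>B. b x \<alpha> \<beta> = 0 \<and> c x \<alpha> \<beta> = 0)"

definition cordes ::
  "(real^'d::finite) set \<Rightarrow> 'm set \<Rightarrow> 'n set \<Rightarrow> (real^'d \<Rightarrow> 'm \<Rightarrow> 'n \<Rightarrow> real^'d^'d) \<Rightarrow>
   (real^'d \<Rightarrow> 'm \<Rightarrow> 'n \<Rightarrow> real^'d) \<Rightarrow> (real^'d \<Rightarrow> 'm \<Rightarrow> 'n \<Rightarrow> real) \<Rightarrow> real \<Rightarrow> bool" where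
  "cordes \<Omega> A B a b c lam \<longleftrightarrow>
     (if lower_order_vanish \<Omega> A B b c then
        lam = 0 \<and>
        (\<exists>\<nu>. 0 < \<nu> \<and> \<nu> \<le> 1 \<and> (\<forall>x\<in>\<Omega>. \<forall>\<alpha>\<in>A. \<forall>\<beta>\<in>B.
           (norm (a x \<alpha> \<beta>))\<^sup>2 / (trace (a x \<alpha> \<beta>))\<^sup>2 \<le> 1 / (real CARD('d) - 1 + \<nu>)))
      else
        lam > 0 \<and>
        (\<exists>\<nu>. 0 < \<nu> \<and> \<nu> \<le> 1 \<and> (\<forall>x\<in>\<Omega>. \<forall>\<alpha>\<in>A. \<forall>\<beta>\<in>B.
           ((norm (a x \<alpha> \<beta>))\<^sup>2 + (norm (b x \<alpha> \<beta>))\<^sup>2 / (2 * lam) + (c x \<alpha> \<beta> / lam)\<^sup>2)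
             / (trace (a x \<alpha> \<beta>) + c x \<alpha> \<beta> / lam)\<^sup>2 \<le> 1 / (real CARD('d) + \<nu>))))"

definition renorm ::
  "(real^'d::finite) set \<Rightarrow> 'm set \<Rightarrow> 'n set \<Rightarrow> (real^'d \<Rightarrow> 'm \<Rightarrow> 'n \<Rightarrow> real^'d^'d) \<Rightarrow>
   (real^'d \<Rightarrow> 'm \<Rightarrow> 'n \<Rightarrow> real^'d) \<Rightarrow> (real^'d \<Rightarrow> 'm \<Rightarrow> 'n \<Rightarrow> real) \<Rightarrow> real \<Rightarrow>
   real^'d \<Rightarrow> 'm \<Rightarrow> 'n \<Rightarrow> real" where
  "renorm \<Omega> A B a b c lam x \<alpha> \<beta> =
     (if lower_order_vanish \<Omega> A B b c then trace (a x \<alpha> \<beta>) / (norm (a x \<alpha> \<beta>))\<^sup>2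
      else (trace (a x \<alpha> \<beta>) + c x \<alpha> \<beta> / lam)
        / ((norm (a x \<alpha> \<beta>))\<^sup>2 + (norm (b x \<alpha> \<beta>))\<^sup>2 / (2 * lam) + (c x \<alpha> \<beta>)\<^sup>2 / lam\<^sup>2))"

text \<open>The set \<open>S\<close> is the open set on which the weak derivatives are taken. The inner product of
  \<open>real ^ 'd ^ 'd\<close> is the Frobenius product.\<close>

definition lin_op ::
  "(real^'d::finite) set \<Rightarrow> (real^'d \<Rightarrow> 'm \<Rightarrow> 'n \<Rightarrow> real^'d^'d) \<Rightarrow>
   (real^'d \<Rightarrow> 'm \<Rightarrow> 'n \<Rightarrow> real^'d) \<Rightarrow> (real^'d \<Rightarrow> 'm \<Rightarrow> 'n \<Rightarrow> real) \<Rightarrow>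
   (real^'d \<Rightarrow> real) \<Rightarrow> real^'d \<Rightarrow> 'm \<Rightarrow> 'n \<Rightarrow> real" where
  "lin_op S a b c v x \<alpha> \<beta> =
     a x \<alpha> \<beta> \<bullet> weak_hess S v x + b x \<alpha> \<beta> \<bullet> weak_grad S v x - c x \<alpha> \<beta> * v x"

definition isaacs_op ::
  "(real^'d::finite) set \<Rightarrow> 'm set \<Rightarrow> 'n set \<Rightarrow> (real^'d \<Rightarrow> 'm \<Rightarrow> 'n \<Rightarrow> real^'d^'d) \<Rightarrow>
   (real^'d \<Rightarrow> 'm \<Rightarrow> 'n \<Rightarrow> real^'d) \<Rightarrow> (real^'d \<Rightarrow> 'm \<Rightarrow> 'n \<Rightarrow> real) \<Rightarrow>
   (real^'d \<Rightarrow> 'm \<Rightarrow> 'n \<Rightarrow> real) \<Rightarrow> (real^'d \<Rightarrow> real) \<Rightarrow> real^'d \<Rightarrow> real" where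
  "isaacs_op S A B a b c f v x =
     (INF \<alpha>\<in>A. SUP \<beta>\<in>B. lin_op S a b c v x \<alpha> \<beta> - f x \<alpha> \<beta>)"

definition isaacs_op_renorm ::
  "(real^'d::finite) set \<Rightarrow> (real^'d) set \<Rightarrow> 'm set \<Rightarrow> 'n set \<Rightarrow>
   (real^'d \<Rightarrow> 'm \<Rightarrow> 'n \<Rightarrow> real^'d^'d) \<Rightarrow>
   (real^'d \<Rightarrow> 'm \<Rightarrow> 'n \<Rightarrow> real^'d) \<Rightarrow> (real^'d \<Rightarrow> 'm \<Rightarrow> 'n \<Rightarrow> real) \<Rightarrow>
   (real^'d \<Rightarrow> 'm \<Rightarrow> 'n \<Rightarrow> real) \<Rightarrow> real \<Rightarrow> (real^'d \<Rightarrow> real) \<Rightarrow> real^'d \<Rightarrow> real" where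
  "isaacs_op_renorm \<Omega> S A B a b c f lam v x =
     (INF \<alpha>\<in>A. SUP \<beta>\<in>B.
        renorm \<Omega> A B a b c lam x \<alpha> \<beta> * (lin_op S a b c v x \<alpha> \<beta> - f x \<alpha> \<beta>))"

end

theory Submission
  imports Defs
begin

text \<open>For a discrete function \<open>v\<close> put \<open>e = v - uT\<close>. Strong monotonicity and consistency bound
  \<open>\<parallel>e\<parallel>\<^sup>2 / C_mon\<close> by the jump seminorm of \<open>v\<close> and the integral of \<open>F\<gamma>[v] LT e\<close>. The exact solution
  has no jumps, so the jump seminorm of \<open>v\<close> is that of \<open>u - v\<close>; and \<open>F\<gamma>[u] = 0\<close>, so the renormalized
  operator is controlled pointwise by the second-order jet of \<open>u - v\<close>, by the
  Cauchy-Schwarz inequality for \<open>Tr a + c / lam\<close> and for the linear operators. It remains to use the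
  triangle inequality. For the jumps of \<open>u\<close> to vanish, traces have to be unique, linear and independent
  of the element: this follows from a trace inequality on cones and from the density of smooth functions
  in H1 of a bounded convex domain.\<close>

section \<open>Smooth functions and test functions\<close>

text \<open>Weak derivatives and face traces are picked by \<open>SOME\<close>, so nothing can be
  computed from a representative: every identity about them holds almost everywhere only and rests
  on a uniqueness theorem. For derivatives this is the fundamental lemma of the calculus of
  variations; for traces it is the trace inequality, which makes the face values of smooth functions
  continuous in the H1 norm. Hausdorff measure on a face enters the trace inequality through upper
  bounds from explicit coverings; its value is never computed. The maximum in the constant comes
  from pairing \<open>norm a\<close>, \<open>norm b / sqrt (2 * lam)\<close>, \<open>c / lam\<close>
  with the Hessian, the gradient and the value, weighted by 1, \<open>sqrt (2 * lam)\<close>,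
  \<open>lam\<close>. The root of d + 1 comes from bounding \<open>trace a + c / lam\<close> by the
  root of the denominator of the renormalization. Two such roots cancel the denominator, so the
  direct estimate yields the factor sqrt (d + 1), which lies below the stated 1 + sqrt (d +
  1).\<close>

lemma pderiv_at_eq:
  assumes "(f has_derivative f') (at x)"
  shows "pderiv_at i f x = f' (axis i 1)"
  using frechet_derivative_at[OF assms] by (simp add: pderiv_at_def)

lemma pderiv_at_add:
  assumes "f differentiable (at x)" "g differentiable (at x)"
  shows "pderiv_at i (\<lambda>x. f x + g x) x = pderiv_at i f x + pderiv_at i g x"
proof -
  have "((\<lambda>x. f x + g x) has_derivative (\<lambda>h. frechet_derivative f (at x) h + frechet_derivative g (at x) h)) (at x)"
    using assms by (auto intro!: derivative_intros simp: frechet_derivative_works)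
  from pderiv_at_eq[OF this] show ?thesis by (simp add: pderiv_at_def)
qed

lemma pderiv_at_mult:
  assumes "f differentiable (at x)" "g differentiable (at x)"
  shows "pderiv_at i (\<lambda>x. f x * g x) x = f x * pderiv_at i g x + pderiv_at i f x * g x"
proof -
  have "((\<lambda>x. f x * g x) has_derivative (\<lambda>h. f x * frechet_derivative g (at x) h + frechet_derivative f (at x) h * g x)) (at x)"
    using assms by (auto intro!: has_derivative_mult simp: frechet_derivative_works)
  from pderiv_at_eq[OF this] show ?thesis by (simp add: pderiv_at_def)
qed

lemma pderiv_at_cmult:
  assumes "f differentiable (at x)"
  shows "pderiv_at i (\<lambda>x. r * f x) x = r * pderiv_at i f x"
proof -
  have "(\<lambda>x. r) differentiable (at x)" by simp
  from pderiv_at_mult[OF this assms, of i] show ?thesis by (simp add: pderiv_at_def)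
qed

lemma pderiv_at_diff:
  assumes "f differentiable (at x)" "g differentiable (at x)"
  shows "pderiv_at i (\<lambda>x. f x - g x) x = pderiv_at i f x - pderiv_at i g x"
proof -
  have "((\<lambda>x. f x - g x) has_derivative (\<lambda>h. frechet_derivative f (at x) h - frechet_derivative g (at x) h)) (at x)"
    using assms by (auto intro!: derivative_intros simp: frechet_derivative_works)
  from pderiv_at_eq[OF this] show ?thesis by (simp add: pderiv_at_def)
qed

lemma pderiv_at_const [simp]: "pderiv_at i (\<lambda>x. r) = (\<lambda>x. 0)"
  by (auto simp: pderiv_at_def)

lemma pderiv_at_cong_eventually:
  assumes "eventually (\<lambda>y. f y = g y) (nhds x)" "g differentiable (at x)"
  shows "f differentiable (at x)" "pderiv_at i f x = pderiv_at i g x"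
proof -
  have "eventually (\<lambda>y. g y = f y) (at x)" "f x = g x"
    using assms(1) eventually_nhds_x_imp_x[OF assms(1)]
    by (auto simp: eventually_at_filter elim: eventually_mono)
  moreover have "(g has_derivative frechet_derivative g (at x)) (at x)"
    using assms(2) by (simp add: frechet_derivative_works)
  ultimately have *: "(f has_derivative frechet_derivative g (at x)) (at x)"
    by (auto elim: has_derivative_transform_eventually)
  then show "f differentiable (at x)" by (auto simp: differentiable_def)
  show "pderiv_at i f x = pderiv_at i g x"
    using pderiv_at_eq[OF *, of i] by (simp add: pderiv_at_def)
qed

section \<open>C^k and smooth functions: algebra, coordinates and affine substitution\<close>

lemma Ck_Suc_imp: "Ck (Suc k) f \<Longrightarrow> Ck k f"
proof (induction k arbitrary: f)
  case 0
  then show ?case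
    by (auto intro!: continuous_at_imp_continuous_on differentiable_imp_continuous_within)
qed auto

lemma Ck_const: "Ck k (\<lambda>x. r)"
  by (induction k arbitrary: r) auto

lemma Ck_add: "Ck k f \<Longrightarrow> Ck k g \<Longrightarrow> Ck k (\<lambda>x. f x + g x)"
proof (induction k arbitrary: f g)
  case (Suc k)
  have "pderiv_at i (\<lambda>x. f x + g x) = (\<lambda>x. pderiv_at i f x + pderiv_at i g x)" for i
    using Suc.prems by (auto simp: pderiv_at_add)
  then show ?case using Suc by auto
qed (auto intro: continuous_intros)

lemma Ck_diff: "Ck k f \<Longrightarrow> Ck k g \<Longrightarrow> Ck k (\<lambda>x. f x - g x)"
proof (induction k arbitrary: f g)
  case (Suc k)
  have "pderiv_at i (\<lambda>x. f x - g x) = (\<lambda>x. pderiv_at i f x - pderiv_at i g x)" for i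
    using Suc.prems by (auto simp: pderiv_at_diff)
  then show ?case using Suc by auto
qed (auto intro: continuous_intros)

lemma Ck_mult: "Ck k f \<Longrightarrow> Ck k g \<Longrightarrow> Ck k (\<lambda>x. f x * g x)"
proof (induction k arbitrary: f g)
  case (Suc k)
  have "pderiv_at i (\<lambda>x. f x * g x) = (\<lambda>x. f x * pderiv_at i g x + pderiv_at i f x * g x)" for i
    using Suc.prems by (auto simp: pderiv_at_mult)
  \<comment> \<open>The product rule leaves one factor undifferentiated, so both factors are needed
    at level k besides their derivatives.\<close>
  moreover have "Ck k f" "Ck k g" using Suc.prems Ck_Suc_imp by blast+
  ultimately show ?case using Suc.prems by (auto intro!: Ck_add Suc.IH)
qed (auto intro: continuous_intros)

lemma smooth_const: "smooth (\<lambda>x. r)"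
  and smooth_add: "smooth f \<Longrightarrow> smooth g \<Longrightarrow> smooth (\<lambda>x. f x + g x)"
  and smooth_diff: "smooth f \<Longrightarrow> smooth g \<Longrightarrow> smooth (\<lambda>x. f x - g x)"
  and smooth_mult: "smooth f \<Longrightarrow> smooth g \<Longrightarrow> smooth (\<lambda>x. f x * g x)"
  by (auto simp: smooth_def intro: Ck_const Ck_add Ck_diff Ck_mult)

lemma smooth_sum: "(\<And>i. i \<in> I \<Longrightarrow> smooth (f i)) \<Longrightarrow> smooth (\<lambda>x. \<Sum>i\<in>I. f i x)"
  by (induction I rule: infinite_finite_induct) (auto intro: smooth_const smooth_add)

lemma smooth_prod: "(\<And>i. i \<in> I \<Longrightarrow> smooth (f i)) \<Longrightarrow> smooth (\<lambda>x. \<Prod>i\<in>I. f i x)"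
  by (induction I rule: infinite_finite_induct) (auto intro: smooth_const smooth_mult)

lemma smooth_power: "smooth f \<Longrightarrow> smooth (\<lambda>x. f x ^ n)"
  by (induction n) (auto intro: smooth_const smooth_mult)

lemma smooth_pderiv: "smooth f \<Longrightarrow> smooth (pderiv_at i f)"
  unfolding smooth_def using Ck.simps(2) by blast

lemma smooth_differentiable: "smooth f \<Longrightarrow> f differentiable (at x)"
  unfolding smooth_def using Ck.simps(2) by blast

lemma smooth_continuous: "smooth f \<Longrightarrow> continuous_on S f"
  by (auto simp: smooth_def intro: continuous_on_subset dest!: spec[of _ 0])

text \<open>A function of one variable enters together with the whole sequence \<open>E\<close> of
  its successive derivatives, because each partial derivative moves one step along the sequence. The
  affine argument covers the coordinates as well as the two bump factors belonging to the ends of an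
  interval.\<close>

lemma Ck_comp_deriv_seq:
  assumes E: "\<And>k t. (E k has_real_derivative E (Suc k) t) (at t)"
  shows "Ck n (\<lambda>x. E k (c * x $ i + d))"
proof (induction n arbitrary: k)
  case 0
  have "continuous_on UNIV (E k)"
    using E[of k] by (auto intro!: continuous_at_imp_continuous_on DERIV_isCont)
  then show ?case
    by (auto intro!: continuous_intros continuous_on_compose2[of UNIV "E k"])
next
  case (Suc n)
  have D: "((\<lambda>x. E k (c * x $ i + d)) has_derivative (\<lambda>h. E (Suc k) (c * x $ i + d) * (c * h $ i))) (at x)" for x
  proof -
    have "(E k has_derivative (\<lambda>h. E (Suc k) (c * x $ i + d) * h)) (at (c * x $ i + d))"
      using E[of k "c * x $ i + d"] by (simp add: has_field_derivative_def)
    moreover have "((\<lambda>x. c * x $ i + d) has_derivative (\<lambda>h. c * h $ i)) (at x)"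
      by (auto intro!: derivative_eq_intros bounded_linear_imp_has_derivative bounded_linear_vec_nth)
    ultimately show ?thesis using has_derivative_compose by blast
  qed
  have "pderiv_at j (\<lambda>x. E k (c * x $ i + d)) = (\<lambda>x. E (Suc k) (c * x $ i + d) * (c * axis j 1 $ i))" for j
    using pderiv_at_eq[OF D] by auto
  moreover have "Ck n (\<lambda>x. E (Suc k) (c * x $ i + d) * (c * axis j 1 $ i))" for j
    by (rule Ck_mult[OF Suc Ck_const])
  ultimately show ?case using D by (auto simp: differentiable_def)
qed

lemma smooth_coord: "smooth (\<lambda>x. x $ i)"
proof -
  define E where "E k = (if k = 0 then (\<lambda>t. t) else if k = 1 then (\<lambda>t. 1) else (\<lambda>t::real. 0::real))" for k :: nat
  have "(E k has_real_derivative E (Suc k) t) (at t)" for k t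
    by (auto simp: E_def)
  from Ck_comp_deriv_seq[of E, OF this, of _ 0 1 i 0] show ?thesis
    by (auto simp: smooth_def E_def)
qed

lemma poly_fun_smooth: "q \<in> poly_fun p \<Longrightarrow> smooth q"
  by (auto simp: poly_fun_def intro!: smooth_sum smooth_mult smooth_const smooth_prod smooth_power smooth_coord)

lemma has_derivative_comp_affine:
  assumes "f differentiable (at (r *\<^sub>R x + v))"
  shows "((\<lambda>x. f (r *\<^sub>R x + v)) has_derivative
    (\<lambda>h. r * frechet_derivative f (at (r *\<^sub>R x + v)) h)) (at x)"
proof -
  let ?D = "frechet_derivative f (at (r *\<^sub>R x + v))"
  have 1: "(f has_derivative ?D) (at (r *\<^sub>R x + v))"
    using assms by (simp add: frechet_derivative_works)
  have "((\<lambda>x. r *\<^sub>R x + v) has_derivative (\<lambda>h. r *\<^sub>R h)) (at x)"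
    by (auto intro!: derivative_eq_intros)
  from has_derivative_compose[OF this 1]
  have "((\<lambda>x. f (r *\<^sub>R x + v)) has_derivative (\<lambda>h. ?D (r *\<^sub>R h))) (at x)" .
  moreover have "?D (r *\<^sub>R h) = r * ?D h" for h
    using has_derivative_linear[OF 1] by (simp add: linear_cmul)
  ultimately show ?thesis by simp
qed

lemma pderiv_at_comp_affine:
  assumes "f differentiable (at (r *\<^sub>R x + v))"
  shows "pderiv_at i (\<lambda>x. f (r *\<^sub>R x + v)) x = r * pderiv_at i f (r *\<^sub>R x + v)"
  using pderiv_at_eq[OF has_derivative_comp_affine[OF assms]] by (simp add: pderiv_at_def)

lemma Ck_comp_affine: "Ck k f \<Longrightarrow> Ck k (\<lambda>x. f (r *\<^sub>R x + v))"
proof (induction k arbitrary: f)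
  case 0
  then show ?case by (auto intro!: continuous_intros continuous_on_compose2[of UNIV f])
next
  case (Suc k)
  have "pderiv_at i (\<lambda>x. f (r *\<^sub>R x + v)) = (\<lambda>x. r * pderiv_at i f (r *\<^sub>R x + v))" for i
    using Suc.prems by (auto simp: pderiv_at_comp_affine)
  moreover have "(\<lambda>x. f (r *\<^sub>R x + v)) differentiable (at x)" for x
    using has_derivative_comp_affine[of f r x v] Suc.prems by (auto simp: differentiable_def)
  ultimately show ?case using Suc by (auto intro!: Ck_mult Ck_const)
qed

lemma smooth_comp_affine: "smooth f \<Longrightarrow> smooth (\<lambda>x. f (r *\<^sub>R x + v))"
  by (auto simp: smooth_def intro: Ck_comp_affine)

section \<open>A flat function and bump functions on boxes\<close>

definition exp_recip :: "real poly \<Rightarrow> real \<Rightarrow> real" where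
  "exp_recip p t = (if t \<le> 0 then 0 else poly p (1 / t) * exp (- (1 / t)))"

lemma poly_times_exp_neg_tendsto_0: "((\<lambda>y::real. poly p y * exp (- y)) \<longlongrightarrow> 0) at_top"
proof (induction p)
  case (pCons a p)
  have "((\<lambda>y::real. y ^ n / exp y) \<longlongrightarrow> 0) at_top" for n
    by (rule tendsto_power_div_exp_0)
  \<comment> \<open>The power of y is carried along so that induction over the polynomial can split
    off one monomial at a time.\<close>
  have *: "((\<lambda>y::real. y ^ n * poly p y * exp (- y)) \<longlongrightarrow> 0) at_top" for n p
  proof (induction p arbitrary: n)
    case (pCons a p)
    have "((\<lambda>y::real. a * (y ^ n / exp y) + y ^ Suc n * poly p y * exp (- y)) \<longlongrightarrow> a * 0 + 0) at_top"
      by (intro tendsto_intros tendsto_power_div_exp_0 pCons.IH)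
    then show ?case by (simp add: algebra_simps exp_minus divide_inverse)
  qed simp
  show ?case using *[of 0 "pCons a p"] by simp
qed simp

text \<open>With s = 1/t, differentiation replaces the polynomial p by s^2 (p - p'). The family is
  thus closed under derivatives, and smoothness across the origin follows for all orders at
  once.\<close>

lemma exp_recip_deriv:
  "(exp_recip p has_real_derivative exp_recip ([:0, 0, 1:] * (p - pderiv p)) t) (at t)"
proof -
  consider "t < 0" | "t > 0" | "t = 0" by linarith
  then show ?thesis
  proof cases
    case 1
    have "((\<lambda>t. 0) has_real_derivative 0) (at t)" by simp
    then have "(exp_recip p has_real_derivative 0) (at t)"
      by (rule has_field_derivative_transform_within_open[where S="{..<0}"]) (use 1 in \<open>auto simp: exp_recip_def\<close>)
    then show ?thesis using 1 by (simp add: exp_recip_def)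
  next
    case 2
    have "((\<lambda>t. poly p (1 / t) * exp (- (1 / t))) has_real_derivative
        poly ([:0, 0, 1:] * (p - pderiv p)) (1 / t) * exp (- (1 / t))) (at t)"
      using 2
      by (auto intro!: derivative_eq_intros DERIV_chain2[OF poly_DERIV] simp: field_simps power2_eq_square)
    then have "(exp_recip p has_real_derivative
        poly ([:0, 0, 1:] * (p - pderiv p)) (1 / t) * exp (- (1 / t))) (at t)"
      by (rule has_field_derivative_transform_within_open[where S="{0<..}"]) (use 2 in \<open>auto simp: exp_recip_def\<close>)
    then show ?thesis using 2 by (simp add: exp_recip_def)
  next
    case 3
    have "((\<lambda>h. exp_recip p h / h) \<longlongrightarrow> 0) (at 0)"
    proof (intro filterlim_split_at_real)
      show "((\<lambda>h. exp_recip p h / h) \<longlongrightarrow> 0) (at_left 0)"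
        by (rule tendsto_eventually) (auto simp: exp_recip_def eventually_at_filter)
      \<comment> \<open>At the origin the difference quotient from the right is (1/h) p(1/h)
        e^(-1/h); the extra factor 1/h is absorbed in the polynomial
        \<open>pCons 0 p\<close>.\<close>
      have "filterlim (\<lambda>h::real. 1 / h) at_top (at_right 0)"
        using filterlim_inverse_at_top_right by (simp add: inverse_eq_divide)
      from filterlim_compose[OF poly_times_exp_neg_tendsto_0[of "pCons 0 p"] this]
      have "((\<lambda>h. poly (pCons 0 p) (1 / h) * exp (- (1 / h))) \<longlongrightarrow> 0) (at_right 0)" .
      then show "((\<lambda>h. exp_recip p h / h) \<longlongrightarrow> 0) (at_right 0)"
        by (rule Lim_transform_eventually) (auto simp: exp_recip_def eventually_at_filter)
    qed

    then show ?thesis using 3 by (simp add: DERIV_def exp_recip_def)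
  qed
qed

text \<open>The parameter \<open>n\<close> steepens all factors: for growing \<open>n\<close> the
  bumps tend to the indicator of the open box and vanish outside it throughout.\<close>

definition box_bump :: "real \<Rightarrow> real^'d::finite \<Rightarrow> real^'d \<Rightarrow> real^'d \<Rightarrow> real" where
  "box_bump n a b x = (\<Prod>i\<in>UNIV. exp_recip 1 (n * x $ i + - (n * a $ i)) * exp_recip 1 (- n * x $ i + n * b $ i))"

lemma smooth_exp_recip_coord: "smooth (\<lambda>x. exp_recip p (c * x $ i + d))"
proof -
  \<comment> \<open>The k-th derivative has the same form, with the map on polynomials iterated k
    times.\<close>
  define E where "E k = exp_recip (((\<lambda>p. [:0, 0, 1:] * (p - pderiv p)) ^^ k) p)" for k
  have "(E k has_real_derivative E (Suc k) t) (at t)" for k t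
    unfolding E_def funpow.simps o_def by (rule exp_recip_deriv)
  from Ck_comp_deriv_seq[of E, OF this, of _ 0 c i d] show ?thesis
    by (auto simp: smooth_def E_def)
qed

lemma smooth_box_bump: "smooth (box_bump n a b)"
  unfolding box_bump_def[abs_def] by (intro smooth_prod smooth_mult smooth_exp_recip_coord)

lemma exp_recip_1_nonneg: "0 \<le> exp_recip 1 t" and exp_recip_1_le_1: "exp_recip 1 t \<le> 1"
  and exp_recip_1_eq_0: "exp_recip 1 t = 0 \<longleftrightarrow> t \<le> 0"
  by (auto simp: exp_recip_def)

lemma box_bump_nonneg: "0 \<le> box_bump n a b x"
  by (auto simp: box_bump_def intro!: prod_nonneg mult_nonneg_nonneg exp_recip_1_nonneg)

lemma box_bump_le_1: "box_bump n a b x \<le> 1"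
  by (auto simp: box_bump_def intro!: prod_le_1 mult_nonneg_nonneg exp_recip_1_nonneg mult_le_one exp_recip_1_le_1)

lemma box_bump_eq_0:
  assumes "n > 0"
  shows "box_bump n a b x = 0 \<longleftrightarrow> x \<notin> box a b"
proof -
  have "n * x $ i + - (n * a $ i) \<le> 0 \<longleftrightarrow> x $ i \<le> a $ i" "- n * x $ i + n * b $ i \<le> 0 \<longleftrightarrow> b $ i \<le> x $ i" for i
    using assms by auto
  then show ?thesis
    by (auto simp: box_bump_def exp_recip_1_eq_0 mem_box_cart not_less)
qed

lemma box_bump_tendsto:
  "(\<lambda>n. box_bump (Suc n) a b x) \<longlonglongrightarrow> indicator (box a b) x"
proof (cases "x \<in> box a b")
  case False
  then show ?thesis using box_bump_eq_0[of "Suc n" a b x for n]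
    by (simp add: not_less)
next
  case True
  have lim: "(\<lambda>n. exp_recip 1 (real (Suc n) * t)) \<longlonglongrightarrow> 1" if "t > 0" for t
  proof -
    have "(\<lambda>n. exp (- (1 / t) * inverse (real (Suc n)))) \<longlonglongrightarrow> exp (- (1 / t) * 0)"
      by (intro tendsto_intros LIMSEQ_inverse_real_of_nat)
    moreover have "exp_recip 1 (real (Suc n) * t) = exp (- (1 / t) * inverse (real (Suc n)))" for n
    proof -
      have "\<not> real (Suc n) * t \<le> 0" using that by (simp add: not_le zero_less_mult_iff)
      then show ?thesis by (simp add: exp_recip_def field_simps)
    qed
    ultimately show ?thesis by simp
  qed
  have "(\<lambda>n. box_bump (Suc n) a b x) = (\<lambda>n. \<Prod>i\<in>UNIV. exp_recip 1 (real (Suc n) * (x $ i - a $ i)) *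
      exp_recip 1 (real (Suc n) * (b $ i - x $ i)))"
    by (simp add: box_bump_def algebra_simps)
  also have "\<dots> \<longlonglongrightarrow> (\<Prod>i\<in>(UNIV::'a set). 1 * 1)"
    using True by (intro tendsto_prod tendsto_mult lim) (auto simp: mem_box_cart)
  finally show ?thesis using True by simp
qed

lemma compact_closure_subset:
  fixes S T :: "'a::heine_borel set"
  assumes "compact T" "closure S \<subseteq> T"
  shows "compact (closure S)"
  using assms compact_imp_bounded bounded_subset compact_eq_bounded_closed closed_closure by metis

lemma test_fun_box_bump:
  assumes "n > 0" "cbox a b \<subseteq> S"
  shows "test_fun S (box_bump n a b)"
proof -
  have *: "closure {x. box_bump n a b x \<noteq> 0} \<subseteq> cbox a b"
    using box_bump_eq_0[OF assms(1)] box_subset_cbox[of a b]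
    by (intro closure_minimal) auto
  then have "compact (closure {x. box_bump n a b x \<noteq> 0})"
    using compact_closure_subset compact_cbox by blast
  then show ?thesis using * assms(2) by (auto simp: test_fun_def smooth_box_bump)
qed

section \<open>Supports, and cutting off along disjoint open sets\<close>

lemma eventually_zero_outside_support:
  assumes "x \<notin> closure {x. f x \<noteq> 0}"
  shows "eventually (\<lambda>y. f y = 0) (nhds x)"
proof -
  have "eventually (\<lambda>y. y \<in> - closure {x. f x \<noteq> 0}) (nhds x)"
    using assms by (intro eventually_nhds_in_open) auto
  then show ?thesis
  proof eventually_elim
    case (elim y)
    then show ?case using closure_subset[of "{x. f x \<noteq> 0}"] by auto
  qed
qed

lemma pderiv_at_zero_outside:
  assumes "x \<notin> closure {x. f x \<noteq> 0}"
  shows "pderiv_at i f x = 0"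
  using pderiv_at_cong_eventually(2)[OF eventually_zero_outside_support[OF assms]] by simp

lemma closure_support_pderiv_at:
  "closure {x. pderiv_at i f x \<noteq> 0} \<subseteq> closure {x. f x \<noteq> 0}"
  by (rule closure_minimal) (use pderiv_at_zero_outside in blast, simp)

lemma test_fun_pderiv: "test_fun S \<phi> \<Longrightarrow> test_fun S (pderiv_at i \<phi>)"
  unfolding test_fun_def using closure_support_pderiv_at[of i \<phi>]
  by (meson smooth_pderiv compact_closure_subset order_trans)

lemma test_fun_outside: "test_fun S \<phi> \<Longrightarrow> x \<notin> S \<Longrightarrow> \<phi> x = 0"
  using closure_subset[of "{x. \<phi> x \<noteq> 0}"] unfolding test_fun_def by blast

lemma test_fun_mono: "test_fun S \<phi> \<Longrightarrow> S \<subseteq> T \<Longrightarrow> test_fun T \<phi>"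
  by (auto simp: test_fun_def)

lemma test_fun_diff:
  assumes "test_fun S \<phi>" "test_fun S \<psi>"
  shows "test_fun S (\<lambda>x. \<phi> x - \<psi> x)"
proof -
  have "closure {x. \<phi> x - \<psi> x \<noteq> 0} \<subseteq> closure {x. \<phi> x \<noteq> 0} \<union> closure {x. \<psi> x \<noteq> 0}"
    by (subst closure_Un[symmetric], rule closure_mono) auto
  moreover from this have "compact (closure {x. \<phi> x - \<psi> x \<noteq> 0})"
    using assms by (intro compact_closure_subset[OF compact_Un]) (auto simp: test_fun_def)
  ultimately show ?thesis using assms by (auto simp: test_fun_def smooth_diff)
qed

text \<open>The discontinuity of the indicator does no harm: every point lies in \<open>U\<close>,
  in \<open>W\<close> or off the support of \<open>f\<close>, and in each case the product agrees
  nearby with \<open>f\<close> or with 0.\<close>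

lemma pderiv_at_cutoff:
  fixes f :: "real^'d::finite \<Rightarrow> real"
  assumes "open U" "open W" "U \<inter> W = {}" "closure {x. f x \<noteq> 0} \<subseteq> U \<union> W"
    and f: "\<And>x. f differentiable (at x)"
  shows "(\<lambda>x. indicator U x * f x) differentiable (at x)"
    and "pderiv_at i (\<lambda>x. indicator U x * f x) x = indicator U x * pderiv_at i f x"
proof -
  let ?g = "\<lambda>x. indicator U x * f x"
  consider "x \<in> U" | "x \<in> W" | "x \<notin> closure {x. f x \<noteq> 0}" "x \<notin> U" using assms(4) by auto
  then have "?g differentiable (at x) \<and> pderiv_at i ?g x = indicator U x * pderiv_at i f x"
  proof cases
    case 1
    have "eventually (\<lambda>y. ?g y = f y) (nhds x)"
      using eventually_nhds_in_open[OF assms(1) 1] by eventually_elim simp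
    from pderiv_at_cong_eventually[OF this f] show ?thesis using 1 by simp
  next
    case 2
    have "eventually (\<lambda>y. ?g y = 0) (nhds x)"
      using eventually_nhds_in_open[OF assms(2) 2] by eventually_elim (use assms(3) in \<open>auto simp: indicator_def\<close>)
    from pderiv_at_cong_eventually[OF this] show ?thesis using 2 assms(3) by (auto simp: indicator_def)
  next
    case 3
    have "eventually (\<lambda>y. ?g y = 0) (nhds x)"
      using eventually_zero_outside_support[OF 3(1)] by eventually_elim simp
    from pderiv_at_cong_eventually[OF this] show ?thesis using 3 by simp
  qed
  then show "?g differentiable (at x)" "pderiv_at i ?g x = indicator U x * pderiv_at i f x" by auto
qed

text \<open>Partial derivatives commute with the cut-off and do not enlarge the support, so the
  induction reduces to continuity of a cut-off first derivative.\<close>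

lemma Ck_cutoff:
  fixes f :: "real^'d::finite \<Rightarrow> real"
  assumes "open U" "open W" "U \<inter> W = {}"
  shows "closure {x. f x \<noteq> 0} \<subseteq> U \<union> W \<Longrightarrow> Ck (Suc k) f \<Longrightarrow> Ck (Suc k) (\<lambda>x. indicator U x * f x)"
proof (induction k arbitrary: f)
  case 0
  have "Ck 1 (\<lambda>x. indicator U x * f x)" if f: "Ck 1 f" "closure {x. f x \<noteq> 0} \<subseteq> U \<union> W" for f :: "real^'d \<Rightarrow> real"
  proof -
    have d: "f differentiable (at x)" and c: "continuous_on UNIV (pderiv_at i f)" for x i using f by auto
    have "continuous_on UNIV (\<lambda>x. indicator U x * pderiv_at i f x)" for i
    proof (intro continuous_at_imp_continuous_on ballI)
      fix x
      let ?p = "pderiv_at i f" let ?g = "\<lambda>x. indicator U x * ?p x"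
      have p: "isCont ?p x" using c by (simp add: continuous_on_eq_continuous_at)
      have s: "closure {x. ?p x \<noteq> 0} \<subseteq> U \<union> W" using closure_support_pderiv_at f by blast
      consider "x \<in> U" | "x \<in> W" | "x \<notin> closure {x. ?p x \<noteq> 0}" using s by auto
      then show "isCont ?g x"
      proof cases
        case 1
        have "eventually (\<lambda>y. ?g y = ?p y) (nhds x)"
          using eventually_nhds_in_open[OF assms(1) 1] by eventually_elim simp
        from isCont_cong[OF this] show ?thesis using p by simp
      next
        case 2
        have "eventually (\<lambda>y. ?g y = 0) (nhds x)"
          using eventually_nhds_in_open[OF assms(2) 2] by eventually_elim (use assms(3) in \<open>auto simp: indicator_def\<close>)
        then show ?thesis using isCont_cong[of ?g "\<lambda>x. 0" x] by simp
      next
        case 3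
        have "eventually (\<lambda>y. ?g y = 0) (nhds x)"
          using eventually_zero_outside_support[OF 3] by eventually_elim simp
        then show ?thesis using isCont_cong[of ?g "\<lambda>x. 0" x] by simp
      qed
    qed
    moreover have "pderiv_at i (\<lambda>x. indicator U x * f x) = (\<lambda>x. indicator U x * pderiv_at i f x)" for i
      using pderiv_at_cutoff(2)[OF assms f(2) d] by auto
    ultimately show ?thesis using pderiv_at_cutoff(1)[OF assms f(2) d] by simp
  qed
  then show ?case using 0 by simp
next
  case (Suc k)
  have d: "f differentiable (at x)" for x using Suc.prems by simp
  have "pderiv_at i (\<lambda>x. indicator U x * f x) = (\<lambda>x. indicator U x * pderiv_at i f x)" for i
    using pderiv_at_cutoff(2)[OF assms Suc.prems(1) d] by auto
  moreover have "Ck (Suc k) (\<lambda>x. indicator U x * pderiv_at i f x)" for i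
  proof (rule Suc.IH)
    show "closure {x. pderiv_at i f x \<noteq> 0} \<subseteq> U \<union> W"
      using closure_support_pderiv_at[of i f] Suc.prems(1) by simp
    show "Ck (Suc k) (pderiv_at i f)"
      using Suc.prems(2) unfolding Ck.simps(2)[of "Suc k" f] by simp
  qed
  ultimately show ?case using pderiv_at_cutoff(1)[OF assms Suc.prems(1) d]
    unfolding Ck.simps(2)[of "Suc k" "\<lambda>x. indicator U x * f x"] by presburger
qed

text \<open>Splits a test function on a union of two disjoint open sets into test functions of the
  pieces; this is what makes weak derivatives local.\<close>

lemma test_fun_cutoff:
  assumes "open U" "open W" "U \<inter> W = {}" "test_fun (U \<union> W) \<phi>"
  shows "test_fun U (\<lambda>x. indicator U x * \<phi> x)"
    and "pderiv_at i (\<lambda>x. indicator U x * \<phi> x) = (\<lambda>x. indicator U x * pderiv_at i \<phi> x)"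
proof -
  have s: "closure {x. \<phi> x \<noteq> 0} \<subseteq> U \<union> W" and sm: "smooth \<phi>" and cp: "compact (closure {x. \<phi> x \<noteq> 0})"
    using assms(4) by (auto simp: test_fun_def)
  have "Ck k (\<lambda>x. indicator U x * \<phi> x)" for k
    using Ck_cutoff[OF assms(1-3) s, of k] sm Ck_Suc_imp by (auto simp: smooth_def simp del: Ck.simps)
  \<comment> \<open>Deleting the open set \<open>W\<close> leaves a closed part of the compact
    support, and this part lies in \<open>U\<close>.\<close>
  moreover have "closure {x. indicator U x * \<phi> x \<noteq> 0} \<subseteq> closure {x. \<phi> x \<noteq> 0} - W"
  proof (rule closure_minimal)
    show "{x. indicator U x * \<phi> x \<noteq> 0} \<subseteq> closure {x. \<phi> x \<noteq> 0} - W"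
      using assms(3) closure_subset[of "{x. \<phi> x \<noteq> 0}"] by (auto simp: indicator_def split: if_splits)
  qed (use assms(2) in auto)
  moreover from this have "compact (closure {x. indicator U x * \<phi> x \<noteq> 0})"
    using cp by (intro compact_closure_subset[OF cp]) auto
  ultimately show "test_fun U (\<lambda>x. indicator U x * \<phi> x)"
    using s by (auto simp: test_fun_def smooth_def)
  show "pderiv_at i (\<lambda>x. indicator U x * \<phi> x) = (\<lambda>x. indicator U x * pderiv_at i \<phi> x)"
    using pderiv_at_cutoff(2)[OF assms(1-3) s smooth_differentiable[OF sm]] by auto
qed

section \<open>Weak derivatives\<close>

text \<open>Completeness of Lebesgue measure: the functions differ on a null set, and all subsets of
  a null set are measurable. This is what permits the exchange of representatives
  throughout.\<close>

lemma borel_measurable_lebesgue_AE_cong: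
  fixes f g :: "'a::euclidean_space \<Rightarrow> 'b::topological_space"
  assumes "f \<in> borel_measurable lebesgue" "AE x in lebesgue. f x = g x"
  shows "g \<in> borel_measurable lebesgue"
proof (rule measurableI)
  fix A :: "'b set" assume A: "A \<in> sets borel"
  define N where "N = {x. f x \<noteq> g x}"
  have N: "N \<in> null_sets lebesgue"
  proof (rule AE_E[OF assms(2)])
    fix N' assume "{x \<in> space lebesgue. f x \<noteq> g x} \<subseteq> N'" "emeasure lebesgue N' = 0" "N' \<in> sets lebesgue"
    then have "N \<subseteq> N'" "N' \<in> null_sets lebesgue" by (auto simp: N_def)
    then show "N \<in> null_sets lebesgue" by (rule null_sets_completion_subset)
  qed
  have "g -` A \<inter> N \<in> null_sets lebesgue"
    by (rule null_sets_completion_subset[OF _ N]) auto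
  moreover have "f -` A - N \<in> sets lebesgue"
    using measurable_sets[OF assms(1) A] N by (auto simp: null_sets_def)
  moreover have "g -` A = (f -` A - N) \<union> (g -` A \<inter> N)" by (auto simp: N_def)
  ultimately show "g -` A \<inter> space lebesgue \<in> sets lebesgue"
    using sets.Un[OF _ null_setsD2, of "f -` A - N" lebesgue "g -` A \<inter> N"] by simp
qed simp

lemma set_integrable_lebesgue_AE_cong:
  fixes f g :: "'a::euclidean_space \<Rightarrow> 'b::{banach, second_countable_topology}"
  assumes "set_integrable lebesgue S f" "AE x in lebesgue. x \<in> S \<longrightarrow> f x = g x"
  shows "set_integrable lebesgue S g" and "(LINT x:S|lebesgue. f x) = (LINT x:S|lebesgue. g x)"
proof -
  have ae: "AE x in lebesgue. indicator S x *\<^sub>R f x = indicator S x *\<^sub>R g x"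
    using assms(2) by eventually_elim (auto simp: indicator_def)
  have f: "(\<lambda>x. indicator S x *\<^sub>R f x) \<in> borel_measurable lebesgue"
    using assms(1) by (auto simp: set_integrable_def)
  have g: "(\<lambda>x. indicator S x *\<^sub>R g x) \<in> borel_measurable lebesgue"
    by (rule borel_measurable_lebesgue_AE_cong[OF f ae])
  show "set_integrable lebesgue S g"
    using assms(1) integrable_cong_AE[OF f g ae] by (simp add: set_integrable_def)
  show "(LINT x:S|lebesgue. f x) = (LINT x:S|lebesgue. g x)"
    using integral_cong_AE[OF f g ae] by (simp add: set_lebesgue_integral_def)
qed

lemma test_fun_bounded:
  assumes "test_fun S \<phi>"
  obtains M where "\<And>x. \<bar>\<phi> x\<bar> \<le> M"
proof -
  let ?C = "closure {x. \<phi> x \<noteq> 0}"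
  have "compact (\<phi> ` ?C)"
    using assms by (intro compact_continuous_image smooth_continuous) (auto simp: test_fun_def)
  then obtain M where M: "\<And>x. x \<in> ?C \<Longrightarrow> \<bar>\<phi> x\<bar> \<le> M"
    using compact_imp_bounded[of "\<phi> ` ?C"] by (auto simp: bounded_iff)
  have "\<bar>\<phi> x\<bar> \<le> max M 0" for x
    using M[of x] closure_subset[of "{x. \<phi> x \<noteq> 0}"] by (cases "\<phi> x = 0") auto
  then show ?thesis using that by blast
qed

lemma smooth_measurable: "smooth f \<Longrightarrow> f \<in> borel_measurable borel"
  by (intro borel_measurable_continuous_onI smooth_continuous)

lemma smooth_measurable_lebesgue: "smooth f \<Longrightarrow> f \<in> borel_measurable lebesgue"
  by (intro measurable_completion) (simp add: smooth_measurable)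

lemma loc_integrable_times_test:
  assumes g: "loc_integrable S g" and \<phi>: "test_fun S \<phi>"
  shows "set_integrable lebesgue S (\<lambda>x. g x * \<phi> x)"
proof -
  let ?C = "closure {x. \<phi> x \<noteq> 0}"
  have C: "compact ?C" "?C \<subseteq> S" "smooth \<phi>" using \<phi> by (auto simp: test_fun_def)
  obtain M where M: "\<And>x. \<bar>\<phi> x\<bar> \<le> M" using test_fun_bounded[OF \<phi>] by blast
  have int: "integrable lebesgue (\<lambda>x. indicator ?C x *\<^sub>R g x)"
    using g C by (auto simp: loc_integrable_def set_integrable_def)
  have "integrable lebesgue (\<lambda>x. (indicator ?C x *\<^sub>R g x) * \<phi> x)"
  proof (rule Bochner_Integration.integrable_bound)
    show "integrable lebesgue (\<lambda>x. (indicator ?C x *\<^sub>R g x) * M)" using int by simp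
    show "(\<lambda>x. indicator ?C x *\<^sub>R g x * \<phi> x) \<in> borel_measurable lebesgue"
      using int smooth_measurable_lebesgue[OF C(3)] by measurable
    have "0 \<le> M" using M[of undefined] by linarith
    then show "AE x in lebesgue. norm (indicator ?C x *\<^sub>R g x * \<phi> x) \<le> norm (indicator ?C x *\<^sub>R g x * M)"
      using M by (intro AE_I2) (auto simp: abs_mult intro!: mult_left_mono)
  qed
  moreover have "(\<lambda>x. (indicator ?C x *\<^sub>R g x) * \<phi> x) = (\<lambda>x. indicator S x *\<^sub>R (g x * \<phi> x))"
    using C(2) closure_subset[of "{x. \<phi> x \<noteq> 0}"] by (intro ext) (auto simp: indicator_def)
  ultimately show ?thesis by (simp only: set_integrable_def)
qed

lemma loc_integrable_diff:
  "loc_integrable S f \<Longrightarrow> loc_integrable S g \<Longrightarrow> loc_integrable S (\<lambda>x. f x - g x)"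
  by (auto simp: loc_integrable_def)

lemma loc_integrable_subset: "loc_integrable S g \<Longrightarrow> U \<subseteq> S \<Longrightarrow> loc_integrable U g"
  by (auto simp: loc_integrable_def)

lemma loc_integrable_AE_cong:
  assumes "loc_integrable S f" "AE x in lebesgue. x \<in> S \<longrightarrow> f x = g x"
  shows "loc_integrable S g"
  unfolding loc_integrable_def
proof safe
  fix C assume "compact C" "C \<subseteq> S"
  moreover from this have "AE x in lebesgue. x \<in> C \<longrightarrow> f x = g x"
    using assms(2) by (auto elim: AE_mp)
  ultimately show "set_integrable lebesgue C g"
    using assms(1) set_integrable_lebesgue_AE_cong(1)[of C f g] by (auto simp: loc_integrable_def)
qed

section \<open>The fundamental lemma of the calculus of variations\<close>

lemma set_lborel_integral_box_zero:
  fixes g :: "real^'d::finite \<Rightarrow> real"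
  assumes g: "loc_integrable S g" and S: "cbox a b \<subseteq> S"
    and zero: "\<And>\<phi>. test_fun S \<phi> \<Longrightarrow> (LINT x:S|lebesgue. g x * \<phi> x) = 0"
  shows "(LINT x:box a b|lebesgue. g x) = 0"
proof -
  let ?\<phi> = "\<lambda>n. box_bump (Suc n) a b"
  have t: "test_fun S (?\<phi> n)" for n using test_fun_box_bump[OF _ S] by simp
  have int: "integrable lebesgue (\<lambda>x. indicator (cbox a b) x *\<^sub>R g x)"
    using g S compact_cbox by (auto simp: loc_integrable_def set_integrable_def)
  have m: "?\<phi> n \<in> borel_measurable lebesgue" for n
    by (intro smooth_measurable_lebesgue smooth_box_bump)
  have z: "?\<phi> n x = 0" if "x \<notin> box a b" for n x
    using box_bump_eq_0[of "Suc n" a b x] that by simp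
  have sub: "x \<in> box a b \<Longrightarrow> x \<in> cbox a b" for x using box_subset_cbox by blast
  \<comment> \<open>The bumps are admissible test functions, stay between 0 and 1 and tend to the
    indicator of the open box, so the zero integrals pass to the limit.\<close>
  have "(\<lambda>n. LINT x|lebesgue. (indicator (cbox a b) x *\<^sub>R g x) * ?\<phi> n x)
      \<longlonglongrightarrow> (LINT x|lebesgue. (indicator (cbox a b) x *\<^sub>R g x) * indicator (box a b) x)"
  proof (rule integral_dominated_convergence)
    show "integrable lebesgue (\<lambda>x. norm (indicator (cbox a b) x *\<^sub>R g x))" using int by simp
    show "AE x in lebesgue. (\<lambda>n. indicator (cbox a b) x *\<^sub>R g x * ?\<phi> n x)
        \<longlonglongrightarrow> indicator (cbox a b) x *\<^sub>R g x * indicator (box a b) x"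
      by (intro AE_I2 tendsto_intros box_bump_tendsto)
    show "AE x in lebesgue. norm (indicator (cbox a b) x *\<^sub>R g x * ?\<phi> n x)
        \<le> norm (indicator (cbox a b) x *\<^sub>R g x)" for n
      using box_bump_nonneg[of "Suc n" a b] box_bump_le_1[of "Suc n" a b]
      by (intro AE_I2) (simp add: abs_mult mult_left_le)
    have [measurable]: "box a b \<in> sets lebesgue" by simp
    show "(\<lambda>x. indicator (cbox a b) x *\<^sub>R g x * indicator (box a b) x) \<in> borel_measurable lebesgue"
      using borel_measurable_integrable[OF int] by measurable
    show "(\<lambda>x. indicator (cbox a b) x *\<^sub>R g x * ?\<phi> n x) \<in> borel_measurable lebesgue" for n
      using borel_measurable_integrable[OF int] m[of n] by measurable
  qed
  moreover have "(LINT x|lebesgue. (indicator (cbox a b) x *\<^sub>R g x) * ?\<phi> n x) = 0" for n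
  proof -
    have "(\<lambda>x. (indicator (cbox a b) x *\<^sub>R g x) * ?\<phi> n x) = (\<lambda>x. indicator S x *\<^sub>R (g x * ?\<phi> n x))"
    proof
      fix x show "(indicator (cbox a b) x *\<^sub>R g x) * ?\<phi> n x = indicator S x *\<^sub>R (g x * ?\<phi> n x)"
        using z[of x n] sub[of x] S by (cases "x \<in> box a b") (auto simp: indicator_def)
    qed
    then show ?thesis using zero[OF t[of n]] by (simp only: set_lebesgue_integral_def)
  qed
  moreover have "(\<lambda>x. (indicator (cbox a b) x *\<^sub>R g x) * indicator (box a b) x) = (\<lambda>x. indicator (box a b) x *\<^sub>R g x)"
    using sub by (auto simp: indicator_def)
  ultimately show ?thesis
    by (simp only: set_lebesgue_integral_def LIMSEQ_const_iff)
qed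

text \<open>The integrals over all small boxes vanish, so by Lebesgue differentiation the function
  vanishes at almost every point.\<close>

lemma AE_zero_on_box:
  fixes g :: "real^'d::finite \<Rightarrow> real"
  assumes g: "loc_integrable S g" and S: "cbox a b \<subseteq> S"
    and zero: "\<And>\<phi>. test_fun S \<phi> \<Longrightarrow> (LINT x:S|lebesgue. g x * \<phi> x) = 0"
  shows "AE x in lebesgue. x \<in> cbox a b \<longrightarrow> g x = 0"
proof -
  \<comment> \<open>The differentiation theorem asks for integrability over every box. Cutting
    \<open>g\<close> off outside \<open>cbox a b\<close> ensures it and changes nothing near points
    of the open box.\<close>
  define G where "G x = (if x \<in> cbox a b then g x else 0)" for x
  have "set_integrable lebesgue (cbox a b) g" using g S compact_cbox by (auto simp: loc_integrable_def)
  then have iG: "integrable lebesgue G"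
    unfolding set_integrable_def
    by (rule Bochner_Integration.integrable_cong[THEN iffD1, OF refl, rotated]) (auto simp: G_def)
  have intG: "set_integrable lebesgue (cbox c d) G" for c d
    unfolding set_integrable_def by (rule integrable_mult_indicator[OF _ iG]) simp
  then have "G integrable_on cbox c d" for c d
    using set_lebesgue_integral_eq_integral(1) by blast
  then obtain N where N: "negligible N"
    and lim: "\<And>x e. \<lbrakk>x \<notin> N; 0 < e\<rbrakk> \<Longrightarrow> \<exists>d>0. \<forall>h. 0 < h \<and> h < d \<longrightarrow>
      norm (integral (cbox x (x + h *\<^sub>R One)) G /\<^sub>R h ^ DIM(real^'d) - G x) < e"
    using integrable_ccontinuous_explicit[of G] by metis
  have "g x = 0" if x: "x \<in> box a b" "x \<notin> N" for x
  proof (rule ccontr)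
    assume "g x \<noteq> 0"
    have Gx: "G x = g x" using x box_subset_cbox[of a b] by (auto simp: G_def)
    obtain d where d: "d > 0" "\<And>h. 0 < h \<Longrightarrow> h < d \<Longrightarrow>
        norm (integral (cbox x (x + h *\<^sub>R One)) G /\<^sub>R h ^ DIM(real^'d) - G x) < norm (g x)"
      using lim[OF x(2), of "norm (g x)"] \<open>g x \<noteq> 0\<close> by auto
    obtain e where e: "e > 0" "cball x e \<subseteq> box a b"
      using open_contains_cball[of "box a b"] x(1) by (auto simp: open_box)
    \<comment> \<open>The side has to be below the differentiation radius \<open>d\<close>, and the
      cube has to stay inside \<open>box a b\<close>, which the ball of radius \<open>e\<close>
      guarantees.\<close>
    define h where "h = min (d / 2) (e / norm (One :: real^'d))"
    have h: "h > 0" "h < d" "h * norm (One :: real^'d) \<le> e"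
      using d(1) e(1) by (auto simp: h_def min_def field_simps)
    have xh: "x + h *\<^sub>R One \<in> box a b"
      using h e(2) by (auto simp: mem_cball dist_norm subset_iff)
    have cb: "cbox x (x + h *\<^sub>R One) \<subseteq> box a b"
      using x(1) xh by (fastforce simp: mem_box)
    then have cbS: "cbox x (x + h *\<^sub>R One) \<subseteq> S" using S box_subset_cbox by blast
    have "integral (cbox x (x + h *\<^sub>R One)) G = (LINT y:cbox x (x + h *\<^sub>R One)|lebesgue. G y)"
      using set_lebesgue_integral_eq_integral(2)[OF intG] by simp
    also have "\<dots> = (LINT y:box x (x + h *\<^sub>R One)|lebesgue. g y)"
    proof -
      let ?B = "box x (x + h *\<^sub>R One)" and ?C = "cbox x (x + h *\<^sub>R One)"
      have "?C - ?B \<in> null_sets lebesgue"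
        using negligible_frontier_interval[of x "x + h *\<^sub>R One"] by (simp add: negligible_iff_null_sets)
      then have "AE y in lebesgue. y \<notin> ?C - ?B" by (rule AE_not_in)
      then have ae: "AE y in lebesgue. indicator ?C y *\<^sub>R G y = indicator ?B y *\<^sub>R g y"
      proof eventually_elim
        case (elim y)
        have "y \<in> ?C \<Longrightarrow> G y = g y" using cb box_subset_cbox[of a b] by (auto simp: G_def)
        then show ?case using elim box_subset_cbox[of x "x + h *\<^sub>R One"] by (auto simp: indicator_def)
      qed
      have "(\<lambda>y. indicator ?C y *\<^sub>R G y) \<in> borel_measurable lebesgue"
        using intG by (auto simp: set_integrable_def)
      then show ?thesis
        using integral_cong_AE[OF _ _ ae] borel_measurable_lebesgue_AE_cong[OF _ ae]
        by (auto simp: set_lebesgue_integral_def)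
    qed
    also have "\<dots> = 0" by (rule set_lborel_integral_box_zero[OF g cbS zero])
    finally show False using d(2)[OF h(1,2)] Gx by simp
  qed
  moreover have "AE x in lebesgue. x \<notin> N \<union> (cbox a b - box a b)"
    using N negligible_frontier_interval[of a b]
    by (intro AE_not_in null_sets.Un) (simp_all add: negligible_iff_null_sets)
  ultimately show ?thesis by (auto elim: AE_mp)
qed

text \<open>An open set is a countable union of boxes with rational corners, so the exceptional null
  sets of the boxes add up to a null set.\<close>

lemma fundamental_lemma_calculus_of_variations:
  fixes g :: "real^'d::finite \<Rightarrow> real"
  assumes "open S" "loc_integrable S g"
    and zero: "\<And>\<phi>. test_fun S \<phi> \<Longrightarrow> (LINT x:S|lebesgue. g x * \<phi> x) = 0"
  shows "AE x in lebesgue. x \<in> S \<longrightarrow> g x = 0"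
proof -
  define a where "a f = (\<Sum>i\<in>(Basis::(real^'d) set). fst (f i) *\<^sub>R i)" for f :: "real^'d \<Rightarrow> real \<times> real"
  define b where "b f = (\<Sum>i\<in>(Basis::(real^'d) set). snd (f i) *\<^sub>R i)" for f :: "real^'d \<Rightarrow> real \<times> real"
  define I where "I = {f\<in>Basis \<rightarrow>\<^sub>E \<rat> \<times> \<rat>. cbox (a f) (b f) \<subseteq> S}"
  have S: "S = (\<Union>f\<in>I. cbox (a f) (b f))"
    using open_UNION_cbox[OF assms(1)] by (simp add: a_def b_def I_def)
  have "countable I"
    unfolding I_def by (rule countable_subset[of _ "Basis \<rightarrow>\<^sub>E \<rat> \<times> \<rat>"])
      (auto intro!: countable_PiE countable_SIGMA countable_rat)
  moreover have "AE x in lebesgue. x \<in> cbox (a f) (b f) \<longrightarrow> g x = 0" if "f \<in> I" for f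
    using that by (intro AE_zero_on_box[OF assms(2) _ zero]) (auto simp: I_def)
  ultimately have "AE x in lebesgue. \<forall>f\<in>I. x \<in> cbox (a f) (b f) \<longrightarrow> g x = 0"
    by (subst AE_ball_countable) auto
  then show ?thesis by eventually_elim (use S in blast)
qed

section \<open>Linearity, uniqueness and locality of weak derivatives\<close>

lemma has_weak_pderiv_diff:
  assumes "has_weak_pderiv S i v g" "has_weak_pderiv S i w h"
  shows "has_weak_pderiv S i (\<lambda>x. v x - w x) (\<lambda>x. g x - h x)"
proof -
  have l: "loc_integrable S v" "loc_integrable S w" "loc_integrable S g" "loc_integrable S h"
    using assms by (auto simp: has_weak_pderiv_def)
  have "(LINT x:S|lebesgue. (v x - w x) * pderiv_at i \<phi> x) = - (LINT x:S|lebesgue. (g x - h x) * \<phi> x)"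
    if t: "test_fun S \<phi>" for \<phi>
  proof -
    note t' = test_fun_pderiv[OF t, of i]
    have "(LINT x:S|lebesgue. (v x - w x) * pderiv_at i \<phi> x)
       = (LINT x:S|lebesgue. v x * pderiv_at i \<phi> x) - (LINT x:S|lebesgue. w x * pderiv_at i \<phi> x)"
      using set_integral_diff(2)[OF loc_integrable_times_test[OF l(1) t'] loc_integrable_times_test[OF l(2) t']]
      by (simp add: left_diff_distrib)
    also have "\<dots> = - (LINT x:S|lebesgue. g x * \<phi> x) + (LINT x:S|lebesgue. h x * \<phi> x)"
      using assms t by (simp add: has_weak_pderiv_def)
    also have "\<dots> = - (LINT x:S|lebesgue. (g x - h x) * \<phi> x)"
      using set_integral_diff(2)[OF loc_integrable_times_test[OF l(3) t] loc_integrable_times_test[OF l(4) t]]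
      by (simp add: left_diff_distrib)
    finally show ?thesis .
  qed
  then show ?thesis using l by (auto simp: has_weak_pderiv_def loc_integrable_diff)
qed

lemma has_weak_pderiv_cong_AE:
  assumes "has_weak_pderiv S i v g" "AE x in lebesgue. x \<in> S \<longrightarrow> v x = w x"
    "AE x in lebesgue. x \<in> S \<longrightarrow> g x = h x"
  shows "has_weak_pderiv S i w h"
proof -
  have l: "loc_integrable S v" "loc_integrable S g" using assms by (auto simp: has_weak_pderiv_def)
  have "(LINT x:S|lebesgue. w x * pderiv_at i \<phi> x) = - (LINT x:S|lebesgue. h x * \<phi> x)"
    if t: "test_fun S \<phi>" for \<phi>
  proof -
    have "(LINT x:S|lebesgue. v x * pderiv_at i \<phi> x) = (LINT x:S|lebesgue. w x * pderiv_at i \<phi> x)"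
      using assms(2) by (intro set_integrable_lebesgue_AE_cong(2) loc_integrable_times_test l test_fun_pderiv t) auto
    moreover have "(LINT x:S|lebesgue. g x * \<phi> x) = (LINT x:S|lebesgue. h x * \<phi> x)"
      using assms(3) by (intro set_integrable_lebesgue_AE_cong(2) loc_integrable_times_test l t) auto
    ultimately show ?thesis using assms(1) t by (simp add: has_weak_pderiv_def)
  qed
  then show ?thesis
    using l loc_integrable_AE_cong[OF _ assms(2)] loc_integrable_AE_cong[OF _ assms(3)]
    by (auto simp: has_weak_pderiv_def)
qed

text \<open>The difference of the two candidates is a weak derivative of the zero function, hence
  annihilates every test function.\<close>

lemma has_weak_pderiv_unique:
  assumes "open S" "has_weak_pderiv S i v g" "has_weak_pderiv S i v h"
  shows "AE x in lebesgue. x \<in> S \<longrightarrow> g x = h x"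
proof -
  have d: "has_weak_pderiv S i (\<lambda>x. v x - v x) (\<lambda>x. g x - h x)"
    by (rule has_weak_pderiv_diff[OF assms(2,3)])
  have "AE x in lebesgue. x \<in> S \<longrightarrow> g x - h x = 0"
    by (rule fundamental_lemma_calculus_of_variations[OF assms(1)])
      (use d in \<open>auto simp: has_weak_pderiv_def\<close>)
  then show ?thesis by simp
qed

lemma has_weak_pderiv_weak_pderiv:
  "has_weak_pderiv S i v g \<Longrightarrow> has_weak_pderiv S i v (weak_pderiv S i v)"
  unfolding weak_pderiv_def by (rule someI[of "has_weak_pderiv S i v"])

lemma weak_pderiv_AE_eq:
  "open S \<Longrightarrow> has_weak_pderiv S i v g \<Longrightarrow> AE x in lebesgue. x \<in> S \<longrightarrow> weak_pderiv S i v x = g x"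
  using has_weak_pderiv_unique has_weak_pderiv_weak_pderiv by blast

lemma has_weak_pderiv_subset:
  assumes "has_weak_pderiv S i v g" "U \<subseteq> S"
  shows "has_weak_pderiv U i v g"
proof -
  have l: "loc_integrable U v" "loc_integrable U g"
    using assms loc_integrable_subset by (auto simp: has_weak_pderiv_def)
  have "(LINT x:U|lebesgue. v x * pderiv_at i \<phi> x) = - (LINT x:U|lebesgue. g x * \<phi> x)"
    if t: "test_fun U \<phi>" for \<phi>
  proof -
    have 1: "(\<lambda>x. indicator U x *\<^sub>R (v x * pderiv_at i \<phi> x)) = (\<lambda>x. indicator S x *\<^sub>R (v x * pderiv_at i \<phi> x))"
      using test_fun_outside[OF test_fun_pderiv[OF t, of i]] assms(2) by (intro ext) (auto simp: indicator_def)
    have 2: "(\<lambda>x. indicator U x *\<^sub>R (g x * \<phi> x)) = (\<lambda>x. indicator S x *\<^sub>R (g x * \<phi> x))"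
      using test_fun_outside[OF t] assms(2) by (intro ext) (auto simp: indicator_def)
    show ?thesis
      using assms(1) test_fun_mono[OF t assms(2)] unfolding has_weak_pderiv_def set_lebesgue_integral_def 1 2 by blast
  qed
  then show ?thesis using l by (auto simp: has_weak_pderiv_def)
qed

lemma loc_integrable_Un:
  assumes "open U" "open W" "U \<inter> W = {}" "loc_integrable U f" "loc_integrable W f"
  shows "loc_integrable (U \<union> W) f"
  unfolding loc_integrable_def
proof safe
  fix C assume C: "compact C" "C \<subseteq> U \<union> W"
  \<comment> \<open>A compact subset of the union remains compact after removal of the open set
    \<open>W\<close>, and what remains lies in \<open>U\<close>; likewise with the roles
    exchanged.\<close>
  then have "C - W \<subseteq> U" "C - U \<subseteq> W" "(C - W) \<union> (C - U) = C" using assms(3) by auto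
  moreover have "compact (C - W)" "compact (C - U)" using C assms by (auto intro: compact_diff)
  ultimately show "set_integrable lebesgue C f"
    using set_integrable_Un[of lebesgue "C - W" f "C - U"] assms(4,5)
    by (simp add: loc_integrable_def lmeasurable_compact fmeasurableD)
qed

lemma set_integral_disjoint_union:
  fixes f :: "'a \<Rightarrow> 'b::{banach, second_countable_topology}"
  assumes "U \<inter> W = {}" "U \<in> sets M" "W \<in> sets M" "set_integrable M (U \<union> W) f"
  shows "(LINT x:U \<union> W|M. f x) = (LINT x:U|M. f x) + (LINT x:W|M. f x)"
  using assms by (intro set_integral_Un set_integrable_subset[OF assms(4)]) auto

text \<open>Integration by parts is tested piece by piece, with the cut-offs of the test function to
  \<open>U\<close> and to \<open>W\<close>. Iterated over the element interiors, this assembles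
  elementwise derivatives into a weak derivative on the broken domain.\<close>

lemma has_weak_pderiv_Un:
  assumes "open U" "open W" "U \<inter> W = {}" "has_weak_pderiv U i v g" "has_weak_pderiv W i v g"
  shows "has_weak_pderiv (U \<union> W) i v g"
proof -
  have l: "loc_integrable (U \<union> W) v" "loc_integrable (U \<union> W) g"
    using assms loc_integrable_Un by (auto simp: has_weak_pderiv_def)
  have part: "(LINT x:U|lebesgue. v x * pderiv_at i \<phi> x) = - (LINT x:U|lebesgue. g x * \<phi> x)"
    if t: "test_fun (U \<union> W) \<phi>" and o: "open U" "open W" "U \<inter> W = {}" and w: "has_weak_pderiv U i v g"
    for \<phi> U W
  proof -
    note c = test_fun_cutoff[OF o t]
    have "(LINT x:U|lebesgue. v x * (indicator U x * pderiv_at i \<phi> x)) = - (LINT x:U|lebesgue. g x * (indicator U x * \<phi> x))"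
    proof -
      have "(LINT x:U|lebesgue. v x * pderiv_at i (\<lambda>x. indicator U x * \<phi> x) x) = - (LINT x:U|lebesgue. g x * (indicator U x * \<phi> x))"
        using w c(1) unfolding has_weak_pderiv_def by blast
      then show ?thesis unfolding c(2) .
    qed
    moreover have "(\<lambda>x. indicator U x *\<^sub>R (h x * (indicator U x * r x))) = (\<lambda>x. indicator U x *\<^sub>R (h x * r x))" for h r :: "_ \<Rightarrow> real"
      by (auto simp: indicator_def)
    ultimately show ?thesis unfolding set_lebesgue_integral_def by simp
  qed
  have "(LINT x:U \<union> W|lebesgue. v x * pderiv_at i \<phi> x) = - (LINT x:U \<union> W|lebesgue. g x * \<phi> x)"
    if t: "test_fun (U \<union> W) \<phi>" for \<phi>
  proof -
    have "test_fun (W \<union> U) \<phi>" "W \<inter> U = {}" using t assms by (auto simp: Un_commute)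
    then show ?thesis
      using part[OF t assms(1-4)] part[OF _ assms(2,1) _ assms(5)]
        set_integral_disjoint_union[OF assms(3) _ _ loc_integrable_times_test[OF l(1) test_fun_pderiv[OF t, of i]]]
        set_integral_disjoint_union[OF assms(3) _ _ loc_integrable_times_test[OF l(2) t]] assms(1,2)
      by simp
  qed
  then show ?thesis using l by (auto simp: has_weak_pderiv_def)
qed

lemma has_weak_pderiv_Union:
  assumes "finite \<U>" "\<And>U. U \<in> \<U> \<Longrightarrow> open U" "disjoint \<U>" "\<And>U. U \<in> \<U> \<Longrightarrow> has_weak_pderiv U i v g"
  shows "has_weak_pderiv (\<Union>\<U>) i v g"
  using assms
proof (induction \<U> rule: finite_induct)
  case empty
  then show ?case
    by (auto simp: has_weak_pderiv_def loc_integrable_def set_lebesgue_integral_def)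
next
  case (insert U \<U>)
  have "disjoint \<U>" "U \<inter> \<Union>\<U> = {}"
    using insert.prems(2) insert.hyps(2) by (auto simp: disjoint_def)
  then have "has_weak_pderiv (U \<union> \<Union>\<U>) i v g"
    using insert by (intro has_weak_pderiv_Un) auto
  then show ?case by simp
qed

section \<open>Integration by parts for smooth functions\<close>

lemma has_bochner_integral_lborel_translation:
  fixes f :: "'a::euclidean_space \<Rightarrow> real"
  assumes "f \<in> borel_measurable borel" "integrable lborel f"
  shows "integrable lborel (\<lambda>x. f (v + x))" "(LINT x|lborel. f (v + x)) = (LINT x|lborel. f x)"
proof -
  show "integrable lborel (\<lambda>x. f (v + x))"
    using assms integrable_distr_eq[of "(+) v" lborel borel f] lborel_distr_plus[of v] by simp
  show "(LINT x|lborel. f (v + x)) = (LINT x|lborel. f x)"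
    using assms integral_distr[of "(+) v" lborel borel f] lborel_distr_plus[of v] by simp
qed

lemma line_has_derivative:
  assumes "f differentiable (at (x + t *\<^sub>R axis i 1))"
  shows "((\<lambda>t. f (x + t *\<^sub>R axis i 1)) has_real_derivative pderiv_at i f (x + t *\<^sub>R axis i 1)) (at t)"
proof -
  let ?D = "frechet_derivative f (at (x + t *\<^sub>R axis i 1))"
  have 1: "(f has_derivative ?D) (at (x + t *\<^sub>R axis i 1))"
    using assms by (simp add: frechet_derivative_works)
  have "((\<lambda>t. x + t *\<^sub>R axis i 1) has_derivative (\<lambda>h. h *\<^sub>R axis i 1)) (at t)"
    by (auto intro!: derivative_eq_intros)
  from has_derivative_compose[OF this 1]
  have "((\<lambda>t. f (x + t *\<^sub>R axis i 1)) has_derivative (\<lambda>h. ?D (h *\<^sub>R axis i 1))) (at t)" .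
  moreover have "?D (h *\<^sub>R axis i 1) = pderiv_at i f (x + t *\<^sub>R axis i 1) * h" for h
    using has_derivative_linear[OF 1] by (simp add: linear_cmul pderiv_at_def mult.commute)
  ultimately show ?thesis by (simp add: has_field_derivative_def)
qed

text \<open>The difference quotients in direction \<open>i\<close> have integral zero by translation invariance.\<close>

lemma integral_pderiv_at_test_fun:
  fixes f :: "real^'d::finite \<Rightarrow> real"
  assumes t: "test_fun UNIV f"
  shows "(LINT x|lebesgue. pderiv_at i f x) = 0"
proof -
  have sm: "smooth f" using t by (simp add: test_fun_def)
  note d = smooth_differentiable[OF sm]
  obtain M where M: "\<And>x. \<bar>pderiv_at i f x\<bar> \<le> M"
    using test_fun_bounded[OF test_fun_pderiv[OF t, of i]] by blast
  have "bounded (closure {x. f x \<noteq> 0})" using t by (auto simp: test_fun_def compact_imp_bounded)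
  then obtain R where R: "\<And>x. x \<in> closure {x. f x \<noteq> 0} \<Longrightarrow> norm x \<le> R" by (auto simp: bounded_iff)
  have z: "f x = 0" if "norm x > R" for x
    using R[of x] that closure_subset[of "{x. f x \<noteq> 0}"] by fastforce
  have mf[measurable]: "f \<in> borel_measurable borel" by (rule smooth_measurable[OF sm])
  have mp[measurable]: "pderiv_at i f \<in> borel_measurable borel" by (intro smooth_measurable smooth_pderiv sm)
  have intf: "integrable lborel f"
  proof -
    have "set_integrable lebesgue UNIV (\<lambda>x. 1 * f x)"
      by (rule loc_integrable_times_test[OF _ t])
        (auto simp: loc_integrable_def set_integrable_def lmeasurable_iff_integrable[symmetric] lmeasurable_compact)
    then show ?thesis by (simp add: set_integrable_def integrable_completion)
  qed
  define q where "q n x = real (Suc n) * (f (inverse (real (Suc n)) *\<^sub>R axis i 1 + x) - f x)" for n x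
  have "(\<lambda>n. LINT x|lborel. q n x) \<longlonglongrightarrow> (LINT x|lborel. pderiv_at i f x)"
  proof (rule integral_dominated_convergence)
    \<comment> \<open>By the mean value theorem the quotients are bounded by \<open>M\<close>. The
      shift has length at most 1, so they vanish outside the ball of radius R + 1.\<close>
    show "integrable lborel (\<lambda>x. M * indicator (cball 0 (R + 1)) x)"
      by (intro integrable_mult_right integrable_real_indicator emeasure_bounded_finite) auto
    show "AE x in lborel. (\<lambda>n. q n x) \<longlonglongrightarrow> pderiv_at i f x"
    proof (rule AE_I2)
      fix x
      have "((\<lambda>t. f (x + t *\<^sub>R axis i 1)) has_real_derivative pderiv_at i f x) (at 0)"
        using line_has_derivative[OF d, where x=x and t=0 and i=i] by simp
      then have "((\<lambda>h. (f (x + h *\<^sub>R axis i 1) - f x) / h) \<longlongrightarrow> pderiv_at i f x) (at 0)"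
        by (simp add: DERIV_def)
      moreover have "filterlim (\<lambda>n. inverse (real (Suc n))) (at 0) sequentially"
        by (intro filterlim_atI LIMSEQ_inverse_real_of_nat) auto
      ultimately have "(\<lambda>n. (f (x + inverse (real (Suc n)) *\<^sub>R axis i 1) - f x) / inverse (real (Suc n))) \<longlonglongrightarrow> pderiv_at i f x"
        by (rule filterlim_compose)
      then show "(\<lambda>n. q n x) \<longlonglongrightarrow> pderiv_at i f x"
        by (simp add: q_def divide_inverse add.commute mult.commute)
    qed
    show "AE x in lborel. norm (q n x) \<le> M * indicator (cball 0 (R + 1)) x" for n
    proof (rule AE_I2)
      fix x
      let ?t = "inverse (real (Suc n))"
      have t: "?t > 0" "?t \<le> 1" by (auto simp: field_simps)
      show "norm (q n x) \<le> M * indicator (cball 0 (R + 1)) x"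
      proof (cases "norm x \<le> R + 1")
        case True
        have "\<exists>z. 0 < z \<and> z < ?t \<and> f (x + ?t *\<^sub>R axis i 1) - f (x + 0 *\<^sub>R axis i 1) = (?t - 0) * pderiv_at i f (x + z *\<^sub>R axis i 1)"
          by (intro MVT2 line_has_derivative d t)
        then obtain z where "f (x + ?t *\<^sub>R axis i 1) - f x = ?t * pderiv_at i f (x + z *\<^sub>R axis i 1)" by auto
        then have "q n x = pderiv_at i f (x + z *\<^sub>R axis i 1)" by (simp add: q_def add.commute)
        then show ?thesis using M True by (simp add: indicator_def)
      next
        case False
        have "norm x - norm (?t *\<^sub>R axis i (1::real) + x) \<le> norm (?t *\<^sub>R axis i (1::real))"
          using norm_triangle_ineq4[of "?t *\<^sub>R axis i 1 + x" "?t *\<^sub>R axis i 1"] by simp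
        also have "\<dots> \<le> 1" using t by (simp add: norm_axis_1)
        finally have "f (?t *\<^sub>R axis i 1 + x) = 0" "f x = 0" using False by (intro z; simp)+
        then show ?thesis using False by (simp add: q_def)
      qed
    qed
    show "q n \<in> borel_measurable lborel" for n unfolding q_def by measurable
  qed (use mp in simp)
  moreover have "(LINT x|lborel. q n x) = 0" for n
    unfolding q_def using has_bochner_integral_lborel_translation[OF mf intf] intf by simp
  ultimately have "(LINT x|lborel. pderiv_at i f x) = 0"
    by (simp add: LIMSEQ_const_iff)
  then show ?thesis by (simp add: integral_completion)
qed

lemma continuous_loc_integrable:
  fixes f :: "real^'d::finite \<Rightarrow> real"
  shows "continuous_on UNIV f \<Longrightarrow> loc_integrable S f"
  unfolding loc_integrable_def set_integrable_def
proof safe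
  fix C :: "(real^'d) set" assume f: "continuous_on UNIV f" and C: "compact C"
  have "integrable lborel (\<lambda>x. indicator C x *\<^sub>R f x)"
    using borel_integrable_compact[OF C continuous_on_subset[OF f]] by simp
  then show "integrable lebesgue (\<lambda>x. indicator C x *\<^sub>R f x)"
    by (subst integrable_completion) auto
qed

lemma test_fun_mult:
  assumes "smooth \<psi>" "test_fun S \<phi>"
  shows "test_fun S (\<lambda>x. \<psi> x * \<phi> x)"
proof -
  have *: "closure {x. \<psi> x * \<phi> x \<noteq> 0} \<subseteq> closure {x. \<phi> x \<noteq> 0}" by (rule closure_mono) auto
  then have "compact (closure {x. \<psi> x * \<phi> x \<noteq> 0})"
    using assms by (intro compact_closure_subset[OF _ *]) (auto simp: test_fun_def)
  then show ?thesis using * assms by (auto simp: test_fun_def smooth_mult)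
qed

text \<open>The product with a test function is a test function, so the integral of its partial
  derivative vanishes; the product rule turns this into integration by parts.\<close>

lemma smooth_has_weak_pderiv:
  assumes "smooth \<psi>"
  shows "has_weak_pderiv S i \<psi> (pderiv_at i \<psi>)"
  unfolding has_weak_pderiv_def
proof safe
  show l: "loc_integrable S \<psi>" "loc_integrable S (pderiv_at i \<psi>)"
    using assms by (auto intro!: continuous_loc_integrable smooth_continuous smooth_pderiv)
  fix \<phi> assume t: "test_fun S \<phi>"
  have "pderiv_at i (\<lambda>x. \<psi> x * \<phi> x) = (\<lambda>x. \<psi> x * pderiv_at i \<phi> x + pderiv_at i \<psi> x * \<phi> x)"
    using assms t by (auto simp: test_fun_def pderiv_at_mult smooth_differentiable)
  then have "0 = (LINT x|lebesgue. \<psi> x * pderiv_at i \<phi> x + pderiv_at i \<psi> x * \<phi> x)"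
    using integral_pderiv_at_test_fun[OF test_fun_mult[OF assms test_fun_mono[OF t subset_UNIV]], of i] by simp
  also have "\<dots> = (LINT x:S|lebesgue. \<psi> x * pderiv_at i \<phi> x + pderiv_at i \<psi> x * \<phi> x)"
    unfolding set_lebesgue_integral_def
    using test_fun_outside[OF t] test_fun_outside[OF test_fun_pderiv[OF t, of i]]
    by (intro Bochner_Integration.integral_cong) (auto simp: indicator_def)
  also have "\<dots> = (LINT x:S|lebesgue. \<psi> x * pderiv_at i \<phi> x) + (LINT x:S|lebesgue. pderiv_at i \<psi> x * \<phi> x)"
    using l t by (intro set_integral_add loc_integrable_times_test test_fun_pderiv)
  finally show "(LINT x:S|lebesgue. \<psi> x * pderiv_at i \<phi> x) = - (LINT x:S|lebesgue. pderiv_at i \<psi> x * \<phi> x)"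
    by simp
qed

section \<open>Square integrable functions and Sobolev spaces\<close>

text \<open>In the next two lemmas nothing is assumed on the measurability of \<open>H\<close>: a non-integrable
  function has integral zero.\<close>

lemma sqrt_set_integral_triangle:
  fixes F G H :: "'a \<Rightarrow> real"
  assumes F: "set_integrable M S (\<lambda>x. (F x)\<^sup>2)" and G: "set_integrable M S (\<lambda>x. (G x)\<^sup>2)"
    and le: "AE x in M. x \<in> S \<longrightarrow> \<bar>H x\<bar> \<le> \<bar>F x\<bar> + \<bar>G x\<bar>"
  shows "sqrt (LINT x:S|M. (H x)\<^sup>2) \<le> sqrt (LINT x:S|M. (F x)\<^sup>2) + sqrt (LINT x:S|M. (G x)\<^sup>2)"
proof (cases "set_integrable M S (\<lambda>x. (H x)\<^sup>2)")
  case False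
  then have "(LINT x:S|M. (H x)\<^sup>2) = 0"
    by (simp add: set_integrable_def set_lebesgue_integral_def not_integrable_integral_eq)
  then show ?thesis by (auto simp: set_lebesgue_integral_def intro!: add_nonneg_nonneg integral_nonneg_AE)
next
  case True
  define a b where "a = sqrt (LINT x:S|M. (F x)\<^sup>2)" and "b = sqrt (LINT x:S|M. (G x)\<^sup>2)"
  have nn: "0 \<le> (LINT x:S|M. (K x)\<^sup>2)" for K :: "'a \<Rightarrow> real"
    by (auto simp: set_lebesgue_integral_def intro!: integral_nonneg_AE)
  have ab: "a \<ge> 0" "b \<ge> 0" "a\<^sup>2 = (LINT x:S|M. (F x)\<^sup>2)" "b\<^sup>2 = (LINT x:S|M. (G x)\<^sup>2)"
    by (auto simp: a_def b_def nn)
  have "sqrt (LINT x:S|M. (H x)\<^sup>2) \<le> a + b + e" if e: "e > 0" for e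
  proof -
    \<comment> \<open>The ratio of the two norms is the optimal weight in Young's inequality; adding
      e / 2 to each norm keeps the ratio defined and positive when a norm vanishes.\<close>
    define \<alpha> \<beta> t where "\<alpha> = a + e / 2" and "\<beta> = b + e / 2" and "t = \<beta> / \<alpha>"
    have pos: "\<alpha> > 0" "\<beta> > 0" "t > 0" using ab e by (auto simp: \<alpha>_def \<beta>_def t_def add_nonneg_pos)
    have young: "(H x)\<^sup>2 \<le> (1 + t) * (F x)\<^sup>2 + (1 + 1 / t) * (G x)\<^sup>2" if "\<bar>H x\<bar> \<le> \<bar>F x\<bar> + \<bar>G x\<bar>" for x
    proof -
      have "(H x)\<^sup>2 \<le> (\<bar>F x\<bar> + \<bar>G x\<bar>)\<^sup>2" using that by (metis abs_ge_zero power2_abs power_mono)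
      also have "\<dots> = (F x)\<^sup>2 + (G x)\<^sup>2 + 2 * \<bar>F x\<bar> * \<bar>G x\<bar>" by (simp add: power2_sum)
      also have "2 * \<bar>F x\<bar> * \<bar>G x\<bar> \<le> t * (F x)\<^sup>2 + (G x)\<^sup>2 / t"
      proof -
        have "0 \<le> (sqrt t * \<bar>F x\<bar> - \<bar>G x\<bar> / sqrt t)\<^sup>2" by simp
        also have "\<dots> = t * (F x)\<^sup>2 + (G x)\<^sup>2 / t - 2 * \<bar>F x\<bar> * \<bar>G x\<bar>"
          using pos by (simp add: power2_diff power_mult_distrib power_divide)
        finally show ?thesis by simp
      qed
      finally show ?thesis by (simp add: algebra_simps)
    qed
    have "(LINT x:S|M. (H x)\<^sup>2) \<le> (LINT x:S|M. (1 + t) * (F x)\<^sup>2 + (1 + 1 / t) * (G x)\<^sup>2)"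
    proof (intro set_integral_mono_AE True)
      show "AE x\<in>S in M. (H x)\<^sup>2 \<le> (1 + t) * (F x)\<^sup>2 + (1 + 1 / t) * (G x)\<^sup>2"
        using le by eventually_elim (use young in blast)
    qed (use F G in auto)
    also have "\<dots> = (1 + t) * a\<^sup>2 + (1 + 1 / t) * b\<^sup>2"
      using F G ab by (subst set_integral_add) auto
    also have "\<dots> \<le> (1 + t) * \<alpha>\<^sup>2 + (1 + 1 / t) * \<beta>\<^sup>2"
      using pos ab e by (intro add_mono mult_left_mono power_mono) (auto simp: \<alpha>_def \<beta>_def)
    also have "\<dots> = (\<alpha> + \<beta>)\<^sup>2"
      using pos by (simp add: t_def field_simps power2_eq_square)
    finally have "sqrt (LINT x:S|M. (H x)\<^sup>2) \<le> \<alpha> + \<beta>"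
      using pos by (intro real_le_lsqrt) auto
    then show ?thesis by (simp add: \<alpha>_def \<beta>_def)
  qed
  then show ?thesis unfolding a_def[symmetric] b_def[symmetric] by (rule field_le_epsilon)
qed

lemma set_integral_Cauchy_Schwarz:
  fixes F G H :: "'a \<Rightarrow> real"
  assumes F: "set_integrable M S (\<lambda>x. (F x)\<^sup>2)" and G: "set_integrable M S (\<lambda>x. (G x)\<^sup>2)"
    and le: "AE x in M. x \<in> S \<longrightarrow> \<bar>H x\<bar> \<le> \<bar>F x\<bar> * \<bar>G x\<bar>"
  shows "\<bar>LINT x:S|M. H x\<bar> \<le> sqrt (LINT x:S|M. (F x)\<^sup>2) * sqrt (LINT x:S|M. (G x)\<^sup>2)"
proof (cases "set_integrable M S H")
  case False
  then have "(LINT x:S|M. H x) = 0"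
    by (simp add: set_integrable_def set_lebesgue_integral_def not_integrable_integral_eq)
  then show ?thesis by (auto simp: set_lebesgue_integral_def intro!: mult_nonneg_nonneg integral_nonneg_AE)
next
  case True
  define a b where "a = sqrt (LINT x:S|M. (F x)\<^sup>2)" and "b = sqrt (LINT x:S|M. (G x)\<^sup>2)"
  have nn: "0 \<le> (LINT x:S|M. (K x)\<^sup>2)" for K :: "'a \<Rightarrow> real"
    by (auto simp: set_lebesgue_integral_def intro!: integral_nonneg_AE)
  have ab: "a \<ge> 0" "b \<ge> 0" "a\<^sup>2 = (LINT x:S|M. (F x)\<^sup>2)" "b\<^sup>2 = (LINT x:S|M. (G x)\<^sup>2)"
    by (auto simp: a_def b_def nn)
  have key: "\<bar>LINT x:S|M. H x\<bar> \<le> (a + e) * (b + e)" if e: "e > 0" for e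
  proof -
    \<comment> \<open>Again the optimal weight for Young's inequality; the perturbation by
      \<open>e\<close> disappears in the limit taken at the end.\<close>
    define \<alpha> \<beta> t where "\<alpha> = a + e" and "\<beta> = b + e" and "t = \<beta> / \<alpha>"
    have pos: "\<alpha> > 0" "\<beta> > 0" "t > 0" using ab e by (auto simp: \<alpha>_def \<beta>_def t_def add_nonneg_pos)
    have young: "\<bar>H x\<bar> \<le> t / 2 * (F x)\<^sup>2 + 1 / (2 * t) * (G x)\<^sup>2" if "\<bar>H x\<bar> \<le> \<bar>F x\<bar> * \<bar>G x\<bar>" for x
    proof -
      have "0 \<le> (sqrt t * \<bar>F x\<bar> - \<bar>G x\<bar> / sqrt t)\<^sup>2" by simp
      also have "\<dots> = t * (F x)\<^sup>2 + (G x)\<^sup>2 / t - 2 * \<bar>F x\<bar> * \<bar>G x\<bar>"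
        using pos by (simp add: power2_diff power_mult_distrib power_divide)
      finally show ?thesis using that by simp
    qed
    have "\<bar>LINT x:S|M. H x\<bar> \<le> (LINT x:S|M. \<bar>H x\<bar>)"
      using set_integral_norm_bound[OF True] by simp
    also have "\<dots> \<le> (LINT x:S|M. t / 2 * (F x)\<^sup>2 + 1 / (2 * t) * (G x)\<^sup>2)"
    proof (intro set_integral_mono_AE set_integrable_abs True)
      show "AE x\<in>S in M. \<bar>H x\<bar> \<le> t / 2 * (F x)\<^sup>2 + 1 / (2 * t) * (G x)\<^sup>2"
        using le by eventually_elim (use young in blast)
    qed (use F G in auto)
    also have "\<dots> = t / 2 * a\<^sup>2 + 1 / (2 * t) * b\<^sup>2"
      using F G ab by (subst set_integral_add) auto
    also have "\<dots> \<le> t / 2 * \<alpha>\<^sup>2 + 1 / (2 * t) * \<beta>\<^sup>2"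
      using pos ab e by (intro add_mono mult_left_mono power_mono) (auto simp: \<alpha>_def \<beta>_def)
    also have "\<dots> = \<alpha> * \<beta>"
      using pos by (simp add: t_def field_simps power2_eq_square)
    finally show ?thesis by (simp add: \<alpha>_def \<beta>_def)
  qed
  have "((\<lambda>e. (a + e) * (b + e)) \<longlongrightarrow> (a + 0) * (b + 0)) (at_right 0)"
    by (intro tendsto_intros)
  then have "\<bar>LINT x:S|M. H x\<bar> \<le> (a + 0) * (b + 0)"
    by (rule tendsto_lowerbound) (auto simp: eventually_at_right_less key intro!: eventually_at_rightI[of 0 1])
  then show ?thesis by (simp add: a_def b_def)
qed

lemma set_borel_measurable_diff:
  fixes v w :: "'a \<Rightarrow> real"
  assumes "set_borel_measurable M S v" "set_borel_measurable M S w"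
  shows "set_borel_measurable M S (\<lambda>x. v x - w x)"
  using borel_measurable_diff[of "\<lambda>x. indicator S x *\<^sub>R v x" M "\<lambda>x. indicator S x *\<^sub>R w x"] assms
  by (simp add: set_borel_measurable_def right_diff_distrib)

lemma set_integrable_square_diff:
  fixes v w :: "'a \<Rightarrow> real"
  assumes "set_borel_measurable M S v" "set_borel_measurable M S w"
    "set_integrable M S (\<lambda>x. (v x)\<^sup>2)" "set_integrable M S (\<lambda>x. (w x)\<^sup>2)"
  shows "set_integrable M S (\<lambda>x. (v x - w x)\<^sup>2)"
proof -
  have *: "indicator S x *\<^sub>R (v x - w x)\<^sup>2 = (indicator S x *\<^sub>R (v x - w x))\<^sup>2" for x
    by (simp add: indicator_def)
  have m: "(\<lambda>x. indicator S x *\<^sub>R (v x - w x)\<^sup>2) \<in> borel_measurable M"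
    using set_borel_measurable_diff[OF assms(1,2)] unfolding set_borel_measurable_def * by measurable
  have "set_integrable M S (\<lambda>x. 2 * (v x)\<^sup>2 + 2 * (w x)\<^sup>2)"
    using assms(3,4) by (intro set_integral_add(1) set_integrable_mult_right)
  then have i: "integrable M (\<lambda>x. indicator S x *\<^sub>R (2 * (v x)\<^sup>2 + 2 * (w x)\<^sup>2))"
    by (simp only: set_integrable_def)
  have "(v x - w x)\<^sup>2 \<le> 2 * (v x)\<^sup>2 + 2 * (w x)\<^sup>2" for x
    using zero_le_power2[of "v x + w x"] by (simp add: power2_sum power2_diff)
  then show ?thesis unfolding set_integrable_def
    by (intro Bochner_Integration.integrable_bound[OF i m]) (auto simp: indicator_def)
qed

lemma L2_space_diff: "v \<in> L2_space S \<Longrightarrow> w \<in> L2_space S \<Longrightarrow> (\<lambda>x. v x - w x) \<in> L2_space S"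
  by (auto simp: L2_space_def set_borel_measurable_diff set_integrable_square_diff)

lemma L2_space_cong_AE:
  assumes "v \<in> L2_space S" "AE x in lebesgue. x \<in> S \<longrightarrow> v x = w x"
  shows "w \<in> L2_space S"
proof -
  have "AE x in lebesgue. indicator S x *\<^sub>R v x = indicator S x *\<^sub>R w x"
    using assms(2) by eventually_elim (auto simp: indicator_def)
  moreover have "AE x in lebesgue. x \<in> S \<longrightarrow> (v x)\<^sup>2 = (w x)\<^sup>2" using assms(2) by auto
  ultimately show ?thesis
    using assms(1) borel_measurable_lebesgue_AE_cong[of "\<lambda>x. indicator S x *\<^sub>R v x" "\<lambda>x. indicator S x *\<^sub>R w x"]
      set_integrable_lebesgue_AE_cong(1)[of S "\<lambda>x. (v x)\<^sup>2" "\<lambda>x. (w x)\<^sup>2"]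
    by (simp add: L2_space_def set_borel_measurable_def)
qed

lemma L2_norm_cong_AE:
  assumes "v \<in> L2_space S" "AE x in lebesgue. x \<in> S \<longrightarrow> v x = w x"
  shows "L2_norm S v = L2_norm S w"
proof -
  have "AE x in lebesgue. x \<in> S \<longrightarrow> (v x)\<^sup>2 = (w x)\<^sup>2" using assms(2) by auto
  then show ?thesis
    using set_integrable_lebesgue_AE_cong(2)[of S "\<lambda>x. (v x)\<^sup>2" "\<lambda>x. (w x)\<^sup>2"] assms(1)
    by (auto simp: L2_norm_def L2_space_def)
qed

lemma L2_space_subset:
  assumes "v \<in> L2_space S" "U \<subseteq> S" "U \<in> sets lebesgue"
  shows "v \<in> L2_space U"
proof -
  have "(\<lambda>x. indicator U x * (indicator S x *\<^sub>R v x)) \<in> borel_measurable lebesgue"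
    using assms(1,3) by (intro borel_measurable_times) (auto simp: L2_space_def set_borel_measurable_def)
  moreover have "(\<lambda>x. indicator U x * (indicator S x *\<^sub>R v x)) = (\<lambda>x. indicator U x *\<^sub>R v x)"
    using assms(2) by (intro ext) (auto simp: indicator_def)
  ultimately show ?thesis
    using assms set_integrable_subset[OF _ assms(3,2), of "\<lambda>x. (v x)\<^sup>2"]
    by (auto simp: L2_space_def set_borel_measurable_def)
qed

lemma L2_norm_nonneg: "0 \<le> L2_norm S v"
  by (auto simp: L2_norm_def set_lebesgue_integral_def intro!: integral_nonneg_AE)

lemma L2_norm_square: "(L2_norm S v)\<^sup>2 = (LINT x:S|lebesgue. (v x)\<^sup>2)"
  by (auto simp: L2_norm_def set_lebesgue_integral_def intro!: integral_nonneg_AE)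

lemma L2_norm_diff_le:
  "v \<in> L2_space S \<Longrightarrow> w \<in> L2_space S \<Longrightarrow> L2_norm S (\<lambda>x. v x - w x) \<le> L2_norm S v + L2_norm S w"
  unfolding L2_norm_def by (rule sqrt_set_integral_triangle) (auto simp: L2_space_def)

section \<open>The space H1, its norm and restriction to open subsets\<close>

lemma H1_space_L2: "v \<in> H1_space S \<Longrightarrow> v \<in> L2_space S"
  by (simp add: H1_space_def)

text \<open>The representative chosen by \<open>SOME\<close> agrees almost everywhere on
  \<open>S\<close> with one that is known to be in L2, hence lies in L2 itself.\<close>

lemma H1_space_weak_pderiv:
  assumes "open S" "v \<in> H1_space S"
  shows "has_weak_pderiv S i v (weak_pderiv S i v)" "weak_pderiv S i v \<in> L2_space S"
proof -
  obtain g where g: "g \<in> L2_space S" "has_weak_pderiv S i v g" using assms(2) by (auto simp: H1_space_def)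
  show "has_weak_pderiv S i v (weak_pderiv S i v)" using has_weak_pderiv_weak_pderiv[OF g(2)] .
  have "AE x in lebesgue. x \<in> S \<longrightarrow> g x = weak_pderiv S i v x"
    using weak_pderiv_AE_eq[OF assms(1) g(2)] by eventually_elim auto
  then show "weak_pderiv S i v \<in> L2_space S" by (rule L2_space_cong_AE[OF g(1)])
qed

lemma H1_space_diff: "v \<in> H1_space S \<Longrightarrow> w \<in> H1_space S \<Longrightarrow> (\<lambda>x. v x - w x) \<in> H1_space S"
  unfolding H1_space_def mem_Collect_eq
proof (intro conjI allI)
  fix i
  assume vw: "v \<in> L2_space S \<and> (\<forall>i. \<exists>g\<in>L2_space S. has_weak_pderiv S i v g)"
    "w \<in> L2_space S \<and> (\<forall>i. \<exists>g\<in>L2_space S. has_weak_pderiv S i w g)"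
  then obtain g h where "g \<in> L2_space S" "has_weak_pderiv S i v g" "h \<in> L2_space S" "has_weak_pderiv S i w h"
    by meson
  then show "\<exists>g\<in>L2_space S. has_weak_pderiv S i (\<lambda>x. v x - w x) g"
    by (intro bexI[of _ "\<lambda>x. g x - h x"] has_weak_pderiv_diff L2_space_diff)
qed (auto intro: L2_space_diff)

lemma weak_pderiv_diff:
  assumes "open S" "v \<in> H1_space S" "w \<in> H1_space S"
  shows "AE x in lebesgue. x \<in> S \<longrightarrow> weak_pderiv S i (\<lambda>x. v x - w x) x = weak_pderiv S i v x - weak_pderiv S i w x"
  by (intro weak_pderiv_AE_eq has_weak_pderiv_diff H1_space_weak_pderiv assms)

lemma weak_grad_diff:
  assumes "open S" "v \<in> H1_space S" "w \<in> H1_space S"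
  shows "AE x in lebesgue. x \<in> S \<longrightarrow> weak_grad S (\<lambda>x. v x - w x) x = weak_grad S v x - weak_grad S w x"
proof -
  have "AE x in lebesgue. \<forall>i. x \<in> S \<longrightarrow> weak_pderiv S i (\<lambda>x. v x - w x) x = weak_pderiv S i v x - weak_pderiv S i w x"
    by (subst AE_all_countable) (use weak_pderiv_diff[OF assms] in auto)
  then show ?thesis by eventually_elim (auto simp: weak_grad_def vec_eq_iff)
qed

lemma H1_space_cong_AE:
  assumes "v \<in> H1_space S" "AE x in lebesgue. x \<in> S \<longrightarrow> v x = w x"
  shows "w \<in> H1_space S"
proof -
  have "has_weak_pderiv S i w g" if "has_weak_pderiv S i v g" for i g
    using has_weak_pderiv_cong_AE[OF that assms(2), of g] by simp
  then show ?thesis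
    using assms L2_space_cong_AE[OF _ assms(2)] unfolding H1_space_def mem_Collect_eq by metis
qed

lemma weak_pderiv_cong_AE:
  assumes "open S" "v \<in> H1_space S" "AE x in lebesgue. x \<in> S \<longrightarrow> v x = w x"
  shows "AE x in lebesgue. x \<in> S \<longrightarrow> weak_pderiv S i v x = weak_pderiv S i w x"
proof -
  have "has_weak_pderiv S i w (weak_pderiv S i v)"
    using has_weak_pderiv_cong_AE[OF H1_space_weak_pderiv(1)[OF assms(1,2)] assms(3)] by simp
  from weak_pderiv_AE_eq[OF assms(1) this] show ?thesis by eventually_elim auto
qed

text \<open>The derivative chosen on the smaller set and the one chosen on the larger set are two
  weak derivatives on the smaller set. This links derivatives on the domain with those on the broken
  domain and on single elements.\<close>

lemma H1_space_subset:
  assumes "open S" "open U" "U \<subseteq> S" "v \<in> H1_space S"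
  shows "v \<in> H1_space U" "AE x in lebesgue. x \<in> U \<longrightarrow> weak_pderiv U i v x = weak_pderiv S i v x"
proof -
  have "U \<in> sets lebesgue" using assms(2) by simp
  then show "v \<in> H1_space U"
    using assms(3,4) L2_space_subset[OF _ assms(3)] has_weak_pderiv_subset[OF _ assms(3)]
    unfolding H1_space_def mem_Collect_eq by metis
  show "AE x in lebesgue. x \<in> U \<longrightarrow> weak_pderiv U i v x = weak_pderiv S i v x"
    by (rule weak_pderiv_AE_eq[OF assms(2) has_weak_pderiv_subset[OF H1_space_weak_pderiv(1) assms(3)]])
      (use assms in auto)
qed

lemma norm_cart_square: "(norm (x :: real^'d::finite))\<^sup>2 = (\<Sum>i\<in>UNIV. (x $ i)\<^sup>2)"
  by (simp add: norm_vec_def L2_set_def sum_nonneg)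

lemma H1_norm_integrand:
  assumes "open S" "v \<in> H1_space S"
  shows "set_integrable lebesgue S (\<lambda>x. (norm (weak_grad S v x))\<^sup>2 + (v x)\<^sup>2)"
    and "(LINT x:S|lebesgue. (norm (weak_grad S v x))\<^sup>2 + (v x)\<^sup>2)
      = (\<Sum>i\<in>UNIV. LINT x:S|lebesgue. (weak_pderiv S i v x)\<^sup>2) + (LINT x:S|lebesgue. (v x)\<^sup>2)"
proof -
  have i: "set_integrable lebesgue S (\<lambda>x. (weak_pderiv S i v x)\<^sup>2)" for i
    using H1_space_weak_pderiv(2)[OF assms] by (simp add: L2_space_def)
  have n: "(norm (weak_grad S v x))\<^sup>2 = (\<Sum>i\<in>UNIV. (weak_pderiv S i v x)\<^sup>2)" for x
    by (simp add: norm_cart_square weak_grad_def)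
  have s: "set_integrable lebesgue S (\<lambda>x. \<Sum>i\<in>UNIV. (weak_pderiv S i v x)\<^sup>2)"
    using i unfolding set_integrable_def scaleR_sum_right by (intro Bochner_Integration.integrable_sum)
  have v: "set_integrable lebesgue S (\<lambda>x. (v x)\<^sup>2)" using H1_space_L2[OF assms(2)] by (simp add: L2_space_def)
  show "set_integrable lebesgue S (\<lambda>x. (norm (weak_grad S v x))\<^sup>2 + (v x)\<^sup>2)"
    unfolding n by (intro set_integral_add s v)
  have "(LINT x:S|lebesgue. (\<Sum>i\<in>UNIV. (weak_pderiv S i v x)\<^sup>2)) = (\<Sum>i\<in>UNIV. LINT x:S|lebesgue. (weak_pderiv S i v x)\<^sup>2)"
    using i unfolding set_integrable_def set_lebesgue_integral_def scaleR_sum_right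
    by (intro Bochner_Integration.integral_sum)
  then show "(LINT x:S|lebesgue. (norm (weak_grad S v x))\<^sup>2 + (v x)\<^sup>2)
      = (\<Sum>i\<in>UNIV. LINT x:S|lebesgue. (weak_pderiv S i v x)\<^sup>2) + (LINT x:S|lebesgue. (v x)\<^sup>2)"
    unfolding n using set_integral_add(2)[OF s v] by simp
qed

lemma H1_norm_nonneg: "0 \<le> H1_norm S v"
  by (auto simp: H1_norm_def set_lebesgue_integral_def intro!: integral_nonneg_AE)

lemma H1_norm_square:
  assumes "open S" "v \<in> H1_space S"
  shows "(H1_norm S v)\<^sup>2 = (\<Sum>i\<in>UNIV. (L2_norm S (weak_pderiv S i v))\<^sup>2) + (L2_norm S v)\<^sup>2"
  unfolding L2_norm_square H1_norm_integrand(2)[OF assms, symmetric]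
  by (auto simp: H1_norm_def set_lebesgue_integral_def intro!: integral_nonneg_AE)

lemma norm_Pair_square: "(norm (x, y :: real))\<^sup>2 = (norm x)\<^sup>2 + y\<^sup>2"
  by (simp add: norm_Pair)

text \<open>The integrand is the squared norm of the pair of gradient and value, so the triangle
  inequality reduces to the pointwise one in the product space.\<close>

lemma H1_norm_diff_le:
  assumes "open S" "v \<in> H1_space S" "w \<in> H1_space S"
  shows "H1_norm S (\<lambda>x. v x - w x) \<le> H1_norm S v + H1_norm S w"
  unfolding H1_norm_def norm_Pair_square[symmetric]
proof (rule sqrt_set_integral_triangle)
  show "set_integrable lebesgue S (\<lambda>x. (norm (weak_grad S v x, v x))\<^sup>2)"
    "set_integrable lebesgue S (\<lambda>x. (norm (weak_grad S w x, w x))\<^sup>2)"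
    unfolding norm_Pair_square using H1_norm_integrand(1) assms by auto
  show "AE x in lebesgue. x \<in> S \<longrightarrow> \<bar>norm (weak_grad S (\<lambda>x. v x - w x) x, v x - w x)\<bar>
      \<le> \<bar>norm (weak_grad S v x, v x)\<bar> + \<bar>norm (weak_grad S w x, w x)\<bar>"
    using weak_grad_diff[OF assms]
  proof eventually_elim
    case (elim x)
    show ?case
    proof
      assume "x \<in> S"
      then have "(weak_grad S (\<lambda>x. v x - w x) x, v x - w x) = (weak_grad S v x, v x) - (weak_grad S w x, w x)"
        using elim by simp
      then show "\<bar>norm (weak_grad S (\<lambda>x. v x - w x) x, v x - w x)\<bar>
          \<le> \<bar>norm (weak_grad S v x, v x)\<bar> + \<bar>norm (weak_grad S w x, w x)\<bar>"
        by (simp only: abs_norm_cancel norm_triangle_ineq4)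
    qed
  qed
qed

lemma H1_norm_cong_AE:
  assumes "open S" "v \<in> H1_space S" "AE x in lebesgue. x \<in> S \<longrightarrow> v x = w x"
  shows "H1_norm S v = H1_norm S w"
proof -
  have "(H1_norm S v)\<^sup>2 = (H1_norm S w)\<^sup>2"
    unfolding H1_norm_square[OF assms(1,2)] H1_norm_square[OF assms(1) H1_space_cong_AE[OF assms(2,3)]]
    using L2_norm_cong_AE[OF H1_space_L2[OF assms(2)] assms(3)]
      L2_norm_cong_AE[OF H1_space_weak_pderiv(2)[OF assms(1,2)] weak_pderiv_cong_AE[OF assms]] by simp
  then show ?thesis by (simp add: H1_norm_nonneg)
qed

lemma L2_norm_subset:
  assumes "v \<in> L2_space S" "U \<subseteq> S" "U \<in> sets lebesgue"
  shows "L2_norm U v \<le> L2_norm S v"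
proof -
  have "set_integrable lebesgue S (\<lambda>x. (v x)\<^sup>2)" "set_integrable lebesgue U (\<lambda>x. (v x)\<^sup>2)"
    using assms(1) L2_space_subset[OF assms] by (auto simp: L2_space_def)
  then show ?thesis
    using assms(2) unfolding L2_norm_def set_lebesgue_integral_def set_integrable_def
    by (intro real_sqrt_le_mono integral_mono) (auto simp: indicator_def)
qed

lemma H1_norm_subset:
  assumes "open S" "open U" "U \<subseteq> S" "v \<in> H1_space S"
  shows "H1_norm U v \<le> H1_norm S v"
proof -
  have U: "U \<in> sets lebesgue" using assms by simp
  have "L2_norm U (weak_pderiv U i v) = L2_norm U (weak_pderiv S i v)" for i
    by (rule L2_norm_cong_AE) (use H1_space_subset[OF assms] H1_space_weak_pderiv assms in blast)+
  then have "(H1_norm U v)\<^sup>2 \<le> (H1_norm S v)\<^sup>2"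
    unfolding H1_norm_square[OF assms(1,4)] H1_norm_square[OF assms(2) H1_space_subset(1)[OF assms]]
    using L2_norm_subset[OF H1_space_weak_pderiv(2)[OF assms(1,4)] assms(3) U]
      L2_norm_subset[OF H1_space_L2[OF assms(4)] assms(3) U]
    by (auto intro!: add_mono sum_mono power_mono L2_norm_nonneg)
  then show ?thesis by (rule power2_le_imp_le) (rule H1_norm_nonneg)
qed

lemma continuous_L2_space:
  fixes f :: "real^'d::finite \<Rightarrow> real"
  assumes "continuous_on UNIV f" "bounded S" "S \<in> sets lebesgue"
  shows "f \<in> L2_space S"
proof -
  have c: "compact (closure S)" using assms(2) by (simp add: compact_closure)
  have "f \<in> borel_measurable lebesgue"
    using assms(1) by (intro measurable_completion) (simp add: borel_measurable_continuous_onI)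
  then have "set_borel_measurable lebesgue S f" using assms(3) unfolding set_borel_measurable_def by measurable
  moreover have "set_integrable lebesgue S (\<lambda>x. (f x)\<^sup>2)"
  proof (rule set_integrable_subset[of lebesgue "closure S"])
    have "continuous_on UNIV (\<lambda>x. (f x)\<^sup>2)" using assms(1) by (intro continuous_intros)
    from continuous_loc_integrable[OF this, of UNIV]
    show "set_integrable lebesgue (closure S) (\<lambda>x. (f x)\<^sup>2)" using c by (simp add: loc_integrable_def)
  qed (use assms(3) closure_subset in auto)
  ultimately show ?thesis by (simp add: L2_space_def)
qed

lemma smooth_H1_space:
  assumes "smooth \<phi>" "bounded S" "open S"
  shows "\<phi> \<in> H1_space S"
  using assms smooth_has_weak_pderiv[OF assms(1)]
  by (auto simp: H1_space_def intro!: continuous_L2_space smooth_continuous bexI[of _ "pderiv_at i \<phi>" for i] smooth_pderiv)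

lemma smooth_weak_pderiv:
  "open S \<Longrightarrow> smooth \<phi> \<Longrightarrow> AE x in lebesgue. x \<in> S \<longrightarrow> weak_pderiv S i \<phi> x = pderiv_at i \<phi> x"
  by (intro weak_pderiv_AE_eq smooth_has_weak_pderiv)

lemma H10_space_diff:
  assumes "open S" "bounded S" "v \<in> H10_space S" "w \<in> H10_space S"
  shows "(\<lambda>x. v x - w x) \<in> H10_space S"
proof -
  obtain \<phi> \<psi> where p: "\<And>n. test_fun S (\<phi> n)" "(\<lambda>n. H1_norm S (\<lambda>x. \<phi> n x - v x)) \<longlonglongrightarrow> 0"
    "\<And>n. test_fun S (\<psi> n)" "(\<lambda>n. H1_norm S (\<lambda>x. \<psi> n x - w x)) \<longlonglongrightarrow> 0"
    and vw: "v \<in> H1_space S" "w \<in> H1_space S"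
    using assms(3,4) unfolding H10_space_def by blast
  have s: "\<phi> n \<in> H1_space S" "\<psi> n \<in> H1_space S" for n
    using p assms by (auto intro!: smooth_H1_space simp: test_fun_def)
  have "H1_norm S (\<lambda>x. (\<phi> n x - \<psi> n x) - (v x - w x)) \<le> H1_norm S (\<lambda>x. \<phi> n x - v x) + H1_norm S (\<lambda>x. \<psi> n x - w x)" for n
    using H1_norm_diff_le[OF assms(1) H1_space_diff[OF s(1) vw(1)] H1_space_diff[OF s(2) vw(2)], of n n]
    by (simp add: algebra_simps)
  then have "(\<lambda>n. H1_norm S (\<lambda>x. (\<phi> n x - \<psi> n x) - (v x - w x))) \<longlonglongrightarrow> 0"
    by (intro tendsto_sandwich[OF _ _ tendsto_const tendsto_add_zero[OF p(2,4)]] always_eventually allI H1_norm_nonneg)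
  then show ?thesis
    using p vw H1_space_diff by (auto simp: H10_space_def intro!: exI[of _ "\<lambda>n x. \<phi> n x - \<psi> n x"] test_fun_diff)
qed

section \<open>Density of smooth functions in H1 of a bounded convex domain\<close>

lemma has_derivative_pderiv_at:
  fixes f :: "real^'d::finite \<Rightarrow> real"
  assumes "f differentiable (at x)"
  shows "(f has_derivative (\<lambda>h. \<Sum>i\<in>UNIV. h $ i * pderiv_at i f x)) (at x)"
proof -
  let ?D = "frechet_derivative f (at x)"
  have 1: "(f has_derivative ?D) (at x)" using assms by (simp add: frechet_derivative_works)
  have "?D h = (\<Sum>i\<in>UNIV. h $ i * pderiv_at i f x)" for h
  proof -
    have lin: "linear ?D" using has_derivative_linear[OF 1] .
    have "?D h = ?D (\<Sum>i\<in>UNIV. h $ i *\<^sub>R axis i 1)"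
      using basis_expansion[of h] by (simp add: scalar_mult_eq_scaleR)
    also have "\<dots> = (\<Sum>i\<in>UNIV. h $ i * ?D (axis i 1))"
      by (simp add: linear_sum[OF lin] linear_cmul[OF lin])
    finally show ?thesis by (simp add: pderiv_at_def)
  qed
  then have "?D = (\<lambda>h. \<Sum>i\<in>UNIV. h $ i * pderiv_at i f x)" by (rule ext)
  then show ?thesis using 1 by simp
qed

lemma test_fun_Lipschitz:
  assumes t: "test_fun S \<eta>"
  obtains M where "M \<ge> 0" "\<And>y k. \<bar>\<eta> (y + k) - \<eta> y\<bar> \<le> M * norm k"
proof -
  have sm: "smooth \<eta>" using t by (simp add: test_fun_def)
  have "\<exists>M. \<forall>x. \<bar>pderiv_at i \<eta> x\<bar> \<le> M" for i
    by (rule test_fun_bounded[OF test_fun_pderiv[OF t, of i]]) blast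
  then obtain B where B: "\<And>i x. \<bar>pderiv_at i \<eta> x\<bar> \<le> B i" by metis
  have B0: "0 \<le> B i" for i using B[of i undefined] by linarith
  have "norm (\<eta> (y + k) - \<eta> y) \<le> (\<Sum>i\<in>UNIV. B i) * norm ((y + k) - y)" for y k
  proof (rule differentiable_bound[where S=UNIV and f'="\<lambda>x h. \<Sum>i\<in>UNIV. h $ i * pderiv_at i \<eta> x"])
    show "(\<eta> has_derivative (\<lambda>h. \<Sum>i\<in>UNIV. h $ i * pderiv_at i \<eta> x)) (at x within UNIV)" for x
      using has_derivative_pderiv_at[OF smooth_differentiable[OF sm]] by simp
    show "onorm (\<lambda>h. \<Sum>i\<in>UNIV. h $ i * pderiv_at i \<eta> x) \<le> (\<Sum>i\<in>UNIV. B i)" for x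
    proof (rule onorm_le)
      fix h :: "real^'a"
      have "norm (\<Sum>i\<in>UNIV. h $ i * pderiv_at i \<eta> x) \<le> (\<Sum>i\<in>UNIV. norm (h $ i * pderiv_at i \<eta> x))"
        by (rule norm_sum)
      also have "\<dots> \<le> (\<Sum>i\<in>UNIV. norm h * B i)"
        using B B0 by (intro sum_mono) (auto simp: abs_mult intro!: mult_mono component_le_norm_cart)
      finally show "norm (\<Sum>i\<in>UNIV. h $ i * pderiv_at i \<eta> x) \<le> (\<Sum>i\<in>UNIV. B i) * norm h"
        by (simp add: sum_distrib_left mult.commute)
    qed
  qed auto
  then show ?thesis using that[of "\<Sum>i\<in>UNIV. B i"] B0 by (simp add: sum_nonneg)
qed

text \<open>The remainder is quadratic because first derivatives of a test function are Lipschitz.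
  Uniformity in \<open>y\<close> is what differentiation under the integral sign will use.\<close>

lemma test_fun_Taylor:
  fixes \<eta> :: "real^'d::finite \<Rightarrow> real"
  assumes t: "test_fun S \<eta>"
  obtains M where "M \<ge> 0" "\<And>y k. \<bar>\<eta> (y + k) - \<eta> y - (\<Sum>i\<in>UNIV. k $ i * pderiv_at i \<eta> y)\<bar> \<le> M * (norm k)\<^sup>2"
proof -
  have sm: "smooth \<eta>" using t by (simp add: test_fun_def)
  have "\<exists>M\<ge>0. \<forall>y k. \<bar>pderiv_at i \<eta> (y + k) - pderiv_at i \<eta> y\<bar> \<le> M * norm k" for i
    by (rule test_fun_Lipschitz[OF test_fun_pderiv[OF t, of i]]) blast
  then have "\<forall>i. \<exists>M. M \<ge> 0 \<and> (\<forall>y k. \<bar>pderiv_at i \<eta> (y + k) - pderiv_at i \<eta> y\<bar> \<le> M * norm k)" by blast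
  from choice[OF this]
  obtain B where BB: "\<forall>i. B i \<ge> 0 \<and> (\<forall>y k. \<bar>pderiv_at i \<eta> (y + k) - pderiv_at i \<eta> y\<bar> \<le> B i * norm k)" ..
  have B0: "0 \<le> B i" for i using BB by simp
  have B: "\<bar>pderiv_at i \<eta> (y + k) - pderiv_at i \<eta> y\<bar> \<le> B i * norm k" for i y k using BB by simp
  \<comment> \<open>On the ball of radius \<open>norm k\<close> the derivative of the remainder is
    at most a constant times \<open>norm k\<close>; the mean value inequality supplies the second
    factor.\<close>
  have bound: "norm ((\<eta> (y + k) - (\<Sum>i\<in>UNIV. k $ i * pderiv_at i \<eta> y)) - (\<eta> (y + 0) - (\<Sum>i\<in>UNIV. 0 $ i * pderiv_at i \<eta> y)))
      \<le> ((\<Sum>i\<in>UNIV. B i) * norm k) * norm (k - 0)" for y k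
  proof (rule differentiable_bound[where S="cball 0 (norm k)" and f="\<lambda>k. \<eta> (y + k) - (\<Sum>i\<in>UNIV. k $ i * pderiv_at i \<eta> y)"
      and f'="\<lambda>x h. (\<Sum>i\<in>UNIV. h $ i * pderiv_at i \<eta> (y + x)) - (\<Sum>i\<in>UNIV. h $ i * pderiv_at i \<eta> y)"])
    fix x :: "real^'d" assume x: "x \<in> cball 0 (norm k)"
    have "((\<lambda>k. y + k) has_derivative (\<lambda>h. h)) (at x)" by (auto intro!: derivative_eq_intros)
    from has_derivative_compose[OF this has_derivative_pderiv_at[OF smooth_differentiable[OF sm]]]
    have "((\<lambda>k. \<eta> (y + k)) has_derivative (\<lambda>h. \<Sum>i\<in>UNIV. h $ i * pderiv_at i \<eta> (y + x))) (at x)" .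
    moreover have "((\<lambda>k. \<Sum>i\<in>UNIV. k $ i * pderiv_at i \<eta> y) has_derivative (\<lambda>h. \<Sum>i\<in>UNIV. h $ i * pderiv_at i \<eta> y)) (at x)"
      by (intro bounded_linear_imp_has_derivative bounded_linear_sum bounded_linear_mult_const bounded_linear_vec_nth)
    ultimately show "((\<lambda>k. \<eta> (y + k) - (\<Sum>i\<in>UNIV. k $ i * pderiv_at i \<eta> y)) has_derivative
        (\<lambda>h. (\<Sum>i\<in>UNIV. h $ i * pderiv_at i \<eta> (y + x)) - (\<Sum>i\<in>UNIV. h $ i * pderiv_at i \<eta> y))) (at x within cball 0 (norm k))"
      by (rule has_derivative_at_withinI[OF has_derivative_diff])
    show "onorm (\<lambda>h. (\<Sum>i\<in>UNIV. h $ i * pderiv_at i \<eta> (y + x)) - (\<Sum>i\<in>UNIV. h $ i * pderiv_at i \<eta> y)) \<le> (\<Sum>i\<in>UNIV. B i) * norm k"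
    proof (rule onorm_le)
      fix h :: "real^'d"
      have "norm ((\<Sum>i\<in>UNIV. h $ i * pderiv_at i \<eta> (y + x)) - (\<Sum>i\<in>UNIV. h $ i * pderiv_at i \<eta> y))
          = norm (\<Sum>i\<in>UNIV. h $ i * (pderiv_at i \<eta> (y + x) - pderiv_at i \<eta> y))"
        by (simp add: sum_subtractf right_diff_distrib)
      also have "\<dots> \<le> (\<Sum>i\<in>UNIV. norm (h $ i * (pderiv_at i \<eta> (y + x) - pderiv_at i \<eta> y)))"
        by (rule norm_sum)
      also have "\<dots> \<le> (\<Sum>i\<in>UNIV. norm h * (B i * norm k))"
      proof (intro sum_mono)
        fix i
        have "\<bar>pderiv_at i \<eta> (y + x) - pderiv_at i \<eta> y\<bar> \<le> B i * norm k"
          using B[of i y x] x B0[of i] by (auto intro: order_trans mult_left_mono)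
        then show "norm (h $ i * (pderiv_at i \<eta> (y + x) - pderiv_at i \<eta> y)) \<le> norm h * (B i * norm k)"
          by (auto simp: abs_mult intro!: mult_mono component_le_norm_cart)
      qed
      finally show "norm ((\<Sum>i\<in>UNIV. h $ i * pderiv_at i \<eta> (y + x)) - (\<Sum>i\<in>UNIV. h $ i * pderiv_at i \<eta> y)) \<le> (\<Sum>i\<in>UNIV. B i) * norm k * norm h"
        by (simp add: sum_distrib_left sum_distrib_right mult_ac)
    qed
  qed auto
  have "\<bar>\<eta> (y + k) - \<eta> y - (\<Sum>i\<in>UNIV. k $ i * pderiv_at i \<eta> y)\<bar> \<le> (\<Sum>i\<in>UNIV. B i) * (norm k)\<^sup>2" for y k
    using bound[of y k] by (simp add: power2_eq_square algebra_simps)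
  moreover have "0 \<le> (\<Sum>i\<in>UNIV. B i)" using B0 by (simp add: sum_nonneg)
  ultimately show ?thesis using that by blast
qed

section \<open>Integrals against a smooth kernel\<close>

definition kernel_integral :: "(real^'d::finite \<Rightarrow> real) \<Rightarrow> (real^'d \<Rightarrow> real) \<Rightarrow> real \<Rightarrow> real \<Rightarrow> real^'d \<Rightarrow> real" where
  "kernel_integral w \<eta> A B x = (LINT z|lborel. w z * \<eta> (B *\<^sub>R x + A *\<^sub>R z))"

lemma integrable_times_bounded:
  fixes w \<eta> :: "'a \<Rightarrow> real"
  assumes "integrable M w" "\<eta> \<in> borel_measurable M" "\<And>z. \<bar>\<eta> z\<bar> \<le> C"
  shows "integrable M (\<lambda>z. w z * \<eta> z)"
proof (rule Bochner_Integration.integrable_bound)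
  show "integrable M (\<lambda>z. C * w z)" using assms(1) by simp
  show "(\<lambda>z. w z * \<eta> z) \<in> borel_measurable M" using assms(1,2) by measurable
  have "\<bar>w z\<bar> * \<bar>\<eta> z\<bar> \<le> \<bar>C\<bar> * \<bar>w z\<bar>" for z
    using mult_right_mono[of "\<bar>\<eta> z\<bar>" "\<bar>C\<bar>" "\<bar>w z\<bar>"] assms(3)[of z] by (simp add: mult.commute)
  then show "AE z in M. norm (w z * \<eta> z) \<le> norm (C * w z)" by (simp add: abs_mult)
qed

lemma kernel_integral_integrable:
  fixes \<eta> :: "real^'d::finite \<Rightarrow> real"
  assumes w: "integrable lborel w" and t: "test_fun UNIV \<eta>"
  shows "integrable lborel (\<lambda>z. w z * \<eta> (v + A *\<^sub>R z))"
proof -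
  obtain M where M: "\<And>x. \<bar>\<eta> x\<bar> \<le> M" using test_fun_bounded[OF t] by blast
  have [measurable]: "\<eta> \<in> borel_measurable borel" using t by (auto simp: test_fun_def intro: smooth_measurable)
  show ?thesis by (rule integrable_times_bounded[OF w _ M]) measurable
qed

text \<open>The uniform Taylor remainder is integrated against the absolute value of
  \<open>w\<close>, so all derivatives fall on \<eta> and \<open>w\<close> may be merely
  integrable.\<close>

lemma kernel_integral_has_derivative:
  fixes \<eta> :: "real^'d::finite \<Rightarrow> real"
  assumes w: "integrable lborel w" and t: "test_fun UNIV \<eta>"
  shows "(kernel_integral w \<eta> A B has_derivative
    (\<lambda>h. \<Sum>i\<in>UNIV. h $ i * (B * kernel_integral w (pderiv_at i \<eta>) A B x))) (at x)"
proof -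
  obtain M where M0: "M \<ge> 0" and M: "\<And>y k. \<bar>\<eta> (y + k) - \<eta> y - (\<Sum>i\<in>UNIV. k $ i * pderiv_at i \<eta> y)\<bar> \<le> M * (norm k)\<^sup>2"
    using test_fun_Taylor[OF t] by blast
  let ?D = "\<lambda>h. \<Sum>i\<in>UNIV. h $ i * (B * kernel_integral w (pderiv_at i \<eta>) A B x)"
  let ?K = "kernel_integral w \<eta> A B"
  define C where "C = M * B\<^sup>2 * (LINT z|lborel. \<bar>w z\<bar>)"
  have bl: "bounded_linear ?D"
    by (intro bounded_linear_sum bounded_linear_mult_const bounded_linear_vec_nth)
  have main: "norm (?K (x + h) - ?K x - ?D h) \<le> C * (norm h)\<^sup>2" for h
  proof -
    let ?y = "\<lambda>z. B *\<^sub>R x + A *\<^sub>R z"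
    have i1: "integrable lborel (\<lambda>z. w z * \<eta> (?y z + B *\<^sub>R h))"
      using kernel_integral_integrable[OF w t, of "B *\<^sub>R x + B *\<^sub>R h" A] by (simp add: add_ac)
    have i2: "integrable lborel (\<lambda>z. w z * \<eta> (?y z))"
      using kernel_integral_integrable[OF w t, of "B *\<^sub>R x" A] by (simp add: add_ac)
    have i3: "integrable lborel (\<lambda>z. h $ i * (B * (w z * pderiv_at i \<eta> (?y z))))" for i
      using kernel_integral_integrable[OF w test_fun_pderiv[OF t, of i], of "B *\<^sub>R x" A] by (simp add: add_ac)
    have eq: "?K (x + h) - ?K x - ?D h = (LINT z|lborel. w z * \<eta> (?y z + B *\<^sub>R h) - w z * \<eta> (?y z)
        - (\<Sum>i\<in>UNIV. h $ i * (B * (w z * pderiv_at i \<eta> (?y z)))))"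
      using i1 i2 i3 unfolding kernel_integral_def
      by (simp add: scaleR_add_right add_ac del: integrable_mult_right_iff)
    have "norm (?K (x + h) - ?K x - ?D h) \<le> (LINT z|lborel. M * B\<^sup>2 * (norm h)\<^sup>2 * \<bar>w z\<bar>)"
      unfolding eq
    proof (rule Bochner_Integration.integral_norm_bound_integral)
      show "integrable lborel (\<lambda>z. w z * \<eta> (?y z + B *\<^sub>R h) - w z * \<eta> (?y z) - (\<Sum>i\<in>UNIV. h $ i * (B * (w z * pderiv_at i \<eta> (?y z)))))"
        by (intro Bochner_Integration.integrable_diff Bochner_Integration.integrable_sum i1 i2 i3)
      show "integrable lborel (\<lambda>z. M * B\<^sup>2 * (norm h)\<^sup>2 * \<bar>w z\<bar>)"
        by (intro integrable_mult_right integrable_abs w)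
      fix z
      have "(\<Sum>i\<in>UNIV. h $ i * (B * (w z * pderiv_at i \<eta> (?y z)))) = w z * (\<Sum>i\<in>UNIV. (B *\<^sub>R h) $ i * pderiv_at i \<eta> (?y z))"
        by (simp add: sum_distrib_left mult_ac)
      then have "norm (w z * \<eta> (?y z + B *\<^sub>R h) - w z * \<eta> (?y z) - (\<Sum>i\<in>UNIV. h $ i * (B * (w z * pderiv_at i \<eta> (?y z)))))
          = \<bar>w z\<bar> * \<bar>\<eta> (?y z + B *\<^sub>R h) - \<eta> (?y z) - (\<Sum>i\<in>UNIV. (B *\<^sub>R h) $ i * pderiv_at i \<eta> (?y z))\<bar>"
        by (simp add: right_diff_distrib flip: abs_mult)
      also have "\<dots> \<le> \<bar>w z\<bar> * (M * (norm (B *\<^sub>R h))\<^sup>2)" by (intro mult_left_mono M) simp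
      finally show "norm (w z * \<eta> (?y z + B *\<^sub>R h) - w z * \<eta> (?y z) - (\<Sum>i\<in>UNIV. h $ i * (B * (w z * pderiv_at i \<eta> (?y z)))))
          \<le> M * B\<^sup>2 * (norm h)\<^sup>2 * \<bar>w z\<bar>"
        by (simp add: power_mult_distrib mult_ac)
    qed
    then show ?thesis by (simp add: C_def mult_ac)
  qed
  have "(\<lambda>h. norm (?K (x + h) - ?K x - ?D h) / norm h) \<midarrow>0\<rightarrow> 0"
  proof (rule Lim_null_comparison)
    show "\<forall>\<^sub>F h in at 0. norm (norm (?K (x + h) - ?K x - ?D h) / norm h) \<le> C * norm h"
    proof (rule eventually_at_filter[THEN iffD2], rule always_eventually, intro allI impI)
      fix h :: "real^'d" assume "h \<noteq> 0"
      then show "norm (norm (?K (x + h) - ?K x - ?D h) / norm h) \<le> C * norm h"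
        using main[of h] by (simp add: field_simps power2_eq_square)
    qed
    have "((\<lambda>h::real^'d. C * norm h) \<longlongrightarrow> C * norm (0::real^'d)) (at 0)" by (intro tendsto_intros)
    then show "((\<lambda>h::real^'d. C * norm h) \<longlongrightarrow> 0) (at 0)" by simp
  qed
  then show ?thesis using bl by (simp add: has_derivative_at)
qed

lemma kernel_integral_pderiv_at:
  assumes w: "integrable lborel w" and t: "test_fun UNIV \<eta>"
  shows "pderiv_at i (kernel_integral w \<eta> A B) = (\<lambda>x. B * kernel_integral w (pderiv_at i \<eta>) A B x)"
proof
  fix x
  show "pderiv_at i (kernel_integral w \<eta> A B) x = B * kernel_integral w (pderiv_at i \<eta>) A B x"
    using pderiv_at_eq[OF kernel_integral_has_derivative[OF assms, of A B x], of i]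
    by (simp add: axis_def if_distrib if_distribR cong: if_cong)
qed

lemma kernel_integral_smooth:
  assumes w: "integrable lborel w" and t: "test_fun UNIV \<eta>"
  shows "smooth (kernel_integral w \<eta> A B)"
proof -
  have "Ck k (kernel_integral w \<eta> A B)" if "test_fun UNIV \<eta>" for k \<eta>
    using that
  proof (induction k arbitrary: \<eta>)
    case 0
    then show ?case
      using kernel_integral_has_derivative[OF w 0] by (auto intro!: continuous_at_imp_continuous_on has_derivative_continuous)
  next
    case (Suc k)
    show ?case
      unfolding Ck.simps kernel_integral_pderiv_at[OF w Suc.prems]
      using kernel_integral_has_derivative[OF w Suc.prems]
      by (auto intro!: Ck_mult Ck_const Suc.IH test_fun_pderiv Suc.prems simp: differentiable_def)
  qed
  then show ?thesis using t by (auto simp: smooth_def)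
qed

lemma nn_integral_lborel_affine:
  fixes f :: "'a::euclidean_space \<Rightarrow> ennreal"
  assumes [measurable]: "f \<in> borel_measurable borel" and "c \<noteq> 0"
  shows "(\<integral>\<^sup>+x. f (t + c *\<^sub>R x) \<partial>lborel) = ennreal ((1 / \<bar>c\<bar>) ^ DIM('a)) * (\<integral>\<^sup>+x. f x \<partial>lborel)"
proof -
  have "(\<integral>\<^sup>+x. f x \<partial>lborel) = (\<integral>\<^sup>+x. f x \<partial>density (distr lborel borel (\<lambda>x. t + c *\<^sub>R x)) (\<lambda>_. ennreal (\<bar>c\<bar> ^ DIM('a))))"
    using lborel_affine[OF assms(2), of t] by simp
  also have "\<dots> = ennreal (\<bar>c\<bar> ^ DIM('a)) * (\<integral>\<^sup>+x. f (t + c *\<^sub>R x) \<partial>lborel)"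
    by (simp add: nn_integral_density nn_integral_distr nn_integral_cmult)
  finally show ?thesis
    using assms(2) by (simp add: mult.assoc[symmetric] ennreal_mult[symmetric] power_mult_distrib[symmetric])
qed

section \<open>Mollification adapted to a convex domain\<close>

definition mollifier :: "(real^'d::finite) set \<Rightarrow> (real^'d \<Rightarrow> real) \<Rightarrow> bool" where
  "mollifier S \<eta> \<longleftrightarrow> test_fun S \<eta> \<and> (\<forall>x. 0 \<le> \<eta> x) \<and> (LINT x|lborel. \<eta> x) = 1"

lemma test_fun_integrable:
  assumes t: "test_fun S (\<phi> :: real^'d::finite \<Rightarrow> real)"
  shows "integrable lborel \<phi>"
proof -
  have "loc_integrable UNIV (\<lambda>x::real^'d. 1)" by (intro continuous_loc_integrable continuous_on_const)
  from loc_integrable_times_test[OF this test_fun_mono[OF t subset_UNIV]]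
  have "integrable lebesgue \<phi>" by (simp add: set_integrable_def)
  then show ?thesis
    using t by (subst (asm) integrable_completion) (auto simp: test_fun_def smooth_measurable)
qed

lemma mollifier_exists:
  fixes S :: "(real^'d::finite) set"
  assumes "open S" "S \<noteq> {}"
  obtains \<eta> where "mollifier S \<eta>"
proof -
  obtain x where "x \<in> S" using assms(2) by auto
  then obtain a b where ab: "x \<in> box a b" "cbox a b \<subseteq> S"
    using open_contains_cbox[of S x] assms(1) by metis
  define \<phi> where "\<phi> = box_bump 1 a b"
  have t: "test_fun S \<phi>" unfolding \<phi>_def by (rule test_fun_box_bump[OF _ ab(2)]) simp
  note int = test_fun_integrable[OF t]
  have nn: "0 \<le> \<phi> x" for x by (simp add: \<phi>_def box_bump_nonneg)
  \<comment> \<open>The bump is positive exactly on the open box, so a vanishing integral would make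
    a nonempty open set negligible.\<close>
  have "(LINT x|lborel. \<phi> x) \<noteq> 0"
  proof
    assume "(LINT x|lborel. \<phi> x) = 0"
    then have "AE x in lborel. \<phi> x = 0"
      using integral_nonneg_eq_0_iff_AE[OF int] nn by simp
    then have "AE x in lborel. x \<notin> box a b"
      by eventually_elim (auto simp: \<phi>_def box_bump_eq_0)
    then have "emeasure lborel (box a b) = 0"
      by (subst (asm) AE_iff_measurable[of "box a b"]) auto
    then have "negligible (box a b)" by (simp add: negligible_iff_null_sets null_sets_def)
    then show False using open_not_negligible[OF open_box, of a b] ab(1) by auto
  qed
  then have pos: "(LINT x|lborel. \<phi> x) > 0"
    using Bochner_Integration.integral_nonneg_AE[of \<phi> lborel] nn by (simp add: less_le)
  define I where "I = (LINT x|lborel. \<phi> x)"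
  have "test_fun S (\<lambda>x. (1 / I) * \<phi> x)" by (intro test_fun_mult smooth_const t)
  moreover have "(LINT x|lborel. (1 / I) * \<phi> x) = 1" using pos by (simp add: I_def)
  ultimately have "mollifier S (\<lambda>x. (1 / I) * \<phi> x)"
    using nn pos unfolding mollifier_def I_def by (auto intro!: divide_nonneg_nonneg)
  then show ?thesis by (rule that)
qed

text \<open>For a convex domain, evaluating at the convex combination of \<open>x\<close> and \<open>y\<close> with weights
  \<open>1 - e\<close> and \<open>e\<close> and averaging over \<open>y\<close> with density \<open>\<eta>\<close> needs the function on the domain only.
  The definition is this average after the change of variables to \<open>z = (1 - e) x + e y\<close>.\<close>

definition mollify :: "(real^'d::finite \<Rightarrow> real) \<Rightarrow> real \<Rightarrow> (real^'d \<Rightarrow> real) \<Rightarrow> real^'d \<Rightarrow> real" where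
  "mollify \<eta> e w x = (1 / e) ^ CARD('d) * kernel_integral w \<eta> (1 / e) (- ((1 - e) / e)) x"

text \<open>The weight of \<open>z\<close> in the average at \<open>x\<close>: the density of (1 -
  e) x + e y when y is distributed with density \<eta>.\<close>

definition mollify_kernel :: "(real^'d::finite \<Rightarrow> real) \<Rightarrow> real \<Rightarrow> real^'d \<Rightarrow> real^'d \<Rightarrow> real" where
  "mollify_kernel \<eta> e x z = (1 / e) ^ CARD('d) * \<eta> (- ((1 - e) / e) *\<^sub>R x + (1 / e) *\<^sub>R z)"

lemma mollify_eq: "mollify \<eta> e w x = (LINT z|lborel. w z * mollify_kernel \<eta> e x z)"
  unfolding mollify_def kernel_integral_def mollify_kernel_def
  by (subst Bochner_Integration.integral_mult_right_zero[symmetric]) (simp add: mult_ac)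

lemma mollifierD:
  assumes "mollifier S \<eta>"
  shows "test_fun S \<eta>" "test_fun UNIV \<eta>" "smooth \<eta>" "0 \<le> \<eta> x" "\<eta> \<in> borel_measurable borel"
    "(\<integral>\<^sup>+x. ennreal (\<eta> x) \<partial>lborel) = 1"
proof -
  show t: "test_fun S \<eta>" "0 \<le> \<eta> x" using assms by (auto simp: mollifier_def)
  then show "test_fun UNIV \<eta>" "smooth \<eta>" by (auto simp: test_fun_def)
  then show "\<eta> \<in> borel_measurable borel" by (intro smooth_measurable)
  show "(\<integral>\<^sup>+x. ennreal (\<eta> x) \<partial>lborel) = 1"
    using nn_integral_eq_integral[OF test_fun_integrable[OF t(1)]] assms by (simp add: mollifier_def)
qed

lemma mollify_kernel_nonneg: "mollifier S \<eta> \<Longrightarrow> e > 0 \<Longrightarrow> 0 \<le> mollify_kernel \<eta> e x z"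
  by (auto simp: mollify_kernel_def mollifierD(4) intro!: divide_nonneg_nonneg)

text \<open>In \<open>z\<close> the kernel is a probability density. In \<open>x\<close> its mass is
  the d-th power of 1 / (1 - e), because \<open>x\<close> is contracted by 1 - e; for e \<le> 1/2
  this is at most 2^d.\<close>

lemma nn_integral_mollify_kernel:
  fixes \<eta> :: "real^'d::finite \<Rightarrow> real"
  assumes m: "mollifier S \<eta>" and e: "0 < e" "e \<le> 1 / 2"
  shows "(\<integral>\<^sup>+z. ennreal (mollify_kernel \<eta> e x z) \<partial>lborel) = 1"
    and "(\<integral>\<^sup>+x. ennreal (mollify_kernel \<eta> e x z) \<partial>lborel) \<le> ennreal (2 ^ CARD('d))"
proof -
  note [measurable] = mollifierD(5)[OF m]
  have k: "ennreal (mollify_kernel \<eta> e x z) = ennreal ((1 / e) ^ CARD('d)) * ennreal (\<eta> (- ((1 - e) / e) *\<^sub>R x + (1 / e) *\<^sub>R z))" for x z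
    using e mollifierD(4)[OF m] by (simp add: mollify_kernel_def ennreal_mult)
  show "(\<integral>\<^sup>+z. ennreal (mollify_kernel \<eta> e x z) \<partial>lborel) = 1"
    unfolding k
    using nn_integral_lborel_affine[of "\<lambda>x. ennreal (\<eta> x)" "1 / e" "- ((1 - e) / e) *\<^sub>R x"] e mollifierD(6)[OF m]
    by (simp add: nn_integral_cmult ennreal_mult[symmetric] power_mult_distrib[symmetric])
  have "(\<integral>\<^sup>+x. ennreal (mollify_kernel \<eta> e x z) \<partial>lborel)
      = ennreal ((1 / e) ^ CARD('d)) * (\<integral>\<^sup>+x. ennreal (\<eta> ((1 / e) *\<^sub>R z + (- ((1 - e) / e)) *\<^sub>R x)) \<partial>lborel)"
    unfolding k by (subst nn_integral_cmult) (simp_all add: add.commute)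
  also have "\<dots> = ennreal ((1 / e) ^ CARD('d)) * ennreal ((1 / \<bar>- ((1 - e) / e)\<bar>) ^ CARD('d))"
    using nn_integral_lborel_affine[of "\<lambda>x. ennreal (\<eta> x)" "- ((1 - e) / e)" "(1 / e) *\<^sub>R z"] e mollifierD(6)[OF m]
    by simp
  also have "\<dots> = ennreal ((1 / (1 - e)) ^ CARD('d))"
    using e by (simp add: ennreal_mult[symmetric] power_mult_distrib[symmetric])
  also have "\<dots> \<le> ennreal (2 ^ CARD('d))"
    using e by (intro ennreal_leI power_mono) (auto simp: field_simps)
  finally show "(\<integral>\<^sup>+x. ennreal (mollify_kernel \<eta> e x z) \<partial>lborel) \<le> ennreal (2 ^ CARD('d))" .
qed

lemma mollify_kernel_integrable:
  fixes \<eta> :: "real^'d::finite \<Rightarrow> real"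
  assumes m: "mollifier S \<eta>" and e: "0 < e" "e \<le> 1 / 2"
  shows "integrable lborel (mollify_kernel \<eta> e x)" "(LINT z|lborel. mollify_kernel \<eta> e x z) = 1"
    and "integrable lborel w \<Longrightarrow> integrable lborel (\<lambda>z. w z * mollify_kernel \<eta> e x z)"
proof -
  note [measurable] = mollifierD(5)[OF m]
  have [measurable]: "mollify_kernel \<eta> e x \<in> borel_measurable borel"
    unfolding mollify_kernel_def[abs_def] by measurable
  note n = mollify_kernel_nonneg[OF m e(1)] and nn = nn_integral_mollify_kernel(1)[OF m e, of x]
  show "integrable lborel (mollify_kernel \<eta> e x)"
    using nn n by (intro integrableI_nonneg) auto
  then show "(LINT z|lborel. mollify_kernel \<eta> e x z) = 1"
    using nn_integral_eq_integral[of lborel "mollify_kernel \<eta> e x"] n nn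
    by (simp add: ennreal_eq_1 flip: ennreal_1)
  show "integrable lborel w \<Longrightarrow> integrable lborel (\<lambda>z. w z * mollify_kernel \<eta> e x z)"
    using integrable_mult_right[OF kernel_integral_integrable[OF _ mollifierD(2)[OF m], of w "- ((1 - e) / e) *\<^sub>R x" "1 / e"],
        of "(1 / e) ^ CARD('d)"]
    by (simp add: mollify_kernel_def mult_ac)
qed

text \<open>Jensen's inequality for the square and the probability density
  \<open>mollify_kernel \<eta> e x\<close>, obtained from nonnegativity of the variance.\<close>

lemma mollify_square_le:
  fixes \<eta> :: "real^'d::finite \<Rightarrow> real"
  assumes m: "mollifier S \<eta>" and e: "0 < e" "e \<le> 1 / 2"
    and w: "integrable lborel w" "integrable lborel (\<lambda>z. (w z)\<^sup>2)"
  shows "ennreal ((mollify \<eta> e w x)\<^sup>2) \<le> (\<integral>\<^sup>+z. ennreal ((w z)\<^sup>2 * mollify_kernel \<eta> e x z) \<partial>lborel)"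
proof -
  let ?k = "mollify_kernel \<eta> e x"
  define c where "c = mollify \<eta> e w x"
  note n = mollify_kernel_nonneg[OF m e(1)]
  note k = mollify_kernel_integrable[OF m e]
  have "0 \<le> (LINT z|lborel. (w z - c)\<^sup>2 * ?k z)"
    using n by (intro Bochner_Integration.integral_nonneg_AE) auto
  also have "\<dots> = (LINT z|lborel. (w z)\<^sup>2 * ?k z - 2 * c * (w z * ?k z) + c\<^sup>2 * ?k z)"
    by (intro Bochner_Integration.integral_cong) (auto simp: power2_eq_square algebra_simps)
  also have "\<dots> = (LINT z|lborel. (w z)\<^sup>2 * ?k z) - 2 * c * (LINT z|lborel. w z * ?k z) + c\<^sup>2 * 1"
    using k(1,2)[of x] k(3)[OF w(1), of x] k(3)[OF w(2), of x] by simp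
  also have "(LINT z|lborel. w z * ?k z) = c" by (simp add: c_def mollify_eq)
  finally have "c\<^sup>2 \<le> (LINT z|lborel. (w z)\<^sup>2 * ?k z)" by (simp add: power2_eq_square)
  then have "ennreal (c\<^sup>2) \<le> ennreal (LINT z|lborel. (w z)\<^sup>2 * ?k z)" by (rule ennreal_leI)
  also have "\<dots> = (\<integral>\<^sup>+z. ennreal ((w z)\<^sup>2 * ?k z) \<partial>lborel)"
    using n by (intro nn_integral_eq_integral[symmetric] k w) auto
  finally show ?thesis by (simp add: c_def)
qed

text \<open>Jensen's inequality at each point, then Tonelli and the bound for the mass of the kernel
  in \<open>x\<close>. The constant does not depend on \<open>e\<close>, so that convergence has to
  be checked for continuous functions only.\<close>

lemma mollify_L2_bound:
  fixes \<eta> :: "real^'d::finite \<Rightarrow> real"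
  assumes m: "mollifier S \<eta>" and e: "0 < e" "e \<le> 1 / 2"
    and w: "integrable lborel w" "integrable lborel (\<lambda>z. (w z)\<^sup>2)"
  shows "(\<integral>\<^sup>+x. ennreal ((mollify \<eta> e w x)\<^sup>2) \<partial>lborel) \<le> ennreal (2 ^ CARD('d) * (LINT z|lborel. (w z)\<^sup>2))"
proof -
  note [measurable] = mollifierD(5)[OF m] borel_measurable_integrable[OF w(1), simplified]
  have [measurable]: "(\<lambda>(x, z). mollify_kernel \<eta> e x z) \<in> borel_measurable (borel \<Otimes>\<^sub>M borel)"
    unfolding mollify_kernel_def[abs_def] by measurable
  note n = mollify_kernel_nonneg[OF m e(1)]
  have "(\<integral>\<^sup>+x. ennreal ((mollify \<eta> e w x)\<^sup>2) \<partial>lborel)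
      \<le> (\<integral>\<^sup>+x. \<integral>\<^sup>+z. ennreal ((w z)\<^sup>2) * ennreal (mollify_kernel \<eta> e x z) \<partial>lborel \<partial>lborel)"
    using mollify_square_le[OF m e w] n by (intro nn_integral_mono) (simp add: ennreal_mult)
  also have "\<dots> = (\<integral>\<^sup>+z. \<integral>\<^sup>+x. ennreal ((w z)\<^sup>2) * ennreal (mollify_kernel \<eta> e x z) \<partial>lborel \<partial>lborel)"
    by (rule lborel_pair.Fubini'[symmetric]) measurable
  also have "\<dots> = (\<integral>\<^sup>+z. ennreal ((w z)\<^sup>2) * (\<integral>\<^sup>+x. ennreal (mollify_kernel \<eta> e x z) \<partial>lborel) \<partial>lborel)"
    by (intro nn_integral_cong nn_integral_cmult) measurable
  also have "\<dots> \<le> (\<integral>\<^sup>+z. ennreal ((w z)\<^sup>2) * ennreal (2 ^ CARD('d)) \<partial>lborel)"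
    by (intro nn_integral_mono mult_left_mono nn_integral_mollify_kernel(2)[OF m e]) auto
  also have "\<dots> = (\<integral>\<^sup>+z. ennreal ((w z)\<^sup>2) \<partial>lborel) * ennreal (2 ^ CARD('d))"
    by (rule nn_integral_multc) measurable
  also have "(\<integral>\<^sup>+z. ennreal ((w z)\<^sup>2) \<partial>lborel) = ennreal (LINT z|lborel. (w z)\<^sup>2)"
    by (intro nn_integral_eq_integral w) auto
  finally show ?thesis by (simp add: ennreal_mult[symmetric] mult.commute)
qed

lemma smooth_mollify: "mollifier S \<eta> \<Longrightarrow> integrable lborel w \<Longrightarrow> smooth (mollify \<eta> e w)"
  unfolding mollify_def[abs_def]
  by (intro smooth_mult smooth_const kernel_integral_smooth mollifierD(2))

lemma L2_norm_le_nn_integral: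
  fixes f :: "real^'d::finite \<Rightarrow> real"
  assumes f: "f \<in> borel_measurable borel" and S: "S \<in> sets borel" and C: "0 \<le> C"
    and le: "(\<integral>\<^sup>+x. ennreal ((f x)\<^sup>2) \<partial>lborel) \<le> ennreal C"
  shows "f \<in> L2_space S" "L2_norm S f \<le> sqrt C"
proof -
  note [measurable] = f S
  have "(\<integral>\<^sup>+x. ennreal (indicator S x * (f x)\<^sup>2) \<partial>lborel) \<le> (\<integral>\<^sup>+x. ennreal ((f x)\<^sup>2) \<partial>lborel)"
    by (intro nn_integral_mono) (auto simp: indicator_def)
  also note le
  finally have le': "(\<integral>\<^sup>+x. ennreal (indicator S x * (f x)\<^sup>2) \<partial>lborel) \<le> ennreal C" .
  have i: "integrable lborel (\<lambda>x. indicator S x * (f x)\<^sup>2)"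
    using le' by (intro integrableI_nonneg) (auto simp: order_le_less_trans)
  have "set_borel_measurable lebesgue S f"
    unfolding set_borel_measurable_def by (intro measurable_completion) simp
  then show "f \<in> L2_space S"
    using i integrable_completion[of "\<lambda>x. indicator S x * (f x)\<^sup>2" lborel] by (simp add: L2_space_def set_integrable_def)
  have "ennreal (LINT x|lborel. indicator S x * (f x)\<^sup>2) \<le> ennreal C"
    using le' nn_integral_eq_integral[OF i] by simp
  then have "(LINT x|lborel. indicator S x * (f x)\<^sup>2) \<le> C" using C by simp
  then show "L2_norm S f \<le> sqrt C"
    by (simp add: L2_norm_def set_lebesgue_integral_def integral_completion)
qed

lemma mollify_diff:
  assumes m: "mollifier S \<eta>" and e: "0 < e" "e \<le> 1 / 2" and w: "integrable lborel w" "integrable lborel w'"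
  shows "mollify \<eta> e (\<lambda>z. w z - w' z) x = mollify \<eta> e w x - mollify \<eta> e w' x"
  unfolding mollify_eq left_diff_distrib
  using mollify_kernel_integrable(3)[OF m e w(1), of x] mollify_kernel_integrable(3)[OF m e w(2), of x] by simp

text \<open>Confines the average at \<open>x\<close> to convex combinations of \<open>x\<close> with
  points of \<open>S\<close>; for convex \<open>S\<close> and \<open>x\<close> in \<open>S\<close>
  these do not leave \<open>S\<close>.\<close>

lemma mollify_kernel_support:
  fixes S :: "(real^'d::finite) set"
  assumes m: "mollifier S \<eta>" and e: "0 < e" and nz: "mollify_kernel \<eta> e x z \<noteq> 0"
  shows "\<exists>y\<in>S. z = (1 - e) *\<^sub>R x + e *\<^sub>R y"
proof -
  let ?y = "- ((1 - e) / e) *\<^sub>R x + (1 / e) *\<^sub>R z"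
  have "\<eta> ?y \<noteq> 0" using nz by (auto simp: mollify_kernel_def)
  then have "?y \<in> S" using test_fun_outside[OF mollifierD(1)[OF m]] by blast
  moreover have "z = (1 - e) *\<^sub>R x + e *\<^sub>R ?y" using e by (simp add: scaleR_diff_right)
  ultimately show ?thesis by blast
qed

text \<open>By convexity the average at a point of \<open>S\<close> sees only nearby points of
  \<open>S\<close>, where the cut-off of \<open>g\<close> has no effect; uniform continuity on the
  compact closure then decides.\<close>

lemma mollify_uniform_limit:
  fixes S :: "(real^'d::finite) set"
  assumes m: "mollifier S \<eta>" and S: "open S" "bounded S" "convex S"
    and g: "continuous_on UNIV g" and eps: "\<epsilon> > 0"
  obtains \<delta> where "\<delta> > 0"
    "\<And>e x. 0 < e \<Longrightarrow> e < \<delta> \<Longrightarrow> e \<le> 1 / 2 \<Longrightarrow> x \<in> S \<Longrightarrow> \<bar>mollify \<eta> e (\<lambda>x. indicator S x * g x) x - g x\<bar> \<le> \<epsilon>"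
proof -
  have c: "compact (closure S)" using S by (simp add: compact_closure)
  then have "uniformly_continuous_on (closure S) g"
    using g continuous_on_subset by (intro compact_uniformly_continuous) blast+
  then obtain d where d: "d > 0" "\<And>x x'. x \<in> closure S \<Longrightarrow> x' \<in> closure S \<Longrightarrow> dist x' x < d \<Longrightarrow> dist (g x') (g x) < \<epsilon>"
    unfolding uniformly_continuous_on_def using eps by metis
  obtain R where R: "\<And>x. x \<in> S \<Longrightarrow> norm x \<le> R" "R > 0" using S(2) bounded_pos by metis
  have ig: "integrable lborel (\<lambda>x. indicator S x * g x)"
  proof -
    have "integrable lborel (\<lambda>x. indicator (closure S) x *\<^sub>R g x)"
      using borel_integrable_compact[OF c continuous_on_subset[OF g]] by simp
    then have "set_integrable lborel S g"
      using S(1) closure_subset by (intro set_integrable_subset[of lborel "closure S" g S]) (auto simp: set_integrable_def)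
    then show ?thesis by (simp add: set_integrable_def)
  qed
  show ?thesis
  \<comment> \<open>The displacement from \<open>x\<close> is e * norm (y - x), at most 2 R e, so
    this radius keeps it below \<open>d\<close>.\<close>
  proof (rule that[of "d / (2 * R)"])
    show "d / (2 * R) > 0" using d R by simp
    fix e x assume e: "0 < e" "e < d / (2 * R)" "e \<le> 1 / 2" and x: "x \<in> S"
    let ?k = "mollify_kernel \<eta> e x"
    note k = mollify_kernel_integrable[OF m e(1,3), where x=x] and n = mollify_kernel_nonneg[OF m e(1)]
    have "mollify \<eta> e (\<lambda>x. indicator S x * g x) x - g x = (LINT z|lborel. indicator S z * g z * ?k z - g x * ?k z)"
      unfolding mollify_eq using k(1,2) k(3)[OF ig] by simp
    moreover have "norm (LINT z|lborel. indicator S z * g z * ?k z - g x * ?k z) \<le> (LINT z|lborel. \<epsilon> * ?k z)"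
    proof (rule Bochner_Integration.integral_norm_bound_integral)
      fix z
      show "norm (indicator S z * g z * ?k z - g x * ?k z) \<le> \<epsilon> * ?k z"
      proof (cases "?k z = 0")
        case False
        then obtain y where y: "y \<in> S" "z = (1 - e) *\<^sub>R x + e *\<^sub>R y" using mollify_kernel_support[OF m e(1)] by blast
        have zS: "z \<in> S" unfolding y(2) using S(3) x y(1) e by (intro convexD) auto
        have "z - x = e *\<^sub>R (y - x)" using y(2) by (simp add: algebra_simps)
        then have "dist z x = e * norm (y - x)" using e by (simp add: dist_norm)
        also have "\<dots> \<le> e * (R + R)"
          using e R(1)[OF x] R(1)[OF y(1)] norm_triangle_ineq4[of y x] by (intro mult_left_mono) auto
        also have "\<dots> < d" using e R by (simp add: field_simps)
        finally have "\<bar>g z - g x\<bar> < \<epsilon>" using d(2)[of x z] zS x closure_subset[of S] by (auto simp: dist_real_def)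
        moreover have "indicator S z * g z * ?k z - g x * ?k z = (g z - g x) * ?k z"
          using zS by (simp add: algebra_simps)
        ultimately show ?thesis using n[of x z] by (simp add: abs_mult mult_right_mono)
      qed simp
    qed (use k(1) k(3)[OF ig] in auto)
    ultimately show "\<bar>mollify \<eta> e (\<lambda>x. indicator S x * g x) x - g x\<bar> \<le> \<epsilon>" using k(2) by simp
  qed
qed

section \<open>Approximation and Borel representatives in L2\<close>

lemma L2_approx_continuous:
  fixes w :: "real^'d::finite \<Rightarrow> real"
  assumes w: "w \<in> borel_measurable borel" "integrable lborel (\<lambda>x. (w x)\<^sup>2)" "\<And>x. x \<notin> S \<Longrightarrow> w x = 0"
    and S: "bounded S" "S \<in> sets borel" and eps: "\<epsilon> > 0"
  obtains g where "continuous_on UNIV g" "integrable lborel (\<lambda>x. (w x - indicator S x * g x)\<^sup>2)"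
    "(LINT x|lborel. (w x - indicator S x * g x)\<^sup>2) < \<epsilon>"
proof -
  note [measurable] = w(1) S(2)
  \<comment> \<open>Clipping to the interval from -M to M. It is applied to \<open>w\<close>, with a
    small L2 error for large M, and then to continuous approximations of \<open>w\<close>, to
    provide a dominating function on the bounded set \<open>S\<close>.\<close>
  define cl where "cl M t = max (- real M) (min (real M) t)" for M :: nat and t :: real
  have cl_le: "\<bar>cl M t\<bar> \<le> real M" for M t by (auto simp: cl_def)
  have cl_diff: "\<bar>t - cl M t\<bar> \<le> \<bar>t\<bar>" for M t by (auto simp: cl_def)
  have cl_cont: "continuous_on UNIV (cl M)" for M unfolding cl_def[abs_def] by (intro continuous_intros)
  have [measurable]: "cl M \<in> borel_measurable borel" for M by (intro borel_measurable_continuous_onI cl_cont)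
  have "(\<lambda>M. LINT x|lborel. (w x - cl M (w x))\<^sup>2) \<longlonglongrightarrow> (LINT x|(lborel :: (real^'d) measure). 0)"
  proof (rule integral_dominated_convergence[where w="\<lambda>x. (w x)\<^sup>2"])
    show "AE x in lborel. (\<lambda>M. (w x - cl M (w x))\<^sup>2) \<longlonglongrightarrow> 0"
    proof (rule AE_I2, rule tendsto_eventually)
      fix x
      show "\<forall>\<^sub>F M in sequentially. (w x - cl M (w x))\<^sup>2 = 0"
        using eventually_ge_at_top[of "nat \<lceil>\<bar>w x\<bar>\<rceil>"] by eventually_elim (auto simp: cl_def)
    qed
    show "AE x in lborel. norm ((w x - cl M (w x))\<^sup>2) \<le> (w x)\<^sup>2" for M
      using cl_diff by (intro AE_I2) (simp add: abs_le_square_iff)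
  qed (use w(2) in measurable)
  then have "(\<lambda>M. LINT x|lborel. (w x - cl M (w x))\<^sup>2) \<longlonglongrightarrow> 0" by simp
  then obtain M where M: "(LINT x|lborel. (w x - cl M (w x))\<^sup>2) < \<epsilon> / 4"
    using eps by (metis (no_types, lifting) order_tendstoD(2) eventually_sequentially order_refl zero_less_divide_iff zero_less_numeral)
  \<comment> \<open>Measurability supplies continuous functions converging to \<open>w\<close>
    almost everywhere; no bound comes with them, hence the clipping.\<close>
  have "w measurable_on UNIV"
    by (intro lebesgue_measurable_imp_measurable_on measurable_completion) auto
  then obtain N g where N: "negligible N" and g: "\<And>n. continuous_on UNIV (g n)"
    and lim: "\<And>x. x \<notin> N \<Longrightarrow> (\<lambda>n. g n x) \<longlonglongrightarrow> w x"
    unfolding measurable_on_def by auto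
  have [measurable]: "g n \<in> borel_measurable borel" for n by (intro borel_measurable_continuous_onI g)
  have iS: "integrable lborel (\<lambda>x. (indicator S x * (2 * real M)\<^sup>2) :: real)"
    using S by (intro integrable_mult_left integrable_real_indicator emeasure_bounded_finite) auto
  have bd: "(indicator S x * (cl M (w x) - cl M (g n x)))\<^sup>2 \<le> indicator S x * (2 * real M)\<^sup>2" for n x
  proof -
    have "\<bar>cl M (w x) - cl M (g n x)\<bar> \<le> \<bar>2 * real M\<bar>" using cl_le[of M "w x"] cl_le[of M "g n x"] by linarith
    then have "(cl M (w x) - cl M (g n x))\<^sup>2 \<le> (2 * real M)\<^sup>2" by (simp only: abs_le_square_iff)
    then show ?thesis by (simp add: indicator_def)
  qed
  have "(\<lambda>n. LINT x|lborel. (indicator S x * (cl M (w x) - cl M (g n x)))\<^sup>2) \<longlonglongrightarrow> (LINT x|(lborel :: (real^'d) measure). 0)"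
  proof (rule integral_dominated_convergence[where w="\<lambda>x. indicator S x * (2 * real M)\<^sup>2"])
    have "AE x in lborel. x \<notin> N"
      using N AE_not_in[of N lebesgue] by (simp add: negligible_iff_null_sets AE_completion_iff)
    then show "AE x in lborel. (\<lambda>n. (indicator S x * (cl M (w x) - cl M (g n x)))\<^sup>2) \<longlonglongrightarrow> 0"
    proof eventually_elim
      case (elim x)
      have "(\<lambda>n. cl M (g n x)) \<longlonglongrightarrow> cl M (w x)"
        using cl_cont by (intro continuous_on_tendsto_compose[OF cl_cont lim[OF elim]]) auto
      then have "(\<lambda>n. (indicator S x * (cl M (w x) - cl M (g n x)))\<^sup>2) \<longlonglongrightarrow> (indicator S x * (cl M (w x) - cl M (w x)))\<^sup>2"
        by (intro tendsto_intros)
      then show ?case by simp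
    qed
    show "AE x in lborel. norm ((indicator S x * (cl M (w x) - cl M (g n x)))\<^sup>2) \<le> indicator S x * (2 * real M)\<^sup>2" for n
      using bd by (intro AE_I2) simp
  qed (use iS in measurable)
  then have "(\<lambda>n. LINT x|lborel. (indicator S x * (cl M (w x) - cl M (g n x)))\<^sup>2) \<longlonglongrightarrow> 0" by simp
  then obtain n where n: "(LINT x|lborel. (indicator S x * (cl M (w x) - cl M (g n x)))\<^sup>2) < \<epsilon> / 4"
    using eps by (metis (no_types, lifting) order_tendstoD(2) eventually_sequentially order_refl zero_less_divide_iff zero_less_numeral)
  have i1: "integrable lborel (\<lambda>x. (w x - cl M (w x))\<^sup>2)"
    by (rule Bochner_Integration.integrable_bound[OF w(2)]) (auto simp: cl_diff abs_le_square_iff[symmetric])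
  have i2: "integrable lborel (\<lambda>x. (indicator S x * (cl M (w x) - cl M (g n x)))\<^sup>2)"
    by (rule Bochner_Integration.integrable_bound[OF iS]) (use bd in auto)
  have le: "(w x - indicator S x * cl M (g n x))\<^sup>2 \<le> 2 * (w x - cl M (w x))\<^sup>2 + 2 * (indicator S x * (cl M (w x) - cl M (g n x)))\<^sup>2" for x
  proof -
    have "cl M 0 = 0" by (simp add: cl_def)
    then have "w x - indicator S x * cl M (g n x) = (w x - cl M (w x)) + indicator S x * (cl M (w x) - cl M (g n x))"
      using w(3)[of x] by (auto simp: indicator_def)
    then show ?thesis
      using zero_le_power2[of "(w x - cl M (w x)) - indicator S x * (cl M (w x) - cl M (g n x))"]
      by (simp only: power2_sum power2_diff) simp
  qed
  have i3: "integrable lborel (\<lambda>x. (w x - indicator S x * cl M (g n x))\<^sup>2)"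
    by (rule Bochner_Integration.integrable_bound[of _ "\<lambda>x. 2 * (w x - cl M (w x))\<^sup>2 + 2 * (indicator S x * (cl M (w x) - cl M (g n x)))\<^sup>2"])
      (use i1 i2 le in auto)
  have "(LINT x|lborel. (w x - indicator S x * cl M (g n x))\<^sup>2)
      \<le> (LINT x|lborel. 2 * (w x - cl M (w x))\<^sup>2 + 2 * (indicator S x * (cl M (w x) - cl M (g n x)))\<^sup>2)"
    using i1 i2 i3 le by (intro integral_mono) auto
  also have "\<dots> = 2 * (LINT x|lborel. (w x - cl M (w x))\<^sup>2) + 2 * (LINT x|lborel. (indicator S x * (cl M (w x) - cl M (g n x)))\<^sup>2)"
    using i1 i2 by simp
  also have "\<dots> < \<epsilon>" using M n by simp
  finally have "(LINT x|lborel. (w x - indicator S x * cl M (g n x))\<^sup>2) < \<epsilon>" .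
  moreover have "continuous_on UNIV (\<lambda>x. cl M (g n x))"
    by (rule continuous_on_compose2[OF cl_cont g]) simp
  ultimately show ?thesis using that i3 by blast
qed

text \<open>A Borel version that vanishes off \<open>S\<close> turns set integrals for the completed
  measure into integrals over the whole space for \<open>lborel\<close>, where Tonelli's theorem and
  affine substitution are available.\<close>

lemma L2_space_borel_representative:
  fixes v :: "real^'d::finite \<Rightarrow> real"
  assumes v: "v \<in> L2_space S" and S: "S \<in> sets borel" "bounded S"
  obtains w where "w \<in> borel_measurable borel" "\<And>x. x \<notin> S \<Longrightarrow> w x = 0"
    "AE x in lebesgue. x \<in> S \<longrightarrow> v x = w x" "integrable lborel w" "integrable lborel (\<lambda>x. (w x)\<^sup>2)"
proof -
  have "(\<lambda>x. indicator S x *\<^sub>R v x) \<in> borel_measurable (completion lborel)"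
    using v by (simp add: L2_space_def set_borel_measurable_def)
  from completion_ex_borel_measurable_real[OF this]
  obtain w0 where w0: "w0 \<in> borel_measurable lborel" "AE x in lborel. indicator S x *\<^sub>R v x = w0 x" by auto
  define w where "w x = indicator S x * w0 x" for x
  have [measurable]: "w0 \<in> borel_measurable borel" "S \<in> sets borel" using w0 S by auto
  have m: "w \<in> borel_measurable borel" unfolding w_def by measurable
  have ae: "AE x in lebesgue. x \<in> S \<longrightarrow> v x = w x"
    using AE_completion[OF w0(2)] by eventually_elim (auto simp: w_def)
  have "set_integrable lebesgue S (\<lambda>x. (w x)\<^sup>2)"
    using L2_space_cong_AE[OF v ae] by (simp add: L2_space_def)
  moreover have "(\<lambda>x. indicator S x *\<^sub>R (w x)\<^sup>2) = (\<lambda>x. (w x)\<^sup>2)"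
    by (auto simp: w_def indicator_def)
  ultimately have i2: "integrable lborel (\<lambda>x. (w x)\<^sup>2)"
    using m by (simp add: set_integrable_def integrable_completion)
  have iS: "integrable lborel (indicator S :: real^'d \<Rightarrow> real)"
    using S by (intro integrable_real_indicator emeasure_bounded_finite) auto
  have i: "integrable lborel w"
  proof (rule Bochner_Integration.integrable_bound)
    show "integrable lborel (\<lambda>x. indicator S x + (w x)\<^sup>2)" using iS i2 by simp
    have "\<bar>t\<bar> \<le> 1 + t\<^sup>2" for t :: real
      using zero_le_power2[of "\<bar>t\<bar> - 1"] by (simp add: power2_diff)
    then show "AE x in lborel. norm (w x) \<le> norm (indicator S x + (w x)\<^sup>2)"
      by (intro AE_I2) (auto simp: w_def indicator_def)
  qed (use m in simp)
  show ?thesis by (rule that[OF m _ ae i i2]) (simp add: w_def)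
qed

lemma set_integral_representative:
  fixes v w h :: "real^'d::finite \<Rightarrow> real"
  assumes w: "w \<in> borel_measurable borel" "\<And>x. x \<notin> S \<Longrightarrow> w x = 0"
    and ae: "AE x in lebesgue. x \<in> S \<longrightarrow> v x = w x" and h: "h \<in> borel_measurable borel"
  shows "(LINT z:S|lebesgue. v z * h z) = (LINT z|lborel. w z * h z)"
proof -
  have wh: "(\<lambda>z. w z * h z) \<in> borel_measurable borel" using w(1) h by measurable
  have ae': "AE z in lebesgue. w z * h z = indicator S z *\<^sub>R (v z * h z)"
    using ae by eventually_elim (use w(2) in \<open>auto simp: indicator_def\<close>)
  have wh': "(\<lambda>z. w z * h z) \<in> borel_measurable lebesgue" using wh by (intro measurable_completion) simp
  have "(LINT z:S|lebesgue. v z * h z) = (LINT z|lebesgue. w z * h z)"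
    unfolding set_lebesgue_integral_def
    using integral_cong_AE[OF wh' borel_measurable_lebesgue_AE_cong[OF wh' ae'] ae'] by simp
  also have "\<dots> = (LINT z|lborel. w z * h z)" using wh by (intro integral_completion) simp
  finally show ?thesis .
qed

text \<open>For fixed \<open>x\<close> in \<open>S\<close> the kernel is a test function in
  \<open>z\<close>, supported in a contracted copy of the support of \<eta> inside \<open>S\<close>.
  Moving the derivative from \<open>x\<close> to \<open>z\<close> costs the factor -(1 - e), and
  integration by parts removes the sign.\<close>

lemma mollify_pderiv_at:
  fixes S :: "(real^'d::finite) set"
  assumes m: "mollifier S \<eta>" and S: "open S" "bounded S" "convex S" and e: "0 < e" "e \<le> 1 / 2"
    and vg: "has_weak_pderiv S i v g"
    and w: "w \<in> borel_measurable borel" "\<And>x. x \<notin> S \<Longrightarrow> w x = 0" "AE x in lebesgue. x \<in> S \<longrightarrow> v x = w x" "integrable lborel w"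
    and w': "w' \<in> borel_measurable borel" "\<And>x. x \<notin> S \<Longrightarrow> w' x = 0" "AE x in lebesgue. x \<in> S \<longrightarrow> g x = w' x"
    and x: "x \<in> S"
  shows "pderiv_at i (mollify \<eta> e w) x = (1 - e) * mollify \<eta> e w' x"
proof -
  let ?A = "1 / e" and ?B = "- ((1 - e) / e)"
  note t = mollifierD(1,2)[OF m] and sm = mollifierD(3)[OF m]
  let ?\<phi> = "\<lambda>z. \<eta> (?A *\<^sub>R z + ?B *\<^sub>R x)"
  have supp: "closure {z. ?\<phi> z \<noteq> 0} \<subseteq> (\<lambda>y. (1 - e) *\<^sub>R x + e *\<^sub>R y) ` closure {y. \<eta> y \<noteq> 0}" (is "_ \<subseteq> ?I")
  proof (rule closure_minimal)
    have "z \<in> ?I" if "?\<phi> z \<noteq> 0" for z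
    proof (rule image_eqI)
      show "z = (1 - e) *\<^sub>R x + e *\<^sub>R (?A *\<^sub>R z + ?B *\<^sub>R x)" using e by (simp add: scaleR_diff_right)
      show "?A *\<^sub>R z + ?B *\<^sub>R x \<in> closure {y. \<eta> y \<noteq> 0}" using that closure_subset by fast
    qed
    then show "{z. ?\<phi> z \<noteq> 0} \<subseteq> ?I" by blast
    have "compact ?I" using t(1) by (intro compact_continuous_image continuous_intros) (auto simp: test_fun_def)
    then show "closed ?I" by (rule compact_imp_closed)
  qed
  have I: "compact ?I" using t(1) by (intro compact_continuous_image continuous_intros) (auto simp: test_fun_def)
  have IS: "?I \<subseteq> S"
  proof
    fix z assume "z \<in> ?I"
    then obtain y where "y \<in> S" "z = (1 - e) *\<^sub>R x + e *\<^sub>R y" using t(1) by (auto simp: test_fun_def)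
    then show "z \<in> S" using S(3) x e by (auto intro!: convexD)
  qed
  have t\<phi>: "test_fun S ?\<phi>"
    unfolding test_fun_def
    using compact_closure_subset[OF I supp] supp IS smooth_comp_affine[OF sm] by (blast intro: order_trans)
  have d\<phi>: "pderiv_at i ?\<phi> = (\<lambda>z. ?A * pderiv_at i \<eta> (?A *\<^sub>R z + ?B *\<^sub>R x))"
    by (intro ext pderiv_at_comp_affine smooth_differentiable sm)
  have m1: "pderiv_at i ?\<phi> \<in> borel_measurable borel" "?\<phi> \<in> borel_measurable borel"
    using t\<phi> by (auto intro!: smooth_measurable smooth_pderiv simp: test_fun_def)
  have "?A * kernel_integral w (pderiv_at i \<eta>) ?A ?B x = (LINT z|lborel. w z * pderiv_at i ?\<phi> z)"
    unfolding d\<phi> kernel_integral_def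
    by (subst Bochner_Integration.integral_mult_right_zero[symmetric]) (simp add: mult_ac add.commute)
  also have "\<dots> = (LINT z:S|lebesgue. v z * pderiv_at i ?\<phi> z)"
    by (rule set_integral_representative[symmetric, OF w(1-3) m1(1)])
  also have "\<dots> = - (LINT z:S|lebesgue. g z * ?\<phi> z)" using vg t\<phi> by (simp add: has_weak_pderiv_def)
  also have "(LINT z:S|lebesgue. g z * ?\<phi> z) = (LINT z|lborel. w' z * ?\<phi> z)"
    by (rule set_integral_representative[OF w' m1(2)])
  also have "\<dots> = kernel_integral w' \<eta> ?A ?B x" by (simp add: kernel_integral_def add.commute)
  finally have *: "kernel_integral w (pderiv_at i \<eta>) ?A ?B x = - e * kernel_integral w' \<eta> ?A ?B x"
    using e by (simp add: field_simps)
  have "pderiv_at i (mollify \<eta> e w) x = (1 / e) ^ CARD('d) * (?B * kernel_integral w (pderiv_at i \<eta>) ?A ?B x)"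
    unfolding mollify_def[abs_def]
    using pderiv_at_cmult[OF smooth_differentiable[OF kernel_integral_smooth[OF w(4) t(2)]]]
    by (simp add: kernel_integral_pderiv_at[OF w(4) t(2)])
  also have "\<dots> = (1 - e) * mollify \<eta> e w' x"
    unfolding * mollify_def using e by simp
  finally show ?thesis .
qed

lemma L2_norm_cmult: "L2_norm S (\<lambda>x. r * v x) = \<bar>r\<bar> * L2_norm S v"
  by (simp add: L2_norm_def power_mult_distrib real_sqrt_mult)

lemma L2_space_cmult: "v \<in> L2_space S \<Longrightarrow> (\<lambda>x. r * v x) \<in> L2_space S"
  using borel_measurable_times[of "\<lambda>x. r" lebesgue "\<lambda>x. indicator S x *\<^sub>R v x"]
  by (simp add: L2_space_def set_borel_measurable_def power_mult_distrib mult.left_commute)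

lemma L2_space_borelI:
  fixes w :: "real^'d::finite \<Rightarrow> real"
  assumes "w \<in> borel_measurable borel" "integrable lborel (\<lambda>x. (w x)\<^sup>2)" "S \<in> sets borel"
  shows "w \<in> L2_space S" "L2_norm S w \<le> sqrt (LINT x|lborel. (w x)\<^sup>2)"
proof -
  have "(\<integral>\<^sup>+x. ennreal ((w x)\<^sup>2) \<partial>lborel) = ennreal (LINT x|lborel. (w x)\<^sup>2)"
    by (intro nn_integral_eq_integral assms) auto
  then have le: "(\<integral>\<^sup>+x. ennreal ((w x)\<^sup>2) \<partial>lborel) \<le> ennreal (LINT x|lborel. (w x)\<^sup>2)" by simp
  have "0 \<le> (LINT x|lborel. (w x)\<^sup>2)" by (intro Bochner_Integration.integral_nonneg_AE) simp
  from L2_norm_le_nn_integral[OF assms(1,3) this le]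
  show "w \<in> L2_space S" "L2_norm S w \<le> sqrt (LINT x|lborel. (w x)\<^sup>2)" by auto
qed

text \<open>A density argument: the L2 bound, uniform in the scale, controls the part of
  \<open>w\<close> that a continuous function misses, and uniform convergence controls the
  continuous part.\<close>

lemma mollify_L2_limit:
  fixes S :: "(real^'d::finite) set"
  assumes m: "mollifier S \<eta>" and S: "open S" "bounded S" "convex S"
    and w: "w \<in> borel_measurable borel" "\<And>x. x \<notin> S \<Longrightarrow> w x = 0" "integrable lborel w" "integrable lborel (\<lambda>x. (w x)\<^sup>2)"
  defines "e \<equiv> \<lambda>n. inverse (real (Suc (Suc n)))"
  shows "(\<lambda>n. L2_norm S (\<lambda>x. mollify \<eta> (e n) w x - w x)) \<longlonglongrightarrow> 0"
proof (rule LIMSEQ_I)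
  have Sb: "S \<in> sets borel" using S(1) by simp
  \<comment> \<open>The double successor in \<open>e\<close> makes the first scale 1/2, as the mass
    bound of the kernel requires.\<close>
  have e: "0 < e n" "e n \<le> 1 / 2" for n by (auto simp: e_def field_simps)
  fix r :: real assume r: "r > 0"
  \<comment> \<open>Bounds the L2 norm of mollification minus the identity, applied to a function of
    norm 1; \<sigma> is then chosen so that the non-continuous part contributes at most r /
    4.\<close>
  define q where "q = sqrt (2 ^ CARD('d)) + 1"
  have q: "q > 0" by (auto simp: q_def intro!: add_nonneg_pos)
  define \<sigma> where "\<sigma> = r / (4 * q)"
  have \<sigma>: "\<sigma> > 0" using r q by (simp add: \<sigma>_def)
  have "0 < \<sigma>\<^sup>2" using \<sigma> by simp
  from L2_approx_continuous[OF w(1,4,2) S(2) Sb this]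
  obtain g where g: "continuous_on UNIV g" "integrable lborel (\<lambda>x. (w x - indicator S x * g x)\<^sup>2)"
    "(LINT x|lborel. (w x - indicator S x * g x)\<^sup>2) < \<sigma>\<^sup>2" by blast
  define G where "G x = indicator S x * g x" for x
  have mG: "G \<in> borel_measurable borel"
    using Sb borel_measurable_continuous_onI[OF g(1)] unfolding G_def by measurable
  have gS: "g \<in> L2_space S" using g(1) S Sb by (intro continuous_L2_space) auto
  have iG: "integrable lborel G"
  proof -
    have "integrable lborel (\<lambda>x. indicator (closure S) x *\<^sub>R g x)"
      using borel_integrable_compact[OF _ continuous_on_subset[OF g(1)]] S(2) by (simp add: compact_closure)
    then have "set_integrable lborel S g"
      using S(1) closure_subset by (intro set_integrable_subset[of lborel "closure S" g S]) (auto simp: set_integrable_def)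
    then show ?thesis by (simp add: set_integrable_def G_def[abs_def])
  qed
  define d where "d x = w x - G x" for x
  have md: "d \<in> borel_measurable borel" unfolding d_def using w(1) mG by measurable
  have id: "integrable lborel d" "integrable lborel (\<lambda>x. (d x)\<^sup>2)"
    unfolding d_def using w(3) iG g(2) by (auto simp: G_def[abs_def])
  have dn: "sqrt (LINT x|lborel. (d x)\<^sup>2) \<le> \<sigma>"
    using g(3) \<sigma> by (intro real_le_lsqrt) (auto simp: d_def G_def)
  define V where "V = measure lborel S"
  \<comment> \<open>A uniform error \<epsilon> on \<open>S\<close> has L2 norm at most \<epsilon>
    times the root of the volume; the added 1 excludes division by zero.\<close>
  define \<epsilon> where "\<epsilon> = r / (4 * (sqrt V + 1))"
  have V: "0 \<le> V" by (simp add: V_def)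
  have sV: "0 < sqrt V + 1" using V by (intro add_nonneg_pos) auto
  have \<epsilon>: "\<epsilon> > 0" using r sV by (simp add: \<epsilon>_def)
  obtain \<delta> where \<delta>: "\<delta> > 0" "\<And>e x. 0 < e \<Longrightarrow> e < \<delta> \<Longrightarrow> e \<le> 1 / 2 \<Longrightarrow> x \<in> S \<Longrightarrow> \<bar>mollify \<eta> e G x - g x\<bar> \<le> \<epsilon>"
    using mollify_uniform_limit[OF m S g(1) \<epsilon>] unfolding G_def by blast
  have "(\<lambda>n. inverse (real (Suc (Suc n)))) \<longlonglongrightarrow> 0" by (rule LIMSEQ_Suc[OF LIMSEQ_inverse_real_of_nat])
  then have "\<forall>\<^sub>F n in sequentially. e n < \<delta>" unfolding e_def using \<delta>(1) by (rule order_tendstoD(2))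
  then obtain N where N: "\<And>n. n \<ge> N \<Longrightarrow> e n < \<delta>" by (auto simp: eventually_sequentially)
  show "\<exists>N. \<forall>n\<ge>N. norm (L2_norm S (\<lambda>x. mollify \<eta> (e n) w x - w x) - 0) < r"
  proof (intro exI allI impI)
    fix n assume n: "n \<ge> N"
    have mT: "mollify \<eta> (e n) w \<in> borel_measurable borel" if "integrable lborel w" for w
      by (intro smooth_measurable smooth_mollify[OF m] that)
    have b1: "mollify \<eta> (e n) d \<in> L2_space S" "L2_norm S (mollify \<eta> (e n) d) \<le> sqrt (2 ^ CARD('d)) * \<sigma>"
    proof -
      have nn: "0 \<le> 2 ^ CARD('d) * (LINT z|lborel. (d z)\<^sup>2)" by (intro mult_nonneg_nonneg Bochner_Integration.integral_nonneg_AE) auto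
      note l = L2_norm_le_nn_integral[OF mT[OF id(1)] Sb nn mollify_L2_bound[OF m e id]]
      show "mollify \<eta> (e n) d \<in> L2_space S" by (rule l(1))
      have "sqrt (2 ^ CARD('d) * (LINT z|lborel. (d z)\<^sup>2)) \<le> sqrt (2 ^ CARD('d)) * \<sigma>"
        unfolding real_sqrt_mult using dn by (intro mult_left_mono) auto
      with l(2) show "L2_norm S (mollify \<eta> (e n) d) \<le> sqrt (2 ^ CARD('d)) * \<sigma>" by linarith
    qed
    have b2: "L2_norm S (\<lambda>x. mollify \<eta> (e n) G x - g x) \<le> \<epsilon> * sqrt V"
    proof -
      have iS: "integrable lborel (indicator S :: real^'d \<Rightarrow> real)"
        using S Sb by (intro integrable_real_indicator emeasure_bounded_finite) auto
      have c: "continuous_on UNIV (\<lambda>x. mollify \<eta> (e n) G x - g x)"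
        by (intro continuous_intros g(1) smooth_continuous smooth_mollify[OF m iG])
      have "set_integrable lebesgue S (\<lambda>x. (mollify \<eta> (e n) G x - g x)\<^sup>2)"
        using continuous_L2_space[OF c S(2)] S(1) by (simp add: L2_space_def)
      moreover have "set_integrable lebesgue S (\<lambda>x. \<epsilon>\<^sup>2)"
        unfolding set_integrable_def using iS by (simp add: integrable_completion)
      ultimately have "(LINT x:S|lebesgue. (mollify \<eta> (e n) G x - g x)\<^sup>2) \<le> (LINT x:S|lebesgue. \<epsilon>\<^sup>2)"
        using \<delta>(2)[OF e(1) N[OF n] e(2)] \<epsilon> by (intro set_integral_mono) (auto simp: abs_le_square_iff[symmetric])
      also have "\<dots> = \<epsilon>\<^sup>2 * V"
        using Sb by (simp add: set_lebesgue_integral_def V_def integral_completion)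
      finally have "L2_norm S (\<lambda>x. mollify \<eta> (e n) G x - g x) \<le> sqrt (\<epsilon>\<^sup>2 * V)" by (simp add: L2_norm_def)
      then show ?thesis using \<epsilon> by (simp add: real_sqrt_mult)
    qed
    have b2': "(\<lambda>x. mollify \<eta> (e n) G x - g x) \<in> L2_space S"
      using S by (intro continuous_L2_space continuous_intros g(1) smooth_continuous smooth_mollify[OF m iG]) auto
    have dS: "d \<in> L2_space S" "L2_norm S d \<le> \<sigma>"
      using L2_space_borelI[OF md id(2) Sb] dn by auto
    have eq: "mollify \<eta> (e n) w x - w x = (mollify \<eta> (e n) d x - d x) - - 1 * (mollify \<eta> (e n) G x - g x)" if "x \<in> S" for x
    proof -
      have "mollify \<eta> (e n) d x = mollify \<eta> (e n) w x - mollify \<eta> (e n) G x"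
        unfolding d_def by (rule mollify_diff[OF m e w(3) iG])
      then show ?thesis using that by (simp add: d_def G_def)
    qed
    have "L2_norm S (\<lambda>x. mollify \<eta> (e n) w x - w x)
        = L2_norm S (\<lambda>x. (mollify \<eta> (e n) d x - d x) - - 1 * (mollify \<eta> (e n) G x - g x))"
      unfolding L2_norm_def set_lebesgue_integral_def using eq
      by (intro arg_cong[where f=sqrt] Bochner_Integration.integral_cong) (auto simp: indicator_def)
    also have "\<dots> \<le> (L2_norm S (mollify \<eta> (e n) d) + L2_norm S d) + L2_norm S (\<lambda>x. mollify \<eta> (e n) G x - g x)"
      using L2_norm_diff_le[OF L2_space_diff[OF b1(1) dS(1)] L2_space_cmult[OF b2', of "-1"]]
        L2_norm_diff_le[OF b1(1) dS(1)] unfolding L2_norm_cmult[of S "-1"] by simp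
    also have "\<dots> \<le> (sqrt (2 ^ CARD('d)) * \<sigma> + \<sigma>) + \<epsilon> * sqrt V"
      using b1(2) dS(2) b2 by linarith
    also have "\<dots> = q * \<sigma> + \<epsilon> * sqrt V" by (simp add: q_def algebra_simps)
    also have "\<dots> \<le> r / 4 + r / 4"
    proof (rule add_mono)
      show "q * \<sigma> \<le> r / 4" using q by (simp add: \<sigma>_def)
      have "\<epsilon> * sqrt V \<le> \<epsilon> * (sqrt V + 1)" using \<epsilon> by (intro mult_left_mono) auto
      also have "\<dots> = r / 4" using sV unfolding \<epsilon>_def by (simp only: times_divide_eq_left nonzero_divide_mult_cancel_right mult_divide_mult_cancel_right)
      finally show "\<epsilon> * sqrt V \<le> r / 4" .
    qed
    also have "\<dots> < r" using r by simp
    finally show "norm (L2_norm S (\<lambda>x. mollify \<eta> (e n) w x - w x) - 0) < r" by (simp add: L2_norm_nonneg)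
  qed
qed

text \<open>On the convex domain mollification commutes with weak derivatives up to the factor 1 -
  e, which tends to 1. Thus L2 convergence of mollified functions applies to the function and to
  each of its derivatives.\<close>

lemma smooth_dense_H1:
  fixes S :: "(real^'d::finite) set"
  assumes S: "open S" "bounded S" "convex S" "S \<noteq> {}" and v: "v \<in> H1_space S"
  obtains \<phi> where "\<And>n. smooth (\<phi> n)" "(\<lambda>n. H1_norm S (\<lambda>x. \<phi> n x - v x)) \<longlonglongrightarrow> 0"
proof -
  have Sb: "S \<in> sets borel" using S(1) by simp
  obtain \<eta> where m: "mollifier S \<eta>" using mollifier_exists[OF S(1,4)] .
  obtain w where w: "w \<in> borel_measurable borel" "\<And>x. x \<notin> S \<Longrightarrow> w x = 0"
    "AE x in lebesgue. x \<in> S \<longrightarrow> v x = w x" "integrable lborel w" "integrable lborel (\<lambda>x. (w x)\<^sup>2)"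
    using L2_space_borel_representative[OF H1_space_L2[OF v] Sb S(2)] by blast
  have "\<exists>w. w \<in> borel_measurable borel \<and> (\<forall>x. x \<notin> S \<longrightarrow> w x = 0) \<and>
    (AE x in lebesgue. x \<in> S \<longrightarrow> weak_pderiv S i v x = w x) \<and> integrable lborel w \<and> integrable lborel (\<lambda>x. (w x)\<^sup>2)" for i
    by (rule L2_space_borel_representative[OF H1_space_weak_pderiv(2)[OF S(1) v, of i] Sb S(2)]) blast
  then have "\<forall>i. \<exists>w. w \<in> borel_measurable borel \<and> (\<forall>x. x \<notin> S \<longrightarrow> w x = 0) \<and>
    (AE x in lebesgue. x \<in> S \<longrightarrow> weak_pderiv S i v x = w x) \<and> integrable lborel w \<and> integrable lborel (\<lambda>x. (w x)\<^sup>2)" ..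
  from choice[OF this] obtain g where g0: "\<forall>i. g i \<in> borel_measurable borel \<and> (\<forall>x. x \<notin> S \<longrightarrow> g i x = 0) \<and>
    (AE x in lebesgue. x \<in> S \<longrightarrow> weak_pderiv S i v x = g i x) \<and> integrable lborel (g i) \<and> integrable lborel (\<lambda>x. (g i x)\<^sup>2)" ..
  have g: "\<And>i. g i \<in> borel_measurable borel" "\<And>i x. x \<notin> S \<Longrightarrow> g i x = 0"
    "\<And>i. AE x in lebesgue. x \<in> S \<longrightarrow> weak_pderiv S i v x = g i x" "\<And>i. integrable lborel (g i)" "\<And>i. integrable lborel (\<lambda>x. (g i x)\<^sup>2)"
    using g0 by simp_all
  define e :: "nat \<Rightarrow> real" where "e n = inverse (real (Suc (Suc n)))" for n
  have e: "0 < e n" "e n \<le> 1 / 2" for n by (auto simp: e_def field_simps)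
  have e0: "e \<longlonglongrightarrow> 0" unfolding e_def by (rule LIMSEQ_Suc[OF LIMSEQ_inverse_real_of_nat])
  define \<phi> where "\<phi> n = mollify \<eta> (e n) w" for n
  have sm: "smooth (\<phi> n)" for n unfolding \<phi>_def by (rule smooth_mollify[OF m w(4)])
  have \<phi>H: "\<phi> n \<in> H1_space S" for n by (rule smooth_H1_space[OF sm S(2,1)])
  have wS: "w \<in> L2_space S" by (rule L2_space_borelI[OF w(1,5) Sb])
  have gS: "g i \<in> L2_space S" for i by (rule L2_space_borelI[OF g(1,5) Sb])
  have TS: "mollify \<eta> (e n) (g i) \<in> L2_space S" for n i
    using S(1) by (intro continuous_L2_space smooth_continuous smooth_mollify[OF m g(4)] S) auto
  have "L2_norm S (\<lambda>x. \<phi> n x - v x) = L2_norm S (\<lambda>x. mollify \<eta> (e n) w x - w x)" for n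
    by (rule L2_norm_cong_AE[OF L2_space_diff[OF H1_space_L2[OF \<phi>H] H1_space_L2[OF v]]])
      (use w(3) in \<open>eventually_elim, auto simp: \<phi>_def\<close>)
  then have lim0: "(\<lambda>n. L2_norm S (\<lambda>x. \<phi> n x - v x)) \<longlonglongrightarrow> 0"
    using mollify_L2_limit[OF m S(1-3) w(1,2,4,5)] by (simp add: e_def)
  have lim: "(\<lambda>n. L2_norm S (weak_pderiv S i (\<lambda>x. \<phi> n x - v x))) \<longlonglongrightarrow> 0" for i
  proof (rule Lim_null_comparison)
    \<comment> \<open>The factor 1 - e is written as mollification error minus a multiple e of the
      derivative itself; both contributions tend to 0.\<close>
    have le: "L2_norm S (weak_pderiv S i (\<lambda>x. \<phi> n x - v x))
        \<le> L2_norm S (\<lambda>x. mollify \<eta> (e n) (g i) x - g i x) + e n * L2_norm S (g i)" for n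
    proof -
      have "AE x in lebesgue. x \<in> S \<longrightarrow> weak_pderiv S i (\<lambda>x. \<phi> n x - v x) x
          = (1 - e n) * (mollify \<eta> (e n) (g i) x - g i x) - e n * g i x"
        using weak_pderiv_diff[OF S(1) \<phi>H v, of i n] smooth_weak_pderiv[OF S(1) sm, of i n] g(3)[of i]
      proof eventually_elim
        case (elim x)
        have "x \<in> S \<Longrightarrow> pderiv_at i (\<phi> n) x = (1 - e n) * mollify \<eta> (e n) (g i) x"
          unfolding \<phi>_def
          by (rule mollify_pderiv_at[OF m S(1-3) e H1_space_weak_pderiv(1)[OF S(1) v] w(1-4) g(1-3)])
        then show ?case using elim by (auto simp: algebra_simps)
      qed
      then have "L2_norm S (weak_pderiv S i (\<lambda>x. \<phi> n x - v x))
          = L2_norm S (\<lambda>x. (1 - e n) * (mollify \<eta> (e n) (g i) x - g i x) - e n * g i x)"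
        by (intro L2_norm_cong_AE H1_space_weak_pderiv(2) H1_space_diff \<phi>H v S)
      also have "\<dots> \<le> \<bar>1 - e n\<bar> * L2_norm S (\<lambda>x. mollify \<eta> (e n) (g i) x - g i x) + \<bar>e n\<bar> * L2_norm S (g i)"
        using L2_norm_diff_le[OF L2_space_cmult[OF L2_space_diff[OF TS gS]] L2_space_cmult[OF gS]]
        by (simp add: L2_norm_cmult)
      also have "\<dots> \<le> 1 * L2_norm S (\<lambda>x. mollify \<eta> (e n) (g i) x - g i x) + e n * L2_norm S (g i)"
        using e[of n] by (intro add_mono mult_right_mono L2_norm_nonneg) auto
      finally show ?thesis by simp
    qed
    then show "\<forall>\<^sub>F n in sequentially. norm (L2_norm S (weak_pderiv S i (\<lambda>x. \<phi> n x - v x)))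
        \<le> L2_norm S (\<lambda>x. mollify \<eta> (e n) (g i) x - g i x) + e n * L2_norm S (g i)"
      by (simp add: L2_norm_nonneg)
    have "(\<lambda>n. L2_norm S (\<lambda>x. mollify \<eta> (e n) (g i) x - g i x) + e n * L2_norm S (g i)) \<longlonglongrightarrow> 0 + 0 * L2_norm S (g i)"
      using mollify_L2_limit[OF m S(1-3) g(1,2,4,5)] by (intro tendsto_intros e0) (simp add: e_def)
    then show "(\<lambda>n. L2_norm S (\<lambda>x. mollify \<eta> (e n) (g i) x - g i x) + e n * L2_norm S (g i)) \<longlonglongrightarrow> 0" by simp
  qed
  have "(\<lambda>n. sqrt ((\<Sum>i\<in>UNIV. (L2_norm S (weak_pderiv S i (\<lambda>x. \<phi> n x - v x)))\<^sup>2) + (L2_norm S (\<lambda>x. \<phi> n x - v x))\<^sup>2))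
      \<longlonglongrightarrow> sqrt ((\<Sum>i\<in>(UNIV::'d set). 0\<^sup>2) + 0\<^sup>2)"
    by (intro tendsto_intros lim lim0)
  moreover have "H1_norm S (\<lambda>x. \<phi> n x - v x)
      = sqrt ((\<Sum>i\<in>UNIV. (L2_norm S (weak_pderiv S i (\<lambda>x. \<phi> n x - v x)))\<^sup>2) + (L2_norm S (\<lambda>x. \<phi> n x - v x))\<^sup>2)" for n
    unfolding H1_norm_square[OF S(1) H1_space_diff[OF \<phi>H v], symmetric] by (simp add: H1_norm_nonneg)
  ultimately have "(\<lambda>n. H1_norm S (\<lambda>x. \<phi> n x - v x)) \<longlonglongrightarrow> 0" by simp
  then show ?thesis using that sm by blast
qed

section \<open>Hausdorff measure on hyperplanes and the trace inequality\<close>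

lemma sets_hausdorff_measure [simp, measurable_cong]: "sets (hausdorff_measure s) = sets borel"
  unfolding hausdorff_measure_def using sets.sigma_sets_eq[of borel]
  by (subst sets_measure_of) auto

lemma space_hausdorff_measure [simp]: "space (hausdorff_measure s) = UNIV"
  unfolding hausdorff_measure_def by (subst space_measure_of) auto

text \<open>If the outer measure were not additive on Borel sets, \<open>measure_of\<close> would give the zero
  measure, so the inequality holds in any case.\<close>

lemma emeasure_hausdorff_measure_le: "emeasure (hausdorff_measure s) E \<le> hausdorff_outer s E"
  unfolding hausdorff_measure_def by (simp add: emeasure_measure_of_conv)

text \<open>A finite covering is padded with empty sets to a sequence. The restriction s \<ge> 1
  matters here: the empty set has diameter 0, and 0 to the power s is then 0, so the padding costs
  nothing.\<close>

lemma hausdorff_outer_leI: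
  fixes E :: "'a::metric_space set"
  assumes s: "s \<ge> 1"
    and cov: "\<And>\<delta>. \<delta> > 0 \<Longrightarrow> \<exists>\<C> \<rho>. finite \<C> \<and> E \<subseteq> \<Union>\<C> \<and> 0 \<le> \<rho> \<and> \<rho> \<le> \<delta> \<and> (\<forall>C\<in>\<C>. bounded C \<and> diameter C \<le> \<rho>) \<and>
      real (card \<C>) * (unit_ball_vol (real s) * (\<rho> / 2) ^ s) \<le> B"
  shows "hausdorff_outer s E \<le> ennreal B"
  unfolding hausdorff_outer_def
proof (rule SUP_least)
  fix \<delta> :: real assume "\<delta> \<in> {0<..}"
  then obtain \<C> \<rho> where \<C>: "finite \<C>" "E \<subseteq> \<Union>\<C>" "0 \<le> \<rho>" "\<rho> \<le> \<delta>" "\<And>C. C \<in> \<C> \<Longrightarrow> bounded C" "\<And>C. C \<in> \<C> \<Longrightarrow> diameter C \<le> \<rho>"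
    and B: "real (card \<C>) * (unit_ball_vol (real s) * (\<rho> / 2) ^ s) \<le> B"
    using cov[of \<delta>] by auto
  obtain h where h: "bij_betw h {0..<card \<C>} \<C>" using ex_bij_betw_nat_finite[OF \<C>(1)] by blast
  define c where "c i = (if i < card \<C> then h i else {})" for i
  have c: "c i \<in> \<C>" if "i < card \<C>" for i using that bij_betwE[OF h] by (auto simp: c_def)
  have "(\<Union>i. c i) = \<Union>\<C>"
  proof
    show "\<Union>\<C> \<subseteq> (\<Union>i. c i)"
    proof
      fix x assume "x \<in> \<Union>\<C>"
      then obtain C where "C \<in> \<C>" "x \<in> C" by blast
      moreover have "C \<in> h ` {0..<card \<C>}" using \<open>C \<in> \<C>\<close> h by (simp add: bij_betw_def)
      then obtain i where "i < card \<C>" "h i = C" by auto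
      ultimately show "x \<in> (\<Union>i. c i)" by (auto simp: c_def intro!: exI[of _ i])
    qed
  qed (use c in \<open>auto simp: c_def split: if_splits\<close>)
  moreover have "bounded (c i) \<and> diameter (c i) \<le> \<delta>" for i
    using c[of i] \<C>(3,4) \<C>(5,6)[of "c i"] by (cases "i < card \<C>") (auto simp: c_def)
  ultimately have mem: "c \<in> {C. E \<subseteq> (\<Union>i. C i) \<and> (\<forall>i. bounded (C i) \<and> diameter (C i) \<le> \<delta>)}"
    using \<C>(2) by auto
  have "(\<Sum>i. ennreal (unit_ball_vol (real s) * (diameter (c i) / 2) ^ s))
      = (\<Sum>i<card \<C>. ennreal (unit_ball_vol (real s) * (diameter (c i) / 2) ^ s))"
    using s by (intro suminf_finite) (auto simp: c_def)
  also have "\<dots> \<le> (\<Sum>i<card \<C>. ennreal (unit_ball_vol (real s) * (\<rho> / 2) ^ s))"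
    using c \<C>(5,6) by (intro sum_mono ennreal_leI mult_left_mono power_mono divide_right_mono)
      (auto intro: diameter_ge_0)
  also have "\<dots> = ennreal (real (card \<C>) * (unit_ball_vol (real s) * (\<rho> / 2) ^ s))"
    using \<C>(3) by (simp add: ennreal_of_nat_eq_real_of_nat ennreal_mult)
  also have "\<dots> \<le> ennreal B" by (intro ennreal_leI B)
  finally have "(\<Sum>i. ennreal (unit_ball_vol (real s) * (diameter (c i) / 2) ^ s)) \<le> ennreal B" .
  then show "(INF C\<in>{C. E \<subseteq> (\<Union>i. C i) \<and> (\<forall>i. bounded (C i) \<and> diameter (C i) \<le> \<delta>)}.
      \<Sum>i. ennreal (unit_ball_vol (real s) * (diameter (C i) / 2) ^ s)) \<le> ennreal B"
    by (rule INF_lower2[OF mem])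
qed

text \<open>With \<open>k\<close> the index of the largest coefficient of the normal, the equation
  of the hyperplane bounds the difference in coordinate \<open>k\<close> by d times the bound in the
  others. Distances inside the hyperplane are therefore controlled by d - 1 coordinates.\<close>

lemma hyperplane_max_coordinate:
  fixes n :: "real^'d::finite"
  assumes "n \<noteq> 0"
  obtains k where "\<And>x y t. n \<bullet> x = c \<Longrightarrow> n \<bullet> y = c \<Longrightarrow> (\<And>i. i \<noteq> k \<Longrightarrow> \<bar>x $ i - y $ i\<bar> \<le> t) \<Longrightarrow> 0 \<le> t \<Longrightarrow>
    dist x y \<le> 2 * real CARD('d) * t"
proof -
  obtain k where k: "\<And>i. \<bar>n $ i\<bar> \<le> \<bar>n $ k\<bar>"
    using finite_set_choice[of UNIV] Max_in[of "range (\<lambda>i. \<bar>n $ i\<bar>)"] Max_ge[of "range (\<lambda>i. \<bar>n $ i\<bar>)"]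
    by (metis (mono_tags, lifting) empty_is_image finite finite_imageI imageE rangeI UNIV_not_empty)
  have nk: "n $ k \<noteq> 0"
  proof
    assume "n $ k = 0"
    then have "n = 0" using k by (simp add: vec_eq_iff)
    then show False using assms by simp
  qed
  show ?thesis
  proof (rule that[of k])
    fix x y and t :: real assume xy: "n \<bullet> x = c" "n \<bullet> y = c" and le: "\<And>i. i \<noteq> k \<Longrightarrow> \<bar>x $ i - y $ i\<bar> \<le> t" and t: "0 \<le> t"
    have "0 = n \<bullet> (x - y)" using xy by (simp add: inner_diff_right)
    also have "\<dots> = n $ k * (x $ k - y $ k) + (\<Sum>i\<in>UNIV - {k}. n $ i * (x $ i - y $ i))"
      by (simp add: inner_vec_def sum.remove[of UNIV k])
    finally have "\<bar>n $ k\<bar> * \<bar>x $ k - y $ k\<bar> = \<bar>\<Sum>i\<in>UNIV - {k}. n $ i * (x $ i - y $ i)\<bar>"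
      unfolding abs_mult[symmetric] by linarith
    also have "\<dots> \<le> (\<Sum>i\<in>UNIV - {k}. \<bar>n $ i * (x $ i - y $ i)\<bar>)" by (rule sum_abs)
    also have "\<dots> \<le> (\<Sum>i\<in>UNIV - {k}. \<bar>n $ k\<bar> * t)"
      using k le by (intro sum_mono) (auto simp: abs_mult intro!: mult_mono)
    also have "\<dots> \<le> (\<Sum>i\<in>(UNIV::'d set). \<bar>n $ k\<bar> * t)" using t by (intro sum_mono2) auto
    also have "\<dots> = \<bar>n $ k\<bar> * (real CARD('d) * t)" by simp
    finally have xk: "\<bar>x $ k - y $ k\<bar> \<le> real CARD('d) * t" using nk by simp
    have "dist x y \<le> (\<Sum>i\<in>UNIV. \<bar>(x - y) $ i\<bar>)" unfolding dist_norm by (rule norm_le_l1_cart)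
    also have "\<dots> = \<bar>x $ k - y $ k\<bar> + (\<Sum>i\<in>UNIV - {k}. \<bar>x $ i - y $ i\<bar>)"
      by (simp add: sum.remove[of UNIV k])
    also have "(\<Sum>i\<in>UNIV - {k}. \<bar>x $ i - y $ i\<bar>) \<le> (\<Sum>i\<in>UNIV - {k}. t)" by (intro sum_mono le) auto
    also have "\<dots> \<le> (\<Sum>i\<in>(UNIV::'d set). t)" using t by (intro sum_mono2) auto
    finally show "dist x y \<le> 2 * real CARD('d) * t" using xk by simp
  qed
qed

text \<open>Cover by the cells of a grid in all coordinates except the one with the largest
  coefficient in the normal.\<close>

lemma hausdorff_outer_hyperplane_le:
  fixes n :: "real^'d::finite"
  assumes n: "n \<noteq> 0" and d: "CARD('d) \<ge> 2" and E: "\<And>x. x \<in> E \<Longrightarrow> n \<bullet> x = c"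
    and r: "r > 0" "\<And>x y. x \<in> E \<Longrightarrow> y \<in> E \<Longrightarrow> dist x y \<le> r"
  shows "hausdorff_outer (CARD('d) - 1) E
    \<le> ennreal (unit_ball_vol (real (CARD('d) - 1)) * (4 * real CARD('d) * r) ^ (CARD('d) - 1))"
proof (cases "E = {}")
  case True
  then show ?thesis
    using d r by (intro order_trans[OF hausdorff_outer_leI[of _ _ 0]]) (auto intro!: exI[of _ "{}"])
next
  case False
  then obtain x0 where x0: "x0 \<in> E" by blast
  let ?s = "CARD('d) - 1" and ?D = "real CARD('d)"
  obtain k where k: "\<And>x y t. n \<bullet> x = c \<Longrightarrow> n \<bullet> y = c \<Longrightarrow> (\<And>i. i \<noteq> k \<Longrightarrow> \<bar>x $ i - y $ i\<bar> \<le> t) \<Longrightarrow> 0 \<le> t \<Longrightarrow>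
      dist x y \<le> 2 * ?D * t"
    by (rule hyperplane_max_coordinate[OF n]) blast
  show ?thesis
  proof (rule hausdorff_outer_leI)
    show "1 \<le> ?s" using d by simp
    fix \<delta> :: real assume \<delta>: "\<delta> > 0"
    \<comment> \<open>The number of subdivisions is large enough for \<rho>, the bound for the
      diameter of a cell, to be at most \<delta>.\<close>
    obtain M :: nat where M: "M \<ge> 1" "4 * ?D * r / \<delta> \<le> real M"
      using real_arch_simple[of "max 1 (4 * ?D * r / \<delta>)"] by auto
    have M0: "real M > 0" using M by simp
    define \<rho> where "\<rho> = 4 * ?D * r / real M"
    have \<rho>: "0 \<le> \<rho>" "\<rho> \<le> \<delta>" using M \<delta> r M0 by (auto simp: \<rho>_def field_simps)
    \<comment> \<open>The index of the cell containing \<open>x\<close>: each coordinate lies within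
      \<open>r\<close> of that of \<open>x0\<close>, in an interval of length 2 r cut into M
      pieces.\<close>
    define q where "q x = (\<lambda>i\<in>UNIV - {k}. nat \<lfloor>(x $ i - x0 $ i + r) * real M / (2 * r)\<rfloor>)" for x
    \<comment> \<open>The right endpoint of the interval has an index of its own, so there are M + 1
      indices per coordinate; since M \<ge> 1 this is at most 2 M.\<close>
    define J where "J = PiE (UNIV - {k}) (\<lambda>_. {..M})"
    define \<C> where "\<C> = (\<lambda>m. {x\<in>E. q x = m}) ` J"
    have J: "finite J" "card J = (M + 1) ^ ?s"
      by (auto simp: J_def card_PiE intro!: finite_PiE)
    have rng: "0 \<le> (x $ i - x0 $ i + r) * real M / (2 * r)" "(x $ i - x0 $ i + r) * real M / (2 * r) \<le> real M" if "x \<in> E" for x i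
    proof -
      have "\<bar>x $ i - x0 $ i\<bar> \<le> r"
        using r(2)[OF that x0] dist_vec_nth_le[of x i x0] by (simp add: dist_real_def)
      then have *: "0 \<le> x $ i - x0 $ i + r" "x $ i - x0 $ i + r \<le> 2 * r" by linarith+
      show "0 \<le> (x $ i - x0 $ i + r) * real M / (2 * r)" using * r M0 by simp
      have "(x $ i - x0 $ i + r) * real M \<le> 2 * r * real M" using * M0 by (intro mult_right_mono) auto
      then show "(x $ i - x0 $ i + r) * real M / (2 * r) \<le> real M" using r by (simp add: divide_le_eq mult.commute)
    qed
    have qJ: "q x \<in> J" if "x \<in> E" for x
    proof -
      have "nat \<lfloor>(x $ i - x0 $ i + r) * real M / (2 * r)\<rfloor> \<le> M" for i
        using rng[OF that, of i] by linarith
      then show ?thesis by (auto simp: q_def J_def)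
    qed
    have dist: "dist x y \<le> \<rho>" if "x \<in> E" "y \<in> E" "q x = q y" for x y
    proof -
      have "\<bar>x $ i - y $ i\<bar> \<le> 2 * r / real M" if "i \<noteq> k" for i
      proof -
        let ?a = "(x $ i - x0 $ i + r) * real M / (2 * r)" and ?b = "(y $ i - x0 $ i + r) * real M / (2 * r)"
        have "nat \<lfloor>?a\<rfloor> = nat \<lfloor>?b\<rfloor>" using \<open>q x = q y\<close> that by (auto simp: q_def fun_eq_iff dest!: spec[of _ i])
        then have "\<bar>?a - ?b\<bar> \<le> 1" using rng[OF \<open>x \<in> E\<close>, of i] rng[OF \<open>y \<in> E\<close>, of i] by linarith
        moreover have "?a - ?b = (x $ i - y $ i) * (real M / (2 * r))" by (simp add: diff_divide_distrib[symmetric] algebra_simps)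
        ultimately have "\<bar>x $ i - y $ i\<bar> * (real M / (2 * r)) \<le> 1"
          using r M0 by (simp add: abs_mult)
        then show ?thesis using r M0 by (simp add: field_simps)
      qed
      then have "dist x y \<le> 2 * ?D * (2 * r / real M)" using E that(1,2) r by (intro k) auto
      then show ?thesis by (simp add: \<rho>_def)
    qed
    have cell: "bounded C \<and> diameter C \<le> \<rho>" if "C \<in> \<C>" for C
    proof -
      have "dist x y \<le> \<rho>" if "x \<in> C" "y \<in> C" for x y using that \<open>C \<in> \<C>\<close> dist by (auto simp: \<C>_def)
      then show ?thesis using \<rho>(1) by (auto intro!: diameter_le simp: bounded_two_points dist_norm)
    qed
    have "card \<C> \<le> (M + 1) ^ ?s" unfolding \<C>_def using card_image_le[OF J(1)] J(2) by metis
    then have "real (card \<C>) \<le> real ((M + 1) ^ ?s)" by (simp only: of_nat_le_iff)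
    also have "\<dots> \<le> (2 * real M) ^ ?s" unfolding of_nat_power using M(1) by (intro power_mono) auto
    finally have "real (card \<C>) * (unit_ball_vol (real ?s) * (\<rho> / 2) ^ ?s) \<le> (2 * real M) ^ ?s * (unit_ball_vol (real ?s) * (\<rho> / 2) ^ ?s)"
      using \<rho> by (intro mult_right_mono) auto
    also have "\<dots> = unit_ball_vol (real ?s) * (2 * real M * (\<rho> / 2)) ^ ?s" by (simp only: power_mult_distrib mult_ac)
    \<comment> \<open>The fineness of the grid cancels, so the bound is the same for every
      \<delta>.\<close>
    also have "2 * real M * (\<rho> / 2) = 4 * ?D * r" using M0 by (simp add: \<rho>_def)
    finally have "real (card \<C>) * (unit_ball_vol (real ?s) * (\<rho> / 2) ^ ?s) \<le> unit_ball_vol (real ?s) * (4 * ?D * r) ^ ?s" .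
    moreover have "finite \<C>" "E \<subseteq> \<Union>\<C>" using J qJ by (auto simp: \<C>_def)
    ultimately show "\<exists>\<C> \<rho>. finite \<C> \<and> E \<subseteq> \<Union>\<C> \<and> 0 \<le> \<rho> \<and> \<rho> \<le> \<delta> \<and> (\<forall>C\<in>\<C>. bounded C \<and> diameter C \<le> \<rho>) \<and>
      real (card \<C>) * (unit_ball_vol (real ?s) * (\<rho> / 2) ^ ?s) \<le> unit_ball_vol (real ?s) * (4 * ?D * r) ^ ?s"
      using \<rho> cell by blast
  qed
qed

lemma surface_measure_hyperplane_le:
  fixes n :: "real^'d::finite"
  assumes n: "n \<noteq> 0" and d: "CARD('d) \<ge> 2"
  obtains B where "B \<ge> 0" "\<And>E c r. (\<And>x. x \<in> E \<Longrightarrow> n \<bullet> x = c) \<Longrightarrow> r > 0 \<Longrightarrow> (\<And>x y. x \<in> E \<Longrightarrow> y \<in> E \<Longrightarrow> dist x y \<le> r) \<Longrightarrow>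
    emeasure surface_measure E \<le> ennreal (B * r ^ (CARD('d) - 1))"
proof (rule that)
  show "0 \<le> unit_ball_vol (real (CARD('d) - 1)) * (4 * real CARD('d)) ^ (CARD('d) - 1)" by simp
  fix E :: "(real^'d) set" and c r
  assume "\<And>x. x \<in> E \<Longrightarrow> n \<bullet> x = c" "r > 0" "\<And>x y. x \<in> E \<Longrightarrow> y \<in> E \<Longrightarrow> dist x y \<le> r"
  from order_trans[OF emeasure_hausdorff_measure_le hausdorff_outer_hyperplane_le[OF n d this]]
  show "emeasure surface_measure E
      \<le> ennreal (unit_ball_vol (real (CARD('d) - 1)) * (4 * real CARD('d)) ^ (CARD('d) - 1) * r ^ (CARD('d) - 1))"
    by (simp add: power_mult_distrib mult_ac)
qed

text \<open>Countable subadditivity spreads the estimate from cubes to Borel sets: the set is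
  covered by dyadic cubes with disjoint interiors whose total volume exceeds that of the set by an
  arbitrarily small amount.\<close>

lemma emeasure_le_lborel_of_cubes:
  fixes \<mu> :: "('a::euclidean_space) measure"
  assumes sets[simp]: "sets \<mu> = sets borel" and C: "C \<ge> 0"
    and cube: "\<And>u v h. h > 0 \<Longrightarrow> (\<And>i. i \<in> Basis \<Longrightarrow> v \<bullet> i - u \<bullet> i = h) \<Longrightarrow> emeasure \<mu> (cbox u v) \<le> ennreal (C * h ^ DIM('a))"
    and A: "A \<in> sets borel" "bounded A"
  shows "emeasure \<mu> A \<le> ennreal C * emeasure lborel A"
proof -
  obtain R where R: "R > 0" "\<And>x. x \<in> A \<Longrightarrow> norm x \<le> R" using A(2) bounded_pos by metis
  \<comment> \<open>The enclosing box is a cube, so its dyadic subdivisions are cubes as well and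
    the hypothesis applies to them.\<close>
  define a b :: 'a where "a = - R *\<^sub>R One" and "b = R *\<^sub>R One"
  have ab: "b \<bullet> i - a \<bullet> i = 2 * R" "a \<bullet> i < b \<bullet> i" if "i \<in> Basis" for i using that R by (auto simp: a_def b_def)
  have sub: "A \<subseteq> cbox a b"
  proof
    fix x assume "x \<in> A"
    then have "\<bar>x \<bullet> i\<bar> \<le> R" if "i \<in> Basis" for i using R(2) Basis_le_norm[OF that, of x] by fastforce
    then show "x \<in> cbox a b" by (auto simp: mem_box a_def b_def abs_le_iff minus_le_iff)
  qed
  have ne: "box a b \<noteq> {}" using ab(2) by (simp add: box_ne_empty)
  have lm: "A \<in> lmeasurable" using A by (auto intro!: bounded_set_imp_lmeasurable)
  have fin: "emeasure lborel A < \<infinity>" using A by (intro emeasure_bounded_finite)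
  have main: "emeasure \<mu> A \<le> ennreal C * (emeasure lborel A + ennreal e)" if e: "e > 0" for e
  proof -
    obtain \<D> where \<D>: "countable \<D>" "\<And>K. K \<in> \<D> \<Longrightarrow> K \<subseteq> cbox a b \<and> K \<noteq> {} \<and> (\<exists>c d. K = cbox c d)"
      "pairwise (\<lambda>A B. interior A \<inter> interior B = {}) \<D>"
      "\<And>u v. cbox u v \<in> \<D> \<Longrightarrow> \<exists>n. \<forall>i \<in> Basis. v \<bullet> i - u \<bullet> i = (b \<bullet> i - a \<bullet> i) / 2 ^ n"
      "A \<subseteq> \<Union>\<D>" "\<Union>\<D> \<in> lmeasurable" "measure lebesgue (\<Union>\<D>) \<le> measure lebesgue A + e"
      by (rule measurable_outer_intervals_bounded[OF lm sub e]) (use ne in auto)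
    define K where "K n = (if n \<in> to_nat_on \<D> ` \<D> then from_nat_into \<D> n else {})" for n
    have KD: "K n \<in> \<D> \<or> K n = {}" for n using from_nat_into[of \<D> n] by (auto simp: K_def)
    have UK: "(\<Union>n. K n) = \<Union>\<D>"
    proof
      show "(\<Union>n. K n) \<subseteq> \<Union>\<D>" using KD by blast
      show "\<Union>\<D> \<subseteq> (\<Union>n. K n)"
      proof
        fix x assume "x \<in> \<Union>\<D>"
        then obtain Q where Q: "Q \<in> \<D>" "x \<in> Q" by blast
        then have "K (to_nat_on \<D> Q) = Q" using \<D>(1) by (simp add: K_def)
        then show "x \<in> (\<Union>n. K n)" using Q(2) by blast
      qed
    qed
    have Kb: "K n \<in> sets borel" for n
    proof (cases "K n = {}")
      case False
      then obtain c d where "K n = cbox c d" using KD[of n] \<D>(2) by blast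
      then show ?thesis by simp
    qed simp
    have le: "emeasure \<mu> (K n) \<le> ennreal C * emeasure lborel (interior (K n))" for n
    proof (cases "K n = {}")
      case False
      then have "K n \<in> \<D>" using KD by blast
      then obtain u v where uv: "K n = cbox u v" using \<D>(2) by blast
      then obtain m where "\<forall>i\<in>Basis. v \<bullet> i - u \<bullet> i = (b \<bullet> i - a \<bullet> i) / 2 ^ m" using \<D>(4) \<open>K n \<in> \<D>\<close> by metis
      then have side: "v \<bullet> i - u \<bullet> i = 2 * R / 2 ^ m" if "i \<in> Basis" for i using that ab by simp
      have pos: "2 * R / 2 ^ m > 0" using R by simp
      have "emeasure lborel (interior (K n)) = ennreal (\<Prod>i\<in>(Basis::'a set). 2 * R / 2 ^ m)"
        unfolding uv interior_cbox using side pos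
        by (subst emeasure_lborel_box) (auto simp: inner_diff_left less_imp_le algebra_simps intro!: ennreal_cong prod.cong)
      also have "\<dots> = ennreal ((2 * R / 2 ^ m) ^ DIM('a))" by simp
      finally have "emeasure lborel (interior (K n)) = ennreal ((2 * R / 2 ^ m) ^ DIM('a))" .
      then show ?thesis using cube[OF pos side] C pos uv by (simp add: ennreal_mult)
    qed simp
    have "disjoint_family (\<lambda>n. interior (K n))"
    proof (rule disjoint_family_on_def[THEN iffD2], intro ballI impI)
      fix n m :: nat assume nm: "n \<noteq> m"
      show "interior (K n) \<inter> interior (K m) = {}"
      proof (cases "n \<in> to_nat_on \<D> ` \<D> \<and> m \<in> to_nat_on \<D> ` \<D>")
        case True
        then obtain P Q where PQ: "P \<in> \<D>" "n = to_nat_on \<D> P" "Q \<in> \<D>" "m = to_nat_on \<D> Q" by blast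
        then have "K n = P" "K m = Q" "P \<noteq> Q" using \<D>(1) nm by (auto simp: K_def)
        then show ?thesis using \<D>(3) PQ by (auto simp: pairwise_def)
      qed (auto simp: K_def)
    qed
    then have dis: "(\<Sum>n. emeasure lborel (interior (K n))) = emeasure lborel (\<Union>n. interior (K n))"
      by (intro suminf_emeasure) auto
    have "emeasure \<mu> A \<le> emeasure \<mu> (\<Union>n. K n)" using \<D>(5) Kb unfolding UK[symmetric] by (intro emeasure_mono) auto
    also have "\<dots> \<le> (\<Sum>n. emeasure \<mu> (K n))" using Kb by (intro emeasure_subadditive_countably) auto
    also have "\<dots> \<le> (\<Sum>n. ennreal C * emeasure lborel (interior (K n)))" by (intro suminf_le le) auto
    also have "\<dots> = ennreal C * emeasure lborel (\<Union>n. interior (K n))" by (simp add: dis)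
    also have "\<dots> \<le> ennreal C * emeasure lborel (\<Union>n. K n)"
      using interior_subset Kb by (intro mult_left_mono emeasure_mono) fastforce+
    also have "\<dots> \<le> ennreal C * (emeasure lborel A + ennreal e)"
    proof (rule mult_left_mono)
    have "emeasure lborel (\<Union>n. K n) = emeasure lebesgue (\<Union>\<D>)"
      using Kb by (simp flip: UK)
    also have "\<dots> = ennreal (measure lebesgue (\<Union>\<D>))" using \<D>(6) by (simp add: emeasure_eq_measure2)
    also have "\<dots> \<le> ennreal (measure lebesgue A + e)" by (intro ennreal_leI \<D>(7))
    also have "\<dots> = emeasure lborel A + ennreal e"
      using e fin A(1) by (simp add: ennreal_plus emeasure_eq_ennreal_measure)
    finally show "emeasure lborel (\<Union>n. K n) \<le> emeasure lborel A + ennreal e" .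
    qed simp
    finally show ?thesis .
  qed
  define M where "M = measure lborel A"
  have M: "emeasure lborel A = ennreal M" "M \<ge> 0" using fin by (auto simp: M_def emeasure_eq_ennreal_measure)
  \<comment> \<open>The error is divided by C + 1 beforehand, which keeps its multiple by
    \<open>C\<close> below \<open>e\<close> and also covers C = 0.\<close>
  have "emeasure \<mu> A \<le> ennreal (C * M) + ennreal e" if "e > 0" for e
  proof -
    have "emeasure \<mu> A \<le> ennreal C * (ennreal M + ennreal (e / (C + 1)))"
      using main[of "e / (C + 1)"] that C M(1) by simp
    also have "\<dots> = ennreal (C * M + C * (e / (C + 1)))"
      using that C M(2) by (simp add: ennreal_mult[symmetric] ennreal_plus[symmetric] distrib_left del: ennreal_plus)
    also have "\<dots> \<le> ennreal (C * M + e)"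
      using that C by (intro ennreal_leI) (simp add: field_simps)
    finally show ?thesis using that C M(2) by simp
  qed
  then have "emeasure \<mu> A \<le> ennreal (C * M)" by (rule ennreal_le_epsilon)
  then show ?thesis using C M by (simp add: ennreal_mult)
qed

section \<open>Integration over a cone with base in a hyperplane\<close>

lemma emeasure_surface_measure_bounded:
  fixes n :: "real^'d::finite"
  assumes n: "n \<noteq> 0" and d: "CARD('d) \<ge> 2" and F: "bounded F" "\<And>x. x \<in> F \<Longrightarrow> n \<bullet> x = c"
  shows "emeasure surface_measure F < \<infinity>"
proof -
  obtain B where B: "\<And>E c r. (\<And>x. x \<in> E \<Longrightarrow> n \<bullet> x = c) \<Longrightarrow> r > 0 \<Longrightarrow> (\<And>x y. x \<in> E \<Longrightarrow> y \<in> E \<Longrightarrow> dist x y \<le> r) \<Longrightarrow>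
    emeasure surface_measure E \<le> ennreal (B * r ^ (CARD('d) - 1))"
    by (rule surface_measure_hyperplane_le[OF n d]) blast
  obtain r where r: "\<And>x y. x \<in> F \<Longrightarrow> y \<in> F \<Longrightarrow> dist x y \<le> r" using F(1) bounded_two_points by metis
  have "emeasure surface_measure F \<le> ennreal (B * (max r 1) ^ (CARD('d) - 1))"
    by (rule B[OF F(2)]) (use r in \<open>auto intro: le_max_iff_disj[THEN iffD2]\<close>)
  also have "\<dots> < \<infinity>" by simp
  finally show ?thesis .
qed

text \<open>The cone with base \<open>F\<close> and apex \<open>z\<close> carries the image of the product of surface measure and
  Lebesgue measure on the lower half of the cone; a cube of side \<open>h\<close> meets parameters \<open>s\<close> from an
  interval of length \<open>O(h)\<close>, each contributing a piece of \<open>F\<close> of diameter \<open>O(h)\<close>.\<close>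

lemma cone_integral_le:
  fixes n z :: "real^'d::finite"
  assumes n: "n \<noteq> 0" and d: "CARD('d) \<ge> 2" and F: "compact F" "\<And>x. x \<in> F \<Longrightarrow> n \<bullet> x = c"
    and z: "n \<bullet> z \<noteq> c" and K: "compact K" "convex K" "F \<subseteq> K" "z \<in> K"
  obtains C where "C \<ge> 0" "\<And>G :: real^'d \<Rightarrow> ennreal. G \<in> borel_measurable borel \<Longrightarrow>
    (\<integral>\<^sup>+x. indicator F x * (\<integral>\<^sup>+s. indicator {0..1/2} s * G ((1 - s) *\<^sub>R x + s *\<^sub>R z) \<partial>lborel) \<partial>surface_measure)
      \<le> ennreal C * (\<integral>\<^sup>+y. G y * indicator K y \<partial>lborel)"
proof -
  let ?D = "real CARD('d)"
  define I where "I = {0..1/2::real}"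
  define \<nu> where "\<nu> = density surface_measure (indicator F :: real^'d \<Rightarrow> ennreal)"
  define L where "L = density lborel (indicator I :: real \<Rightarrow> ennreal)"
  define f where "f p = (1 - snd p) *\<^sub>R fst p + snd p *\<^sub>R z" for p :: "(real^'d) \<times> real"
  have Fb[measurable]: "F \<in> sets borel" using F(1) by (simp add: borel_compact)
  have Kb[measurable]: "K \<in> sets borel" using K(1) by (simp add: borel_compact)
  have Ib[measurable]: "I \<in> sets borel" by (simp add: I_def)
  have s\<nu>[simp, measurable_cong]: "sets \<nu> = sets borel" by (simp add: \<nu>_def)
  have sL[simp, measurable_cong]: "sets L = sets borel" by (simp add: L_def)
  have fm[measurable]: "f \<in> borel_measurable (borel \<Otimes>\<^sub>M borel)" unfolding f_def[abs_def] by measurable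
  have \<nu>E: "emeasure \<nu> E = emeasure surface_measure (F \<inter> E)" if "E \<in> sets borel" for E
    unfolding \<nu>_def by (rule emeasure_restricted) (use that in auto)
  interpret \<nu>: finite_measure \<nu>
    by (rule finite_measureI)
      (use \<nu>E[of UNIV] emeasure_surface_measure_bounded[OF n d compact_imp_bounded[OF F(1)] F(2)] in \<open>simp add: \<nu>_def\<close>)
  interpret L: finite_measure L
    by (rule finite_measureI) (auto simp: L_def I_def emeasure_restricted)
  interpret pair_sigma_finite \<nu> L ..
  define \<mu> where "\<mu> = distr (\<nu> \<Otimes>\<^sub>M L) borel f"
  have s\<mu>[simp, measurable_cong]: "sets \<mu> = sets borel" by (simp add: \<mu>_def)
  have f': "f \<in> (\<nu> \<Otimes>\<^sub>M L) \<rightarrow>\<^sub>M borel" by measurable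
  \<comment> \<open>Slicing the product measure at fixed \<open>s\<close>: the slice collects the
    points of the base that the contraction towards \<open>z\<close> with ratio 1 - s sends into
    \<open>A\<close>.\<close>
  have \<mu>A: "emeasure \<mu> A = (\<integral>\<^sup>+s. indicator I s * emeasure surface_measure {x\<in>F. (1 - s) *\<^sub>R x + s *\<^sub>R z \<in> A} \<partial>lborel)"
    if A: "A \<in> sets borel" for A
  proof -
    have "emeasure \<mu> A = emeasure (\<nu> \<Otimes>\<^sub>M L) (f -` A \<inter> space (\<nu> \<Otimes>\<^sub>M L))"
      unfolding \<mu>_def by (rule emeasure_distr[OF f' A])
    also have "\<dots> = (\<integral>\<^sup>+s. emeasure \<nu> ((\<lambda>x. (x, s)) -` (f -` A \<inter> space (\<nu> \<Otimes>\<^sub>M L))) \<partial>L)"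
      using measurable_sets[OF f' A] by (rule emeasure_pair_measure_alt2)
    also have "\<dots> = (\<integral>\<^sup>+s. emeasure surface_measure {x\<in>F. (1 - s) *\<^sub>R x + s *\<^sub>R z \<in> A} \<partial>L)"
    proof (rule nn_integral_cong)
      fix s
      have "(\<lambda>x. (x, s)) -` (f -` A \<inter> space (\<nu> \<Otimes>\<^sub>M L)) = (\<lambda>x. (1 - s) *\<^sub>R x + s *\<^sub>R z) -` A"
        by (auto simp: f_def space_pair_measure \<nu>_def L_def)
      moreover have "(\<lambda>x::real^'d. (1 - s) *\<^sub>R x + s *\<^sub>R z) -` A \<in> sets borel"
        using measurable_sets[of "\<lambda>x::real^'d. (1 - s) *\<^sub>R x + s *\<^sub>R z" borel borel A] A by simp
      moreover have "F \<inter> (\<lambda>x::real^'d. (1 - s) *\<^sub>R x + s *\<^sub>R z) -` A = {x\<in>F. (1 - s) *\<^sub>R x + s *\<^sub>R z \<in> A}" by auto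
      ultimately show "emeasure \<nu> ((\<lambda>x. (x, s)) -` (f -` A \<inter> space (\<nu> \<Otimes>\<^sub>M L))) = emeasure surface_measure {x\<in>F. (1 - s) *\<^sub>R x + s *\<^sub>R z \<in> A}"
        by (simp add: \<nu>E)
    qed
    also have "\<dots> = (\<integral>\<^sup>+s. indicator I s * emeasure surface_measure {x\<in>F. (1 - s) *\<^sub>R x + s *\<^sub>R z \<in> A} \<partial>lborel)"
    proof -
      have "(\<lambda>s. emeasure \<nu> ((\<lambda>x. (x, s)) -` (f -` A \<inter> space (\<nu> \<Otimes>\<^sub>M L)))) \<in> borel_measurable L"
        using measurable_sets[OF f' A] by (rule measurable_emeasure_Pair2)
      moreover have "emeasure \<nu> ((\<lambda>x. (x, s)) -` (f -` A \<inter> space (\<nu> \<Otimes>\<^sub>M L))) = emeasure surface_measure {x\<in>F. (1 - s) *\<^sub>R x + s *\<^sub>R z \<in> A}" for s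
      proof -
        have "(\<lambda>x. (x, s)) -` (f -` A \<inter> space (\<nu> \<Otimes>\<^sub>M L)) = (\<lambda>x. (1 - s) *\<^sub>R x + s *\<^sub>R z) -` A"
          by (auto simp: f_def space_pair_measure \<nu>_def L_def)
        moreover have "(\<lambda>x::real^'d. (1 - s) *\<^sub>R x + s *\<^sub>R z) -` A \<in> sets borel"
          using measurable_sets[of "\<lambda>x::real^'d. (1 - s) *\<^sub>R x + s *\<^sub>R z" borel borel A] A by simp
        moreover have "F \<inter> (\<lambda>x::real^'d. (1 - s) *\<^sub>R x + s *\<^sub>R z) -` A = {x\<in>F. (1 - s) *\<^sub>R x + s *\<^sub>R z \<in> A}" by auto
        ultimately show ?thesis by (simp add: \<nu>E)
      qed
      ultimately have "(\<lambda>s. emeasure surface_measure {x\<in>F. (1 - s) *\<^sub>R x + s *\<^sub>R z \<in> A}) \<in> borel_measurable lborel"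
        by (simp add: measurable_cong_sets[of L lborel])
      then show ?thesis unfolding L_def by (intro nn_integral_density) auto
    qed
    finally show ?thesis .
  qed
  obtain B where B0: "B \<ge> 0" and B: "\<And>E c r. (\<And>x. x \<in> E \<Longrightarrow> n \<bullet> x = c) \<Longrightarrow> r > 0 \<Longrightarrow> (\<And>x y. x \<in> E \<Longrightarrow> y \<in> E \<Longrightarrow> dist x y \<le> r) \<Longrightarrow>
    emeasure surface_measure E \<le> ennreal (B * r ^ (CARD('d) - 1))"
    by (rule surface_measure_hyperplane_le[OF n d]) blast
  define \<rho> where "\<rho> = \<bar>n \<bullet> z - c\<bar>"
  have \<rho>: "\<rho> > 0" using z by (simp add: \<rho>_def)
  \<comment> \<open>The surface bound for a piece of diameter 2 d h, times the length 2 w of the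
    parameter interval below, with all powers of h divided out.\<close>
  define C where "C = B * (2 * ?D) ^ (CARD('d) - 1) * (2 * norm n * ?D / \<rho>)"
  have C0: "C \<ge> 0" using B0 \<rho> by (simp add: C_def)
  have cube: "emeasure \<mu> (cbox u v) \<le> ennreal (C * h ^ DIM(real^'d))"
    if h: "h > 0" "\<And>i. i \<in> Basis \<Longrightarrow> v \<bullet> i - u \<bullet> i = h" for u v h
  proof -
    have diam: "dist y y' \<le> ?D * h" if "y \<in> cbox u v" "y' \<in> cbox u v" for y y'
    proof -
      have "dist y y' \<le> (\<Sum>i\<in>Basis. \<bar>(y - y') \<bullet> i\<bar>)" unfolding dist_norm by (rule norm_le_l1)
      also have "\<dots> \<le> (\<Sum>i\<in>(Basis::(real^'d) set). h)"
      proof (intro sum_mono)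
        fix i :: "real^'d" assume i: "i \<in> Basis"
        then have "u \<bullet> i \<le> y \<bullet> i" "y \<bullet> i \<le> v \<bullet> i" "u \<bullet> i \<le> y' \<bullet> i" "y' \<bullet> i \<le> v \<bullet> i" using that by (auto simp: mem_box)
        then show "\<bar>(y - y') \<bullet> i\<bar> \<le> h" using h(2)[OF i] by (simp add: inner_diff_left)
      qed
      finally show ?thesis by simp
    qed
    \<comment> \<open>The linear form takes the value c + s (n \<bullet> z - c) at parameter
      \<open>s\<close>. It equals n \<bullet> u at \<open>s0\<close>, and it varies over the cube by
      at most the norm of \<open>n\<close> times the diameter, which gives the half-length
      \<open>w\<close>.\<close>
    define s0 where "s0 = (n \<bullet> u - c) / (n \<bullet> z - c)"
    define w where "w = norm n * (?D * h) / \<rho>"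
    have w: "w \<ge> 0" using h \<rho> by (simp add: w_def)
    have uv: "u \<in> cbox u v" using h by (force simp: mem_box)
    have le: "indicator I s * emeasure surface_measure {x\<in>F. (1 - s) *\<^sub>R x + s *\<^sub>R z \<in> cbox u v}
        \<le> ennreal (B * (2 * ?D * h) ^ (CARD('d) - 1)) * indicator {s0 - w..s0 + w} s" for s
    proof (cases "s \<in> I \<and> {x\<in>F. (1 - s) *\<^sub>R x + s *\<^sub>R z \<in> cbox u v} \<noteq> {}")
      case False
      then consider "s \<notin> I" | "{x\<in>F. (1 - s) *\<^sub>R x + s *\<^sub>R z \<in> cbox u v} = {}" by blast
      then show ?thesis
      proof cases
        case 2
        show ?thesis unfolding 2 by simp
      qed simp
    next
      case True
      then have s: "0 \<le> s" "s \<le> 1 / 2" by (auto simp: I_def)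
      obtain x where x: "x \<in> F" "(1 - s) *\<^sub>R x + s *\<^sub>R z \<in> cbox u v" using True by blast
      have e1: "n \<bullet> ((1 - s) *\<^sub>R x + s *\<^sub>R z) = c + s * (n \<bullet> z - c)"
        using F(2)[OF x(1)] by (simp add: inner_add_right algebra_simps)
      have "(s - s0) * (n \<bullet> z - c) = n \<bullet> ((1 - s) *\<^sub>R x + s *\<^sub>R z) - n \<bullet> u"
        unfolding e1 using z by (simp add: s0_def field_simps)
      also have "\<dots> = n \<bullet> ((1 - s) *\<^sub>R x + s *\<^sub>R z - u)" by (simp only: inner_diff_right)
      finally have "\<bar>s - s0\<bar> * \<rho> = \<bar>n \<bullet> ((1 - s) *\<^sub>R x + s *\<^sub>R z - u)\<bar>"
        unfolding \<rho>_def abs_mult[symmetric] by simp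
      also have "\<dots> \<le> norm n * norm ((1 - s) *\<^sub>R x + s *\<^sub>R z - u)" by (rule Cauchy_Schwarz_ineq2)
      also have "\<dots> \<le> norm n * (?D * h)" using diam[OF x(2) uv] by (intro mult_left_mono) (auto simp: dist_norm)
      finally have "\<bar>s - s0\<bar> \<le> w" using \<rho> by (simp add: w_def field_simps)
      then have sw: "s \<in> {s0 - w..s0 + w}" by auto
      have "emeasure surface_measure {x\<in>F. (1 - s) *\<^sub>R x + s *\<^sub>R z \<in> cbox u v} \<le> ennreal (B * (2 * ?D * h) ^ (CARD('d) - 1))"
      proof (rule B)
        show "2 * ?D * h > 0" using h by simp
        fix x y assume "x \<in> {x\<in>F. (1 - s) *\<^sub>R x + s *\<^sub>R z \<in> cbox u v}" "y \<in> {x\<in>F. (1 - s) *\<^sub>R x + s *\<^sub>R z \<in> cbox u v}"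
        then have "dist ((1 - s) *\<^sub>R x + s *\<^sub>R z) ((1 - s) *\<^sub>R y + s *\<^sub>R z) \<le> ?D * h" using diam by blast
        moreover have "dist ((1 - s) *\<^sub>R x + s *\<^sub>R z) ((1 - s) *\<^sub>R y + s *\<^sub>R z) = (1 - s) * dist x y"
          using s by (simp add: dist_norm flip: scaleR_diff_right)
        \<comment> \<open>In the lower half of the cone distances shrink by a factor of at least
          1/2, so the piece of the base has at most twice the diameter of the cube.\<close>
        moreover have "1 / 2 * dist x y \<le> (1 - s) * dist x y" using s by (intro mult_right_mono) auto
        ultimately show "dist x y \<le> 2 * ?D * h" by simp
      qed (use F(2) in auto)
      then show ?thesis using sw True by simp
    qed
    have "emeasure \<mu> (cbox u v) \<le> (\<integral>\<^sup>+s. ennreal (B * (2 * ?D * h) ^ (CARD('d) - 1)) * indicator {s0 - w..s0 + w} s \<partial>lborel)"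
    proof -
      have cb: "cbox u v \<in> sets borel" by simp
      show ?thesis unfolding \<mu>A[OF cb] by (rule nn_integral_mono[OF le])
    qed
    also have "\<dots> = ennreal (B * (2 * ?D * h) ^ (CARD('d) - 1)) * ennreal (2 * w)"
      using w by (simp add: nn_integral_cmult_indicator)
    also have "\<dots> = ennreal (B * (2 * ?D * h) ^ (CARD('d) - 1) * (2 * w))"
      using B0 h w by (intro ennreal_mult[symmetric] mult_nonneg_nonneg) auto
    also have "B * (2 * ?D * h) ^ (CARD('d) - 1) * (2 * w) = C * (h ^ (CARD('d) - 1) * h)"
      by (simp add: C_def w_def power_mult_distrib)
    also have "h ^ (CARD('d) - 1) * h = h ^ DIM(real^'d)"
      using d by (simp flip: power_Suc2)
    finally show ?thesis .
  qed
  have A: "emeasure \<mu> A \<le> emeasure (density lborel (\<lambda>y. ennreal C * indicator K y)) A" if A: "A \<in> sets borel" for A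
  proof -
    have "emeasure \<mu> A \<le> emeasure \<mu> (A \<inter> K) + emeasure \<mu> (A - K)"
      using A emeasure_subadditive[of "A \<inter> K" \<mu> "A - K"] by (simp add: Int_Diff_Un)
    \<comment> \<open>The convex set \<open>K\<close> contains the base and the apex, hence the
      whole cone, and the image measure does not charge its complement.\<close>
    also have "emeasure \<mu> (A - K) = 0"
    proof -
      have "{x\<in>F. (1 - s) *\<^sub>R x + s *\<^sub>R z \<in> A - K} = {}" (is "?E s = {}") if "s \<in> I" for s
        using that K by (auto simp: I_def intro!: convexD)
      then have z: "indicator I s * emeasure surface_measure (?E s) = 0" for s
        by (cases "s \<in> I") (simp_all only: emeasure_empty indicator_def if_False of_bool_eq mult_zero_left mult_zero_right)
      have "A - K \<in> sets borel" using A by simp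
      from \<mu>A[OF this] show ?thesis unfolding z by simp
    qed
    also have "emeasure \<mu> (A \<inter> K) \<le> ennreal C * emeasure lborel (A \<inter> K)"
      using A K(1) by (intro emeasure_le_lborel_of_cubes[OF s\<mu> C0 cube]) (auto intro: bounded_subset compact_imp_bounded)
    also have "ennreal C * emeasure lborel (A \<inter> K) = emeasure (density lborel (\<lambda>y. ennreal C * indicator K y)) A"
      using A by (subst emeasure_density) (auto simp: nn_integral_cmult mult.assoc indicator_inter_arith[symmetric] Int_commute)
    finally show ?thesis by simp
  qed
  have le: "\<mu> \<le> density lborel (\<lambda>y. ennreal C * indicator K y)"
  proof (subst le_measure)
    show "sets \<mu> = sets (density lborel (\<lambda>y. ennreal C * indicator K y))" by simp
    show "\<forall>A\<in>sets \<mu>. emeasure \<mu> A \<le> emeasure (density lborel (\<lambda>y. ennreal C * indicator K y)) A" using A by simp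
  qed
  show ?thesis
  proof (rule that[OF C0])
    fix G :: "real^'d \<Rightarrow> ennreal" assume G[measurable]: "G \<in> borel_measurable borel"
    have "(\<integral>\<^sup>+x. indicator F x * (\<integral>\<^sup>+s. indicator {0..1/2} s * G ((1 - s) *\<^sub>R x + s *\<^sub>R z) \<partial>lborel) \<partial>surface_measure)
        = (\<integral>\<^sup>+x. (\<integral>\<^sup>+s. indicator I s * G ((1 - s) *\<^sub>R x + s *\<^sub>R z) \<partial>lborel) \<partial>\<nu>)"
      unfolding \<nu>_def I_def[symmetric] by (intro nn_integral_density[symmetric]) measurable
    also have "\<dots> = (\<integral>\<^sup>+x. (\<integral>\<^sup>+s. G (f (x, s)) \<partial>L) \<partial>\<nu>)"
      unfolding L_def f_def by (intro nn_integral_cong, subst nn_integral_density) auto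
    also have "\<dots> = (\<integral>\<^sup>+p. G (f p) \<partial>(\<nu> \<Otimes>\<^sub>M L))"
      by (rule L.nn_integral_fst) measurable
    also have "\<dots> = (\<integral>\<^sup>+y. G y \<partial>\<mu>)" unfolding \<mu>_def by (rule nn_integral_distr[symmetric, OF f']) measurable
    also have "\<dots> \<le> (\<integral>\<^sup>+y. G y \<partial>density lborel (\<lambda>y. ennreal C * indicator K y))"
      by (rule nn_integral_mono_measure[OF _ le]) simp
    also have "\<dots> = ennreal C * (\<integral>\<^sup>+y. G y * indicator K y \<partial>lborel)"
      by (subst nn_integral_density) (auto simp: nn_integral_cmult[symmetric] mult_ac)
    finally show "(\<integral>\<^sup>+x. indicator F x * (\<integral>\<^sup>+s. indicator {0..1/2} s * G ((1 - s) *\<^sub>R x + s *\<^sub>R z) \<partial>lborel) \<partial>surface_measure)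
      \<le> ennreal C * (\<integral>\<^sup>+y. G y * indicator K y \<partial>lborel)" .
  qed
qed

text \<open>Integrate the derivative of \<open>- (1 - 2 s) h(s)\<^sup>2\<close> over the interval.\<close>

lemma square_at_0_le_integral:
  fixes h h' :: "real \<Rightarrow> real"
  assumes h: "\<And>s. (h has_real_derivative h' s) (at s)" and h': "continuous_on UNIV h'"
  shows "ennreal ((h 0)\<^sup>2) \<le> (\<integral>\<^sup>+s. indicator {0..1/2} s * ennreal (3 * (h s)\<^sup>2 + (h' s)\<^sup>2) \<partial>lborel)"
proof -
  have ch: "continuous_on UNIV h" using h by (auto intro!: continuous_at_imp_continuous_on DERIV_isCont)
  define f where "f s = 2 * (h s)\<^sup>2 - (1 - 2 * s) * (2 * h s * h' s)" for s
  define q where "q s = 3 * (h s)\<^sup>2 + (h' s)\<^sup>2" for s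
  \<comment> \<open>The weight 1 - 2 s vanishes at 1/2, so the boundary term at the upper end
    disappears and only the value at 0 survives.\<close>
  have "has_bochner_integral lborel (\<lambda>s. f s * indicator {0..1/2} s) (- (1 - 2 * (1/2)) * (h (1/2))\<^sup>2 - - (1 - 2 * 0) * (h 0)\<^sup>2)"
  proof (rule has_bochner_integral_FTC_Icc_real)
    fix s :: real
    show "DERIV (\<lambda>s. - (1 - 2 * s) * (h s)\<^sup>2) s :> f s"
      unfolding f_def by (auto intro!: derivative_eq_intros h simp: algebra_simps power2_eq_square)
    have "continuous_on UNIV f" unfolding f_def[abs_def] by (intro continuous_intros ch h')
    then show "isCont f s" by (simp add: continuous_on_eq_continuous_at)
  qed simp
  then have f: "integrable lborel (\<lambda>s. indicator {0..1/2} s * f s)" "(LINT s|lborel. indicator {0..1/2} s * f s) = (h 0)\<^sup>2"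
    by (auto simp: has_bochner_integral_iff mult.commute)
  have cq: "continuous_on {0..1/2} q" unfolding q_def[abs_def]
    by (intro continuous_intros continuous_on_subset[OF ch] continuous_on_subset[OF h']) auto
  have q: "integrable lborel (\<lambda>s. indicator {0..1/2} s * q s)"
    using borel_integrable_compact[OF compact_Icc cq] by simp
  have "indicator {0..1/2} s * f s \<le> indicator {0..1/2} s * q s" for s
  proof (cases "s \<in> {0..1/2}")
    case True
    define t where "t = 1 - 2 * s"
    \<comment> \<open>The square absorbs the mixed term at the cost of one more h^2; with the two
      already present this gives the coefficient 3.\<close>
    have "0 \<le> (h s + t * h' s)\<^sup>2" by simp
    then have "- (t * (2 * h s * h' s)) \<le> (h s)\<^sup>2 + t\<^sup>2 * (h' s)\<^sup>2"
      by (simp add: power2_sum power_mult_distrib algebra_simps)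
    also have "t\<^sup>2 * (h' s)\<^sup>2 \<le> 1 * (h' s)\<^sup>2" using True by (intro mult_right_mono) (auto simp: t_def power_le_one)
    finally show ?thesis using True by (simp add: f_def q_def t_def)
  qed simp
  then have "(h 0)\<^sup>2 \<le> (LINT s|lborel. indicator {0..1/2} s * q s)"
    unfolding f(2)[symmetric] by (intro integral_mono f q)
  then have "ennreal ((h 0)\<^sup>2) \<le> ennreal (LINT s|lborel. indicator {0..1/2} s * q s)" by (rule ennreal_leI)
  also have "\<dots> = (\<integral>\<^sup>+s. ennreal (indicator {0..1/2} s * q s) \<partial>lborel)"
    by (intro nn_integral_eq_integral[symmetric] q) (auto simp: q_def)
  also have "\<dots> = (\<integral>\<^sup>+s. indicator {0..1/2} s * ennreal (q s) \<partial>lborel)"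
    by (intro nn_integral_cong) (auto simp: indicator_def)
  finally show ?thesis by (simp add: q_def)
qed

section \<open>The trace inequality for smooth functions\<close>

lemma smooth_square_le_segment_integral:
  fixes \<phi> :: "real^'d::finite \<Rightarrow> real"
  assumes sm: "smooth \<phi>" and D: "norm (z - x) \<le> D"
  shows "ennreal ((\<phi> x)\<^sup>2) \<le> (\<integral>\<^sup>+s. indicator {0..1/2} s *
    ennreal ((3 + D\<^sup>2) * ((\<phi> ((1 - s) *\<^sub>R x + s *\<^sub>R z))\<^sup>2 + (\<Sum>i\<in>UNIV. (pderiv_at i \<phi> ((1 - s) *\<^sub>R x + s *\<^sub>R z))\<^sup>2))) \<partial>lborel)"
proof -
  define w where "w = z - x"
  define y where "y s = x + s *\<^sub>R w" for s
  have y: "(1 - s) *\<^sub>R x + s *\<^sub>R z = y s" for s by (simp add: y_def w_def algebra_simps)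
  define h' where "h' s = (\<Sum>i\<in>UNIV. w $ i * pderiv_at i \<phi> (y s))" for s
  have "((\<lambda>s. \<phi> (y s)) has_real_derivative h' s) (at s)" for s
  proof -
    have "(y has_derivative (\<lambda>t. t *\<^sub>R w)) (at s)" unfolding y_def by (auto intro!: derivative_eq_intros)
    from has_derivative_compose[OF this has_derivative_pderiv_at[OF smooth_differentiable[OF sm]]]
    have "((\<lambda>s. \<phi> (y s)) has_derivative (\<lambda>t. \<Sum>i\<in>UNIV. (t *\<^sub>R w) $ i * pderiv_at i \<phi> (y s))) (at s)" .
    moreover have "(\<lambda>t. \<Sum>i\<in>UNIV. (t *\<^sub>R w) $ i * pderiv_at i \<phi> (y s)) = (*) (h' s)"
      by (rule ext) (simp add: h'_def sum_distrib_left mult_ac)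
    ultimately show ?thesis by (simp only: has_field_derivative_def)
  qed
  moreover have "continuous_on UNIV y" unfolding y_def by (intro continuous_intros)
  then have "continuous_on UNIV h'" unfolding h'_def
    by (intro continuous_intros continuous_on_compose2[OF smooth_continuous[OF smooth_pderiv[OF sm], of UNIV]]) auto
  ultimately have "ennreal ((\<phi> (y 0))\<^sup>2) \<le> (\<integral>\<^sup>+s. indicator {0..1/2} s * ennreal (3 * (\<phi> (y s))\<^sup>2 + (h' s)\<^sup>2) \<partial>lborel)"
    by (rule square_at_0_le_integral)
  also have "\<dots> \<le> (\<integral>\<^sup>+s. indicator {0..1/2} s * ennreal ((3 + D\<^sup>2) * ((\<phi> (y s))\<^sup>2 + (\<Sum>i\<in>UNIV. (pderiv_at i \<phi> (y s))\<^sup>2))) \<partial>lborel)"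
  proof (intro nn_integral_mono mult_left_mono ennreal_leI)
    fix s
    let ?g = "\<chi> i. pderiv_at i \<phi> (y s)"
    \<comment> \<open>By Cauchy-Schwarz the derivative along the segment is at most D times the norm
      of the gradient, whence the factor 3 + D^2.\<close>
    have "h' s = w \<bullet> ?g" by (simp add: h'_def inner_vec_def)
    then have "\<bar>h' s\<bar> \<le> norm w * norm ?g" by (simp add: Cauchy_Schwarz_ineq2)
    also have "\<dots> \<le> D * norm ?g" using D by (intro mult_right_mono) (auto simp: w_def)
    finally have "\<bar>h' s\<bar> \<le> \<bar>D * norm ?g\<bar>" by linarith
    then have "(h' s)\<^sup>2 \<le> (D * norm ?g)\<^sup>2" by (simp only: abs_le_square_iff)
    also have "\<dots> = D\<^sup>2 * (\<Sum>i\<in>UNIV. (pderiv_at i \<phi> (y s))\<^sup>2)" by (simp add: power_mult_distrib norm_cart_square)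
    finally have "(h' s)\<^sup>2 \<le> D\<^sup>2 * (\<Sum>i\<in>UNIV. (pderiv_at i \<phi> (y s))\<^sup>2)" .
    moreover have "0 \<le> (\<Sum>i\<in>UNIV. (pderiv_at i \<phi> (y s))\<^sup>2)" by (intro sum_nonneg) auto
    moreover have "0 \<le> D\<^sup>2 * (\<phi> (y s))\<^sup>2" by simp
    ultimately have "3 * (\<phi> (y s))\<^sup>2 + (h' s)\<^sup>2 \<le> 3 * (\<phi> (y s))\<^sup>2 + 3 * (\<Sum>i\<in>UNIV. (pderiv_at i \<phi> (y s))\<^sup>2)
        + (D\<^sup>2 * (\<phi> (y s))\<^sup>2 + D\<^sup>2 * (\<Sum>i\<in>UNIV. (pderiv_at i \<phi> (y s))\<^sup>2))" by linarith
    then show "3 * (\<phi> (y s))\<^sup>2 + (h' s)\<^sup>2 \<le> (3 + D\<^sup>2) * ((\<phi> (y s))\<^sup>2 + (\<Sum>i\<in>UNIV. (pderiv_at i \<phi> (y s))\<^sup>2))"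
      by (simp only: distrib_left distrib_right)
  qed simp
  finally show ?thesis by (simp add: y y_def)
qed

text \<open>Each value on the face is bounded by an integral along half of the segment to the apex
  \<open>z\<close>. Integrating over the face produces a cone integral, which the preceding
  comparison bounds by an integral over \<open>K\<close>.\<close>

lemma trace_inequality:
  fixes n z :: "real^'d::finite"
  assumes n: "n \<noteq> 0" and d: "CARD('d) \<ge> 2" and F: "compact F" "\<And>x. x \<in> F \<Longrightarrow> n \<bullet> x = c"
    and z: "n \<bullet> z \<noteq> c" and K: "compact K" "convex K" "F \<subseteq> K" "z \<in> K"
  obtains C where "C \<ge> 0"
    "\<And>\<phi>. smooth \<phi> \<Longrightarrow> (LINT x:F|surface_measure. (\<phi> x)\<^sup>2) \<le> C * (H1_norm (interior K) \<phi>)\<^sup>2"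
proof -
  obtain C where C: "C \<ge> 0" "\<And>G :: real^'d \<Rightarrow> ennreal. G \<in> borel_measurable borel \<Longrightarrow>
    (\<integral>\<^sup>+x. indicator F x * (\<integral>\<^sup>+s. indicator {0..1/2} s * G ((1 - s) *\<^sub>R x + s *\<^sub>R z) \<partial>lborel) \<partial>surface_measure)
      \<le> ennreal C * (\<integral>\<^sup>+y. G y * indicator K y \<partial>lborel)"
    by (rule cone_integral_le[OF n d F z K]) (assumption, rule that)
  obtain D where D: "\<And>x. x \<in> K \<Longrightarrow> norm (z - x) \<le> D"
    using compact_imp_bounded[OF K(1)] K(4) by (metis bounded_two_points dist_norm)
  show ?thesis
  proof (rule that[of "C * (3 + D\<^sup>2)"])
    show "0 \<le> C * (3 + D\<^sup>2)" using C(1) by (simp add: add_nonneg_nonneg)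
    fix \<phi> :: "real^'d \<Rightarrow> real" assume sm: "smooth \<phi>"
    define Q where "Q y = (\<phi> y)\<^sup>2 + (\<Sum>i\<in>UNIV. (pderiv_at i \<phi> y)\<^sup>2)" for y
    have Q0: "0 \<le> Q y" for y by (auto simp: Q_def intro!: add_nonneg_nonneg sum_nonneg)
    have cQ: "continuous_on S Q" for S
      unfolding Q_def[abs_def] by (intro continuous_intros smooth_continuous smooth_pderiv sm)
    then have mQ[measurable]: "Q \<in> borel_measurable borel" by (intro borel_measurable_continuous_onI)
    have Fb[measurable]: "F \<in> sets borel" using F(1) by (simp add: borel_compact)
    have m[measurable]: "\<phi> \<in> borel_measurable borel" by (rule smooth_measurable[OF sm])
    have iQ: "integrable lborel (\<lambda>y. indicator K y * Q y)"
      using borel_integrable_compact[OF K(1) cQ] by simp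
    have H1: "(LINT y|lborel. indicator K y * Q y) = (H1_norm (interior K) \<phi>)\<^sup>2"
    proof -
      let ?S = "interior K"
      have "?S \<subseteq> K" by (rule interior_subset)
      \<comment> \<open>The boundary of a convex set is negligible, so the integral over the compact
        set agrees with the one over its interior, where the H1 norm lives.\<close>
      have "K - ?S \<in> null_sets lebesgue"
        using negligible_convex_frontier[OF K(2)] K(1)
        by (simp add: negligible_iff_null_sets frontier_def closure_closed compact_imp_closed)
      then have "AE y in lebesgue. y \<notin> K - ?S" by (rule AE_not_in)
      moreover have "AE y in lebesgue. \<forall>i. y \<in> ?S \<longrightarrow> weak_pderiv ?S i \<phi> y = pderiv_at i \<phi> y"
        by (subst AE_all_countable) (auto intro: smooth_weak_pderiv sm)
      ultimately have ae: "AE y in lebesgue. indicator K y * Q y = indicator ?S y *\<^sub>R ((norm (weak_grad ?S \<phi> y))\<^sup>2 + (\<phi> y)\<^sup>2)"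
        by eventually_elim (use interior_subset[of K] in \<open>auto simp: indicator_def Q_def norm_cart_square weak_grad_def\<close>)
      have mK: "(\<lambda>y. indicator K y * Q y) \<in> borel_measurable lebesgue"
        using iQ by (intro measurable_completion) auto
      have "(LINT y|lborel. indicator K y * Q y) = (LINT y|lebesgue. indicator K y * Q y)"
        using iQ by (intro integral_completion[symmetric]) auto
      also have "\<dots> = (LINT y:?S|lebesgue. (norm (weak_grad ?S \<phi> y))\<^sup>2 + (\<phi> y)\<^sup>2)"
        unfolding set_lebesgue_integral_def
        by (rule integral_cong_AE[OF mK borel_measurable_lebesgue_AE_cong[OF mK ae] ae])
      also have "\<dots> = (H1_norm ?S \<phi>)\<^sup>2"
        unfolding H1_norm_def by (subst real_sqrt_pow2) (auto simp: set_lebesgue_integral_def intro!: integral_nonneg_AE)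
      finally show ?thesis .
    qed
    have "(\<integral>\<^sup>+x. ennreal (indicator F x * (\<phi> x)\<^sup>2) \<partial>surface_measure)
        \<le> (\<integral>\<^sup>+x. indicator F x * (\<integral>\<^sup>+s. indicator {0..1/2} s * ennreal ((3 + D\<^sup>2) * Q ((1 - s) *\<^sub>R x + s *\<^sub>R z)) \<partial>lborel) \<partial>surface_measure)"
    proof (intro nn_integral_mono)
      fix x
      show "ennreal (indicator F x * (\<phi> x)\<^sup>2) \<le> indicator F x * (\<integral>\<^sup>+s. indicator {0..1/2} s * ennreal ((3 + D\<^sup>2) * Q ((1 - s) *\<^sub>R x + s *\<^sub>R z)) \<partial>lborel)"
        using smooth_square_le_segment_integral[OF sm D, of x] K(3) by (cases "x \<in> F") (auto simp: Q_def)
    qed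
    also have "\<dots> \<le> ennreal C * (\<integral>\<^sup>+y. ennreal ((3 + D\<^sup>2) * Q y) * indicator K y \<partial>lborel)"
      by (rule C(2)) measurable
    also have "(\<integral>\<^sup>+y. ennreal ((3 + D\<^sup>2) * Q y) * indicator K y \<partial>lborel) = (\<integral>\<^sup>+y. ennreal ((3 + D\<^sup>2) * (indicator K y * Q y)) \<partial>lborel)"
      by (intro nn_integral_cong) (auto simp: indicator_def)
    also have "\<dots> = ennreal (LINT y|lborel. (3 + D\<^sup>2) * (indicator K y * Q y))"
      using Q0 by (intro nn_integral_eq_integral integrable_mult_right iQ) (auto intro!: mult_nonneg_nonneg add_nonneg_nonneg)
    also have "\<dots> = ennreal ((3 + D\<^sup>2) * (H1_norm (interior K) \<phi>)\<^sup>2)" by (simp add: H1)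
    also have "ennreal C * \<dots> = ennreal (C * (3 + D\<^sup>2) * (H1_norm (interior K) \<phi>)\<^sup>2)"
      using C(1) by (simp add: ennreal_mult' mult.assoc)
    finally have le: "(\<integral>\<^sup>+x. ennreal (indicator F x * (\<phi> x)\<^sup>2) \<partial>surface_measure) \<le> ennreal (C * (3 + D\<^sup>2) * (H1_norm (interior K) \<phi>)\<^sup>2)" .
    have "(LINT x:F|surface_measure. (\<phi> x)\<^sup>2) = enn2real (\<integral>\<^sup>+x. ennreal (indicator F x * (\<phi> x)\<^sup>2) \<partial>surface_measure)"
      unfolding set_lebesgue_integral_def real_scaleR_def
      by (subst integral_eq_nn_integral) (auto simp: measurable_cong_sets[of surface_measure borel])
    also have "\<dots> \<le> enn2real (ennreal (C * (3 + D\<^sup>2) * (H1_norm (interior K) \<phi>)\<^sup>2))"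
      by (rule enn2real_mono[OF le]) simp
    also have "\<dots> = C * (3 + D\<^sup>2) * (H1_norm (interior K) \<phi>)\<^sup>2"
      using C(1) by (intro enn2real_ennreal mult_nonneg_nonneg add_nonneg_nonneg) auto
    finally show "(LINT x:F|surface_measure. (\<phi> x)\<^sup>2) \<le> C * (3 + D\<^sup>2) * (H1_norm (interior K) \<phi>)\<^sup>2" .
  qed
qed

section \<open>Traces\<close>

text \<open>Completeness of L2 in the manner of Riesz and Fischer: geometrically small increments
  are absolutely summable almost everywhere, and Fatou's lemma carries the tail bounds to the
  limit.\<close>

lemma L2_limit_of_fast_Cauchy:
  fixes \<phi> :: "nat \<Rightarrow> 'a \<Rightarrow> real"
  assumes m[measurable]: "\<And>n. \<phi> n \<in> borel_measurable M" and F[measurable]: "F \<in> sets M" and fin: "emeasure M F < \<infinity>"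
    and i: "\<And>n. set_integrable M F (\<lambda>x. (\<phi> n x)\<^sup>2)"
    and fast: "\<And>n. sqrt (LINT x:F|M. (\<phi> (Suc n) x - \<phi> n x)\<^sup>2) \<le> (1/2) ^ n"
  obtains g where "g \<in> borel_measurable M" "set_integrable M F (\<lambda>x. (g x)\<^sup>2)"
    "\<And>n. set_integrable M F (\<lambda>x. (\<phi> n x - g x)\<^sup>2)" "(\<lambda>n. LINT x:F|M. (\<phi> n x - g x)\<^sup>2) \<longlonglongrightarrow> 0"
proof -
  have sm: "set_borel_measurable M F f" if "f \<in> borel_measurable M" for f :: "'a \<Rightarrow> real"
    using that unfolding set_borel_measurable_def by measurable
  have id: "set_integrable M F (\<lambda>x. (\<phi> k x - \<phi> n x)\<^sup>2)" for k n
    by (intro set_integrable_square_diff sm m i)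
  have i1: "set_integrable M F (\<lambda>x. 1\<^sup>2 :: real)"
    using fin by (simp add: set_integrable_def less_top)
  \<comment> \<open>The root of the measure of \<open>F\<close>, the constant in the passage from L2
    to L1 by Cauchy-Schwarz.\<close>
  define c where "c = sqrt (LINT x:F|M. 1\<^sup>2)"
  have c: "c \<ge> 0" by (simp add: c_def set_lebesgue_integral_def)
  define d where "d n x = \<bar>\<phi> (Suc n) x - \<phi> n x\<bar>" for n x
  have [measurable]: "d n \<in> borel_measurable M" for n unfolding d_def by measurable
  have id1: "set_integrable M F (d n)" for n
  proof -
    have "set_integrable M F (\<lambda>x. 1\<^sup>2 + (d n x)\<^sup>2)"
      unfolding d_def power2_abs by (intro set_integral_add(1) i1 id)
    then show ?thesis unfolding set_integrable_def
    proof (rule Bochner_Integration.integrable_bound)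
      have "\<bar>t\<bar> \<le> 1 + t\<^sup>2" for t :: real
        using zero_le_power2[of "\<bar>t\<bar> - 1"] by (simp add: power2_diff)
      then show "AE x in M. norm (indicator F x *\<^sub>R d n x) \<le> norm (indicator F x *\<^sub>R (1\<^sup>2 + (d n x)\<^sup>2))"
        by (intro AE_I2) (auto simp: indicator_def d_def)
    qed measurable
  qed
  have ld: "(LINT x:F|M. d n x) \<le> c * (1/2) ^ n" for n
  proof -
    have "\<bar>LINT x:F|M. d n x\<bar> \<le> sqrt (LINT x:F|M. 1\<^sup>2) * sqrt (LINT x:F|M. (d n x)\<^sup>2)"
      by (rule set_integral_Cauchy_Schwarz[OF i1]) (use id in \<open>auto simp: d_def\<close>)
    also have "\<dots> \<le> c * (1/2) ^ n"
      unfolding c_def[symmetric] using fast[of n] c by (intro mult_left_mono) (auto simp: d_def)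
    finally show ?thesis by linarith
  qed
  have "(\<integral>\<^sup>+x. (\<Sum>n. ennreal (indicator F x * d n x)) \<partial>M) = (\<Sum>n. \<integral>\<^sup>+x. ennreal (indicator F x * d n x) \<partial>M)"
    by (rule nn_integral_suminf) measurable
  also have "\<dots> \<le> (\<Sum>n. ennreal (c * (1/2) ^ n))"
  proof (intro suminf_le)
    fix n
    have "(\<integral>\<^sup>+x. ennreal (indicator F x * d n x) \<partial>M) = ennreal (LINT x:F|M. d n x)"
      using id1[of n] unfolding set_lebesgue_integral_def set_integrable_def real_scaleR_def
      by (intro nn_integral_eq_integral) (auto simp: d_def)
    also have "\<dots> \<le> ennreal (c * (1/2) ^ n)" by (intro ennreal_leI ld)
    finally show "(\<integral>\<^sup>+x. ennreal (indicator F x * d n x) \<partial>M) \<le> ennreal (c * (1/2) ^ n)" .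
  qed auto
  also have "\<dots> = ennreal (\<Sum>n. c * (1/2) ^ n)"
    using c by (intro suminf_ennreal2) (auto intro!: summable_mult summable_geometric)
  also have "\<dots> < \<infinity>" by simp
  finally have "AE x in M. (\<Sum>n. ennreal (indicator F x * d n x)) \<noteq> \<infinity>"
    by (intro nn_integral_PInf_AE) auto
  then have conv: "AE x in M. x \<in> F \<longrightarrow> convergent (\<lambda>n. \<phi> n x)"
  proof eventually_elim
    case (elim x)
    show ?case
    proof
      assume x: "x \<in> F"
      then have "(\<Sum>n. ennreal (d n x)) \<noteq> \<infinity>" using elim by simp
      then have "summable (\<lambda>n. d n x)" by (intro summable_suminf_not_top) (auto simp: d_def)
      then have "summable (\<lambda>n. norm (\<phi> (Suc n) x - \<phi> n x))" by (simp add: d_def)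
      then have "summable (\<lambda>n. \<phi> (Suc n) x - \<phi> n x)" by (rule summable_norm_cancel)
      then have "convergent (\<lambda>n. \<Sum>k<n. \<phi> (Suc k) x - \<phi> k x)" by (simp add: summable_iff_convergent)
      then have "convergent (\<lambda>n. \<phi> n x - \<phi> 0 x)" by (simp only: sum_lessThan_telescope[of "\<lambda>n. \<phi> n x"])
      then have "convergent (\<lambda>n. (\<phi> n x - \<phi> 0 x) + \<phi> 0 x)" by (intro convergent_add convergent_const)
      then show "convergent (\<lambda>n. \<phi> n x)" by simp
    qed
  qed
  define g where "g x = lim (\<lambda>n. \<phi> n x)" for x
  have gm[measurable]: "g \<in> borel_measurable M" unfolding g_def by measurable
  \<comment> \<open>The geometric tail is stated with its exact partial sum so that the induction on
    \<open>k\<close> closes.\<close>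
  have tail: "sqrt (LINT x:F|M. (\<phi> (n + k) x - \<phi> n x)\<^sup>2) \<le> 2 * (1/2) ^ n - 2 * (1/2) ^ (n + k)" for n k
  proof (induction k)
    case (Suc k)
    have "sqrt (LINT x:F|M. (\<phi> (n + Suc k) x - \<phi> n x)\<^sup>2)
        \<le> sqrt (LINT x:F|M. (\<phi> (n + k) x - \<phi> n x)\<^sup>2) + sqrt (LINT x:F|M. (\<phi> (Suc (n + k)) x - \<phi> (n + k) x)\<^sup>2)"
      by (rule sqrt_set_integral_triangle) (auto intro: id)
    also have "\<dots> \<le> (2 * (1/2) ^ n - 2 * (1/2) ^ (n + k)) + (1/2) ^ (n + k)" by (intro add_mono Suc fast)
    finally show ?case by simp
  qed simp
  have le: "(\<integral>\<^sup>+x. ennreal (indicator F x * (\<phi> n x - g x)\<^sup>2) \<partial>M) \<le> ennreal ((2 * (1/2) ^ n)\<^sup>2)" for n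
  proof -
    have "(\<integral>\<^sup>+x. ennreal (indicator F x * (\<phi> n x - g x)\<^sup>2) \<partial>M)
        = (\<integral>\<^sup>+x. liminf (\<lambda>k. ennreal (indicator F x * (\<phi> (n + k) x - \<phi> n x)\<^sup>2)) \<partial>M)"
    proof (rule nn_integral_cong_AE)
      show "AE x in M. ennreal (indicator F x * (\<phi> n x - g x)\<^sup>2) = liminf (\<lambda>k. ennreal (indicator F x * (\<phi> (n + k) x - \<phi> n x)\<^sup>2))"
        using conv
      proof eventually_elim
        case (elim x)
        have "(\<lambda>k. ennreal (indicator F x * (\<phi> (n + k) x - \<phi> n x)\<^sup>2)) \<longlonglongrightarrow> ennreal (indicator F x * (g x - \<phi> n x)\<^sup>2)"
        proof (cases "x \<in> F")
          case True
          then have "(\<lambda>k. \<phi> k x) \<longlonglongrightarrow> g x" using elim by (simp add: g_def convergent_LIMSEQ_iff)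
          then have "(\<lambda>k. \<phi> (n + k) x) \<longlonglongrightarrow> g x" using LIMSEQ_ignore_initial_segment[of "\<lambda>k. \<phi> k x" "g x" n] by (simp add: add.commute)
          then show ?thesis by (intro tendsto_ennrealI tendsto_intros)
        qed simp
        then have "liminf (\<lambda>k. ennreal (indicator F x * (\<phi> (n + k) x - \<phi> n x)\<^sup>2)) = ennreal (indicator F x * (g x - \<phi> n x)\<^sup>2)"
          by (intro lim_imp_Liminf) auto
        then show ?case by (simp add: power2_commute)
      qed
    qed
    also have "\<dots> \<le> liminf (\<lambda>k. \<integral>\<^sup>+x. ennreal (indicator F x * (\<phi> (n + k) x - \<phi> n x)\<^sup>2) \<partial>M)"
      by (rule nn_integral_liminf) measurable
    also have "\<dots> \<le> liminf (\<lambda>k. ennreal ((2 * (1/2) ^ n)\<^sup>2))"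
    proof (rule Liminf_mono, rule always_eventually, rule allI)
      fix k
      have nn: "0 \<le> (LINT x:F|M. (\<phi> (n + k) x - \<phi> n x)\<^sup>2)" by (auto simp: set_lebesgue_integral_def intro!: Bochner_Integration.integral_nonneg_AE)
      have "sqrt (LINT x:F|M. (\<phi> (n + k) x - \<phi> n x)\<^sup>2) \<le> 2 * (1/2) ^ n" using tail[of n k] zero_le_power[of "1/2::real" "n + k"] by linarith
      then have l: "(LINT x:F|M. (\<phi> (n + k) x - \<phi> n x)\<^sup>2) \<le> (2 * (1/2) ^ n)\<^sup>2" using nn by (metis real_sqrt_ge_zero real_sqrt_pow2 power_mono)
      have "(\<integral>\<^sup>+x. ennreal (indicator F x * (\<phi> (n + k) x - \<phi> n x)\<^sup>2) \<partial>M) = ennreal (LINT x:F|M. (\<phi> (n + k) x - \<phi> n x)\<^sup>2)"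
        using id[of "n + k" n] unfolding set_lebesgue_integral_def set_integrable_def real_scaleR_def
        by (intro nn_integral_eq_integral) auto
      then show "(\<integral>\<^sup>+x. ennreal (indicator F x * (\<phi> (n + k) x - \<phi> n x)\<^sup>2) \<partial>M) \<le> ennreal ((2 * (1/2) ^ n)\<^sup>2)"
        using ennreal_leI[OF l] by simp
    qed
    also have "\<dots> = ennreal ((2 * (1/2) ^ n)\<^sup>2)" by (rule Liminf_const) simp
    finally show ?thesis .
  qed
  have ig: "set_integrable M F (\<lambda>x. (\<phi> n x - g x)\<^sup>2)" for n
    unfolding set_integrable_def real_scaleR_def
    by (rule integrableI_nonneg) (use le[of n] in \<open>auto simp: order_le_less_trans\<close>)
  have "set_integrable M F (\<lambda>x. (\<phi> 0 x - (\<phi> 0 x - g x))\<^sup>2)"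
    by (intro set_integrable_square_diff sm i ig) measurable
  then have ig2: "set_integrable M F (\<lambda>x. (g x)\<^sup>2)" by simp
  have "(\<lambda>n. LINT x:F|M. (\<phi> n x - g x)\<^sup>2) \<longlonglongrightarrow> 0"
  proof (rule Lim_null_comparison)
    show "\<forall>\<^sub>F n in sequentially. norm (LINT x:F|M. (\<phi> n x - g x)\<^sup>2) \<le> (2 * (1/2) ^ n)\<^sup>2"
    proof (rule always_eventually, rule allI)
      fix n
      have nn: "0 \<le> (LINT x:F|M. (\<phi> n x - g x)\<^sup>2)" by (auto simp: set_lebesgue_integral_def intro!: Bochner_Integration.integral_nonneg_AE)
      have "(\<integral>\<^sup>+x. ennreal (indicator F x * (\<phi> n x - g x)\<^sup>2) \<partial>M) = ennreal (LINT x:F|M. (\<phi> n x - g x)\<^sup>2)"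
        using ig[of n] unfolding set_lebesgue_integral_def set_integrable_def real_scaleR_def
        by (intro nn_integral_eq_integral) auto
      then show "norm (LINT x:F|M. (\<phi> n x - g x)\<^sup>2) \<le> (2 * (1/2) ^ n)\<^sup>2" using le[of n] nn by simp
    qed
    have "(\<lambda>n. (2 * (1/2::real) ^ n)\<^sup>2) \<longlonglongrightarrow> (2 * 0)\<^sup>2"
      by (intro tendsto_intros LIMSEQ_realpow_zero) auto
    then show "(\<lambda>n. (2 * (1/2::real) ^ n)\<^sup>2) \<longlonglongrightarrow> 0" by simp
  qed
  then show ?thesis by (rule that[OF gm ig2 ig])
qed

text \<open>Collects what the theory of traces uses of a face of an element: finite surface measure
  and continuity of restriction in the H1 norm on smooth functions. The cone estimate establishes it
  for mesh faces.\<close>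

definition trace_face :: "(real^'d::finite) set \<Rightarrow> (real^'d) set \<Rightarrow> bool" where
  "trace_face K F \<longleftrightarrow> bounded K \<and> compact F \<and> emeasure surface_measure F < \<infinity> \<and>
    (\<exists>C\<ge>0. \<forall>\<phi>. smooth \<phi> \<longrightarrow> (LINT x:F|surface_measure. (\<phi> x)\<^sup>2) \<le> C * (H1_norm (interior K) \<phi>)\<^sup>2)"

lemma trace_faceD:
  assumes "trace_face K F"
  shows "bounded K" "compact F" "emeasure surface_measure F < \<infinity>" "F \<in> sets surface_measure"
    "\<exists>C\<ge>0. \<forall>\<phi>. smooth \<phi> \<longrightarrow> sqrt (LINT x:F|surface_measure. (\<phi> x)\<^sup>2) \<le> C * H1_norm (interior K) \<phi>"
proof -
  show "bounded K" "compact F" "emeasure surface_measure F < \<infinity>" using assms by (auto simp: trace_face_def)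
  then show "F \<in> sets surface_measure" by (simp add: borel_compact)
  obtain C where C: "C \<ge> 0" "\<And>\<phi>. smooth \<phi> \<Longrightarrow> (LINT x:F|surface_measure. (\<phi> x)\<^sup>2) \<le> C * (H1_norm (interior K) \<phi>)\<^sup>2"
    using assms by (auto simp: trace_face_def)
  have "sqrt (LINT x:F|surface_measure. (\<phi> x)\<^sup>2) \<le> sqrt C * H1_norm (interior K) \<phi>" if "smooth \<phi>" for \<phi>
    using real_sqrt_le_mono[OF C(2)[OF that]] by (simp add: real_sqrt_mult H1_norm_nonneg)
  then show "\<exists>C\<ge>0. \<forall>\<phi>. smooth \<phi> \<longrightarrow> sqrt (LINT x:F|surface_measure. (\<phi> x)\<^sup>2) \<le> C * H1_norm (interior K) \<phi>"
    using C(1) by (intro exI[of _ "sqrt C"]) auto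
qed

lemma borel_measurable_surface:
  fixes f :: "real^'d::finite \<Rightarrow> 'b::topological_space"
  shows "f \<in> borel_measurable borel \<longleftrightarrow> f \<in> borel_measurable surface_measure"
proof -
  have "borel_measurable (borel :: (real^'d) measure) = (borel_measurable surface_measure :: (real^'d \<Rightarrow> 'b) set)"
    by (rule measurable_cong_sets) (rule sets_hausdorff_measure[symmetric], rule refl)
  then show ?thesis by simp
qed

lemma set_borel_measurable_surface:
  fixes f :: "_ \<Rightarrow> real"
  assumes "F \<in> sets surface_measure" "f \<in> borel_measurable borel"
  shows "set_borel_measurable surface_measure F f"
  using assms unfolding set_borel_measurable_def borel_measurable_surface by measurable

lemma smooth_square_integrable_face:
  assumes F: "trace_face K F" and sm: "smooth \<phi>"
  shows "set_integrable surface_measure F (\<lambda>x. (\<phi> x)\<^sup>2)"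
proof -
  note t = trace_faceD[OF F]
  have "compact ((\<lambda>x. (\<phi> x)\<^sup>2) ` F)"
    by (intro compact_continuous_image continuous_intros smooth_continuous sm t(2))
  then obtain M where M: "\<And>x. x \<in> F \<Longrightarrow> (\<phi> x)\<^sup>2 \<le> M" using compact_imp_bounded[of "(\<lambda>x. (\<phi> x)\<^sup>2) ` F"] by (auto simp: bounded_iff)
  have [measurable]: "\<phi> \<in> borel_measurable surface_measure" "F \<in> sets surface_measure"
    using smooth_measurable[OF sm] t(4) by (auto simp: borel_measurable_surface)
  have "integrable surface_measure (\<lambda>x. M * indicator F x)" using t(3,4) by (intro integrable_mult_right integrable_real_indicator) auto
  then show ?thesis unfolding set_integrable_def
  proof (rule Bochner_Integration.integrable_bound)
    show "AE x in surface_measure. norm (indicator F x *\<^sub>R (\<phi> x)\<^sup>2) \<le> norm (M * indicator F x)"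
      by (intro AE_I2) (auto simp: indicator_def intro: order_trans[OF M])
  qed measurable
qed

lemma face_square_integral_nonneg: "0 \<le> (LINT x:F|M. (f x)\<^sup>2 :: real)"
  by (auto simp: set_lebesgue_integral_def intro!: Bochner_Integration.integral_nonneg_AE)

text \<open>Two approximating sequences have the same limit in H1, so their difference tends to 0
  there; the trace inequality for smooth functions forces the same on the face.\<close>

lemma has_trace_unique:
  assumes F: "trace_face K F" and g: "has_trace K F w g" and g': "has_trace K F w g'"
  shows "AE x in surface_measure. x \<in> F \<longrightarrow> g x = g' x"
proof -
  let ?N = "\<lambda>f. sqrt (LINT x:F|surface_measure. (f x)\<^sup>2)" and ?S = "interior K"
  obtain \<phi> where \<phi>: "\<And>n. smooth (\<phi> n)" "\<And>n. (\<lambda>x. \<phi> n x - w x) \<in> H1_space ?S" "(\<lambda>n. H1_norm ?S (\<lambda>x. \<phi> n x - w x)) \<longlonglongrightarrow> 0"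
    "\<And>n. set_integrable surface_measure F (\<lambda>x. (\<phi> n x - g x)\<^sup>2)" "(\<lambda>n. LINT x:F|surface_measure. (\<phi> n x - g x)\<^sup>2) \<longlonglongrightarrow> 0"
    and gb: "g \<in> borel_measurable borel" "set_integrable surface_measure F (\<lambda>x. (g x)\<^sup>2)"
    using g unfolding has_trace_def by blast
  obtain \<psi> where \<psi>: "\<And>n. smooth (\<psi> n)" "\<And>n. (\<lambda>x. \<psi> n x - w x) \<in> H1_space ?S" "(\<lambda>n. H1_norm ?S (\<lambda>x. \<psi> n x - w x)) \<longlonglongrightarrow> 0"
    "\<And>n. set_integrable surface_measure F (\<lambda>x. (\<psi> n x - g' x)\<^sup>2)" "(\<lambda>n. LINT x:F|surface_measure. (\<psi> n x - g' x)\<^sup>2) \<longlonglongrightarrow> 0"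
    and gb': "g' \<in> borel_measurable borel" "set_integrable surface_measure F (\<lambda>x. (g' x)\<^sup>2)"
    using g' unfolding has_trace_def by blast
  obtain C where C: "C \<ge> 0" "\<And>\<phi>. smooth \<phi> \<Longrightarrow> ?N \<phi> \<le> C * H1_norm ?S \<phi>" using trace_faceD(5)[OF F] by blast
  have le: "?N (\<lambda>x. g x - g' x) \<le> ?N (\<lambda>x. \<phi> n x - g x) + (C * (H1_norm ?S (\<lambda>x. \<phi> n x - w x) + H1_norm ?S (\<lambda>x. \<psi> n x - w x)) + ?N (\<lambda>x. \<psi> n x - g' x))" for n
  proof -
    have m: "set_borel_measurable surface_measure F (\<lambda>x. \<phi> n x - \<psi> n x)" "set_borel_measurable surface_measure F (\<lambda>x. \<psi> n x - g' x)"
      by (intro set_borel_measurable_surface trace_faceD(4)[OF F] borel_measurable_diff smooth_measurable \<phi> \<psi> gb')+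
    have i1: "set_integrable surface_measure F (\<lambda>x. (\<phi> n x - \<psi> n x)\<^sup>2)"
      by (intro smooth_square_integrable_face[OF F] smooth_diff \<phi> \<psi>)
    \<comment> \<open>The double sign writes a sum as a difference, the form in which integrability
      of squares was proved.\<close>
    have i2: "set_integrable surface_measure F (\<lambda>x. ((\<phi> n x - \<psi> n x) - - 1 * (\<psi> n x - g' x))\<^sup>2)"
    proof -
      have "set_borel_measurable surface_measure F (\<lambda>x. - 1 * (\<psi> n x - g' x))"
        by (intro set_borel_measurable_surface trace_faceD(4)[OF F] borel_measurable_times borel_measurable_const borel_measurable_diff smooth_measurable \<psi> gb')
      moreover have "set_integrable surface_measure F (\<lambda>x. (- 1 * (\<psi> n x - g' x))\<^sup>2)"
        using \<psi>(4)[of n] by (simp add: power2_commute)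
      ultimately show ?thesis by (intro set_integrable_square_diff m(1) i1)
    qed
    have "?N (\<lambda>x. g x - g' x) \<le> ?N (\<lambda>x. \<phi> n x - g x) + ?N (\<lambda>x. (\<phi> n x - \<psi> n x) - - 1 * (\<psi> n x - g' x))"
      by (rule sqrt_set_integral_triangle[OF \<phi>(4) i2]) auto
    also have "?N (\<lambda>x. (\<phi> n x - \<psi> n x) - - 1 * (\<psi> n x - g' x)) \<le> ?N (\<lambda>x. \<phi> n x - \<psi> n x) + ?N (\<lambda>x. \<psi> n x - g' x)"
      by (rule sqrt_set_integral_triangle[OF i1 \<psi>(4)]) auto
    also have "?N (\<lambda>x. \<phi> n x - \<psi> n x) \<le> C * H1_norm ?S (\<lambda>x. \<phi> n x - \<psi> n x)"
      by (rule C(2)[OF smooth_diff[OF \<phi>(1) \<psi>(1)]])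
    also have "H1_norm ?S (\<lambda>x. \<phi> n x - \<psi> n x) \<le> H1_norm ?S (\<lambda>x. \<phi> n x - w x) + H1_norm ?S (\<lambda>x. \<psi> n x - w x)"
      using H1_norm_diff_le[OF open_interior \<phi>(2)[of n] \<psi>(2)[of n]] by simp
    finally show ?thesis using C(1) by (simp add: mult_left_mono)
  qed
  have "(\<lambda>n. ?N (\<lambda>x. \<phi> n x - g x) + (C * (H1_norm ?S (\<lambda>x. \<phi> n x - w x) + H1_norm ?S (\<lambda>x. \<psi> n x - w x)) + ?N (\<lambda>x. \<psi> n x - g' x)))
      \<longlonglongrightarrow> sqrt 0 + (C * (0 + 0) + sqrt 0)"
    by (intro tendsto_intros \<phi> \<psi>)
  then have "?N (\<lambda>x. g x - g' x) \<le> sqrt 0 + (C * (0 + 0) + sqrt 0)"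
    by (rule tendsto_lowerbound) (use le in auto)
  then have "(LINT x:F|surface_measure. (g x - g' x)\<^sup>2) = 0"
    using face_square_integral_nonneg[where F=F and M=surface_measure and f="\<lambda>x. g x - g' x"] by simp
  moreover have "set_integrable surface_measure F (\<lambda>x. (g x - g' x)\<^sup>2)"
    by (intro set_integrable_square_diff set_borel_measurable_surface trace_faceD(4)[OF F] gb gb')
  ultimately have "AE x in surface_measure. indicator F x *\<^sub>R (g x - g' x)\<^sup>2 = 0"
    unfolding set_lebesgue_integral_def set_integrable_def by (subst (asm) integral_nonneg_eq_0_iff_AE) auto
  then show ?thesis by eventually_elim auto
qed

lemma has_trace_diff:
  assumes F: "trace_face K F" and g: "has_trace K F v g" and g': "has_trace K F w g'"
  shows "has_trace K F (\<lambda>x. v x - w x) (\<lambda>x. g x - g' x)"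
proof -
  let ?N = "\<lambda>f. sqrt (LINT x:F|surface_measure. (f x)\<^sup>2)" and ?S = "interior K"
  obtain \<phi> where \<phi>: "\<And>n. smooth (\<phi> n)" "\<And>n. (\<lambda>x. \<phi> n x - v x) \<in> H1_space ?S" "(\<lambda>n. H1_norm ?S (\<lambda>x. \<phi> n x - v x)) \<longlonglongrightarrow> 0"
    "\<And>n. set_integrable surface_measure F (\<lambda>x. (\<phi> n x - g x)\<^sup>2)" "(\<lambda>n. LINT x:F|surface_measure. (\<phi> n x - g x)\<^sup>2) \<longlonglongrightarrow> 0"
    and gb: "g \<in> borel_measurable borel" "set_integrable surface_measure F (\<lambda>x. (g x)\<^sup>2)" "v \<in> H1_space ?S"
    using g unfolding has_trace_def by blast
  obtain \<psi> where \<psi>: "\<And>n. smooth (\<psi> n)" "\<And>n. (\<lambda>x. \<psi> n x - w x) \<in> H1_space ?S" "(\<lambda>n. H1_norm ?S (\<lambda>x. \<psi> n x - w x)) \<longlonglongrightarrow> 0"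
    "\<And>n. set_integrable surface_measure F (\<lambda>x. (\<psi> n x - g' x)\<^sup>2)" "(\<lambda>n. LINT x:F|surface_measure. (\<psi> n x - g' x)\<^sup>2) \<longlonglongrightarrow> 0"
    and gb': "g' \<in> borel_measurable borel" "set_integrable surface_measure F (\<lambda>x. (g' x)\<^sup>2)" "w \<in> H1_space ?S"
    using g' unfolding has_trace_def by blast
  have eq: "(\<phi> n x - \<psi> n x) - (p x - q x) = (\<phi> n x - p x) - (\<psi> n x - q x)" for n p q x by simp
  have H: "(\<lambda>x. (\<phi> n x - \<psi> n x) - (v x - w x)) \<in> H1_space ?S" for n
    unfolding eq by (intro H1_space_diff \<phi> \<psi>)
  have "(\<lambda>n. H1_norm ?S (\<lambda>x. (\<phi> n x - \<psi> n x) - (v x - w x))) \<longlonglongrightarrow> 0"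
  proof (rule Lim_null_comparison)
    show "\<forall>\<^sub>F n in sequentially. norm (H1_norm ?S (\<lambda>x. (\<phi> n x - \<psi> n x) - (v x - w x))) \<le> H1_norm ?S (\<lambda>x. \<phi> n x - v x) + H1_norm ?S (\<lambda>x. \<psi> n x - w x)"
      using H1_norm_diff_le[OF open_interior \<phi>(2) \<psi>(2)] unfolding eq by (auto simp: H1_norm_nonneg)
    show "(\<lambda>n. H1_norm ?S (\<lambda>x. \<phi> n x - v x) + H1_norm ?S (\<lambda>x. \<psi> n x - w x)) \<longlonglongrightarrow> 0"
      using tendsto_add[OF \<phi>(3) \<psi>(3)] by simp
  qed
  moreover have i: "set_integrable surface_measure F (\<lambda>x. ((\<phi> n x - \<psi> n x) - (g x - g' x))\<^sup>2)" for n
    unfolding eq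
    by (intro set_integrable_square_diff \<phi> \<psi> set_borel_measurable_surface trace_faceD(4)[OF F] borel_measurable_diff
      smooth_measurable gb gb')
  moreover have "(\<lambda>n. LINT x:F|surface_measure. ((\<phi> n x - \<psi> n x) - (g x - g' x))\<^sup>2) \<longlonglongrightarrow> 0"
  proof (rule Lim_null_comparison)
    show "\<forall>\<^sub>F n in sequentially. norm (LINT x:F|surface_measure. ((\<phi> n x - \<psi> n x) - (g x - g' x))\<^sup>2)
        \<le> (?N (\<lambda>x. \<phi> n x - g x) + ?N (\<lambda>x. \<psi> n x - g' x))\<^sup>2"
    proof (rule always_eventually, rule allI)
      fix n
      have "?N (\<lambda>x. (\<phi> n x - \<psi> n x) - (g x - g' x)) \<le> ?N (\<lambda>x. \<phi> n x - g x) + ?N (\<lambda>x. \<psi> n x - g' x)"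
        by (rule sqrt_set_integral_triangle[OF \<phi>(4) \<psi>(4)]) auto
      from power_mono[OF this, of 2]
      show "norm (LINT x:F|surface_measure. ((\<phi> n x - \<psi> n x) - (g x - g' x))\<^sup>2)
          \<le> (?N (\<lambda>x. \<phi> n x - g x) + ?N (\<lambda>x. \<psi> n x - g' x))\<^sup>2"
        by (simp add: face_square_integral_nonneg)
    qed
    have "(\<lambda>n. (?N (\<lambda>x. \<phi> n x - g x) + ?N (\<lambda>x. \<psi> n x - g' x))\<^sup>2) \<longlonglongrightarrow> (sqrt 0 + sqrt 0)\<^sup>2"
      by (intro tendsto_intros \<phi> \<psi>)
    then show "(\<lambda>n. (?N (\<lambda>x. \<phi> n x - g x) + ?N (\<lambda>x. \<psi> n x - g' x))\<^sup>2) \<longlonglongrightarrow> 0" by simp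
  qed
  moreover have "set_integrable surface_measure F (\<lambda>x. (g x - g' x)\<^sup>2)"
    by (intro set_integrable_square_diff set_borel_measurable_surface trace_faceD(4)[OF F] gb gb')
  ultimately show ?thesis
    unfolding has_trace_def using H1_space_diff[OF gb(3) gb'(3)] gb(1) gb'(1) H \<phi>(1) \<psi>(1)
    by (intro conjI exI[of _ "\<lambda>n x. \<phi> n x - \<psi> n x"] borel_measurable_diff) (auto intro: smooth_diff)
qed

lemma has_trace_cong_AE:
  assumes g: "has_trace K F v g" and ae: "AE x in lebesgue. x \<in> interior K \<longrightarrow> v x = w x"
  shows "has_trace K F w g"
proof -
  let ?S = "interior K"
  obtain \<phi> where \<phi>: "\<And>n. smooth (\<phi> n)" "\<And>n. (\<lambda>x. \<phi> n x - v x) \<in> H1_space ?S" "(\<lambda>n. H1_norm ?S (\<lambda>x. \<phi> n x - v x)) \<longlonglongrightarrow> 0"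
    "\<And>n. set_integrable surface_measure F (\<lambda>x. (\<phi> n x - g x)\<^sup>2)" "(\<lambda>n. LINT x:F|surface_measure. (\<phi> n x - g x)\<^sup>2) \<longlonglongrightarrow> 0"
    and gb: "g \<in> borel_measurable borel" "set_integrable surface_measure F (\<lambda>x. (g x)\<^sup>2)" "v \<in> H1_space ?S"
    using g unfolding has_trace_def by blast
  have ae': "AE x in lebesgue. x \<in> ?S \<longrightarrow> \<phi> n x - v x = \<phi> n x - w x" for n using ae by eventually_elim auto
  have "(\<lambda>x. \<phi> n x - w x) \<in> H1_space ?S" for n by (rule H1_space_cong_AE[OF \<phi>(2) ae'])
  moreover have "(\<lambda>n. H1_norm ?S (\<lambda>x. \<phi> n x - w x)) \<longlonglongrightarrow> 0"
    using \<phi>(3) H1_norm_cong_AE[OF open_interior \<phi>(2) ae'] by simp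
  ultimately show ?thesis
    unfolding has_trace_def using gb H1_space_cong_AE[OF gb(3) ae] \<phi> by blast
qed

text \<open>The weak derivative of 0 is a representative picked by \<open>SOME\<close>, which
  vanishes almost everywhere only, so the norm cannot simply be evaluated.\<close>

lemma H1_norm_zero: "open S \<Longrightarrow> bounded S \<Longrightarrow> H1_norm S (\<lambda>x. 0) = 0"
proof -
  assume S: "open S" "bounded S"
  have z: "(\<lambda>x. 0) \<in> H1_space S" by (rule smooth_H1_space[OF smooth_const S(2,1)])
  have "L2_norm S (weak_pderiv S i (\<lambda>x. 0)) = L2_norm S (\<lambda>x. 0)" for i
    using smooth_weak_pderiv[OF S(1) smooth_const[of 0], of i]
    by (intro L2_norm_cong_AE H1_space_weak_pderiv[OF S(1) z]) simp
  then have "(H1_norm S (\<lambda>x. 0))\<^sup>2 = 0"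
    unfolding H1_norm_square[OF S(1) z] by (simp add: L2_norm_def)
  then show ?thesis by simp
qed

lemma smooth_has_trace:
  assumes F: "trace_face K F" and sm: "smooth \<phi>"
  shows "has_trace K F \<phi> \<phi>"
proof -
  have S: "open (interior K)" "bounded (interior K)" using trace_faceD(1)[OF F] by auto
  have "(\<lambda>x. \<phi> x - \<phi> x) \<in> H1_space (interior K)" using smooth_H1_space[OF smooth_const[of 0] S(2,1)] by simp
  then show ?thesis
    unfolding has_trace_def
    using smooth_H1_space[OF sm S(2,1)] smooth_measurable[OF sm] smooth_square_integrable_face[OF F sm] sm H1_norm_zero[OF S]
    by (intro conjI exI[of _ "\<lambda>n. \<phi>"]) (auto simp: set_integrable_def set_lebesgue_integral_def)
qed

text \<open>The trace inequality makes the restrictions to the face a Cauchy sequence in L2; a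
  subsequence with geometric increments is extracted so that the completeness lemma applies.\<close>

lemma face_limit_exists:
  assumes F: "trace_face K F" and sm: "\<And>n. smooth (\<phi> n)" and w: "w \<in> H1_space (interior K)"
    and lim: "(\<lambda>n. H1_norm (interior K) (\<lambda>x. \<phi> n x - w x)) \<longlonglongrightarrow> 0"
  obtains r g where "strict_mono (r :: nat \<Rightarrow> nat)" "g \<in> borel_measurable borel" "set_integrable surface_measure F (\<lambda>x. (g x)\<^sup>2)"
    "\<And>n. set_integrable surface_measure F (\<lambda>x. (\<phi> (r n) x - g x)\<^sup>2)"
    "(\<lambda>n. LINT x:F|surface_measure. (\<phi> (r n) x - g x)\<^sup>2) \<longlonglongrightarrow> 0"
proof -
  let ?N = "\<lambda>f. sqrt (LINT x:F|surface_measure. (f x)\<^sup>2)" and ?S = "interior K"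
  have S: "open ?S" "bounded ?S" using trace_faceD(1)[OF F] by auto
  obtain C where C: "C \<ge> 0" "\<And>\<phi>. smooth \<phi> \<Longrightarrow> ?N \<phi> \<le> C * H1_norm ?S \<phi>" using trace_faceD(5)[OF F] by blast
  \<comment> \<open>Two successive errors below this bound, multiplied by the constant of the trace
    inequality, add up to at most (1/2)^n; C + 1 replaces \<open>C\<close> to avoid division by
    zero.\<close>
  define e where "e n = (1/2) ^ n / (2 * (C + 1))" for n :: nat
  have e: "e n > 0" for n using C(1) by (simp add: e_def)
  have "\<exists>m. \<forall>k\<ge>m. H1_norm ?S (\<lambda>x. \<phi> k x - w x) < e n" for n
    using order_tendstoD(2)[OF lim e] by (simp add: eventually_sequentially)
  then obtain m where m: "\<And>n k. k \<ge> m n \<Longrightarrow> H1_norm ?S (\<lambda>x. \<phi> k x - w x) < e n" by metis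
  \<comment> \<open>The sum makes \<open>r n\<close> at least \<open>m n\<close> and monotone, and
    the added \<open>n\<close> makes it strictly increasing.\<close>
  define r where "r n = (\<Sum>k\<le>n. m k) + n" for n
  have r: "strict_mono r" unfolding strict_mono_Suc_iff r_def by simp
  have rm: "m n \<le> r n" for n unfolding r_def by (simp add: member_le_sum trans_le_add1)
  have fast: "?N (\<lambda>x. \<phi> (r (Suc n)) x - \<phi> (r n) x) \<le> (1/2) ^ n" for n
  proof -
    have H: "(\<lambda>x. \<phi> k x - w x) \<in> H1_space ?S" for k by (intro H1_space_diff w smooth_H1_space sm S)
    have "?N (\<lambda>x. \<phi> (r (Suc n)) x - \<phi> (r n) x) \<le> C * H1_norm ?S (\<lambda>x. \<phi> (r (Suc n)) x - \<phi> (r n) x)"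
      by (intro C(2) smooth_diff sm)
    also have "\<dots> \<le> C * (e (Suc n) + e n)"
    proof (rule mult_left_mono[OF _ C(1)])
      have "H1_norm ?S (\<lambda>x. \<phi> (r (Suc n)) x - \<phi> (r n) x) \<le> H1_norm ?S (\<lambda>x. \<phi> (r (Suc n)) x - w x) + H1_norm ?S (\<lambda>x. \<phi> (r n) x - w x)"
        using H1_norm_diff_le[OF S(1) H H, of "r (Suc n)" "r n"] by simp
      then show "H1_norm ?S (\<lambda>x. \<phi> (r (Suc n)) x - \<phi> (r n) x) \<le> e (Suc n) + e n"
        using m[OF rm, of "Suc n"] m[OF rm, of n] by linarith
    qed
    also have "\<dots> \<le> (C + 1) * (e n + e n)"
      using C(1) e[of n] e[of "Suc n"] by (intro mult_mono add_mono) (auto simp: e_def field_simps)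
    also have "\<dots> = (1/2) ^ n"
    proof -
      have "2 * (C + 1) \<noteq> 0" using C(1) by simp
      then have "2 * (C + 1) * e n = (1/2) ^ n" unfolding e_def by simp
      then show ?thesis by (simp add: algebra_simps)
    qed
    finally show ?thesis .
  qed
  obtain g where "g \<in> borel_measurable surface_measure" "set_integrable surface_measure F (\<lambda>x. (g x)\<^sup>2)"
    "\<And>n. set_integrable surface_measure F (\<lambda>x. (\<phi> (r n) x - g x)\<^sup>2)"
    "(\<lambda>n. LINT x:F|surface_measure. (\<phi> (r n) x - g x)\<^sup>2) \<longlonglongrightarrow> 0"
    by (rule L2_limit_of_fast_Cauchy[of "\<lambda>n. \<phi> (r n)" surface_measure F])
      (use fast trace_faceD(3,4)[OF F] smooth_measurable[OF sm] smooth_square_integrable_face[OF F sm] in \<open>auto simp: borel_measurable_surface\<close>)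
  then show ?thesis using that[OF r] by (simp add: borel_measurable_surface)
qed

text \<open>The limit \<open>g\<close> on the face is kept separate from the element, so that one
  and the same \<open>g\<close> can serve all elements sharing the face.\<close>

lemma has_traceI:
  assumes F: "trace_face K F" and sm: "\<And>n. smooth (\<phi> n)" and w: "w \<in> H1_space (interior K)"
    and lim: "(\<lambda>n. H1_norm (interior K) (\<lambda>x. \<phi> n x - w x)) \<longlonglongrightarrow> 0" and r: "strict_mono (r :: nat \<Rightarrow> nat)"
    and g: "g \<in> borel_measurable borel" "set_integrable surface_measure F (\<lambda>x. (g x)\<^sup>2)"
      "\<And>n. set_integrable surface_measure F (\<lambda>x. (\<phi> (r n) x - g x)\<^sup>2)"
      "(\<lambda>n. LINT x:F|surface_measure. (\<phi> (r n) x - g x)\<^sup>2) \<longlonglongrightarrow> 0"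
  shows "has_trace K F w g"
proof -
  have S: "open (interior K)" "bounded (interior K)" using trace_faceD(1)[OF F] by auto
  have "(\<lambda>n. H1_norm (interior K) (\<lambda>x. \<phi> (r n) x - w x)) \<longlonglongrightarrow> 0"
    using LIMSEQ_subseq_LIMSEQ[OF lim r] by (simp add: o_def)
  moreover have "(\<lambda>x. \<phi> (r n) x - w x) \<in> H1_space (interior K)" for n by (intro H1_space_diff w smooth_H1_space sm S)
  ultimately show ?thesis unfolding has_trace_def using w g sm by (intro conjI exI[of _ "\<lambda>n. \<phi> (r n)"]) auto
qed

lemma face_trace_has_trace: "has_trace K F w g \<Longrightarrow> has_trace K F w (face_trace K F w)"
  unfolding face_trace_def by (rule someI[of "has_trace K F w"])

lemma face_trace_AE_eq:
  "trace_face K F \<Longrightarrow> has_trace K F w g \<Longrightarrow> AE x in surface_measure. x \<in> F \<longrightarrow> face_trace K F w x = g x"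
  using has_trace_unique face_trace_has_trace by blast

lemma face_trace_measurable:
  assumes "has_trace K F w g"
  shows "face_trace K F w \<in> borel_measurable borel" "set_integrable surface_measure F (\<lambda>x. (face_trace K F w x)\<^sup>2)"
  using face_trace_has_trace[OF assms] by (auto simp: has_trace_def)

section \<open>Faces of a simplicial mesh\<close>

definition normal_to :: "(real^'d::finite) set \<Rightarrow> real^'d \<Rightarrow> bool" where
  "normal_to F n \<longleftrightarrow> n \<noteq> 0 \<and> (\<forall>x\<in>F. \<forall>y\<in>F. n \<bullet> (x - y) = 0)"

lemma normal_to_uminus: "normal_to F (- n) \<longleftrightarrow> normal_to F n"
  by (simp add: normal_to_def)

lemma normal_toD:
  assumes "normal_to F n" "x \<in> F" "y \<in> F"
  shows "n \<bullet> x = n \<bullet> y"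
proof -
  have "n \<bullet> (x - y) = 0" using assms unfolding normal_to_def by blast
  then show ?thesis by (simp add: inner_diff_right)
qed

lemma simplicial_meshD:
  assumes "simplicial_mesh \<Omega> \<T>"
  shows "finite \<T>" "\<And>K. K \<in> \<T> \<Longrightarrow> compact K" "\<And>K. K \<in> \<T> \<Longrightarrow> convex K" "\<And>K. K \<in> \<T> \<Longrightarrow> aff_dim K = int CARD('d)"
    "\<And>K K'. K \<in> \<T> \<Longrightarrow> K' \<in> \<T> \<Longrightarrow> K \<inter> K' face_of K" "\<Union>\<T> = closure (\<Omega> :: (real^'d::finite) set)"
proof -
  have s: "int CARD('d) simplex K" if "K \<in> \<T>" for K
    using assms that by (simp add: simplicial_mesh_def)
  show "finite \<T>" "\<Union>\<T> = closure \<Omega>" "\<And>K K'. K \<in> \<T> \<Longrightarrow> K' \<in> \<T> \<Longrightarrow> K \<inter> K' face_of K"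
    using assms by (simp_all add: simplicial_mesh_def triangulation_def)
  show "compact K" "convex K" "aff_dim K = int CARD('d)" if "K \<in> \<T>" for K
    using s[OF that] compact_simplex convex_simplex aff_dim_simplex by blast+
qed

text \<open>The affine hull of a facet lies in the hyperplane and has the same dimension d -
  1.\<close>

lemma facet_affine_hull:
  fixes F :: "(real^'d::finite) set"
  assumes F: "F facet_of K" and K: "aff_dim K = int CARD('d)" and n: "normal_to F n" and y: "y \<in> F"
  shows "affine hull F = {x. n \<bullet> x = n \<bullet> y}"
proof (rule affine_dim_equal)
  have "F \<subseteq> {x. n \<bullet> x = n \<bullet> y}" using normal_toD[OF n _ y] by blast
  then show "affine hull F \<subseteq> {x. n \<bullet> x = n \<bullet> y}" by (intro hull_minimal affine_hyperplane)
  have "n \<noteq> 0" using n by (simp add: normal_to_def)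
  then show "aff_dim (affine hull F) = aff_dim {x. n \<bullet> x = n \<bullet> y}"
    using F K by (simp add: facet_of_def)
  show "affine hull F \<noteq> {}" using y by auto
qed (auto simp: affine_hyperplane)

lemma facet_Int_hyperplane:
  fixes F :: "(real^'d::finite) set"
  assumes F: "F facet_of K" and K: "convex K" "aff_dim K = int CARD('d)" and n: "normal_to F n" and y: "y \<in> F"
    and x: "x \<in> K" "n \<bullet> (x - y) = 0"
  shows "x \<in> F"
proof -
  have "F = affine hull F \<inter> K" by (rule face_of_imp_eq_affine_Int[OF K(1) facet_of_imp_face_of[OF F]])
  then show ?thesis using x facet_affine_hull[OF F K(2) n y] by (auto simp: inner_diff_right)
qed

lemma facet_off_hyperplane:
  fixes F :: "(real^'d::finite) set"
  assumes F: "F facet_of K" and K: "aff_dim K = int CARD('d)" and n: "normal_to F n" and y: "y \<in> F"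
  shows "\<exists>z\<in>K. n \<bullet> (z - y) \<noteq> 0"
proof (rule ccontr)
  assume "\<not> ?thesis"
  then have "K \<subseteq> {x. n \<bullet> x = n \<bullet> y}" by (auto simp: inner_diff_right)
  then have "aff_dim K \<le> aff_dim {x. n \<bullet> x = n \<bullet> y}" by (rule aff_dim_subset)
  moreover have "n \<noteq> 0" using n by (simp add: normal_to_def)
  ultimately show False using K by simp
qed

text \<open>If \<open>K\<close> had points strictly on both sides, the segment joining them would
  cross the hyperplane in a point of the facet, and the face property would put both endpoints into
  the facet.\<close>

lemma facet_one_side:
  fixes F :: "(real^'d::finite) set"
  assumes F: "F facet_of K" and K: "convex K" "aff_dim K = int CARD('d)" and n: "normal_to F n"
  shows "outward_to K F n \<or> outward_to K F (- n)"
proof (rule ccontr)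
  assume neg: "\<not> ?thesis"
  obtain y where y: "y \<in> F" using F by (auto simp: facet_of_def)
  have eq: "n \<bullet> (x - y') = n \<bullet> (x - y)" if "y' \<in> F" for x y'
  proof -
    have "n \<bullet> (y - y') = 0" using n y that by (auto simp: normal_to_def)
    then show ?thesis by (simp add: inner_diff_right)
  qed
  obtain a b where a: "a \<in> K" "n \<bullet> (a - y) > 0" and b: "b \<in> K" "n \<bullet> (b - y) < 0"
    using neg eq by (force simp: outward_to_def not_le)
  define \<alpha> \<beta> where "\<alpha> = n \<bullet> (a - y)" and "\<beta> = - (n \<bullet> (b - y))"
  have pos: "\<alpha> > 0" "\<beta> > 0" using a b by (auto simp: \<alpha>_def \<beta>_def)
  \<comment> \<open>The weight at which the segment from \<open>a\<close> to \<open>b\<close>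
    crosses the hyperplane.\<close>
  define u where "u = \<alpha> / (\<alpha> + \<beta>)"
  have u: "0 < u" "u < 1" using pos by (auto simp: u_def)
  define p where "p = (1 - u) *\<^sub>R a + u *\<^sub>R b"
  have "n \<bullet> (p - y) = (1 - u) * \<alpha> - u * \<beta>"
    by (simp add: p_def \<alpha>_def \<beta>_def inner_diff_right inner_add_right algebra_simps)
  also have "\<dots> = 0" using pos by (simp add: u_def field_simps)
  finally have "n \<bullet> (p - y) = 0" .
  moreover have "p \<in> K" unfolding p_def using K(1) a(1) b(1) u by (intro convexD) auto
  ultimately have "p \<in> F" by (intro facet_Int_hyperplane[OF F K n y])
  moreover have "a \<noteq> b" using a b by auto
  then have "p \<in> open_segment a b" unfolding p_def in_segment using u by blast
  ultimately have "a \<in> F" using face_ofD[OF facet_of_imp_face_of[OF F] _ a(1) b(1)] by blast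
  then show False using n y a(2) by (auto simp: normal_to_def)
qed

lemma outward_to_off_hyperplane:
  fixes F :: "(real^'d::finite) set"
  assumes F: "F facet_of K" and K: "aff_dim K = int CARD('d)" and n: "normal_to F n" and o: "outward_to K F n" and y: "y \<in> F"
  shows "\<exists>z\<in>K. n \<bullet> (z - y) < 0"
  using facet_off_hyperplane[OF F K n y] o y by (force simp: outward_to_def)

text \<open>Proper faces drop in dimension, and between a facet of dimension d - 1 and the element
  of dimension d there is no room for a proper face strictly larger than the facet.\<close>

lemma face_of_both_full_dimensional:
  fixes K K' :: "(real^'d::finite) set"
  assumes K: "convex K" "aff_dim K = int CARD('d)" "K \<inter> K' face_of K" and F: "F facet_of K" "F \<subseteq> K \<inter> K'" "F \<noteq> K \<inter> K'"
  shows "K \<inter> K' = K"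
proof (rule ccontr)
  assume "K \<inter> K' \<noteq> K"
  from face_of_aff_dim_lt[OF K(1,3) this] have lt: "aff_dim (K \<inter> K') < int CARD('d)" using K(2) by simp
  have "F face_of K \<inter> K'" using face_of_subset[OF facet_of_imp_face_of[OF F(1)] F(2)] by simp
  from face_of_aff_dim_lt[OF face_of_imp_convex[OF K(3)] this F(3)] F(1) K(2) lt
  show False by (simp add: facet_of_def)
qed

text \<open>Under the hypotheses \<open>K\<close> is a face of \<open>K'\<close> of the same
  dimension, hence not a proper one.\<close>

lemma full_dimensional_faces_eq:
  fixes K K' :: "(real^'d::finite) set"
  assumes K: "K \<inter> K' = K" and K': "convex K'" "aff_dim K = aff_dim K'" "K' \<inter> K face_of K'"
  shows "K = K'"
  using face_of_aff_dim_lt[OF K'(1,3)] K K'(2) by (auto simp: Int_commute)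

text \<open>Starting from a relative interior point \<open>y\<close> of the common facet, a short step towards a point
  of one simplex on this side of the facet stays in the other simplex.\<close>

lemma mesh_facet_same_side_unique:
  fixes \<T> :: "(real^'d::finite) set set"
  assumes mesh: "simplicial_mesh \<Omega> \<T>" and K: "K \<in> \<T>" "F facet_of K" "outward_to K F n"
    and K': "K' \<in> \<T>" "F facet_of K'" "outward_to K' F n" and n: "normal_to F n"
  shows "K = K'"
proof -
  note m = simplicial_meshD[OF mesh]
  note cK = m(3)[OF K(1)] m(4)[OF K(1)] and cK' = m(3)[OF K'(1)] m(4)[OF K'(1)]
  have Fc: "convex F" using face_of_imp_convex facet_of_imp_face_of K(2) by blast
  have Fsub: "F \<subseteq> K \<inter> K'" using facet_of_imp_subset K(2) K'(2) by blast
  obtain y where y: "y \<in> rel_interior F"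
    using rel_interior_eq_empty[OF Fc] K(2) by (auto simp: facet_of_def)
  then have yF: "y \<in> F" using rel_interior_subset by blast
  obtain e where e: "e > 0" "ball y e \<inter> affine hull F \<subseteq> F" using y by (auto simp: mem_rel_interior_ball)
  obtain z where z: "z \<in> K" "n \<bullet> (z - y) < 0" using outward_to_off_hyperplane[OF K(2) cK(2) n K(3) yF] by blast
  obtain z' where z': "z' \<in> K'" "n \<bullet> (z' - y) < 0" using outward_to_off_hyperplane[OF K'(2) cK'(2) n K'(3) yF] by blast
  \<comment> \<open>This ratio balances the normal components of the two directions, so that
    \<open>v\<close> is parallel to the hyperplane.\<close>
  define \<alpha> where "\<alpha> = (n \<bullet> (z' - y)) / (n \<bullet> (z - y))"
  have \<alpha>: "\<alpha> > 0" using z z' by (simp add: \<alpha>_def divide_neg_neg)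
  define v where "v = (z' - y) - \<alpha> *\<^sub>R (z - y)"
  have nv: "n \<bullet> v = 0" using z(2) by (simp add: v_def \<alpha>_def inner_diff_right)
  \<comment> \<open>Small enough for s = t \<alpha> to be at most 1/2 and for the point
    \<open>q\<close> below to stay within distance \<open>e\<close> of \<open>y\<close>.\<close>
  define t where "t = 1 / (1 + 2 * \<alpha> + 2 * norm v / e)"
  have den: "1 + 2 * \<alpha> + 2 * norm v / e \<ge> 1" using \<alpha> e by simp
  have t: "0 < t" "t \<le> 1" using den by (auto simp: t_def)
  have tden: "t + 2 * (t * \<alpha>) + 2 * (t * norm v) / e = 1"
  proof -
    have "t * (1 + 2 * \<alpha> + 2 * norm v / e) = 1" using den by (simp add: t_def)
    then show ?thesis by (simp add: algebra_simps)
  qed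
  have nn: "0 \<le> 2 * (t * norm v) / e" "0 \<le> 2 * (t * \<alpha>)" using t e \<alpha> by auto
  define s where "s = t * \<alpha>"
  have s: "0 \<le> s" "2 * s \<le> 1" using tden nn t by (auto simp: s_def mult.commute)
  have tv: "2 * (t * norm v) / e < 1" using tden nn t by linarith
  define p where "p = (1 - t) *\<^sub>R y + t *\<^sub>R z'"
  \<comment> \<open>Chosen so that \<open>p\<close>, a point of the segment from \<open>y\<close> to
    \<open>z'\<close>, also lies on the segment from \<open>q\<close> to \<open>z\<close>; the first
    shows \<open>p\<close> in \<open>K'\<close>, the second in \<open>K\<close>.\<close>
  define q where "q = y + (t / (1 - s)) *\<^sub>R v"
  have "norm (q - y) = t / (1 - s) * norm v" using t s by (simp add: q_def)
  also have "\<dots> \<le> 2 * t * norm v"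
  proof (rule mult_right_mono)
    have "t / (1 - s) \<le> t / (1/2)" using t s by (intro divide_left_mono) auto
    then show "t / (1 - s) \<le> 2 * t" by simp
  qed simp
  also have "\<dots> < e" using tv e by (simp add: divide_less_eq)
  finally have "q \<in> ball y e" by (simp add: dist_norm norm_minus_commute)
  moreover have "q \<in> affine hull F"
    unfolding facet_affine_hull[OF K(2) cK(2) n yF] using nv by (simp add: q_def inner_add_right)
  ultimately have qF: "q \<in> F" using e(2) by blast
  have "(1 - s) *\<^sub>R q + s *\<^sub>R z = (1 - s) *\<^sub>R y + t *\<^sub>R v + s *\<^sub>R z"
    using s by (simp add: q_def scaleR_add_right)
  also have "\<dots> = p" by (simp add: p_def v_def s_def algebra_simps)
  finally have pq: "p = (1 - s) *\<^sub>R q + s *\<^sub>R z" ..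
  have "p \<in> K" unfolding pq using cK(1) qF Fsub z(1) s by (intro convexD) auto
  moreover have "p \<in> K'" unfolding p_def using cK'(1) yF Fsub z'(1) t by (intro convexD) auto
  moreover have "p \<notin> F"
  proof
    assume "p \<in> F"
    then have "n \<bullet> (p - y) = 0" using n yF by (auto simp: normal_to_def)
    moreover have "p - y = t *\<^sub>R (z' - y)" by (simp add: p_def algebra_simps)
    ultimately show False using t z'(2) by simp
  qed
  ultimately have "F \<noteq> K \<inter> K'" by blast
  from face_of_both_full_dimensional[OF cK m(5)[OF K(1) K'(1)] K(2) Fsub this]
  show ?thesis by (rule full_dimensional_faces_eq) (use cK cK' m(5)[OF K'(1) K(1)] in auto)
qed

text \<open>A facet not contained in the boundary has a relative interior point \<open>y\<close> in
  \<Omega>. A short step along the normal leaves \<open>K\<close> but not \<Omega>; the element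
  reached there contains \<open>y\<close>, hence by conformity the whole facet.\<close>

lemma mesh_facet_other_side:
  fixes \<T> :: "(real^'d::finite) set set"
  assumes mesh: "simplicial_mesh \<Omega> \<T>" and \<Omega>: "open \<Omega>" "convex \<Omega>"
    and K: "K \<in> \<T>" "F facet_of K" "outward_to K F n" and n: "normal_to F n" and F: "\<not> F \<subseteq> frontier \<Omega>"
  obtains K' where "K' \<in> \<T>" "F facet_of K'" "outward_to K' F (- n)"
proof -
  note m = simplicial_meshD[OF mesh]
  note cK = m(3)[OF K(1)] m(4)[OF K(1)]
  have Fc: "convex F" using face_of_imp_convex facet_of_imp_face_of K(2) by blast
  have Fcl: "closed F"
    using face_of_imp_closed[OF cK(1) compact_imp_closed[OF m(2)[OF K(1)]] facet_of_imp_face_of[OF K(2)]] .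
  obtain y0 where y0: "y0 \<in> F" "y0 \<notin> frontier \<Omega>" using F by blast
  have "y0 \<in> closure \<Omega>" using y0(1) K(1) facet_of_imp_subset[OF K(2)] m(6) by blast
  then have "y0 \<in> \<Omega>" using y0(2) \<Omega>(1) by (simp add: frontier_def interior_open)
  then have "\<Omega> \<inter> closure (rel_interior F) \<noteq> {}"
    using y0(1) convex_closure_rel_interior[OF Fc] Fcl by auto
  then obtain y where y: "y \<in> rel_interior F" "y \<in> \<Omega>"
    using open_Int_closure_eq_empty[OF \<Omega>(1), of "rel_interior F"] by blast
  then have yF: "y \<in> F" using rel_interior_subset by blast
  obtain e where e: "e > 0" "ball y e \<subseteq> \<Omega>" using \<Omega>(1) y(2) openE by blast
  \<comment> \<open>The finitely many elements that miss \<open>y\<close> form a closed set, so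
    close to \<open>y\<close> only elements containing \<open>y\<close> are met.\<close>
  define \<U> where "\<U> = {K \<in> \<T>. y \<notin> K}"
  have "closed (\<Union>\<U>)" using m(1,2) by (intro closed_Union) (auto simp: \<U>_def compact_imp_closed)
  moreover have "y \<notin> \<Union>\<U>" by (auto simp: \<U>_def)
  ultimately obtain d where d: "d > 0" "ball y d \<inter> \<Union>\<U> = {}"
    using openE[of "- \<Union>\<U>" y] by (metis Compl_iff closed_def disjoint_eq_subset_Compl)
  have n0: "n \<noteq> 0" using n by (simp add: normal_to_def)
  define t where "t = min e d / (2 * norm n)"
  have t: "t > 0" using e d n0 by (simp add: t_def)
  define x where "x = y + t *\<^sub>R n"
  have "dist y x = min e d / 2" using e d n0 by (simp add: x_def dist_norm t_def min_def)
  then have x: "x \<in> ball y e" "x \<in> ball y d" using e d by auto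
  have nx: "n \<bullet> (x - y) > 0" using t n0 by (simp add: x_def)
  have "x \<in> \<Union>\<T>" using x(1) e(2) m(6) closure_subset by blast
  then obtain K' where K': "K' \<in> \<T>" "x \<in> K'" by blast
  have yK': "y \<in> K'" using K' x(2) d(2) by (auto simp: \<U>_def)
  note cK' = m(3)[OF K'(1)] m(4)[OF K'(1)]
  have "x \<notin> K" using K(3) yF nx by (force simp: outward_to_def)
  then have ne: "K \<noteq> K'" using K'(2) by blast
  have yK: "y \<in> K" using yF facet_of_imp_subset[OF K(2)] by blast
  have "F \<subseteq> K \<inter> K'"
    by (rule subset_of_face_of[OF m(5)[OF K(1) K'(1)] facet_of_imp_subset[OF K(2)]]) (use y yK yK' in blast)
  moreover have "F = K \<inter> K'"
  proof (rule ccontr)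
    assume "F \<noteq> K \<inter> K'"
    from face_of_both_full_dimensional[OF cK m(5)[OF K(1) K'(1)] K(2) \<open>F \<subseteq> K \<inter> K'\<close> this]
    have "K = K'" by (rule full_dimensional_faces_eq) (use cK cK' m(5)[OF K'(1) K(1)] in auto)
    then show False using ne by simp
  qed
  then have "F face_of K'" using m(5)[OF K'(1) K(1)] by (simp add: Int_commute)
  then have F': "F facet_of K'" using K(2) cK(2) cK'(2) by (simp add: facet_of_def)
  have "\<not> outward_to K' F n" using K'(2) yF nx by (force simp: outward_to_def)
  then have "outward_to K' F (- n)" using facet_one_side[OF F' cK' n] by blast
  then show ?thesis using that K'(1) F' by blast
qed

lemma mesh_normals_normal_to:
  "mesh_normals \<Omega> \<T> nrm \<Longrightarrow> F \<in> mesh_faces \<T> \<Longrightarrow> normal_to F (nrm F)"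
  unfolding mesh_normals_def normal_to_def by (metis norm_zero zero_neq_one)

text \<open>Shows that both definite descriptions in \<open>jump\<close> denote: the sides of the
  hyperplane give uniqueness, and the step across the facet gives existence.\<close>

lemma interior_face_neighbours:
  fixes \<T> :: "(real^'d::finite) set set"
  assumes mesh: "simplicial_mesh \<Omega> \<T>" "mesh_normals \<Omega> \<T> nrm" and \<Omega>: "open \<Omega>" "convex \<Omega>" and F: "F \<in> interior_faces \<Omega> \<T>"
  obtains K K' where "K \<in> \<T>" "F facet_of K" "K' \<in> \<T>" "F facet_of K'"
    "(THE K. K \<in> \<T> \<and> F facet_of K \<and> outward_to K F (nrm F)) = K"
    "(THE K. K \<in> \<T> \<and> F facet_of K \<and> outward_to K F (- nrm F)) = K'"
proof -
  note m = simplicial_meshD[OF mesh(1)]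
  have Fm: "F \<in> mesh_faces \<T>" and nf: "\<not> F \<subseteq> frontier \<Omega>"
    using F by (auto simp: interior_faces_def boundary_faces_def)
  note n = mesh_normals_normal_to[OF mesh(2) Fm]
  have n': "normal_to F (- nrm F)" using n by (simp add: normal_to_uminus)
  obtain K0 where K0: "K0 \<in> \<T>" "F facet_of K0" using Fm by (auto simp: mesh_faces_def)
  have "\<exists>K\<in>\<T>. F facet_of K \<and> outward_to K F (nrm F)" "\<exists>K\<in>\<T>. F facet_of K \<and> outward_to K F (- nrm F)"
    using facet_one_side[OF K0(2) m(3,4)[OF K0(1)] n]
      mesh_facet_other_side[OF mesh(1) \<Omega> K0 _ n nf] mesh_facet_other_side[OF mesh(1) \<Omega> K0 _ n' nf] K0
    by (metis minus_minus)+
  then obtain K K' where K: "K \<in> \<T>" "F facet_of K" "outward_to K F (nrm F)"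
    and K': "K' \<in> \<T>" "F facet_of K'" "outward_to K' F (- nrm F)" by blast
  show ?thesis
  proof (rule that[OF K(1,2) K'(1,2)])
    show "(THE K. K \<in> \<T> \<and> F facet_of K \<and> outward_to K F (nrm F)) = K"
      using K mesh_facet_same_side_unique[OF mesh(1) _ _ _ _ _ _ n] by (intro the_equality) blast+
    show "(THE K. K \<in> \<T> \<and> F facet_of K \<and> outward_to K F (- nrm F)) = K'"
      using K' mesh_facet_same_side_unique[OF mesh(1) _ _ _ _ _ _ n'] by (intro the_equality) blast+
  qed
qed

text \<open>The normal points out of \<Omega> and therefore, passing to the closure, out of every
  element. All elements with this facet thus lie on the same side and coincide.\<close>

lemma boundary_face_neighbour:
  fixes \<T> :: "(real^'d::finite) set set"
  assumes mesh: "simplicial_mesh \<Omega> \<T>" "mesh_normals \<Omega> \<T> nrm" and F: "F \<in> boundary_faces \<Omega> \<T>"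
  obtains K where "K \<in> \<T>" "F facet_of K" "(THE K. K \<in> \<T> \<and> F facet_of K) = K"
proof -
  note m = simplicial_meshD[OF mesh(1)]
  have Fm: "F \<in> mesh_faces \<T>" using F by (auto simp: boundary_faces_def)
  note n = mesh_normals_normal_to[OF mesh(2) Fm]
  have o: "outward_to \<Omega> F (nrm F)" using mesh(2) F by (auto simp: mesh_normals_def)
  have oK: "outward_to K F (nrm F)" if "K \<in> \<T>" for K
    unfolding outward_to_def
  proof (intro ballI)
    fix x y assume x: "x \<in> K" and y: "y \<in> F"
    have "\<Omega> \<subseteq> {x. nrm F \<bullet> x \<le> nrm F \<bullet> y}" using o y by (auto simp: outward_to_def inner_diff_right)
    then have "closure \<Omega> \<subseteq> {x. nrm F \<bullet> x \<le> nrm F \<bullet> y}" by (intro closure_minimal closed_halfspace_le)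
    moreover have "x \<in> closure \<Omega>" using x that m(6) by blast
    ultimately show "nrm F \<bullet> (x - y) \<le> 0" by (auto simp: inner_diff_right)
  qed
  obtain K where K: "K \<in> \<T>" "F facet_of K" using Fm by (auto simp: mesh_faces_def)
  have "(THE K. K \<in> \<T> \<and> F facet_of K) = K"
    using K mesh_facet_same_side_unique[OF mesh(1) _ _ oK _ _ oK n] by (intro the_equality) blast+
  then show ?thesis using that K by blast
qed

text \<open>Overlapping interiors would make the intersection a face of full dimension, hence equal
  to both elements.\<close>

lemma mesh_interiors_disjoint:
  fixes \<T> :: "(real^'d::finite) set set"
  assumes mesh: "simplicial_mesh \<Omega> \<T>" and K: "K \<in> \<T>" "K' \<in> \<T>" "K \<noteq> K'"
  shows "interior K \<inter> interior K' = {}"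
proof (rule ccontr)
  note m = simplicial_meshD[OF mesh]
  assume "interior K \<inter> interior K' \<noteq> {}"
  then have "interior (K \<inter> K') \<noteq> {}" by (simp add: interior_Int)
  then have "aff_dim (K \<inter> K') = int CARD('d)" using aff_dim_nonempty_interior by fastforce
  then have "K \<inter> K' = K" using face_of_aff_dim_lt[OF m(3)[OF K(1)] m(5)[OF K(1,2)]] m(4)[OF K(1)] by auto
  then have "K = K'" by (rule full_dimensional_faces_eq) (use m K in auto)
  then show False using K(3) by simp
qed

section \<open>The broken domain, and the trace inequality on mesh faces\<close>

lemma broken_domain_open: "open (broken_domain \<T>)"
  by (auto simp: broken_domain_def)

text \<open>The elements fill the closure of \<Omega>, and an open convex set is the interior of its
  closure.\<close>

lemma broken_domain_subset:
  assumes mesh: "simplicial_mesh \<Omega> \<T>" and \<Omega>: "open \<Omega>" "convex \<Omega>"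
  shows "broken_domain \<T> \<subseteq> \<Omega>"
proof -
  have "interior K \<subseteq> \<Omega>" if "K \<in> \<T>" for K
  proof -
    have "interior K \<subseteq> interior (closure \<Omega>)" using that simplicial_meshD(6)[OF mesh] by (intro interior_mono) blast
    then show ?thesis using convex_interior_closure[OF \<Omega>(2)] \<Omega>(1) by (simp add: interior_open)
  qed
  then show ?thesis by (auto simp: broken_domain_def)
qed

lemma negligible_mesh_skeleton:
  assumes mesh: "simplicial_mesh \<Omega> \<T>"
  shows "AE x in lebesgue. x \<in> \<Omega> \<longrightarrow> x \<in> broken_domain \<T>"
proof -
  note m = simplicial_meshD[OF mesh]
  have "negligible (\<Union>(frontier ` \<T>))"
    using m by (intro negligible_Union) (auto intro: negligible_convex_frontier)
  then have "AE x in lebesgue. x \<notin> \<Union>(frontier ` \<T>)" by (intro AE_not_in) (simp add: negligible_iff_null_sets)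
  then show ?thesis
  proof eventually_elim
    case (elim x)
    show ?case
    proof
      assume "x \<in> \<Omega>"
      then obtain K where "K \<in> \<T>" "x \<in> K" using m(6) closure_subset[of \<Omega>] by blast
      moreover from this have "x \<in> interior K" using elim closure_subset[of K] by (auto simp: frontier_def)
      ultimately show "x \<in> broken_domain \<T>" by (auto simp: broken_domain_def)
    qed
  qed
qed

text \<open>Any point of the element off the hyperplane of the facet serves as the apex of the
  cone.\<close>

lemma mesh_trace_face:
  fixes \<T> :: "(real^'d::finite) set set"
  assumes d: "CARD('d) \<ge> 2" and mesh: "simplicial_mesh \<Omega> \<T>" "mesh_normals \<Omega> \<T> nrm" and K: "K \<in> \<T>" "F facet_of K"
  shows "trace_face K F"
proof -
  note m = simplicial_meshD[OF mesh(1)]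
  have Fm: "F \<in> mesh_faces \<T>" using K by (auto simp: mesh_faces_def)
  note n = mesh_normals_normal_to[OF mesh(2) Fm]
  obtain y where y: "y \<in> F" using K(2) by (auto simp: facet_of_def)
  have n0: "nrm F \<noteq> 0" using n by (simp add: normal_to_def)
  have Fh: "nrm F \<bullet> x = nrm F \<bullet> y" if "x \<in> F" for x using normal_toD[OF n that y] .
  obtain z where z: "z \<in> K" "nrm F \<bullet> z \<noteq> nrm F \<bullet> y"
    using facet_off_hyperplane[OF K(2) m(4)[OF K(1)] n y] by (auto simp: inner_diff_right)
  have Fc: "compact F"
    by (rule face_of_imp_compact[OF m(3)[OF K(1)] m(2)[OF K(1)] facet_of_imp_face_of[OF K(2)]])
  have fin: "emeasure surface_measure F < \<infinity>"
    by (rule emeasure_surface_measure_bounded[OF n0 d compact_imp_bounded[OF Fc] Fh])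
  obtain C where C: "C \<ge> 0" "\<And>\<phi>. smooth \<phi> \<Longrightarrow> (LINT x:F|surface_measure. (\<phi> x)\<^sup>2) \<le> C * (H1_norm (interior K) \<phi>)\<^sup>2"
    by (rule trace_inequality[OF n0 d Fc Fh z(2) m(2)[OF K(1)] m(3)[OF K(1)] facet_of_imp_subset[OF K(2)] z(1)]) (assumption, rule that)
  then have "\<exists>C\<ge>0. \<forall>\<phi>. smooth \<phi> \<longrightarrow> (LINT x:F|surface_measure. (\<phi> x)\<^sup>2) \<le> C * (H1_norm (interior K) \<phi>)\<^sup>2" by blast
  then show ?thesis
    unfolding trace_face_def using compact_imp_bounded[OF m(2)[OF K(1)]] Fc fin by blast
qed

section \<open>The mesh-dependent norm\<close>

locale mesh_domain =
  fixes \<Omega> :: "(real^'d::finite) set" and \<T> :: "(real^'d) set set" and nrm :: "(real^'d) set \<Rightarrow> real^'d"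
  assumes dim: "CARD('d) \<ge> 2"
    and \<Omega>: "open \<Omega>" "bounded \<Omega>" "convex \<Omega>"
    and mesh: "simplicial_mesh \<Omega> \<T>" and normals: "mesh_normals \<Omega> \<T> nrm"
begin

abbreviation "B \<equiv> broken_domain \<T>"

lemma openB: "open B" by (rule broken_domain_open)
lemma B\<Omega>: "B \<subseteq> \<Omega>" by (rule broken_domain_subset[OF mesh \<Omega>(1,3)])
lemma interior_B: "K \<in> \<T> \<Longrightarrow> interior K \<subseteq> B" by (auto simp: broken_domain_def)
lemma finT: "finite \<T>" by (rule simplicial_meshD(1)[OF mesh])

lemma AE_interior:
  assumes "AE x in lebesgue. x \<in> B \<longrightarrow> P x" "K \<in> \<T>"
  shows "AE x in lebesgue. x \<in> interior K \<longrightarrow> P x"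
  using assms(1) by eventually_elim (use interior_B[OF assms(2)] in blast)

lemma AE_\<Omega>:
  assumes "AE x in lebesgue. x \<in> B \<longrightarrow> P x"
  shows "AE x in lebesgue. x \<in> \<Omega> \<longrightarrow> P x"
  using assms negligible_mesh_skeleton[OF mesh] by eventually_elim blast

lemma set_integrable_B_\<Omega>:
  fixes f :: "real^'d \<Rightarrow> real"
  assumes "set_integrable lebesgue B f"
  shows "set_integrable lebesgue \<Omega> f"
proof -
  have ae: "AE x in lebesgue. indicator B x *\<^sub>R f x = indicator \<Omega> x *\<^sub>R f x"
    using negligible_mesh_skeleton[OF mesh] by eventually_elim (use B\<Omega> in \<open>auto simp: indicator_def\<close>)
  have m: "(\<lambda>x. indicator B x *\<^sub>R f x) \<in> borel_measurable lebesgue" using assms by (auto simp: set_integrable_def)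
  show ?thesis
    using assms integrable_cong_AE[OF m borel_measurable_lebesgue_AE_cong[OF m ae] ae] by (simp add: set_integrable_def)
qed

lemma tf: "K \<in> \<T> \<Longrightarrow> F facet_of K \<Longrightarrow> trace_face K F"
  by (rule mesh_trace_face[OF dim mesh normals])

definition traceable :: "(real^'d \<Rightarrow> real) \<Rightarrow> bool" where
  "traceable v \<longleftrightarrow> v \<in> H1_space B \<and> (\<forall>K\<in>\<T>. \<forall>F. F facet_of K \<longrightarrow> (\<exists>g. has_trace K F v g))"

text \<open>A common home for the discrete functions and the exact solution: it is closed under
  differences and provides the integrability and the traces that the norm estimates use.\<close>

definition broken_H2 :: "(real^'d \<Rightarrow> real) \<Rightarrow> bool" where
  "broken_H2 v \<longleftrightarrow> traceable v \<and> (\<forall>i. traceable (weak_pderiv B i v))"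

lemma traceableD: "traceable v \<Longrightarrow> K \<in> \<T> \<Longrightarrow> F facet_of K \<Longrightarrow> \<exists>g. has_trace K F v g"
  by (simp add: traceable_def)

lemma traceable_diff: "traceable v \<Longrightarrow> traceable w \<Longrightarrow> traceable (\<lambda>x. v x - w x)"
proof -
  assume v: "traceable v" and w: "traceable w"
  have "\<exists>g. has_trace K F (\<lambda>x. v x - w x) g" if K: "K \<in> \<T>" "F facet_of K" for K F
  proof -
    obtain g where "has_trace K F v g" using traceableD[OF v K] ..
    moreover obtain g' where "has_trace K F w g'" using traceableD[OF w K] ..
    ultimately have "has_trace K F (\<lambda>x. v x - w x) (\<lambda>x. g x - g' x)" by (rule has_trace_diff[OF tf[OF K]])
    then show ?thesis by (rule exI[of "has_trace K F (\<lambda>x. v x - w x)"])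
  qed
  moreover have "(\<lambda>x. v x - w x) \<in> H1_space B" using v w by (intro H1_space_diff) (auto simp: traceable_def)
  ultimately show "traceable (\<lambda>x. v x - w x)" by (simp add: traceable_def)
qed

lemma traceable_cong_AE:
  assumes "traceable v" "AE x in lebesgue. x \<in> B \<longrightarrow> v x = w x"
  shows "traceable w"
  unfolding traceable_def
proof (intro conjI ballI allI impI)
  show "w \<in> H1_space B" using assms H1_space_cong_AE[OF _ assms(2)] by (auto simp: traceable_def)
  fix K F assume K: "K \<in> \<T>" "F facet_of K"
  then obtain g where "has_trace K F v g" using assms(1) by (auto simp: traceable_def)
  from has_trace_cong_AE[OF this AE_interior[OF assms(2) K(1)]] show "\<exists>g. has_trace K F w g" by blast
qed

lemma weak_pderiv_diff_AE:
  assumes "broken_H2 v" "broken_H2 w"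
  shows "AE x in lebesgue. x \<in> B \<longrightarrow> weak_pderiv B i v x - weak_pderiv B i w x = weak_pderiv B i (\<lambda>x. v x - w x) x"
  using weak_pderiv_diff[OF openB, of v w i] assms by (auto simp: broken_H2_def traceable_def)

lemma broken_H2_diff:
  assumes "broken_H2 v" "broken_H2 w"
  shows "broken_H2 (\<lambda>x. v x - w x)"
  using assms traceable_diff traceable_cong_AE[OF traceable_diff weak_pderiv_diff_AE[OF assms]]
  by (simp add: broken_H2_def)

text \<open>The first derivative of a difference is known only almost everywhere, so the second
  derivative is first transferred along that identity and then split.\<close>

lemma weak_hess_diff_AE:
  assumes v: "broken_H2 v" and w: "broken_H2 w"
  shows "AE x in lebesgue. x \<in> B \<longrightarrow> weak_hess B (\<lambda>x. v x - w x) x = weak_hess B v x - weak_hess B w x"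
proof -
  have "AE x in lebesgue. x \<in> B \<longrightarrow> weak_pderiv B j (weak_pderiv B i (\<lambda>x. v x - w x)) x
      = weak_pderiv B j (weak_pderiv B i v) x - weak_pderiv B j (weak_pderiv B i w) x" for i j
  proof -
    have H: "weak_pderiv B i v \<in> H1_space B" "weak_pderiv B i w \<in> H1_space B"
      using v w by (auto simp: broken_H2_def traceable_def)
    from weak_pderiv_cong_AE[OF openB H1_space_diff[OF H] weak_pderiv_diff_AE[OF v w], of j] weak_pderiv_diff[OF openB H, of j]
    show ?thesis by eventually_elim simp
  qed
  then have "AE x in lebesgue. \<forall>i j. x \<in> B \<longrightarrow> weak_pderiv B j (weak_pderiv B i (\<lambda>x. v x - w x)) x
      = weak_pderiv B j (weak_pderiv B i v) x - weak_pderiv B j (weak_pderiv B i w) x"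
    unfolding AE_all_countable by blast
  then show ?thesis by eventually_elim (simp add: weak_hess_def vec_eq_iff)
qed

text \<open>Hessian, gradient and value as one vector; the square of its product norm is the volume
  integrand of the mesh norm.\<close>

definition jet :: "(real^'d \<Rightarrow> real) \<Rightarrow> real^'d \<Rightarrow> (real^'d^'d) \<times> (real^'d) \<times> real" where
  "jet v x = (weak_hess B v x, weak_grad B v x, v x)"

lemma norm_jet_square: "(norm (jet v x))\<^sup>2 = (norm (weak_hess B v x))\<^sup>2 + (norm (weak_grad B v x))\<^sup>2 + (v x)\<^sup>2"
  by (simp add: jet_def norm_Pair)

lemma jet_diff_AE:
  assumes v: "broken_H2 v" and w: "broken_H2 w"
  shows "AE x in lebesgue. x \<in> \<Omega> \<longrightarrow> jet (\<lambda>x. v x - w x) x = jet v x - jet w x"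
proof (rule AE_\<Omega>)
  have "AE x in lebesgue. x \<in> B \<longrightarrow> weak_grad B (\<lambda>x. v x - w x) x = weak_grad B v x - weak_grad B w x"
    using v w by (intro weak_grad_diff openB) (auto simp: broken_H2_def traceable_def)
  with weak_hess_diff_AE[OF v w]
  show "AE x in lebesgue. x \<in> B \<longrightarrow> jet (\<lambda>x. v x - w x) x = jet v x - jet w x"
    by eventually_elim (simp add: jet_def)
qed

lemma norm_jet_integrable:
  assumes v: "broken_H2 v"
  shows "set_integrable lebesgue \<Omega> (\<lambda>x. (norm (jet v x))\<^sup>2)"
proof (rule set_integrable_B_\<Omega>)
  have H: "v \<in> H1_space B" "weak_pderiv B i v \<in> H1_space B" for i
    using v by (auto simp: broken_H2_def traceable_def)
  have "(norm (weak_hess B v x))\<^sup>2 = (\<Sum>i\<in>UNIV. \<Sum>j\<in>UNIV. (weak_pderiv B j (weak_pderiv B i v) x)\<^sup>2)" for x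
    by (simp add: weak_hess_def norm_vec_def L2_set_def sum_nonneg)
  moreover have "set_integrable lebesgue B (\<lambda>x. (weak_pderiv B j (weak_pderiv B i v) x)\<^sup>2)" for i j
    using H1_space_weak_pderiv(2)[OF openB H(2)] by (simp add: L2_space_def)
  then have "set_integrable lebesgue B (\<lambda>x. \<Sum>i\<in>UNIV. \<Sum>j\<in>UNIV. (weak_pderiv B j (weak_pderiv B i v) x)\<^sup>2)"
    unfolding set_integrable_def scaleR_sum_right by (intro Bochner_Integration.integrable_sum)
  ultimately have "set_integrable lebesgue B (\<lambda>x. (norm (weak_hess B v x))\<^sup>2 + ((norm (weak_grad B v x))\<^sup>2 + (v x)\<^sup>2))"
    by (simp only: set_integral_add(1)[OF _ H1_norm_integrand(1)[OF openB H(1)]])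
  then show "set_integrable lebesgue B (\<lambda>x. (norm (jet v x))\<^sup>2)"
    by (simp add: norm_jet_square add.assoc)
qed

text \<open>Both sides of an interior face carry a trace, so a jump is a difference of traces.\<close>

lemma jump_cases:
  assumes F: "F \<in> mesh_faces \<T>"
  obtains K where "K \<in> \<T>" "F facet_of K" "\<And>v. jump \<Omega> \<T> nrm F v = face_trace K F v" "F \<subseteq> frontier \<Omega>"
  | K K' where "K \<in> \<T>" "F facet_of K" "K' \<in> \<T>" "F facet_of K'" "F \<in> interior_faces \<Omega> \<T>"
    "\<And>v. jump \<Omega> \<T> nrm F v = (\<lambda>x. face_trace K F v x - face_trace K' F v x)"
proof (cases "F \<in> boundary_faces \<Omega> \<T>")
  case True
  then obtain K where K: "K \<in> \<T>" "F facet_of K" "(THE K. K \<in> \<T> \<and> F facet_of K) = K"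
    by (rule boundary_face_neighbour[OF mesh normals])
  show ?thesis
  proof (rule that(1)[OF K(1,2)])
    show "jump \<Omega> \<T> nrm F v = face_trace K F v" for v
      using True K(3) by (simp add: jump_def fun_eq_iff)
    show "F \<subseteq> frontier \<Omega>" using True by (simp add: boundary_faces_def)
  qed
next
  case False
  then have Fi: "F \<in> interior_faces \<Omega> \<T>" using F by (simp add: interior_faces_def)
  then obtain K K' where K: "K \<in> \<T>" "F facet_of K" "K' \<in> \<T>" "F facet_of K'"
    "(THE K. K \<in> \<T> \<and> F facet_of K \<and> outward_to K F (nrm F)) = K"
    "(THE K. K \<in> \<T> \<and> F facet_of K \<and> outward_to K F (- nrm F)) = K'"
    by (rule interior_face_neighbours[OF mesh normals \<Omega>(1,3)])
  show ?thesis
  proof (rule that(2)[OF K(1-4) Fi])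
    show "jump \<Omega> \<T> nrm F v = (\<lambda>x. face_trace K F v x - face_trace K' F v x)" for v
      using False K(5,6) by (simp add: jump_def fun_eq_iff)
  qed
qed

text \<open>The function \<open>z\<close> is tied to the difference almost everywhere only, since in
  the application to gradients it is a chosen weak derivative of a difference.\<close>

lemma face_trace_diff_AE:
  assumes K: "K \<in> \<T>" "F facet_of K" and v: "traceable v" and w: "traceable w"
    and z: "AE x in lebesgue. x \<in> B \<longrightarrow> v x - w x = z x"
  shows "AE x in surface_measure. x \<in> F \<longrightarrow> face_trace K F z x = face_trace K F v x - face_trace K F w x"
proof -
  obtain g g' where g: "has_trace K F v g" "has_trace K F w g'" using traceableD[OF v K] traceableD[OF w K] by blast
  show ?thesis
    by (rule face_trace_AE_eq[OF tf[OF K] has_trace_cong_AE[OF has_trace_diff[OF tf[OF K] face_trace_has_trace[OF g(1)] face_trace_has_trace[OF g(2)]]]])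
      (rule AE_interior[OF z K(1)])
qed

lemma jump_diff_AE:
  assumes F: "F \<in> mesh_faces \<T>" and v: "traceable v" and w: "traceable w"
    and z: "AE x in lebesgue. x \<in> B \<longrightarrow> v x - w x = z x"
  shows "AE x in surface_measure. x \<in> F \<longrightarrow> jump \<Omega> \<T> nrm F z x = jump \<Omega> \<T> nrm F v x - jump \<Omega> \<T> nrm F w x"
  using F
proof (cases rule: jump_cases)
  case (1 K)
  then show ?thesis using face_trace_diff_AE[OF 1(1,2) v w z] by simp
next
  case (2 K K')
  from face_trace_diff_AE[OF 2(1,2) v w z] face_trace_diff_AE[OF 2(3,4) v w z]
  show ?thesis unfolding 2(6) by eventually_elim auto
qed

lemma jump_square_integrable:
  assumes F: "F \<in> mesh_faces \<T>" and v: "traceable v"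
  shows "set_integrable surface_measure F (\<lambda>x. (jump \<Omega> \<T> nrm F v x)\<^sup>2)"
  using F
proof (cases rule: jump_cases)
  case (1 K)
  then obtain g where "has_trace K F v g" using traceableD[OF v 1(1,2)] by blast
  then show ?thesis unfolding 1(3) by (rule face_trace_measurable(2))
next
  case (2 K K')
  then obtain g g' where g: "has_trace K F v g" "has_trace K' F v g'" using traceableD[OF v] by blast
  show ?thesis unfolding 2(6)
    by (intro set_integrable_square_diff set_borel_measurable_surface face_trace_measurable[OF g(1)] face_trace_measurable[OF g(2)]
        trace_faceD(4)[OF tf[OF 2(1,2)]])
qed

lemma grad_jump_diff_AE:
  assumes F: "F \<in> mesh_faces \<T>" and v: "broken_H2 v" and w: "broken_H2 w"
  shows "AE x in surface_measure. x \<in> F \<longrightarrow>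
    grad_jump \<Omega> \<T> nrm F (\<lambda>x. v x - w x) x = grad_jump \<Omega> \<T> nrm F v x - grad_jump \<Omega> \<T> nrm F w x"
proof -
  have "AE x in surface_measure. \<forall>i. x \<in> F \<longrightarrow> jump \<Omega> \<T> nrm F (weak_pderiv B i (\<lambda>x. v x - w x)) x
      = jump \<Omega> \<T> nrm F (weak_pderiv B i v) x - jump \<Omega> \<T> nrm F (weak_pderiv B i w) x"
    using v w unfolding AE_all_countable
    by (intro allI jump_diff_AE[OF F _ _ weak_pderiv_diff_AE[OF v w]]) (auto simp: broken_H2_def)
  then show ?thesis by eventually_elim (auto simp: grad_jump_def vec_eq_iff)
qed

lemma grad_jump_square_integrable:
  assumes F: "F \<in> mesh_faces \<T>" and v: "broken_H2 v"
  shows "set_integrable surface_measure F (\<lambda>x. (norm (grad_jump \<Omega> \<T> nrm F v x))\<^sup>2)"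
proof -
  have "set_integrable surface_measure F (\<lambda>x. (jump \<Omega> \<T> nrm F (weak_pderiv B i v) x)\<^sup>2)" for i
    using v by (intro jump_square_integrable[OF F]) (simp add: broken_H2_def)
  then have "set_integrable surface_measure F (\<lambda>x. \<Sum>i\<in>UNIV. (jump \<Omega> \<T> nrm F (weak_pderiv B i v) x)\<^sup>2)"
    unfolding set_integrable_def scaleR_sum_right by (intro Bochner_Integration.integrable_sum)
  then show ?thesis by (simp add: norm_cart_square grad_jump_def)
qed

section \<open>The mesh norm as a nested sum of L2 norms\<close>

definition jump_part :: "(real^'d) set \<Rightarrow> (real^'d \<Rightarrow> real) \<Rightarrow> real" where
  "jump_part F v = sqrt (LINT x:F|surface_measure. (jump \<Omega> \<T> nrm F v x / sqrt (face_size F ^ 3))\<^sup>2)"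

definition grad_jump_part :: "(real^'d) set \<Rightarrow> (real^'d \<Rightarrow> real) \<Rightarrow> real" where
  "grad_jump_part F v = sqrt (LINT x:F|surface_measure. (norm (grad_jump \<Omega> \<T> nrm F v x) / sqrt (face_size F))\<^sup>2)"

definition volume_part :: "(real^'d \<Rightarrow> real) \<Rightarrow> real" where
  "volume_part v = sqrt (LINT x:\<Omega>|lebesgue. (norm (jet v x))\<^sup>2)"

lemma face_size_nonneg: "0 \<le> face_size F"
  by (simp add: face_size_def)

lemma jump_seminorm_eq:
  "jump_seminorm \<Omega> \<T> nrm v = sqrt ((L2_set (\<lambda>F. grad_jump_part F v) (interior_faces \<Omega> \<T>))\<^sup>2 + (L2_set (\<lambda>F. jump_part F v) (mesh_faces \<T>))\<^sup>2)"
  by (simp add: jump_seminorm_def L2_set_def jump_part_def grad_jump_part_def sum_nonneg face_square_integral_nonneg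
      power_divide face_size_nonneg)

lemma mesh_norm_eq: "mesh_norm \<Omega> \<T> nrm v = sqrt ((volume_part v)\<^sup>2 + (jump_seminorm \<Omega> \<T> nrm v)\<^sup>2)"
  by (simp add: mesh_norm_def volume_part_def norm_jet_square[symmetric] face_square_integral_nonneg)

lemma jump_part_triangle:
  assumes F: "F \<in> mesh_faces \<T>" and u: "broken_H2 u" and v: "broken_H2 v" and t: "broken_H2 t"
  shows "jump_part F (\<lambda>x. u x - t x) \<le> jump_part F (\<lambda>x. u x - v x) + jump_part F (\<lambda>x. v x - t x)"
  unfolding jump_part_def
proof (rule sqrt_set_integral_triangle)
  have i: "set_integrable surface_measure F (\<lambda>x. (jump \<Omega> \<T> nrm F v x / sqrt (face_size F ^ 3))\<^sup>2)" if "broken_H2 v" for v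
    using that unfolding power_divide by (intro set_integrable_divide jump_square_integrable[OF F]) (simp add: broken_H2_def)
  show "set_integrable surface_measure F (\<lambda>x. (jump \<Omega> \<T> nrm F (\<lambda>x. u x - v x) x / sqrt (face_size F ^ 3))\<^sup>2)"
    "set_integrable surface_measure F (\<lambda>x. (jump \<Omega> \<T> nrm F (\<lambda>x. v x - t x) x / sqrt (face_size F ^ 3))\<^sup>2)"
    by (intro i broken_H2_diff u v t)+
  have d: "AE x in surface_measure. x \<in> F \<longrightarrow> jump \<Omega> \<T> nrm F (\<lambda>x. v x - w x) x = jump \<Omega> \<T> nrm F v x - jump \<Omega> \<T> nrm F w x"
    if "broken_H2 v" "broken_H2 w" for v w
    using that by (intro jump_diff_AE[OF F]) (auto simp: broken_H2_def)
  show "AE x in surface_measure. x \<in> F \<longrightarrow> \<bar>jump \<Omega> \<T> nrm F (\<lambda>x. u x - t x) x / sqrt (face_size F ^ 3)\<bar>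
      \<le> \<bar>jump \<Omega> \<T> nrm F (\<lambda>x. u x - v x) x / sqrt (face_size F ^ 3)\<bar> + \<bar>jump \<Omega> \<T> nrm F (\<lambda>x. v x - t x) x / sqrt (face_size F ^ 3)\<bar>"
    using d[OF u t] d[OF u v] d[OF v t]
    by eventually_elim (auto simp: abs_divide face_size_nonneg simp flip: add_divide_distrib intro!: divide_right_mono)
qed

lemma grad_jump_part_triangle:
  assumes F: "F \<in> mesh_faces \<T>" and u: "broken_H2 u" and v: "broken_H2 v" and t: "broken_H2 t"
  shows "grad_jump_part F (\<lambda>x. u x - t x) \<le> grad_jump_part F (\<lambda>x. u x - v x) + grad_jump_part F (\<lambda>x. v x - t x)"
  unfolding grad_jump_part_def
proof (rule sqrt_set_integral_triangle)
  have i: "set_integrable surface_measure F (\<lambda>x. (norm (grad_jump \<Omega> \<T> nrm F v x) / sqrt (face_size F))\<^sup>2)" if "broken_H2 v" for v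
    using that unfolding power_divide by (intro set_integrable_divide grad_jump_square_integrable[OF F])
  show "set_integrable surface_measure F (\<lambda>x. (norm (grad_jump \<Omega> \<T> nrm F (\<lambda>x. u x - v x) x) / sqrt (face_size F))\<^sup>2)"
    "set_integrable surface_measure F (\<lambda>x. (norm (grad_jump \<Omega> \<T> nrm F (\<lambda>x. v x - t x) x) / sqrt (face_size F))\<^sup>2)"
    by (intro i broken_H2_diff u v t)+
  show "AE x in surface_measure. x \<in> F \<longrightarrow> \<bar>norm (grad_jump \<Omega> \<T> nrm F (\<lambda>x. u x - t x) x) / sqrt (face_size F)\<bar>
      \<le> \<bar>norm (grad_jump \<Omega> \<T> nrm F (\<lambda>x. u x - v x) x) / sqrt (face_size F)\<bar> + \<bar>norm (grad_jump \<Omega> \<T> nrm F (\<lambda>x. v x - t x) x) / sqrt (face_size F)\<bar>"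
    using grad_jump_diff_AE[OF F u t] grad_jump_diff_AE[OF F u v] grad_jump_diff_AE[OF F v t]
  proof eventually_elim
    case (elim x)
    have "norm (p - r) \<le> norm (p - q) + norm (q - r)" for p q r :: "real^'d"
      using norm_triangle_ineq[of "p - q" "q - r"] by simp
    then show ?case using elim
      by (auto simp: abs_divide face_size_nonneg simp flip: add_divide_distrib intro!: divide_right_mono)
  qed
qed

lemma volume_part_triangle:
  assumes u: "broken_H2 u" and v: "broken_H2 v" and t: "broken_H2 t"
  shows "volume_part (\<lambda>x. u x - t x) \<le> volume_part (\<lambda>x. u x - v x) + volume_part (\<lambda>x. v x - t x)"
  unfolding volume_part_def
proof (rule sqrt_set_integral_triangle)
  show "set_integrable lebesgue \<Omega> (\<lambda>x. (norm (jet (\<lambda>x. u x - v x) x))\<^sup>2)" "set_integrable lebesgue \<Omega> (\<lambda>x. (norm (jet (\<lambda>x. v x - t x) x))\<^sup>2)"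
    by (intro norm_jet_integrable broken_H2_diff u v t)+
  show "AE x in lebesgue. x \<in> \<Omega> \<longrightarrow> \<bar>norm (jet (\<lambda>x. u x - t x) x)\<bar> \<le> \<bar>norm (jet (\<lambda>x. u x - v x) x)\<bar> + \<bar>norm (jet (\<lambda>x. v x - t x) x)\<bar>"
    using jet_diff_AE[OF u t] jet_diff_AE[OF u v] jet_diff_AE[OF v t]
  proof eventually_elim
    case (elim x)
    show ?case using elim norm_triangle_ineq[of "jet u x - jet v x" "jet v x - jet t x"] by simp
  qed
qed

lemma L2_set_triangle_le:
  assumes "\<And>i. i \<in> I \<Longrightarrow> 0 \<le> f i" "\<And>i. i \<in> I \<Longrightarrow> f i \<le> g i + h i"
  shows "L2_set f I \<le> L2_set g I + L2_set h I"
  using L2_set_mono[of I f "\<lambda>i. g i + h i"] L2_set_triangle_ineq[of g h I] assms by fastforce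

lemma sqrt_sum_squares_triangle_le:
  fixes a b :: real
  assumes "0 \<le> a" "0 \<le> b" "a \<le> a1 + a2" "b \<le> b1 + b2"
  shows "sqrt (a\<^sup>2 + b\<^sup>2) \<le> sqrt (a1\<^sup>2 + b1\<^sup>2) + sqrt (a2\<^sup>2 + b2\<^sup>2)"
proof -
  have "sqrt (a\<^sup>2 + b\<^sup>2) \<le> sqrt ((a1 + a2)\<^sup>2 + (b1 + b2)\<^sup>2)"
    using assms by (intro real_sqrt_le_mono add_mono power_mono) auto
  also have "\<dots> \<le> sqrt (a1\<^sup>2 + b1\<^sup>2) + sqrt (a2\<^sup>2 + b2\<^sup>2)" by (rule real_sqrt_sum_squares_triangle_ineq)
  finally show ?thesis .
qed

lemma parts_nonneg: "0 \<le> jump_part F v" "0 \<le> grad_jump_part F v" "0 \<le> volume_part v" "0 \<le> jump_seminorm \<Omega> \<T> nrm v"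
  by (auto simp: jump_part_def grad_jump_part_def volume_part_def face_square_integral_nonneg jump_seminorm_eq)

text \<open>Triangle inequalities are nested: for each integral, for the l2 sums over the faces, and
  for the outer roots of sums of squares.\<close>

lemma mesh_norm_triangle:
  assumes u: "broken_H2 u" and v: "broken_H2 v" and t: "broken_H2 t"
  shows "mesh_norm \<Omega> \<T> nrm (\<lambda>x. u x - t x) \<le> mesh_norm \<Omega> \<T> nrm (\<lambda>x. u x - v x) + mesh_norm \<Omega> \<T> nrm (\<lambda>x. v x - t x)"
proof -
  have "jump_seminorm \<Omega> \<T> nrm (\<lambda>x. u x - t x) \<le> jump_seminorm \<Omega> \<T> nrm (\<lambda>x. u x - v x) + jump_seminorm \<Omega> \<T> nrm (\<lambda>x. v x - t x)"
    unfolding jump_seminorm_eq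
    using u v t
    by (intro sqrt_sum_squares_triangle_le L2_set_nonneg L2_set_triangle_le parts_nonneg jump_part_triangle grad_jump_part_triangle)
      (auto simp: interior_faces_def)
  then show ?thesis
    unfolding mesh_norm_eq by (intro sqrt_sum_squares_triangle_le parts_nonneg volume_part_triangle u v t)
qed

lemma mesh_norm_nonneg: "0 \<le> mesh_norm \<Omega> \<T> nrm v"
  by (simp add: mesh_norm_eq)

lemma volume_part_le_mesh_norm: "volume_part v \<le> mesh_norm \<Omega> \<T> nrm v"
  unfolding mesh_norm_eq by (rule real_le_rsqrt) simp

lemma jump_seminorm_le_mesh_norm: "jump_seminorm \<Omega> \<T> nrm v \<le> mesh_norm \<Omega> \<T> nrm v"
  unfolding mesh_norm_eq by (rule real_le_rsqrt) simp

text \<open>The jumps of \<open>v\<close> and of the difference agree up to sign almost everywhere.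
  The comparison of integrals is the triangle inequality with 0 as the second function.\<close>

lemma jump_seminorm_jump_free:
  assumes u: "broken_H2 u" and v: "broken_H2 v"
    and ju: "\<And>F. F \<in> mesh_faces \<T> \<Longrightarrow> AE x in surface_measure. x \<in> F \<longrightarrow> jump \<Omega> \<T> nrm F u x = 0"
    and gu: "\<And>F. F \<in> interior_faces \<Omega> \<T> \<Longrightarrow> AE x in surface_measure. x \<in> F \<longrightarrow> grad_jump \<Omega> \<T> nrm F u x = 0"
  shows "jump_seminorm \<Omega> \<T> nrm v \<le> jump_seminorm \<Omega> \<T> nrm (\<lambda>x. u x - v x)"
proof -
  note uv = broken_H2_diff[OF u v]
  have z: "set_integrable surface_measure F (\<lambda>x. 0\<^sup>2 :: real)" for F by (simp add: set_integrable_def)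
  have j: "jump_part F v \<le> jump_part F (\<lambda>x. u x - v x)" if F: "F \<in> mesh_faces \<T>" for F
  proof -
    have i: "set_integrable surface_measure F (\<lambda>x. (jump \<Omega> \<T> nrm F (\<lambda>x. u x - v x) x / sqrt (face_size F ^ 3))\<^sup>2)"
      using uv unfolding power_divide by (intro set_integrable_divide jump_square_integrable[OF F]) (simp add: broken_H2_def)
    have "AE x in surface_measure. x \<in> F \<longrightarrow> jump \<Omega> \<T> nrm F (\<lambda>x. u x - v x) x = jump \<Omega> \<T> nrm F u x - jump \<Omega> \<T> nrm F v x"
      using u v by (intro jump_diff_AE[OF F]) (auto simp: broken_H2_def)
    with ju[OF F] have "AE x in surface_measure. x \<in> F \<longrightarrow> \<bar>jump \<Omega> \<T> nrm F v x / sqrt (face_size F ^ 3)\<bar>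
        \<le> \<bar>jump \<Omega> \<T> nrm F (\<lambda>x. u x - v x) x / sqrt (face_size F ^ 3)\<bar> + \<bar>0\<bar>"
      by eventually_elim (auto simp: abs_divide)
    from sqrt_set_integral_triangle[OF i z this] show ?thesis by (simp add: jump_part_def set_lebesgue_integral_def)
  qed
  have g: "grad_jump_part F v \<le> grad_jump_part F (\<lambda>x. u x - v x)" if Fi: "F \<in> interior_faces \<Omega> \<T>" for F
  proof -
    have F: "F \<in> mesh_faces \<T>" using Fi by (simp add: interior_faces_def)
    have i: "set_integrable surface_measure F (\<lambda>x. (norm (grad_jump \<Omega> \<T> nrm F (\<lambda>x. u x - v x) x) / sqrt (face_size F))\<^sup>2)"
      using uv unfolding power_divide by (intro set_integrable_divide grad_jump_square_integrable[OF F])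
    from gu[OF Fi] grad_jump_diff_AE[OF F u v]
    have "AE x in surface_measure. x \<in> F \<longrightarrow> \<bar>norm (grad_jump \<Omega> \<T> nrm F v x) / sqrt (face_size F)\<bar>
        \<le> \<bar>norm (grad_jump \<Omega> \<T> nrm F (\<lambda>x. u x - v x) x) / sqrt (face_size F)\<bar> + \<bar>0\<bar>"
      by eventually_elim (auto simp: abs_divide)
    from sqrt_set_integral_triangle[OF i z this] show ?thesis by (simp add: grad_jump_part_def set_lebesgue_integral_def)
  qed
  show ?thesis unfolding jump_seminorm_eq
    by (intro real_sqrt_le_mono add_mono power_mono L2_set_mono L2_set_nonneg j g parts_nonneg)
qed

end

section \<open>Discrete functions and the exact solution in the mesh norm\<close>

context mesh_domain
begin

lemma bounded_interior: "K \<in> \<T> \<Longrightarrow> bounded (interior K)"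
  using bounded_interior[of K] simplicial_meshD(2)[OF mesh] compact_imp_bounded by blast

lemma piecewise_smooth_L2:
  assumes r: "\<And>K. K \<in> \<T> \<Longrightarrow> smooth (r K)" and v: "\<And>K. K \<in> \<T> \<Longrightarrow> AE x in lebesgue. x \<in> interior K \<longrightarrow> v x = r K x"
  shows "v \<in> L2_space B"
proof -
  have ae: "AE x in lebesgue. \<forall>K\<in>\<T>. x \<in> interior K \<longrightarrow> v x = r K x"
    using v by (subst AE_ball_countable) (auto intro: countable_finite finT)
  \<comment> \<open>The interiors are disjoint, so at most one summand is nonzero; the sum equals
    \<open>v\<close> almost everywhere on the broken domain and settles measurability.\<close>
  let ?w = "\<lambda>x. \<Sum>K\<in>\<T>. indicator (interior K) x * r K x"
  have "(\<lambda>x. indicator (interior K) x * r K x) \<in> borel_measurable lebesgue" if "K \<in> \<T>" for K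
    using smooth_measurable_lebesgue[OF r[OF that]]
    by (intro borel_measurable_times borel_measurable_indicator) auto
  then have m: "?w \<in> borel_measurable lebesgue" by (rule borel_measurable_sum)
  have "AE x in lebesgue. ?w x = indicator B x *\<^sub>R v x"
    using ae
  proof eventually_elim
    case (elim x)
    show ?case
    proof (cases "x \<in> B")
      case True
      then obtain K where K: "K \<in> \<T>" "x \<in> interior K" by (auto simp: broken_domain_def)
      have "?w x = (\<Sum>K'\<in>{K}. indicator (interior K') x * r K' x)"
        using mesh_interiors_disjoint[OF mesh K(1)] K finT by (intro sum.mono_neutral_right) (auto simp: indicator_def)
      then show ?thesis using True K elim by simp
    qed (auto simp: broken_domain_def indicator_def intro!: sum.neutral)
  qed
  then have mv: "set_borel_measurable lebesgue B v"
    unfolding set_borel_measurable_def by (rule borel_measurable_lebesgue_AE_cong[OF m])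
  have "set_integrable lebesgue (interior K) (\<lambda>x. (v x)\<^sup>2)" if K: "K \<in> \<T>" for K
  proof -
    have "r K \<in> L2_space (interior K)"
      by (intro continuous_L2_space smooth_continuous r K bounded_interior) auto
    moreover have "AE x in lebesgue. x \<in> interior K \<longrightarrow> r K x = v x" using v[OF K] by eventually_elim auto
    ultimately have "v \<in> L2_space (interior K)" by (rule L2_space_cong_AE)
    then show ?thesis by (simp add: L2_space_def)
  qed
  then have "set_integrable lebesgue B (\<lambda>x. (v x)\<^sup>2)"
    unfolding broken_domain_def by (intro set_integrable_UN finT) auto
  then show ?thesis using mv by (simp add: L2_space_def)
qed

text \<open>The candidate glues the classical derivatives on the elements; locality on disjoint open
  sets makes it the weak derivative on the broken domain.\<close>

lemma piecewise_smooth_weak_pderiv: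
  assumes r: "\<And>K. K \<in> \<T> \<Longrightarrow> smooth (r K)" and v: "\<And>K. K \<in> \<T> \<Longrightarrow> AE x in lebesgue. x \<in> interior K \<longrightarrow> v x = r K x"
  shows "has_weak_pderiv B i v (weak_pderiv B i v)"
    and "K \<in> \<T> \<Longrightarrow> AE x in lebesgue. x \<in> interior K \<longrightarrow> weak_pderiv B i v x = pderiv_at i (r K) x"
proof -
  define g where "g x = (\<Sum>K\<in>\<T>. indicator (interior K) x * pderiv_at i (r K) x)" for x
  have g: "g x = pderiv_at i (r K) x" if "K \<in> \<T>" "x \<in> interior K" for K x
  proof -
    have "g x = (\<Sum>K'\<in>{K}. indicator (interior K') x * pderiv_at i (r K') x)"
      unfolding g_def using mesh_interiors_disjoint[OF mesh that(1)] that finT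
      by (intro sum.mono_neutral_right) (auto simp: indicator_def)
    then show ?thesis using that by simp
  qed
  have "has_weak_pderiv U i v g" if U: "U \<in> interior ` \<T>" for U
  proof -
    obtain K where K: "K \<in> \<T>" "U = interior K" using U by blast
    have "AE x in lebesgue. x \<in> U \<longrightarrow> r K x = v x" using v[OF K(1)] unfolding K(2) by eventually_elim auto
    moreover have "AE x in lebesgue. x \<in> U \<longrightarrow> pderiv_at i (r K) x = g x" using g K by (intro AE_I2) auto
    ultimately show ?thesis by (rule has_weak_pderiv_cong_AE[OF smooth_has_weak_pderiv[OF r[OF K(1)]]])
  qed
  moreover have "disjoint (interior ` \<T>)"
    using mesh_interiors_disjoint[OF mesh] unfolding disjoint_def by blast
  ultimately have "has_weak_pderiv (\<Union>(interior ` \<T>)) i v g"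
    using finT by (intro has_weak_pderiv_Union) auto
  then have w: "has_weak_pderiv B i v g" by (simp add: broken_domain_def)
  then show "has_weak_pderiv B i v (weak_pderiv B i v)" by (rule has_weak_pderiv_weak_pderiv)
  show "K \<in> \<T> \<Longrightarrow> AE x in lebesgue. x \<in> interior K \<longrightarrow> weak_pderiv B i v x = pderiv_at i (r K) x"
    using weak_pderiv_AE_eq[OF openB w] by (elim eventually_mono) (use g interior_B in auto)
qed

lemma piecewise_smooth_traceable:
  assumes r: "\<And>K. K \<in> \<T> \<Longrightarrow> smooth (r K)" and v: "\<And>K. K \<in> \<T> \<Longrightarrow> AE x in lebesgue. x \<in> interior K \<longrightarrow> v x = r K x"
  shows "traceable v"
  unfolding traceable_def
proof (intro conjI ballI allI impI)
  have "weak_pderiv B i v \<in> L2_space B" for i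
    by (rule piecewise_smooth_L2[where r="\<lambda>K. pderiv_at i (r K)"])
      (auto intro: smooth_pderiv r piecewise_smooth_weak_pderiv(2)[OF r v])
  then show "v \<in> H1_space B"
    using piecewise_smooth_L2[OF r v] piecewise_smooth_weak_pderiv(1)[OF r v] unfolding H1_space_def by blast
  fix K F assume K: "K \<in> \<T>" "F facet_of K"
  have "AE x in lebesgue. x \<in> interior K \<longrightarrow> r K x = v x" using v[OF K(1)] by eventually_elim auto
  from has_trace_cong_AE[OF smooth_has_trace[OF tf[OF K] r[OF K(1)]] this] show "\<exists>g. has_trace K F v g"
    by (rule exI[of "has_trace K F v"])
qed

lemma V_space_broken_H2:
  assumes "v \<in> V_space s p \<Omega> \<T>"
  shows "broken_H2 v"
proof -
  have "v \<in> V0_space p \<Omega> \<T>" using assms by (auto simp: V_space_def split: if_splits)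
  then have "\<forall>K\<in>\<T>. \<exists>q. q \<in> poly_fun p \<and> (AE x in lebesgue. x \<in> K \<longrightarrow> v x = q x)" by (auto simp: V0_space_def)
  from bchoice[OF this] obtain q where q: "\<forall>K\<in>\<T>. q K \<in> poly_fun p \<and> (AE x in lebesgue. x \<in> K \<longrightarrow> v x = q K x)" ..
  have sm: "smooth (q K)" if "K \<in> \<T>" for K using q that poly_fun_smooth by blast
  have ae: "AE x in lebesgue. x \<in> interior K \<longrightarrow> v x = q K x" if "K \<in> \<T>" for K
  proof -
    have "AE x in lebesgue. x \<in> K \<longrightarrow> v x = q K x" using q that by blast
    then show ?thesis by eventually_elim (use interior_subset in blast)
  qed
  have "traceable (weak_pderiv B i v)" for i
    by (rule piecewise_smooth_traceable[where r="\<lambda>K. pderiv_at i (q K)"])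
      (auto intro: smooth_pderiv sm piecewise_smooth_weak_pderiv(2)[OF sm ae])
  then show ?thesis using piecewise_smooth_traceable[OF sm ae] by (simp add: broken_H2_def)
qed

lemma poly_fun_diff:
  assumes "q \<in> poly_fun p" "q' \<in> poly_fun p"
  shows "(\<lambda>x::real^'d. q x - q' x) \<in> poly_fun p"
proof -
  obtain c c' where "q = (\<lambda>x. \<Sum>\<alpha> | (\<Sum>i\<in>UNIV. \<alpha> i) \<le> p. c \<alpha> * (\<Prod>i\<in>UNIV. (x $ i) ^ \<alpha> i))"
    "q' = (\<lambda>x. \<Sum>\<alpha> | (\<Sum>i\<in>UNIV. \<alpha> i) \<le> p. c' \<alpha> * (\<Prod>i\<in>UNIV. (x $ i) ^ \<alpha> i))"
    using assms by (auto simp: poly_fun_def)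
  then have "(\<lambda>x. q x - q' x) = (\<lambda>x. \<Sum>\<alpha> | (\<Sum>i\<in>UNIV. \<alpha> i) \<le> p. (c \<alpha> - c' \<alpha>) * (\<Prod>i\<in>UNIV. (x $ i) ^ \<alpha> i))"
    by (simp add: left_diff_distrib sum_subtractf)
  then show ?thesis unfolding poly_fun_def by (intro CollectI exI[of _ "\<lambda>\<alpha>. c \<alpha> - c' \<alpha>"])
qed

text \<open>Makes the error between two discrete functions an admissible test function, in the
  discontinuous as well as in the conforming case.\<close>

lemma V_space_diff:
  assumes v: "v \<in> V_space s p \<Omega> \<T>" and w: "w \<in> V_space s p \<Omega> \<T>"
  shows "(\<lambda>x. v x - w x) \<in> V_space s p \<Omega> \<T>"
proof -
  have vw: "v \<in> V0_space p \<Omega> \<T>" "w \<in> V0_space p \<Omega> \<T>" using v w by (auto simp: V_space_def split: if_splits)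
  have "(\<lambda>x. v x - w x) \<in> V0_space p \<Omega> \<T>"
    unfolding V0_space_def mem_Collect_eq
  proof (intro conjI ballI)
    show "(\<lambda>x. v x - w x) \<in> L2_space \<Omega>" using vw by (intro L2_space_diff) (auto simp: V0_space_def)
    fix K assume "K \<in> \<T>"
    then have "\<exists>q\<in>poly_fun p. AE x in lebesgue. x \<in> K \<longrightarrow> v x = q x" "\<exists>q\<in>poly_fun p. AE x in lebesgue. x \<in> K \<longrightarrow> w x = q x"
      using vw by (simp_all add: V0_space_def)
    then obtain q q' where q: "q \<in> poly_fun p" "AE x in lebesgue. x \<in> K \<longrightarrow> v x = q x"
      "q' \<in> poly_fun p" "AE x in lebesgue. x \<in> K \<longrightarrow> w x = q' x"
      by (elim bexE)
    show "\<exists>q\<in>poly_fun p. AE x in lebesgue. x \<in> K \<longrightarrow> v x - w x = q x"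
      by (rule bexI[OF _ poly_fun_diff[OF q(1,3)]]) (use q(2,4) in \<open>eventually_elim, auto\<close>)
  qed
  then show ?thesis using v w H10_space_diff[OF \<Omega>(1,2)] by (auto simp: V_space_def split: if_splits)
qed

lemma facet_\<Omega>_nonempty:
  assumes "K \<in> \<T>" "F facet_of K"
  shows "\<Omega> \<noteq> {}"
proof -
  have "F \<subseteq> closure \<Omega>" "F \<noteq> {}"
    using assms facet_of_imp_subset[OF assms(2)] simplicial_meshD(6)[OF mesh] by (auto simp: facet_of_def)
  then show ?thesis by auto
qed

lemma H1_norm_interior_lim:
  assumes "\<And>n. smooth (\<phi> n)" "v \<in> H1_space \<Omega>" "(\<lambda>n. H1_norm \<Omega> (\<lambda>x. \<phi> n x - v x)) \<longlonglongrightarrow> 0" "K \<in> \<T>"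
  shows "(\<lambda>n. H1_norm (interior K) (\<lambda>x. \<phi> n x - v x)) \<longlonglongrightarrow> 0"
proof (rule Lim_null_comparison[OF _ assms(3)])
  have "H1_norm (interior K) (\<lambda>x. \<phi> n x - v x) \<le> H1_norm \<Omega> (\<lambda>x. \<phi> n x - v x)" for n
    using interior_B[OF assms(4)] B\<Omega>
    by (intro H1_norm_subset \<Omega> open_interior H1_space_diff smooth_H1_space assms) auto
  then show "\<forall>\<^sub>F n in sequentially. norm (H1_norm (interior K) (\<lambda>x. \<phi> n x - v x)) \<le> H1_norm \<Omega> (\<lambda>x. \<phi> n x - v x)"
    by (simp add: H1_norm_nonneg)
qed

lemma H1_space_interior: "v \<in> H1_space \<Omega> \<Longrightarrow> K \<in> \<T> \<Longrightarrow> v \<in> H1_space (interior K)"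
  using H1_space_subset(1)[OF \<Omega>(1) open_interior order_trans[OF interior_B B\<Omega>]] by simp

text \<open>Approximating by functions that are smooth on all of \<open>\<Omega>\<close> yields the same trace from all
  elements that share the face.\<close>

lemma H1_common_trace:
  assumes v: "v \<in> H1_space \<Omega>" and K: "K \<in> \<T>" "F facet_of K"
  obtains g where "\<And>K. K \<in> \<T> \<Longrightarrow> F facet_of K \<Longrightarrow> has_trace K F v g"
proof -
  obtain \<phi> where \<phi>: "\<And>n. smooth (\<phi> n)" "(\<lambda>n. H1_norm \<Omega> (\<lambda>x. \<phi> n x - v x)) \<longlonglongrightarrow> 0"
    using smooth_dense_H1[OF \<Omega> facet_\<Omega>_nonempty[OF K] v] by blast
  note lim = H1_norm_interior_lim[OF \<phi>(1) v \<phi>(2)]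
  obtain r g where g: "strict_mono (r :: nat \<Rightarrow> nat)" "g \<in> borel_measurable borel" "set_integrable surface_measure F (\<lambda>x. (g x)\<^sup>2)"
    "\<And>n. set_integrable surface_measure F (\<lambda>x. (\<phi> (r n) x - g x)\<^sup>2)"
    "(\<lambda>n. LINT x:F|surface_measure. (\<phi> (r n) x - g x)\<^sup>2) \<longlonglongrightarrow> 0"
    using face_limit_exists[OF tf[OF K] \<phi>(1) H1_space_interior[OF v K(1)] lim[OF K(1)]] by blast
  show ?thesis
  proof (rule that)
    fix K assume K: "K \<in> \<T>" "F facet_of K"
    show "has_trace K F v g"
      by (rule has_traceI[OF tf[OF K] \<phi>(1) H1_space_interior[OF v K(1)] lim[OF K(1)] g])
  qed
qed

lemma H1_traceable:
  assumes v: "v \<in> H1_space \<Omega>"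
  shows "traceable v"
  unfolding traceable_def
proof (intro conjI ballI allI impI)
  show "v \<in> H1_space B" by (rule H1_space_subset(1)[OF \<Omega>(1) openB B\<Omega> v])
  fix K F assume K: "K \<in> \<T>" "F facet_of K"
  then show "\<exists>g. has_trace K F v g" using H1_common_trace[OF v K] by metis
qed

text \<open>The traces from both sides are the common limit of globally smooth functions and cancel.
  The second function \<open>w\<close> accommodates derivatives on the broken domain, which agree
  with those on \<Omega> almost everywhere only.\<close>

lemma H1_interior_jump:
  assumes v: "v \<in> H1_space \<Omega>" and w: "AE x in lebesgue. x \<in> B \<longrightarrow> v x = w x" and F: "F \<in> interior_faces \<Omega> \<T>"
  shows "AE x in surface_measure. x \<in> F \<longrightarrow> jump \<Omega> \<T> nrm F w x = 0"
proof -
  have Fm: "F \<in> mesh_faces \<T>" and nf: "\<not> F \<subseteq> frontier \<Omega>" using F by (auto simp: interior_faces_def boundary_faces_def)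
  from Fm show ?thesis
  proof (cases rule: jump_cases)
    case (1 K)
    then show ?thesis using nf by simp
  next
    case (2 K K')
    obtain g where g: "\<And>K. K \<in> \<T> \<Longrightarrow> F facet_of K \<Longrightarrow> has_trace K F v g"
      by (rule H1_common_trace[OF v 2(1,2)]) (rule that)
    have "has_trace K F w g" "has_trace K' F w g"
      using has_trace_cong_AE[OF g[OF 2(1,2)] AE_interior[OF w 2(1)]] has_trace_cong_AE[OF g[OF 2(3,4)] AE_interior[OF w 2(3)]] by auto
    from face_trace_AE_eq[OF tf[OF 2(1,2)] this(1)] face_trace_AE_eq[OF tf[OF 2(3,4)] this(2)]
    show ?thesis unfolding 2(6) by eventually_elim auto
  qed
qed

text \<open>On a boundary face the approximating test functions vanish identically, so 0 is a trace;
  on an interior face the jump vanishes as for every function in H1.\<close>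

lemma H10_jump:
  assumes v: "v \<in> H10_space \<Omega>" and F: "F \<in> mesh_faces \<T>"
  shows "AE x in surface_measure. x \<in> F \<longrightarrow> jump \<Omega> \<T> nrm F v x = 0"
  using F
proof (cases rule: jump_cases)
  case (1 K)
  have vH: "v \<in> H1_space \<Omega>" using v by (simp add: H10_space_def)
  obtain \<phi> where \<phi>: "\<And>n. test_fun \<Omega> (\<phi> n)" "(\<lambda>n. H1_norm \<Omega> (\<lambda>x. \<phi> n x - v x)) \<longlonglongrightarrow> 0"
    using v by (auto simp: H10_space_def)
  have sm: "smooth (\<phi> n)" for n using \<phi>(1) by (simp add: test_fun_def)
  have z: "\<phi> n x = 0" if "x \<in> F" for n x
    using test_fun_outside[OF \<phi>(1)] that 1(4) \<Omega>(1) by (auto simp: frontier_def interior_open)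
  have z': "indicator F x *\<^sub>R (\<phi> n x - 0)\<^sup>2 = 0" for n x using z by (auto simp: indicator_def)
  have "has_trace K F v (\<lambda>x. 0)"
    by (rule has_traceI[OF tf[OF 1(1,2)] sm H1_space_interior[OF vH 1(1)] H1_norm_interior_lim[OF sm vH \<phi>(2) 1(1)], of "\<lambda>n. n"])
      (simp_all only: set_integrable_def set_lebesgue_integral_def z' strict_mono_def, simp_all)
  from face_trace_AE_eq[OF tf[OF 1(1,2)] this] show ?thesis unfolding 1(3) .
next
  case (2 K K')
  show ?thesis
    by (rule H1_interior_jump[OF _ _ 2(5)]) (use v in \<open>auto simp: H10_space_def\<close>)
qed

lemma weak_pderiv_B_\<Omega>:
  assumes "v \<in> H1_space \<Omega>"
  shows "AE x in lebesgue. x \<in> B \<longrightarrow> weak_pderiv B i v x = weak_pderiv \<Omega> i v x"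
  by (rule H1_space_subset(2)[OF \<Omega>(1) openB B\<Omega> assms])

lemma H2_broken_H2:
  assumes u: "u \<in> H2_space \<Omega>"
  shows "broken_H2 u"
proof -
  have H: "u \<in> H1_space \<Omega>" "weak_pderiv \<Omega> i u \<in> H1_space \<Omega>" for i using u by (auto simp: H2_space_def)
  have "AE x in lebesgue. x \<in> B \<longrightarrow> weak_pderiv \<Omega> i u x = weak_pderiv B i u x" for i
    using weak_pderiv_B_\<Omega>[OF H(1), of i] by eventually_elim auto
  then have "traceable (weak_pderiv B i u)" for i by (rule traceable_cong_AE[OF H1_traceable[OF H(2)]])
  then show ?thesis using H1_traceable[OF H(1)] by (simp add: broken_H2_def)
qed

lemma H2_grad_jump:
  assumes u: "u \<in> H2_space \<Omega>" and F: "F \<in> interior_faces \<Omega> \<T>"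
  shows "AE x in surface_measure. x \<in> F \<longrightarrow> grad_jump \<Omega> \<T> nrm F u x = 0"
proof -
  have H: "u \<in> H1_space \<Omega>" "weak_pderiv \<Omega> i u \<in> H1_space \<Omega>" for i using u by (auto simp: H2_space_def)
  have "AE x in surface_measure. x \<in> F \<longrightarrow> jump \<Omega> \<T> nrm F (weak_pderiv B i u) x = 0" for i
    by (rule H1_interior_jump[OF H(2) _ F]) (use weak_pderiv_B_\<Omega>[OF H(1), of i] in \<open>eventually_elim, auto\<close>)
  then have "AE x in surface_measure. \<forall>i. x \<in> F \<longrightarrow> jump \<Omega> \<T> nrm F (weak_pderiv B i u) x = 0"
    unfolding AE_all_countable by blast
  then show ?thesis by eventually_elim (auto simp: grad_jump_def vec_eq_iff)
qed

lemma jump_seminorm_le: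
  assumes u: "u \<in> H2_space \<Omega>" "u \<in> H10_space \<Omega>" and v: "broken_H2 v"
  shows "jump_seminorm \<Omega> \<T> nrm v \<le> jump_seminorm \<Omega> \<T> nrm (\<lambda>x. u x - v x)"
  by (rule jump_seminorm_jump_free[OF H2_broken_H2[OF u(1)] v H10_jump[OF u(2)] H2_grad_jump[OF u(1)]])

text \<open>Connects the equation, whose derivatives are taken on \<Omega>, with the renormalized
  operator of the discrete setting, whose derivatives are taken on the broken domain.\<close>

lemma H2_jet_\<Omega>:
  assumes u: "u \<in> H2_space \<Omega>"
  shows "AE x in lebesgue. x \<in> \<Omega> \<longrightarrow> weak_hess B u x = weak_hess \<Omega> u x \<and> weak_grad B u x = weak_grad \<Omega> u x"
proof (rule AE_\<Omega>)
  have H: "u \<in> H1_space \<Omega>" "weak_pderiv \<Omega> i u \<in> H1_space \<Omega>" for i using u by (auto simp: H2_space_def)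
  have 1: "AE x in lebesgue. x \<in> B \<longrightarrow> weak_pderiv B i u x = weak_pderiv \<Omega> i u x" for i
    by (rule weak_pderiv_B_\<Omega>[OF H(1)])
  have 2: "AE x in lebesgue. x \<in> B \<longrightarrow> weak_pderiv B j (weak_pderiv B i u) x = weak_pderiv \<Omega> j (weak_pderiv \<Omega> i u) x" for i j
  proof -
    have "weak_pderiv B i u \<in> H1_space B" using H2_broken_H2[OF u] by (auto simp: broken_H2_def traceable_def)
    from weak_pderiv_cong_AE[OF openB this 1, of j] weak_pderiv_B_\<Omega>[OF H(2), of j i]
    show ?thesis by eventually_elim auto
  qed
  have "AE x in lebesgue. \<forall>i. x \<in> B \<longrightarrow> weak_pderiv B i u x = weak_pderiv \<Omega> i u x"
    unfolding AE_all_countable using 1 by blast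
  moreover have "AE x in lebesgue. \<forall>i j. x \<in> B \<longrightarrow> weak_pderiv B j (weak_pderiv B i u) x = weak_pderiv \<Omega> j (weak_pderiv \<Omega> i u) x"
    unfolding AE_all_countable using 2 by blast
  ultimately show "AE x in lebesgue. x \<in> B \<longrightarrow> weak_hess B u x = weak_hess \<Omega> u x \<and> weak_grad B u x = weak_grad \<Omega> u x"
    by eventually_elim (simp add: weak_hess_def weak_grad_def vec_eq_iff)
qed

end

section \<open>Isaacs operators\<close>

lemma bounded_range2:
  fixes X :: "'m \<Rightarrow> 'n \<Rightarrow> real"
  assumes "\<And>\<alpha> \<beta>. \<alpha> \<in> A \<Longrightarrow> \<beta> \<in> B \<Longrightarrow> \<bar>X \<alpha> \<beta>\<bar> \<le> M" and B: "B \<noteq> {}"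
  shows "\<And>\<alpha>. \<alpha> \<in> A \<Longrightarrow> bdd_above (X \<alpha> ` B)" "bdd_below ((\<lambda>\<alpha>. SUP \<beta>\<in>B. X \<alpha> \<beta>) ` A)"
proof -
  show 1: "bdd_above (X \<alpha> ` B)" if "\<alpha> \<in> A" for \<alpha>
    using assms(1)[OF that] by (intro bdd_aboveI[of _ M]) (auto simp: abs_le_iff)
  obtain \<beta> where \<beta>: "\<beta> \<in> B" using B by blast
  show "bdd_below ((\<lambda>\<alpha>. SUP \<beta>\<in>B. X \<alpha> \<beta>) ` A)"
  proof (rule bdd_belowI)
    fix y assume "y \<in> (\<lambda>\<alpha>. SUP \<beta>\<in>B. X \<alpha> \<beta>) ` A"
    then obtain \<alpha> where \<alpha>: "\<alpha> \<in> A" "y = (SUP \<beta>\<in>B. X \<alpha> \<beta>)" by blast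
    have "- M \<le> X \<alpha> \<beta>" using assms(1)[OF \<alpha>(1) \<beta>] by linarith
    also have "\<dots> \<le> y" unfolding \<alpha>(2) by (rule cSUP_upper[OF \<beta> 1[OF \<alpha>(1)]])
    finally show "- M \<le> y" .
  qed
qed

text \<open>Monotonicity of inf-sup together with its compatibility with added constants. The bounds
  are part of the statement because real infima and suprema are meaningful for bounded families
  only.\<close>

lemma INF_SUP_le_add:
  fixes X Y :: "'m \<Rightarrow> 'n \<Rightarrow> real"
  assumes X: "\<And>\<alpha> \<beta>. \<alpha> \<in> A \<Longrightarrow> \<beta> \<in> B \<Longrightarrow> \<bar>X \<alpha> \<beta>\<bar> \<le> M" and Y: "\<And>\<alpha> \<beta>. \<alpha> \<in> A \<Longrightarrow> \<beta> \<in> B \<Longrightarrow> \<bar>Y \<alpha> \<beta>\<bar> \<le> M'"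
    and ne: "A \<noteq> {}" "B \<noteq> {}" and le: "\<And>\<alpha> \<beta>. \<alpha> \<in> A \<Longrightarrow> \<beta> \<in> B \<Longrightarrow> X \<alpha> \<beta> \<le> Y \<alpha> \<beta> + m"
  shows "(INF \<alpha>\<in>A. SUP \<beta>\<in>B. X \<alpha> \<beta>) \<le> (INF \<alpha>\<in>A. SUP \<beta>\<in>B. Y \<alpha> \<beta>) + m"
proof -
  have "(INF \<alpha>\<in>A. SUP \<beta>\<in>B. X \<alpha> \<beta>) - m \<le> (INF \<alpha>\<in>A. SUP \<beta>\<in>B. Y \<alpha> \<beta>)"
  proof (rule cINF_greatest[OF ne(1)])
    fix \<alpha> assume \<alpha>: "\<alpha> \<in> A"
    have "(INF \<alpha>\<in>A. SUP \<beta>\<in>B. X \<alpha> \<beta>) \<le> (SUP \<beta>\<in>B. X \<alpha> \<beta>)"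
      by (rule cINF_lower[OF bounded_range2(2)[OF X ne(2)] \<alpha>])
    also have "\<dots> \<le> (SUP \<beta>\<in>B. Y \<alpha> \<beta>) + m"
    proof (rule cSUP_least[OF ne(2)])
      fix \<beta> assume \<beta>: "\<beta> \<in> B"
      have "Y \<alpha> \<beta> \<le> (SUP \<beta>\<in>B. Y \<alpha> \<beta>)" by (rule cSUP_upper[OF \<beta> bounded_range2(1)[OF Y ne(2) \<alpha>]])
      then show "X \<alpha> \<beta> \<le> (SUP \<beta>\<in>B. Y \<alpha> \<beta>) + m" using le[OF \<alpha> \<beta>] by linarith
    qed
    finally show "(INF \<alpha>\<in>A. SUP \<beta>\<in>B. X \<alpha> \<beta>) - m \<le> (SUP \<beta>\<in>B. Y \<alpha> \<beta>)" by linarith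
  qed
  then show ?thesis by linarith
qed

lemma continuous_on_bounded2:
  fixes X :: "'m::metric_space \<Rightarrow> 'n::metric_space \<Rightarrow> real"
  assumes "compact A" "compact B" "continuous_on (A \<times> B) (\<lambda>(\<alpha>, \<beta>). X \<alpha> \<beta>)"
  obtains M where "\<And>\<alpha> \<beta>. \<alpha> \<in> A \<Longrightarrow> \<beta> \<in> B \<Longrightarrow> \<bar>X \<alpha> \<beta>\<bar> \<le> M"
proof -
  have "bounded ((\<lambda>(\<alpha>, \<beta>). X \<alpha> \<beta>) ` (A \<times> B))"
    by (intro compact_imp_bounded compact_continuous_image assms compact_Times)
  then obtain M where "\<forall>y\<in>(\<lambda>(\<alpha>, \<beta>). X \<alpha> \<beta>) ` (A \<times> B). norm y \<le> M" by (auto simp: bounded_iff)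
  then show ?thesis using that[of M] by force
qed

text \<open>Compactness of the control sets makes the supremum a maximum, so a positive factor preserves
  its sign.\<close>

lemma INF_SUP_times_pos_eq_0:
  fixes G \<gamma> :: "'m::metric_space \<Rightarrow> 'n::metric_space \<Rightarrow> real"
  assumes AB: "compact A" "A \<noteq> {}" "compact B" "B \<noteq> {}"
    and G: "continuous_on (A \<times> B) (\<lambda>(\<alpha>, \<beta>). G \<alpha> \<beta>)" and \<gamma>: "continuous_on (A \<times> B) (\<lambda>(\<alpha>, \<beta>). \<gamma> \<alpha> \<beta>)"
    and pos: "\<And>\<alpha> \<beta>. \<alpha> \<in> A \<Longrightarrow> \<beta> \<in> B \<Longrightarrow> \<gamma> \<alpha> \<beta> > 0"
    and zero: "(INF \<alpha>\<in>A. SUP \<beta>\<in>B. G \<alpha> \<beta>) = 0"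
  shows "(INF \<alpha>\<in>A. SUP \<beta>\<in>B. \<gamma> \<alpha> \<beta> * G \<alpha> \<beta>) = 0"
proof -
  have G\<gamma>: "continuous_on (A \<times> B) (\<lambda>(\<alpha>, \<beta>). \<gamma> \<alpha> \<beta> * G \<alpha> \<beta>)"
    using continuous_on_mult[OF \<gamma> G] by (simp add: case_prod_unfold)
  obtain M where M: "\<And>\<alpha> \<beta>. \<alpha> \<in> A \<Longrightarrow> \<beta> \<in> B \<Longrightarrow> \<bar>G \<alpha> \<beta>\<bar> \<le> M" by (rule continuous_on_bounded2[OF AB(1,3) G]) blast
  obtain M' where M': "\<And>\<alpha> \<beta>. \<alpha> \<in> A \<Longrightarrow> \<beta> \<in> B \<Longrightarrow> \<bar>\<gamma> \<alpha> \<beta> * G \<alpha> \<beta>\<bar> \<le> M'" by (rule continuous_on_bounded2[OF AB(1,3) G\<gamma>]) blast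
  obtain \<Gamma> where \<Gamma>: "\<And>\<alpha> \<beta>. \<alpha> \<in> A \<Longrightarrow> \<beta> \<in> B \<Longrightarrow> \<bar>\<gamma> \<alpha> \<beta>\<bar> \<le> \<Gamma>" by (rule continuous_on_bounded2[OF AB(1,3) \<gamma>]) blast
  have bG: "bdd_above (G \<alpha> ` B)" if "\<alpha> \<in> A" for \<alpha> by (rule bounded_range2(1)[OF M AB(4) that])
  have bG2: "bdd_below ((\<lambda>\<alpha>. SUP \<beta>\<in>B. G \<alpha> \<beta>) ` A)" by (rule bounded_range2(2)[OF M AB(4)])
  have bG': "bdd_above ((\<lambda>\<beta>. \<gamma> \<alpha> \<beta> * G \<alpha> \<beta>) ` B)" if "\<alpha> \<in> A" for \<alpha> by (rule bounded_range2(1)[OF M' AB(4) that])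
  have bG2': "bdd_below ((\<lambda>\<alpha>. SUP \<beta>\<in>B. \<gamma> \<alpha> \<beta> * G \<alpha> \<beta>) ` A)" by (rule bounded_range2(2)[OF M' AB(4)])
  have "0 \<le> (INF \<alpha>\<in>A. SUP \<beta>\<in>B. \<gamma> \<alpha> \<beta> * G \<alpha> \<beta>)"
  proof (rule cINF_greatest[OF AB(2)])
    fix \<alpha> assume \<alpha>: "\<alpha> \<in> A"
    have "continuous_on B (\<lambda>\<beta>. G \<alpha> \<beta>)"
    proof -
      have "continuous_on B (\<lambda>\<beta>. (\<alpha>, \<beta>))" by (intro continuous_on_Pair continuous_on_const continuous_on_id)
      from continuous_on_compose2[OF G this] show ?thesis using \<alpha> by auto
    qed
    then obtain \<beta> where \<beta>: "\<beta> \<in> B" "\<And>\<beta>'. \<beta>' \<in> B \<Longrightarrow> G \<alpha> \<beta>' \<le> G \<alpha> \<beta>"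
      using continuous_attains_sup[OF AB(3,4)] by blast
    have "0 \<le> (SUP \<beta>\<in>B. G \<alpha> \<beta>)" unfolding zero[symmetric] by (rule cINF_lower[OF bG2 \<alpha>])
    also have "\<dots> \<le> G \<alpha> \<beta>" by (rule cSUP_least[OF AB(4) \<beta>(2)])
    finally have "0 \<le> \<gamma> \<alpha> \<beta> * G \<alpha> \<beta>" using pos[OF \<alpha> \<beta>(1)] by simp
    also have "\<dots> \<le> (SUP \<beta>\<in>B. \<gamma> \<alpha> \<beta> * G \<alpha> \<beta>)" by (rule cSUP_upper[OF \<beta>(1) bG'[OF \<alpha>]])
    finally show "0 \<le> (SUP \<beta>\<in>B. \<gamma> \<alpha> \<beta> * G \<alpha> \<beta>)" .
  qed
  \<comment> \<open>For the upper bound it suffices to pick a control \<alpha> whose supremum is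
    below e / \<Gamma>, with \<Gamma> a bound for the factor.\<close>
  moreover have "(INF \<alpha>\<in>A. SUP \<beta>\<in>B. \<gamma> \<alpha> \<beta> * G \<alpha> \<beta>) \<le> 0 + e" if e: "e > 0" for e
  proof -
    obtain \<alpha>0 \<beta>0 where "\<alpha>0 \<in> A" "\<beta>0 \<in> B" using AB by blast
    then have \<Gamma>0: "\<Gamma> > 0" using \<Gamma> pos by (meson abs_ge_self less_le_trans)
    have "(INF \<alpha>\<in>A. SUP \<beta>\<in>B. G \<alpha> \<beta>) < e / \<Gamma>" using zero e \<Gamma>0 by simp
    then obtain \<alpha> where \<alpha>: "\<alpha> \<in> A" "(SUP \<beta>\<in>B. G \<alpha> \<beta>) < e / \<Gamma>" using cINF_less_iff[OF AB(2) bG2] by blast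
    have "(INF \<alpha>\<in>A. SUP \<beta>\<in>B. \<gamma> \<alpha> \<beta> * G \<alpha> \<beta>) \<le> (SUP \<beta>\<in>B. \<gamma> \<alpha> \<beta> * G \<alpha> \<beta>)" by (rule cINF_lower[OF bG2' \<alpha>(1)])
    also have "\<dots> \<le> e"
    proof (rule cSUP_least[OF AB(4)])
      fix \<beta> assume \<beta>: "\<beta> \<in> B"
      have "G \<alpha> \<beta> \<le> (SUP \<beta>\<in>B. G \<alpha> \<beta>)" by (rule cSUP_upper[OF \<beta> bG[OF \<alpha>(1)]])
      then have "\<gamma> \<alpha> \<beta> * G \<alpha> \<beta> \<le> \<gamma> \<alpha> \<beta> * (e / \<Gamma>)" using \<alpha>(2) pos[OF \<alpha>(1) \<beta>] by (intro mult_left_mono) auto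
      also have "\<dots> \<le> \<Gamma> * (e / \<Gamma>)" using \<Gamma>[OF \<alpha>(1) \<beta>] e \<Gamma>0 by (intro mult_right_mono) auto
      finally show "\<gamma> \<alpha> \<beta> * G \<alpha> \<beta> \<le> e" using \<Gamma>0 by simp
    qed
    finally show ?thesis by simp
  qed
  then have "(INF \<alpha>\<in>A. SUP \<beta>\<in>B. \<gamma> \<alpha> \<beta> * G \<alpha> \<beta>) \<le> 0" by (rule field_le_epsilon)
  ultimately show ?thesis by simp
qed

section \<open>Bounds for the renormalized linear operators\<close>

lemma trace_le_norm:
  fixes a :: "real^'d^'d::finite"
  shows "trace a \<le> sqrt (real CARD('d)) * norm a"
proof -
  have i: "(\<Sum>j\<in>UNIV. a $ i $ j * (mat 1 :: real^'d^'d) $ i $ j) = a $ i $ i" for i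
    by (simp add: mat_def if_distrib cong: if_cong)
  \<comment> \<open>The trace is the Frobenius product with the identity matrix, whose norm is the
    square root of d.\<close>
  have "trace a = a \<bullet> mat 1" by (simp add: trace_def inner_vec_def i[unfolded])
  also have "\<dots> \<le> norm a * norm (mat 1 :: real^'d^'d)" by (rule norm_cauchy_schwarz)
  also have "norm (mat 1 :: real^'d^'d) = sqrt (real CARD('d))"
    by (simp add: norm_eq_sqrt_inner inner_vec_def mat_def if_distrib cong: if_cong)
  finally show ?thesis by (simp add: mult.commute)
qed

lemma trace_pos_of_elliptic:
  fixes a :: "real^'d^'d::finite"
  assumes "\<nu> > 0" "\<And>\<xi>. \<nu> * (norm \<xi>)\<^sup>2 \<le> \<xi> \<bullet> (a *v \<xi>)"
  shows "trace a > 0"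
  unfolding trace_def
proof (rule sum_pos)
  fix i
  have "axis i 1 \<bullet> (a *v axis i 1) = a $ i $ i"
    by (simp add: inner_axis' matrix_vector_mult_basis column_def)
  then show "a $ i $ i > 0" using assms(2)[of "axis i 1"] assms(1) by simp
qed auto

lemma norm_square_add3:
  fixes x y z :: real
  shows "x1 * x2 + y1 * y2 + z1 * z2 \<le> sqrt (x1\<^sup>2 + y1\<^sup>2 + z1\<^sup>2) * sqrt (x2\<^sup>2 + y2\<^sup>2 + z2\<^sup>2)"
  using norm_cauchy_schwarz[of "(x1, y1, z1)" "(x2, y2, z2)"] by (simp add: norm_Pair add.assoc)

text \<open>Two Cauchy-Schwarz estimates, one for the operator and one for
  \<open>trace a + c / lam\<close>, each produce a factor \<open>sqrt N\<close>, where
  \<open>N\<close> is the squared length of (\<open>norm a\<close>,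
  \<open>norm b / sqrt (2 * lam)\<close>, \<open>c / lam\<close>). Their product cancels the
  denominator of the renormalization.\<close>

lemma renormalized_linear_bound:
  fixes a H :: "real^'d^'d::finite" and b g :: "real^'d" and c z lam :: real
  assumes lam: "lam > 0" and c: "c \<ge> 0" and tr: "trace a > 0"
  defines "N \<equiv> (norm a)\<^sup>2 + (norm b)\<^sup>2 / (2 * lam) + c\<^sup>2 / lam\<^sup>2"
  shows "(trace a + c / lam) / N * \<bar>a \<bullet> H + b \<bullet> g - c * z\<bar>
    \<le> Max {1, sqrt (2 * lam), lam} * sqrt (real CARD('d) + 1) * norm (H, g, z)"
proof -
  define m where "m = Max {1, sqrt (2 * lam), lam}"
  have m: "1 \<le> m" "sqrt (2 * lam) \<le> m" "lam \<le> m" by (auto simp: m_def)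
  have a0: "norm a > 0" using tr by (auto simp: trace_def)
  have N: "N > 0" unfolding N_def using a0 lam by (intro add_pos_nonneg) auto
  have "\<bar>a \<bullet> H + b \<bullet> g - c * z\<bar> \<le> \<bar>a \<bullet> H\<bar> + \<bar>b \<bullet> g\<bar> + c * \<bar>z\<bar>"
    using c abs_mult[of c z] by (auto intro: order_trans[OF abs_triangle_ineq4] add_mono abs_triangle_ineq)
  \<comment> \<open>The weights \<open>sqrt (2 * lam)\<close> and \<open>lam\<close> are inserted
    and divided out so that the first factors form the vector of squared length
    \<open>N\<close>.\<close>
  also have "\<dots> \<le> norm a * norm H + (norm b / sqrt (2 * lam)) * (sqrt (2 * lam) * norm g) + (c / lam) * (lam * \<bar>z\<bar>)"
    using lam Cauchy_Schwarz_ineq2[of a H] Cauchy_Schwarz_ineq2[of b g] by simp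
  also have "\<dots> \<le> sqrt N * sqrt ((norm H)\<^sup>2 + (sqrt (2 * lam) * norm g)\<^sup>2 + (lam * \<bar>z\<bar>)\<^sup>2)"
    using norm_square_add3[of "norm a" "norm H" "norm b / sqrt (2 * lam)" "sqrt (2 * lam) * norm g" "c / lam" "lam * \<bar>z\<bar>"] lam
    by (simp add: N_def power_divide)
  also have "\<dots> \<le> sqrt N * (m * norm (H, g, z))"
  proof (rule mult_left_mono)
    have "1\<^sup>2 * (norm H)\<^sup>2 + (sqrt (2 * lam))\<^sup>2 * (norm g)\<^sup>2 + lam\<^sup>2 * z\<^sup>2 \<le> m\<^sup>2 * (norm H)\<^sup>2 + m\<^sup>2 * (norm g)\<^sup>2 + m\<^sup>2 * z\<^sup>2"
      using m lam by (intro add_mono mult_right_mono power_mono) auto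
    then have "sqrt ((norm H)\<^sup>2 + (sqrt (2 * lam) * norm g)\<^sup>2 + (lam * \<bar>z\<bar>)\<^sup>2) \<le> sqrt (m\<^sup>2 * ((norm H)\<^sup>2 + ((norm g)\<^sup>2 + z\<^sup>2)))"
      by (intro real_sqrt_le_mono) (simp add: power_mult_distrib distrib_left)
    also have "\<dots> = m * norm (H, g, z)" using m by (simp add: real_sqrt_mult norm_Pair)
    finally show "sqrt ((norm H)\<^sup>2 + (sqrt (2 * lam) * norm g)\<^sup>2 + (lam * \<bar>z\<bar>)\<^sup>2) \<le> m * norm (H, g, z)" .
  qed (use N in simp)
  finally have lin: "\<bar>a \<bullet> H + b \<bullet> g - c * z\<bar> \<le> sqrt N * (m * norm (H, g, z))" .
  \<comment> \<open>The zero summand brings the two-term sum into the form of the three-term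
    inequality.\<close>
  have "trace a + c / lam \<le> sqrt (real CARD('d)) * norm a + 1 * (c / lam) + 0 * 0" using trace_le_norm[of a] by simp
  also have "\<dots> \<le> sqrt ((sqrt (real CARD('d)))\<^sup>2 + 1\<^sup>2 + 0\<^sup>2) * sqrt ((norm a)\<^sup>2 + (c / lam)\<^sup>2 + 0\<^sup>2)"
    by (rule norm_square_add3)
  also have "\<dots> \<le> sqrt (real CARD('d) + 1) * sqrt N"
    using lam by (intro mult_mono real_sqrt_le_mono) (auto simp: N_def power_divide)
  finally have t: "trace a + c / lam \<le> sqrt (real CARD('d) + 1) * sqrt N" .
  have t0: "0 \<le> trace a + c / lam" using tr c lam by (intro add_nonneg_nonneg) auto
  have "(trace a + c / lam) / N * \<bar>a \<bullet> H + b \<bullet> g - c * z\<bar> \<le> (sqrt (real CARD('d) + 1) * sqrt N) / N * (sqrt N * (m * norm (H, g, z)))"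
    using t t0 lin N by (intro mult_mono divide_right_mono) auto
  also have "\<dots> = m * sqrt (real CARD('d) + 1) * norm (H, g, z) * (sqrt N * sqrt N / N)"
    by simp
  also have "sqrt N * sqrt N / N = 1" using N by simp
  finally show ?thesis by (simp add: m_def)
qed

text \<open>In the case without lower order terms \<open>lam\<close> is 0: the weights of the
  general estimate would divide by zero, while the maximum in the constant is 1.\<close>

lemma renormalized_pure_bound:
  fixes a H :: "real^'d^'d::finite" and g :: "real^'d" and z :: real
  assumes tr: "trace a > 0"
  shows "trace a / (norm a)\<^sup>2 * \<bar>a \<bullet> H\<bar> \<le> sqrt (real CARD('d) + 1) * norm (H, g, z)"
proof -
  have a0: "norm a > 0" using tr by (auto simp: trace_def)
  have "trace a / (norm a)\<^sup>2 * \<bar>a \<bullet> H\<bar> \<le> (sqrt (real CARD('d)) * norm a) / (norm a)\<^sup>2 * (norm a * norm H)"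
    using tr trace_le_norm[of a] Cauchy_Schwarz_ineq2[of a H] by (intro mult_mono divide_right_mono) auto
  also have "\<dots> = sqrt (real CARD('d)) * norm H" using a0 by (simp add: power2_eq_square)
  also have "\<dots> \<le> sqrt (real CARD('d) + 1) * norm (H, g, z)"
    using norm_fst_le[of H "(g, z)"] by (intro mult_mono) auto
  finally show ?thesis .
qed

section \<open>Quasi-optimality of the discrete solution\<close>

theorem theorem4p3:
  fixes \<Omega> :: "(real^'d::finite) set"
    and A :: "'m::metric_space set" and B :: "'n::metric_space set"
    and a :: "real^'d \<Rightarrow> 'm \<Rightarrow> 'n \<Rightarrow> real^'d^'d"
    and b :: "real^'d \<Rightarrow> 'm \<Rightarrow> 'n \<Rightarrow> real^'d"
    and c f :: "real^'d \<Rightarrow> 'm \<Rightarrow> 'n \<Rightarrow> real"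
    and nu_lo nu_hi lam :: real
    and \<T> :: "(real^'d) set set" and nrm :: "(real^'d) set \<Rightarrow> real^'d"
    and p s :: nat
    and AT :: "(real^'d \<Rightarrow> real) \<Rightarrow> (real^'d \<Rightarrow> real) \<Rightarrow> real"
    and LT :: "(real^'d \<Rightarrow> real) \<Rightarrow> real^'d \<Rightarrow> real"
    and C_Lip C_cons C_LT C_mon :: real
    and u uT :: "real^'d \<Rightarrow> real"
  defines "V \<equiv> V_space s p \<Omega> \<T>"
    and "nrmT \<equiv> mesh_norm \<Omega> \<T> nrm"
    and "F \<equiv> isaacs_op \<Omega> A B a b c f"
    and "F\<gamma>T \<equiv> isaacs_op_renorm \<Omega> (broken_domain \<T>) A B a b c f lam"
  assumes dim: "CARD('d) = 2 \<or> CARD('d) = 3"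
    and dom: "open \<Omega>" "bounded \<Omega>" "convex \<Omega>" "polytope (closure \<Omega>)"
    and controls: "compact A" "A \<noteq> {}" "compact B" "B \<noteq> {}"
    and cont_a: "continuous_on (closure \<Omega> \<times> A \<times> B) (\<lambda>(x, \<alpha>, \<beta>). a x \<alpha> \<beta>)"
    and cont_b: "continuous_on (closure \<Omega> \<times> A \<times> B) (\<lambda>(x, \<alpha>, \<beta>). b x \<alpha> \<beta>)"
    and cont_c: "continuous_on (closure \<Omega> \<times> A \<times> B) (\<lambda>(x, \<alpha>, \<beta>). c x \<alpha> \<beta>)"
    and cont_f: "continuous_on (closure \<Omega> \<times> A \<times> B) (\<lambda>(x, \<alpha>, \<beta>). f x \<alpha> \<beta>)"
    and sym_a: "\<And>x \<alpha> \<beta>. x \<in> closure \<Omega> \<Longrightarrow> \<alpha> \<in> A \<Longrightarrow> \<beta> \<in> B \<Longrightarrow>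
                  transpose (a x \<alpha> \<beta>) = a x \<alpha> \<beta>"
    and c_nonneg: "\<And>x \<alpha> \<beta>. x \<in> \<Omega> \<Longrightarrow> \<alpha> \<in> A \<Longrightarrow> \<beta> \<in> B \<Longrightarrow> c x \<alpha> \<beta> \<ge> 0"
    and nu_pos: "nu_lo > 0" "nu_hi > 0"
    and elliptic: "\<And>x \<xi> \<alpha> \<beta>. x \<in> \<Omega> \<Longrightarrow> \<alpha> \<in> A \<Longrightarrow> \<beta> \<in> B \<Longrightarrow>
                     nu_lo * (norm \<xi>)\<^sup>2 \<le> \<xi> \<bullet> (a x \<alpha> \<beta> *v \<xi>) \<and>
                     \<xi> \<bullet> (a x \<alpha> \<beta> *v \<xi>) \<le> nu_hi * (norm \<xi>)\<^sup>2"
    and cordes: "cordes \<Omega> A B a b c lam"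
    and mesh: "simplicial_mesh \<Omega> \<T>" "mesh_normals \<Omega> \<T> nrm"
    and degree: "p \<ge> 2"
    and s01: "s \<in> {0, 1}"
    and AT_linear: "\<And>w v z r t. w \<in> V \<Longrightarrow> v \<in> V \<Longrightarrow> z \<in> V \<Longrightarrow>
                      AT w (\<lambda>x. r * v x + t * z x) = r * AT w v + t * AT w z"
    and C_pos: "C_Lip > 0" "C_cons > 0" "C_LT > 0" "C_mon > 0"
    and A1: "\<And>w z v. w \<in> V \<Longrightarrow> z \<in> V \<Longrightarrow> v \<in> V \<Longrightarrow>
               \<bar>AT w v - AT z v\<bar> \<le> C_Lip * nrmT (\<lambda>x. w x - z x) * nrmT v"
    and LT_L2: "\<And>v. v \<in> V \<Longrightarrow> LT v \<in> L2_space \<Omega>"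
    and LT_linear: "\<And>v z r t. v \<in> V \<Longrightarrow> z \<in> V \<Longrightarrow>
                      AE x in lebesgue. x \<in> \<Omega> \<longrightarrow>
                        LT (\<lambda>y. r * v y + t * z y) x = r * LT v x + t * LT z x"
    and A2_cons: "\<And>w v. w \<in> V \<Longrightarrow> v \<in> V \<Longrightarrow>
               \<bar>AT w v - (LINT x:\<Omega>|lebesgue. F\<gamma>T w x * LT v x)\<bar>
                 \<le> C_cons * jump_seminorm \<Omega> \<T> nrm w * nrmT v"
    and A2_bound: "\<And>v. v \<in> V \<Longrightarrow> L2_norm \<Omega> (LT v) \<le> C_LT * nrmT v"
    and A3: "\<And>w v. w \<in> V \<Longrightarrow> v \<in> V \<Longrightarrow>
               inverse C_mon * (nrmT (\<lambda>x. w x - v x))\<^sup>2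
                 \<le> AT w (\<lambda>x. w x - v x) - AT v (\<lambda>x. w x - v x)"
    and u_space: "u \<in> H2_space \<Omega> \<inter> H10_space \<Omega>"
    and u_solves: "AE x in lebesgue. x \<in> \<Omega> \<longrightarrow> F u x = 0"
    and uT_space: "uT \<in> V"
    and uT_solves: "\<And>v. v \<in> V \<Longrightarrow> AT uT v = 0"
  shows "nrmT (\<lambda>x. u x - uT x)
           \<le> (1 + C_mon * (C_cons + C_LT * Max {1, sqrt (2 * lam), lam} * (1 + sqrt (real CARD('d) + 1))))
             * (INF v\<in>V. nrmT (\<lambda>x. u x - v x))"
proof -
  interpret mesh_domain \<Omega> \<T> nrm
    by unfold_locales (use dim dom mesh in auto)
  let ?S = "broken_domain \<T>"
  define m where "m = Max {1, sqrt (2 * lam), lam}"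
  \<comment> \<open>A Lipschitz constant of the renormalized operator with respect to the jet, valid
    at every point and for all controls.\<close>
  define k where "k = m * sqrt (real CARD('d) + 1)"
  define \<gamma> where "\<gamma> = renorm \<Omega> A B a b c lam"
  have m1: "1 \<le> m" by (simp add: m_def)
  have k0: "0 \<le> k" using m1 by (simp add: k_def)
  have u: "u \<in> H2_space \<Omega>" "u \<in> H10_space \<Omega>" using u_space by auto
  note bu = H2_broken_H2[OF u(1)]
  have bV: "broken_H2 v" if "v \<in> V" for v using that V_space_broken_H2 by (simp add: V_def)
  have tr: "trace (a x \<alpha> \<beta>) > 0" if "x \<in> \<Omega>" "\<alpha> \<in> A" "\<beta> \<in> B" for x \<alpha> \<beta>
    using elliptic[OF that] nu_pos(1) by (intro trace_pos_of_elliptic[of nu_lo]) auto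
  have na: "norm (a x \<alpha> \<beta>) > 0" if "x \<in> \<Omega>" "\<alpha> \<in> A" "\<beta> \<in> B" for x \<alpha> \<beta>
    using tr[OF that] by (auto simp: trace_def)
  have lam: "lam > 0" if "\<not> lower_order_vanish \<Omega> A B b c"
    using cordes that by (simp add: cordes_def)
  have den: "(norm (a x \<alpha> \<beta>))\<^sup>2 + (norm (b x \<alpha> \<beta>))\<^sup>2 / (2 * lam) + (c x \<alpha> \<beta>)\<^sup>2 / lam\<^sup>2 > 0"
    if "x \<in> \<Omega>" "\<alpha> \<in> A" "\<beta> \<in> B" "\<not> lower_order_vanish \<Omega> A B b c" for x \<alpha> \<beta>
    using na[OF that(1-3)] lam[OF that(4)] by (intro add_pos_nonneg) auto
  have \<gamma>_pos: "\<gamma> x \<alpha> \<beta> > 0" if "x \<in> \<Omega>" "\<alpha> \<in> A" "\<beta> \<in> B" for x \<alpha> \<beta>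
    using tr[OF that] na[OF that] den[OF that] lam c_nonneg[OF that]
    by (auto simp: \<gamma>_def renorm_def intro!: divide_pos_pos add_pos_nonneg)
  have bound: "\<bar>\<gamma> x \<alpha> \<beta> * (a x \<alpha> \<beta> \<bullet> H + b x \<alpha> \<beta> \<bullet> g - c x \<alpha> \<beta> * z)\<bar> \<le> k * norm (H, g, z)"
    if x: "x \<in> \<Omega>" "\<alpha> \<in> A" "\<beta> \<in> B" for x \<alpha> \<beta> H g z
  proof (cases "lower_order_vanish \<Omega> A B b c")
    case True
    then have bc: "b x \<alpha> \<beta> = 0" "c x \<alpha> \<beta> = 0" using x closure_subset by (auto simp: lower_order_vanish_def)
    have "\<bar>\<gamma> x \<alpha> \<beta> * (a x \<alpha> \<beta> \<bullet> H + b x \<alpha> \<beta> \<bullet> g - c x \<alpha> \<beta> * z)\<bar> = \<gamma> x \<alpha> \<beta> * \<bar>a x \<alpha> \<beta> \<bullet> H\<bar>"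
      using \<gamma>_pos[OF x] by (simp add: abs_mult bc)
    also have "\<dots> \<le> sqrt (real CARD('d) + 1) * norm (H, g, z)"
      using renormalized_pure_bound[OF tr[OF x], of H g z] True by (simp add: \<gamma>_def renorm_def)
    also have "\<dots> \<le> k * norm (H, g, z)" unfolding k_def using m1 by (intro mult_right_mono) auto
    finally show ?thesis .
  next
    case False
    have "\<bar>\<gamma> x \<alpha> \<beta> * (a x \<alpha> \<beta> \<bullet> H + b x \<alpha> \<beta> \<bullet> g - c x \<alpha> \<beta> * z)\<bar>
        = \<gamma> x \<alpha> \<beta> * \<bar>a x \<alpha> \<beta> \<bullet> H + b x \<alpha> \<beta> \<bullet> g - c x \<alpha> \<beta> * z\<bar>"
      using \<gamma>_pos[OF x] by (simp add: abs_mult)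
    also have "\<dots> \<le> k * norm (H, g, z)"
      using renormalized_linear_bound[OF lam[OF False] c_nonneg[OF x] tr[OF x], of "b x \<alpha> \<beta>" H g z] False
      by (simp add: \<gamma>_def renorm_def k_def m_def)
    finally show ?thesis .
  qed
  \<comment> \<open>With \<open>x\<close> frozen, the data are continuous on the compact set of
    controls; this yields the bounds and the maxima that the inf-sup lemmas ask for.\<close>
  have slice: "continuous_on (A \<times> B) (\<lambda>p. h x (fst p) (snd p))"
    if "continuous_on (closure \<Omega> \<times> A \<times> B) (\<lambda>(x, \<alpha>, \<beta>). h x \<alpha> \<beta>)" "x \<in> \<Omega>"
    for h :: "real^'d \<Rightarrow> 'm \<Rightarrow> 'n \<Rightarrow> 'e::topological_space" and x
  proof -
    have "x \<in> closure \<Omega>" using that(2) closure_subset by blast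
    moreover have "continuous_on (A \<times> B) (\<lambda>p. (x, fst p, snd p))"
      by (intro continuous_on_Pair continuous_on_const continuous_on_fst continuous_on_snd continuous_on_id)
    from continuous_on_compose2[OF that(1) this]
    have "(\<lambda>p. (x, fst p, snd p)) ` (A \<times> B) \<subseteq> closure \<Omega> \<times> A \<times> B \<Longrightarrow>
      continuous_on (A \<times> B) (\<lambda>p. case (x, fst p, snd p) of (x, \<alpha>, \<beta>) \<Rightarrow> h x \<alpha> \<beta>)" .
    ultimately show ?thesis by (simp only: case_prod_conv) auto
  qed
  have cont: "continuous_on (A \<times> B) (\<lambda>(\<alpha>, \<beta>). lin_op S a b c v x \<alpha> \<beta> - f x \<alpha> \<beta>)" if x: "x \<in> \<Omega>" for S v x
    unfolding lin_op_def case_prod_unfold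
    by (intro continuous_intros slice[OF cont_a x] slice[OF cont_b x] slice[OF cont_c x] slice[OF cont_f x])
  have cont\<gamma>: "continuous_on (A \<times> B) (\<lambda>(\<alpha>, \<beta>). \<gamma> x \<alpha> \<beta>)" if x: "x \<in> \<Omega>" for x
  proof (cases "lower_order_vanish \<Omega> A B b c")
    case True
    have "continuous_on (A \<times> B) (\<lambda>p. trace (a x (fst p) (snd p)) / (norm (a x (fst p) (snd p)))\<^sup>2)"
      unfolding trace_def using na[OF x] by (intro continuous_intros slice[OF cont_a x]) force
    then show ?thesis using True by (simp add: \<gamma>_def renorm_def case_prod_unfold)
  next
    case False
    have "continuous_on (A \<times> B) (\<lambda>p. (trace (a x (fst p) (snd p)) + c x (fst p) (snd p) / lam)
        / ((norm (a x (fst p) (snd p)))\<^sup>2 + (norm (b x (fst p) (snd p)))\<^sup>2 / (2 * lam) + (c x (fst p) (snd p))\<^sup>2 / lam\<^sup>2))"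
      unfolding trace_def using den[OF x _ _ False] lam[OF False]
      by (intro continuous_intros slice[OF cont_a x] slice[OF cont_b x] slice[OF cont_c x]) force+
    then show ?thesis using False by (simp add: \<gamma>_def renorm_def case_prod_unfold)
  qed
  have cont\<gamma>G: "continuous_on (A \<times> B) (\<lambda>(\<alpha>, \<beta>). \<gamma> x \<alpha> \<beta> * (lin_op S a b c v x \<alpha> \<beta> - f x \<alpha> \<beta>))" if "x \<in> \<Omega>" for S v x
    using continuous_on_mult[OF cont\<gamma>[OF that] cont[OF that]] by (simp add: case_prod_unfold)
  \<comment> \<open>The given equation concerns \<open>F\<close> with derivatives on \<Omega>.
    Agreement of the jets moves it to the broken domain, and positivity of the renormalization moves
    it to the renormalized operator.\<close>
  have F\<gamma>u: "AE x in lebesgue. x \<in> \<Omega> \<longrightarrow> F\<gamma>T u x = 0"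
    using u_solves H2_jet_\<Omega>[OF u(1)]
  proof eventually_elim
    case (elim x)
    show ?case
    proof
      assume x: "x \<in> \<Omega>"
      have "lin_op ?S a b c u x = lin_op \<Omega> a b c u x" using elim x by (simp add: lin_op_def fun_eq_iff)
      moreover have "(INF \<alpha>\<in>A. SUP \<beta>\<in>B. lin_op \<Omega> a b c u x \<alpha> \<beta> - f x \<alpha> \<beta>) = 0"
        using elim x by (simp add: F_def isaacs_op_def)
      ultimately show "F\<gamma>T u x = 0"
        unfolding F\<gamma>T_def isaacs_op_renorm_def \<gamma>_def[symmetric]
        using INF_SUP_times_pos_eq_0[OF controls cont[OF x] cont\<gamma>[OF x] \<gamma>_pos[OF x]] by simp
    qed
  qed
  \<comment> \<open>The Lipschitz estimate is obtained from both orderings of \<open>u\<close> and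
    \<open>v\<close>; since the operator vanishes at \<open>u\<close>, it bounds the value at
    \<open>v\<close> itself.\<close>
  have F\<gamma>v: "AE x in lebesgue. x \<in> \<Omega> \<longrightarrow> \<bar>F\<gamma>T v x\<bar> \<le> k * norm (jet (\<lambda>x. u x - v x) x)" if v: "v \<in> V" for v
    using F\<gamma>u jet_diff_AE[OF bu bV[OF v]]
  proof eventually_elim
    case (elim x)
    show ?case
    proof
      assume x: "x \<in> \<Omega>"
      let ?X = "\<lambda>w \<alpha> \<beta>. \<gamma> x \<alpha> \<beta> * (lin_op ?S a b c w x \<alpha> \<beta> - f x \<alpha> \<beta>)"
      let ?J = "jet (\<lambda>x. u x - v x) x"
      have J: "?J = (weak_hess ?S u x - weak_hess ?S v x, weak_grad ?S u x - weak_grad ?S v x, u x - v x)"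
        using elim x by (simp add: jet_def)
      have le: "\<bar>?X u \<alpha> \<beta> - ?X v \<alpha> \<beta>\<bar> \<le> k * norm ?J" if "\<alpha> \<in> A" "\<beta> \<in> B" for \<alpha> \<beta>
      proof -
        have "?X u \<alpha> \<beta> - ?X v \<alpha> \<beta> = \<gamma> x \<alpha> \<beta> * (a x \<alpha> \<beta> \<bullet> (weak_hess ?S u x - weak_hess ?S v x)
            + b x \<alpha> \<beta> \<bullet> (weak_grad ?S u x - weak_grad ?S v x) - c x \<alpha> \<beta> * (u x - v x))"
          by (simp add: lin_op_def inner_diff_right algebra_simps)
        then show ?thesis using bound[OF x that] by (simp only: J)
      qed
      obtain M where M: "\<And>\<alpha> \<beta>. \<alpha> \<in> A \<Longrightarrow> \<beta> \<in> B \<Longrightarrow> \<bar>?X u \<alpha> \<beta>\<bar> \<le> M"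
        by (rule continuous_on_bounded2[OF controls(1,3) cont\<gamma>G[OF x]]) blast
      obtain M' where M': "\<And>\<alpha> \<beta>. \<alpha> \<in> A \<Longrightarrow> \<beta> \<in> B \<Longrightarrow> \<bar>?X v \<alpha> \<beta>\<bar> \<le> M'"
        by (rule continuous_on_bounded2[OF controls(1,3) cont\<gamma>G[OF x]]) blast
      have "F\<gamma>T u x \<le> F\<gamma>T v x + k * norm ?J"
        unfolding F\<gamma>T_def isaacs_op_renorm_def \<gamma>_def[symmetric]
      proof (rule INF_SUP_le_add[OF M M' controls(2,4)])
        show "?X u \<alpha> \<beta> \<le> ?X v \<alpha> \<beta> + k * norm ?J" if "\<alpha> \<in> A" "\<beta> \<in> B" for \<alpha> \<beta>
          using le[OF that] by linarith
      qed
      moreover have "F\<gamma>T v x \<le> F\<gamma>T u x + k * norm ?J"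
        unfolding F\<gamma>T_def isaacs_op_renorm_def \<gamma>_def[symmetric]
      proof (rule INF_SUP_le_add[OF M' M controls(2,4)])
        show "?X v \<alpha> \<beta> \<le> ?X u \<alpha> \<beta> + k * norm ?J" if "\<alpha> \<in> A" "\<beta> \<in> B" for \<alpha> \<beta>
          using le[OF that] by linarith
      qed
      ultimately show "\<bar>F\<gamma>T v x\<bar> \<le> k * norm ?J" using elim x by simp
    qed
  qed
  define C where "C = C_mon * (C_cons + C_LT * m * (1 + sqrt (real CARD('d) + 1)))"
  have C0: "0 \<le> C" using C_pos m1 by (auto simp: C_def intro!: mult_nonneg_nonneg add_nonneg_nonneg)
  have best: "nrmT (\<lambda>x. u x - uT x) \<le> (1 + C) * nrmT (\<lambda>x. u x - v x)" if v: "v \<in> V" for v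
  proof -
    define e where "e = (\<lambda>x. v x - uT x)"
    have e: "e \<in> V" using V_space_diff v uT_space by (simp add: e_def V_def)
    let ?N = "nrmT (\<lambda>x. u x - v x)" and ?E = "nrmT e"
    have N0: "0 \<le> ?N" "0 \<le> ?E" by (simp_all add: nrmT_def mesh_norm_nonneg)
    \<comment> \<open>The error \<open>e\<close> is itself a discrete function, so the discrete
      equation removes the second term of the monotonicity inequality.\<close>
    have "inverse C_mon * ?E\<^sup>2 \<le> AT v e"
      using A3[OF v uT_space] uT_solves[OF e] by (simp add: e_def)
    also have "AT v e \<le> (C_cons * ?N + k * ?N * C_LT) * ?E"
    proof -
      \<comment> \<open>Only the pointwise bound by the jet is passed on: the Cauchy-Schwarz lemma
        accepts any integrand dominated almost everywhere by a product of square integrable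
        functions.\<close>
      have "\<bar>LINT x:\<Omega>|lebesgue. F\<gamma>T v x * LT e x\<bar>
          \<le> sqrt (LINT x:\<Omega>|lebesgue. (k * norm (jet (\<lambda>x. u x - v x) x))\<^sup>2) * sqrt (LINT x:\<Omega>|lebesgue. (LT e x)\<^sup>2)"
      proof (rule set_integral_Cauchy_Schwarz)
        show "set_integrable lebesgue \<Omega> (\<lambda>x. (k * norm (jet (\<lambda>x. u x - v x) x))\<^sup>2)"
          unfolding power_mult_distrib by (intro set_integrable_mult_right norm_jet_integrable broken_H2_diff bu bV v)
        show "set_integrable lebesgue \<Omega> (\<lambda>x. (LT e x)\<^sup>2)" using LT_L2[OF e] by (simp add: L2_space_def)
        show "AE x in lebesgue. x \<in> \<Omega> \<longrightarrow> \<bar>F\<gamma>T v x * LT e x\<bar> \<le> \<bar>k * norm (jet (\<lambda>x. u x - v x) x)\<bar> * \<bar>LT e x\<bar>"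
          using F\<gamma>v[OF v]
        proof eventually_elim
          case (elim x)
          show ?case
          proof
            assume "x \<in> \<Omega>"
            then have "\<bar>F\<gamma>T v x\<bar> \<le> \<bar>k * norm (jet (\<lambda>x. u x - v x) x)\<bar>" using elim by linarith
            then show "\<bar>F\<gamma>T v x * LT e x\<bar> \<le> \<bar>k * norm (jet (\<lambda>x. u x - v x) x)\<bar> * \<bar>LT e x\<bar>"
              unfolding abs_mult[of "F\<gamma>T v x" "LT e x"] by (rule mult_right_mono) simp
          qed
        qed
      qed
      also have "\<dots> = k * volume_part (\<lambda>x. u x - v x) * L2_norm \<Omega> (LT e)"
        using k0 by (simp add: volume_part_def L2_norm_def power_mult_distrib real_sqrt_mult)
      also have "\<dots> \<le> (k * ?N) * (C_LT * ?E)"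
        using volume_part_le_mesh_norm[of "\<lambda>x. u x - v x"] k0 A2_bound[OF e] N0
        by (intro mult_mono mult_left_mono) (auto simp: nrmT_def L2_norm_nonneg)
      finally have int: "\<bar>LINT x:\<Omega>|lebesgue. F\<gamma>T v x * LT e x\<bar> \<le> (k * ?N) * (C_LT * ?E)" .
      have "jump_seminorm \<Omega> \<T> nrm v \<le> ?N"
        using jump_seminorm_le[OF u bV[OF v]] jump_seminorm_le_mesh_norm[of "\<lambda>x. u x - v x"] by (simp add: nrmT_def)
      then have "C_cons * jump_seminorm \<Omega> \<T> nrm v * ?E \<le> C_cons * ?N * ?E"
        using C_pos N0 by (intro mult_right_mono mult_left_mono) auto
      then have "AT v e \<le> C_cons * ?N * ?E + (k * ?N) * (C_LT * ?E)"
        using A2_cons[OF v e] int by linarith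
      then show ?thesis by (simp add: algebra_simps)
    qed
    finally have key: "inverse C_mon * ?E\<^sup>2 \<le> (C_cons * ?N + k * ?N * C_LT) * ?E" .
    \<comment> \<open>One factor \<open>?E\<close> is to be cancelled; when it is 0, the right-hand
      side is nonnegative anyway.\<close>
    have "?E \<le> C_mon * (C_cons * ?N + k * ?N * C_LT)"
    proof (cases "?E = 0")
      case True
      then show ?thesis using C_pos N0 k0 by (auto intro!: mult_nonneg_nonneg add_nonneg_nonneg)
    next
      case False
      then have E: "?E > 0" using N0 by simp
      have "(inverse C_mon * ?E) * ?E \<le> (C_cons * ?N + k * ?N * C_LT) * ?E" using key by (simp add: power2_eq_square mult.assoc)
      then have "inverse C_mon * ?E \<le> C_cons * ?N + k * ?N * C_LT" using E by (simp only: mult_le_cancel_right_pos)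
      then show ?thesis using C_pos(4) by (simp add: field_simps)
    qed
    also have "\<dots> = C_mon * (C_cons + C_LT * k) * ?N" by (simp add: algebra_simps)
    also have "\<dots> \<le> C * ?N"
    proof (rule mult_right_mono[OF _ N0(1)])
      \<comment> \<open>Here the factor sqrt (d + 1) obtained in the proof is enlarged to the 1 +
        sqrt (d + 1) of the stated constant.\<close>
      have "C_LT * k \<le> C_LT * m * (1 + sqrt (real CARD('d) + 1))"
        using C_pos m1 by (simp add: k_def algebra_simps)
      then show "C_mon * (C_cons + C_LT * k) \<le> C" using C_pos unfolding C_def by (intro mult_left_mono) auto
    qed
    finally have "?E \<le> C * ?N" .
    moreover have "nrmT (\<lambda>x. u x - uT x) \<le> ?N + ?E"
      unfolding nrmT_def e_def by (rule mesh_norm_triangle[OF bu bV[OF v] bV[OF uT_space]])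
    ultimately show ?thesis by (simp add: distrib_right)
  qed
  \<comment> \<open>Dividing by 1 + C first makes the left-hand side a lower bound for every member
    of the family, and hence for its infimum.\<close>
  have "nrmT (\<lambda>x. u x - uT x) / (1 + C) \<le> (INF v\<in>V. nrmT (\<lambda>x. u x - v x))"
  proof (rule cINF_greatest)
    show "V \<noteq> {}" using uT_space by blast
    show "nrmT (\<lambda>x. u x - uT x) / (1 + C) \<le> nrmT (\<lambda>x. u x - v x)" if "v \<in> V" for v
      using best[OF that] C0 by (simp add: divide_le_eq mult.commute)
  qed
  then show ?thesis using C0 by (simp add: divide_le_eq C_def m_def mult.commute)
qed

end
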